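(* Let $w$ be a weight whose primitive sequence $\sigma$ is doubling, and let $0<q\le\infty$. Then $d_{1,q}(w)$ is superreflexive if and only if $1<q<\infty$ and $\sigma$ has both the LRP and the URP.
   Context: A weight is a sequence $w=(w_n)_{n=1}^\infty$ of non-negative scalars with $w_1>0$; its primitive sequence is $\sigma=(s_m)_{m=1}^\infty$, $s_m=\sum_{n=1}^m w_n$. It is doubling if $\sup_m s_m/s_{\lceil m/2\rceil}<\infty$. For $0<q<\infty$ and $f\in c_0$ with non-increasing rearrangement $f^*=(a_n)_{n=1}^\infty$ of $|f|$, put $\|f\|_{1,q,w}=\left(\sum_{n=1}^\infty (a_ns_n)^q\frac{w_n}{s_n}\right)^{1/q}$, and $\|f\|_{1,\infty,w}=\sup_n a_ns_n$. The Lorentz sequence space is $d_{1,q}(w)=\{f\in c_0:\|f\|_{1,q,w}<\infty\}$, a quasi-Banach space when $\sigma$ is doubling. A sequence $(t_n)_{n=1}^\infty$ of positive scalars has the URP if there is an integer $b\ge2$ with $t_{bn}\le\frac b2t_n$ for all $n$, and the LRP if there is an integer $b\ge2$ with $2t_n\le t_{bn}$ for all $n$. A quasi-Banach space is called superreflexive if it is locally convex (its quasi-norm is equivalent to a norm) and, as a Banach space, it is superreflexive, i.e. every Banach space finitely representable in it is reflexive. *)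

theory Defs
  imports Complex_Main "HOL-Library.Extended_Real" "HOL-Algebra.Module"
begin

section \<open>Normed and quasi-normed spaces over a scalar field\<close>

definition scalar_ring :: "'k::real_normed_field ring" where
  "scalar_ring = \<lparr>carrier = UNIV, mult = (*), one = 1, zero = 0, add = (+)\<rparr>"

text \<open>The inherited record fields \<open>mult\<close> and \<open>one\<close> play no role: a module in HOL-Algebra is only
  an abelian group with a scalar multiplication.\<close>

record ('k, 'v) nspace = "('k, 'v) module" + vnorm :: "'v \<Rightarrow> real"

definition is_quasinorm :: "('k::real_normed_field, 'v) nspace \<Rightarrow> bool" where
  "is_quasinorm X \<longleftrightarrow>
     (\<forall>x\<in>carrier X. 0 \<le> vnorm X x \<and> (vnorm X x = 0 \<longleftrightarrow> x = \<zero>\<^bsub>X\<^esub>)) \<and>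
     (\<forall>c. \<forall>x\<in>carrier X. vnorm X (c \<odot>\<^bsub>X\<^esub> x) = norm c * vnorm X x) \<and>
     (\<exists>K. \<forall>x\<in>carrier X. \<forall>y\<in>carrier X. vnorm X (x \<oplus>\<^bsub>X\<^esub> y) \<le> K * (vnorm X x + vnorm X y))"

definition is_norm :: "('k::real_normed_field, 'v) nspace \<Rightarrow> bool" where
  "is_norm X \<longleftrightarrow>
     is_quasinorm X \<and>
     (\<forall>x\<in>carrier X. \<forall>y\<in>carrier X. vnorm X (x \<oplus>\<^bsub>X\<^esub> y) \<le> vnorm X x + vnorm X y)"

definition complete_nspace :: "('k::real_normed_field, 'v) nspace \<Rightarrow> bool" where
  "complete_nspace X \<longleftrightarrow>
     (\<forall>u :: nat \<Rightarrow> 'v.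
        (\<forall>i. u i \<in> carrier X) \<and>
        (\<forall>e>0. \<exists>M. \<forall>i\<ge>M. \<forall>j\<ge>M. vnorm X (u i \<ominus>\<^bsub>X\<^esub> u j) < e) \<longrightarrow>
        (\<exists>x\<in>carrier X. (\<lambda>i. vnorm X (u i \<ominus>\<^bsub>X\<^esub> x)) \<longlonglongrightarrow> 0))"

definition quasi_banach :: "('k::real_normed_field, 'v) nspace \<Rightarrow> bool" where
  "quasi_banach X \<longleftrightarrow> module scalar_ring X \<and> is_quasinorm X \<and> complete_nspace X"

definition banach_nspace :: "('k::real_normed_field, 'v) nspace \<Rightarrow> bool" where
  "banach_nspace X \<longleftrightarrow> module scalar_ring X \<and> is_norm X \<and> complete_nspace X"

definition linear_on_nspace ::
  "'v set \<Rightarrow> ('k::real_normed_field, 'v) nspace \<Rightarrow> ('k, 'u) nspace \<Rightarrow> ('v \<Rightarrow> 'u) \<Rightarrow> bool" where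
  "linear_on_nspace E Y X T \<longleftrightarrow>
     (\<forall>y\<in>E. T y \<in> carrier X) \<and>
     (\<forall>y\<in>E. \<forall>z\<in>E. T (y \<oplus>\<^bsub>Y\<^esub> z) = T y \<oplus>\<^bsub>X\<^esub> T z) \<and>
     (\<forall>c. \<forall>y\<in>E. T (c \<odot>\<^bsub>Y\<^esub> y) = c \<odot>\<^bsub>X\<^esub> T y)"


section \<open>Reflexivity\<close>

text \<open>A functional on \<open>Y\<close> is represented by a function that vanishes outside \<open>carrier Y\<close>, so that
  distinct elements of the dual are distinct functionals and the operations are pointwise.\<close>

definition dual_nspace :: "('k::real_normed_field, 'v) nspace \<Rightarrow> ('k, 'v \<Rightarrow> 'k) nspace" where
  "dual_nspace Y =
     \<lparr>carrier = {\<phi>.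
          (\<forall>y. y \<notin> carrier Y \<longrightarrow> \<phi> y = 0) \<and>
          (\<forall>y\<in>carrier Y. \<forall>z\<in>carrier Y. \<phi> (y \<oplus>\<^bsub>Y\<^esub> z) = \<phi> y + \<phi> z) \<and>
          (\<forall>c. \<forall>y\<in>carrier Y. \<phi> (c \<odot>\<^bsub>Y\<^esub> y) = c * \<phi> y) \<and>
          (\<exists>C. \<forall>y\<in>carrier Y. norm (\<phi> y) \<le> C * vnorm Y y)},
      mult = (\<lambda>\<phi> \<psi> y. \<phi> y * \<psi> y), one = (\<lambda>y. 1),
      zero = (\<lambda>y. 0), add = (\<lambda>\<phi> \<psi> y. \<phi> y + \<psi> y),
      smult = (\<lambda>c \<phi> y. c * \<phi> y),
      vnorm = (\<lambda>\<phi>. Sup {norm (\<phi> y) | y. y \<in> carrier Y \<and> vnorm Y y \<le> 1})\<rparr>"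

definition reflexive_nspace :: "('k::real_normed_field, 'v) nspace \<Rightarrow> bool" where
  "reflexive_nspace Y \<longleftrightarrow>
     (\<forall>\<Phi>\<in>carrier (dual_nspace (dual_nspace Y)).
        \<exists>y\<in>carrier Y. \<forall>\<phi>\<in>carrier (dual_nspace Y). \<Phi> \<phi> = \<phi> y)"


section \<open>Superreflexivity\<close>

definition finite_dim_subspace :: "('k::real_normed_field, 'v) nspace \<Rightarrow> 'v set \<Rightarrow> bool" where
  "finite_dim_subspace Y E \<longleftrightarrow>
     (\<exists>B. finite B \<and> B \<subseteq> carrier Y \<and> E = (\<lambda>S. submodule S scalar_ring Y) hull B)"

text \<open>The constants \<open>a\<close> and \<open>b\<close> say that \<open>T\<close> is an isomorphism of \<open>E\<close> onto its image
  with \<open>\<parallel>T\<parallel> \<le> b\<close> and \<open>\<parallel>T\<^sup>-\<^sup>1\<parallel> \<le> 1 / a\<close>.\<close>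

definition finitely_representable ::
  "('k::real_normed_field, 'v) nspace \<Rightarrow> ('k, 'u) nspace \<Rightarrow> bool" where
  "finitely_representable Y X \<longleftrightarrow>
     (\<forall>E. finite_dim_subspace Y E \<longrightarrow>
       (\<forall>\<epsilon>>0. \<exists>T a b. linear_on_nspace E Y X T \<and> 0 < a \<and> b / a < 1 + \<epsilon> \<and>
          (\<forall>y\<in>E. a * vnorm Y y \<le> vnorm X (T y) \<and> vnorm X (T y) \<le> b * vnorm Y y)))"

text \<open>HOL cannot quantify over all types inside a formula, so the Banach spaces \<open>Y\<close> range over
  those whose underlying set is contained in a type \<open>'v\<close> given as a parameter. Every
  non-zero Banach space has at least the cardinality of the continuum, so a statement that
  holds for all \<open>'v\<close> of at least that cardinality accounts for all Banach spaces.\<close>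

definition superreflexive_banach ::
  "'v itself \<Rightarrow> ('k::real_normed_field, 'u) nspace \<Rightarrow> bool" where
  "superreflexive_banach _ X \<longleftrightarrow>
     banach_nspace X \<and>
     (\<forall>Y :: ('k, 'v) nspace.
        banach_nspace Y \<and> finitely_representable Y X \<longrightarrow> reflexive_nspace Y)"

definition equivalent_to_vnorm :: "('k::real_normed_field, 'u) nspace \<Rightarrow> ('u \<Rightarrow> real) \<Rightarrow> bool" where
  "equivalent_to_vnorm X N \<longleftrightarrow>
     (\<exists>c C. 0 < c \<and> (\<forall>x\<in>carrier X. c * N x \<le> vnorm X x \<and> vnorm X x \<le> C * N x))"

definition superreflexive ::
  "'v itself \<Rightarrow> ('k::real_normed_field, 'u) nspace \<Rightarrow> bool" where
  "superreflexive U X \<longleftrightarrow>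
     quasi_banach X \<and>
     (\<exists>N. is_norm (X\<lparr>vnorm := N\<rparr>) \<and> equivalent_to_vnorm X N \<and>
          superreflexive_banach U (X\<lparr>vnorm := N\<rparr>))"


section \<open>Weights\<close>

text \<open>Weights and their primitive sequences are indexed by \<open>n \<ge> 1\<close>; the value at \<open>0\<close> of a weight
  is never used.\<close>

definition is_weight :: "(nat \<Rightarrow> real) \<Rightarrow> bool" where
  "is_weight w \<longleftrightarrow> (\<forall>n\<ge>1. 0 \<le> w n) \<and> 0 < w 1"

definition primitive_seq :: "(nat \<Rightarrow> real) \<Rightarrow> nat \<Rightarrow> real" where
  "primitive_seq w m = (\<Sum>n=1..m. w n)"

definition doubling :: "(nat \<Rightarrow> real) \<Rightarrow> bool" where
  "doubling s \<longleftrightarrow> bdd_above {s m / s (nat \<lceil>real m / 2\<rceil>) | m. m \<ge> 1}"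

definition URP :: "(nat \<Rightarrow> real) \<Rightarrow> bool" where
  "URP t \<longleftrightarrow> (\<exists>b\<ge>2. \<forall>n\<ge>1. t (b * n) \<le> real b / 2 * t n)"

definition LRP :: "(nat \<Rightarrow> real) \<Rightarrow> bool" where
  "LRP t \<longleftrightarrow> (\<exists>b\<ge>2. \<forall>n\<ge>1. 2 * t n \<le> t (b * n))"


section \<open>Lorentz sequence spaces\<close>

text \<open>Elements of \<open>c\<^sub>0\<close> are functions on all of \<open>nat\<close>, with \<open>f k\<close> as the term number \<open>k + 1\<close>.
  Their rearrangement is indexed by \<open>n \<ge> 1\<close>, like the weights. The \<open>finite\<close> in it is needed because
  \<open>card\<close> is 0 on infinite sets.\<close>

definition rearrangement :: "(nat \<Rightarrow> 'k::real_normed_field) \<Rightarrow> nat \<Rightarrow> real" where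
  "rearrangement f n =
     Inf {t. 0 \<le> t \<and> finite {k. t < norm (f k)} \<and> card {k. t < norm (f k)} < n}"

definition lorentz_term ::
  "(nat \<Rightarrow> real) \<Rightarrow> real \<Rightarrow> (nat \<Rightarrow> 'k::real_normed_field) \<Rightarrow> nat \<Rightarrow> real" where
  "lorentz_term w q f n =
     (rearrangement f n * primitive_seq w n) powr q * (w n / primitive_seq w n)"

definition lorentz_set ::
  "(nat \<Rightarrow> real) \<Rightarrow> ereal \<Rightarrow> (nat \<Rightarrow> 'k::real_normed_field) set" where
  "lorentz_set w q = {f. f \<longlonglongrightarrow> 0 \<and>
     (if q = \<infinity> then bdd_above {rearrangement f n * primitive_seq w n | n. n \<ge> 1}
      else summable (\<lambda>i. lorentz_term w (real_of_ereal q) f (Suc i)))}"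

definition lorentz_norm ::
  "(nat \<Rightarrow> real) \<Rightarrow> ereal \<Rightarrow> (nat \<Rightarrow> 'k::real_normed_field) \<Rightarrow> real" where
  "lorentz_norm w q f =
     (if q = \<infinity> then Sup {rearrangement f n * primitive_seq w n | n. n \<ge> 1}
      else (\<Sum>i. lorentz_term w (real_of_ereal q) f (Suc i)) powr (1 / real_of_ereal q))"

definition lorentz_space ::
  "(nat \<Rightarrow> real) \<Rightarrow> ereal \<Rightarrow> ('k::real_normed_field, nat \<Rightarrow> 'k) nspace" where
  "lorentz_space w q =
     \<lparr>carrier = lorentz_set w q,
      mult = (\<lambda>f g k. f k * g k), one = (\<lambda>k. 1),
      zero = (\<lambda>k. 0), add = (\<lambda>f g k. f k + g k),
      smult = (\<lambda>c f k. c * f k),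
      vnorm = lorentz_norm w q\<rparr>"

end

theory Submission
  imports "HOL-Analysis.Analysis" Defs
begin

text \<open>
  If \<open>1 < q < \<infinity>\<close> and both regularity properties hold, there is a common base \<open>\<beta>\<close> for them. With
  \<open>\<sigma>\<^sub>j = s(\<beta>\<^sup>j)\<close>, the quasi-norm is equivalent to the \<open>\<ell>\<^sub>q\<close>-sum over \<open>j\<close> of \<open>\<sigma>\<^sub>j\<close> times the Luxemburg
  norm given by \<open>\<Sum>k. \<phi> (\<bar>f k\<bar> / l) \<le> \<beta>\<^sup>j\<close>, where the Orlicz function \<open>\<phi>\<close> grows like a large power near
  0 and like a power close to 1 near infinity: the URP controls the coordinates large for the level \<open>j\<close>,
  and the LRP the small ones. This norm is uniformly convex. Uniform convexity passes to finitely
  representable spaces and implies reflexivity.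

  Conversely, if \<open>\<ell>\<^sub>\<infinity>\<^sup>b\<close> or \<open>\<ell>\<^sub>1\<^sup>b\<close> embeds uniformly for all \<open>b\<close>, the limits along an ultrafilter of the norms
  pulled back by the embeddings make \<open>c\<^sub>0\<close> or \<open>\<ell>\<^sub>1\<close> a finitely representable non-reflexive space.
  Suitable disjoint blocks span copies of \<open>\<ell>\<^sub>\<infinity>\<^sup>b\<close> if \<open>q = \<infinity>\<close>, if the LRP fails, or if the norm of
  \<open>n\<close> ones is bounded; they span copies of \<open>\<ell>\<^sub>1\<^sup>b\<close> if \<open>q \<le> 1\<close> or if the URP fails.
\<close>

subsection \<open>Uniform convexity of powers\<close>

text \<open>The rearrangement at \<open>\<beta> ^ j\<close> is not subadditive in the function, so a
  weighted sum of such values need not be a norm. A Luxemburg norm at level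
  \<open>\<beta> ^ j\<close> is a convex substitute, at the price that it also sees the coordinates
  of every other level \<open>i\<close>. Their contribution is bearable only if it decays
  geometrically in the distance of \<open>i\<close> and \<open>j\<close>. For the large coordinates
  the room is the factor 1/2 in the URP, which tolerates an exponent slightly above 1; the exponent
  1 itself would not be uniformly convex. For the small ones it is the factor 2 in the LRP, which a
  large exponent exploits. The room is split in two: \<open>\<rho>\<close> is spent on the sum over
  levels, \<open>\<eta>\<close> on the sum inside the modular. Conversely, non-reflexivity is
  detected by a bounded sequence. In a reflexive space the limits of the values of functionals along
  the ultrafilter are given by a vector, while the partial sums of the unit vectors in
  \<open>c_0\<close> and the unit vectors themselves in \<open>l_1\<close> have no such
  limit.\<close>

lemma powr_midpoint_strict:
  fixes a b r :: real
  assumes "1 < r" "0 \<le> a" "a < b"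
  shows "((a + b) / 2) powr r < (a powr r + b powr r) / 2"
proof -
  \<comment> \<open>With \<open>a\<close> fixed the gap grows with the other point: its derivative
    at \<open>x\<close> is a positive multiple of
    \<open>x powr (r - 1) - ((a + x) / 2) powr (r - 1)\<close>.\<close>
  define g where "g = (\<lambda>x. (a powr r + x powr r) / 2 - ((a + x) / 2) powr r)"
  have "g a < g b"
  proof (rule DERIV_pos_imp_increasing_open[OF assms(3)])
    fix x assume x: "a < x" "x < b"
    have "(g has_real_derivative (r * x powr (r - 1)) / 2 - r * ((a + x) / 2) powr (r - 1) * (1/2)) (at x)"
      unfolding g_def using x assms(2) by (auto intro!: derivative_eq_intros)
    moreover have "((a + x) / 2) powr (r - 1) < x powr (r - 1)"
      using x assms by (intro powr_less_mono2) auto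
    ultimately show "\<exists>y. (g has_real_derivative y) (at x) \<and> 0 < y"
      using assms(1) by (intro exI conjI) (assumption, auto simp: field_simps)
  next
    show "continuous_on {a..b} g"
      unfolding g_def using assms by (auto intro!: continuous_intros continuous_on_powr')
  qed
  then show ?thesis by (simp add: g_def)
qed

lemma powr_convex_combination:
  fixes x y t r :: real
  assumes "1 \<le> r" "0 \<le> x" "0 \<le> y" "0 \<le> t" "t \<le> 1"
  shows "(t * x + (1 - t) * y) powr r \<le> t * x powr r + (1 - t) * y powr r"
proof -
  have le1: "s powr r \<le> s" if "0 \<le> s" "s \<le> 1" for s :: real
  proof (cases "s = 0")
    case False
    then have "s powr r \<le> s powr 1"
      using that assms(1) by (intro powr_mono') auto
    then show ?thesis using False that by simp
  qed simp
  consider "x = 0" | "y = 0" | "0 < x" "0 < y" using assms by fastforce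
  then show ?thesis
  proof cases
    case 1
    then show ?thesis
      using le1[of "1 - t"] assms by (simp add: powr_mult mult_right_mono)
  next
    case 2
    then show ?thesis
      using le1[of t] assms by (simp add: powr_mult mult_right_mono)
  next
    case 3
    then show ?thesis
      using convex_onD[OF powr_convex[OF assms(1)], of "1 - t" x y] assms by simp
  qed
qed

lemma powr_midpoint:
  fixes a b r :: real
  assumes "1 \<le> r" "0 \<le> a" "0 \<le> b"
  shows "((a + b) / 2) powr r \<le> (a powr r + b powr r) / 2"
  using powr_convex_combination[of r a b "1/2"] assms by (simp add: field_simps)

text \<open>Strictness has two sources: strict convexity of the power if the norms of
  \<open>u\<close> and \<open>v\<close> differ, the parallelogram law if they agree.\<close>

lemma norm_midpoint_powr_strict:
  fixes u v :: "'a::real_inner"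
  assumes "1 < r" "u \<noteq> v"
  shows "norm ((1/2) *\<^sub>R (u + v)) powr r < (norm u powr r + norm v powr r) / 2"
proof (cases "norm u = norm v")
  case False
  have "norm ((1/2) *\<^sub>R (u + v)) \<le> (norm u + norm v) / 2"
    using norm_triangle_ineq[of u v] by simp
  then have "norm ((1/2) *\<^sub>R (u + v)) powr r \<le> ((norm u + norm v) / 2) powr r"
    using assms by (intro powr_mono2) auto
  also have "\<dots> < (norm u powr r + norm v powr r) / 2"
  proof (cases "norm u < norm v")
    case True
    then show ?thesis using powr_midpoint_strict[OF assms(1), of "norm u" "norm v"] by simp
  next
    case nl: False
    then show ?thesis
      using False powr_midpoint_strict[OF assms(1), of "norm v" "norm u"] by (simp add: add.commute)
  qed
  finally show ?thesis .
next
  case True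
  have "0 < norm (u - v)" using assms by simp
  then have "0 < (norm (u - v))\<^sup>2" by (simp only: zero_less_power)
  moreover have "(norm (u + v))\<^sup>2 = 2 * (norm u)\<^sup>2 + 2 * (norm v)\<^sup>2 - (norm (u - v))\<^sup>2"
    by (simp add: power2_norm_eq_inner inner_diff inner_add inner_commute)
  ultimately have "(norm (u + v))\<^sup>2 < (2 * norm u)\<^sup>2" using True by (simp add: power_mult_distrib)
  then have "norm (u + v) < 2 * norm u" by (rule power2_less_imp_less) simp
  then have "norm ((1/2) *\<^sub>R (u + v)) powr r < norm u powr r"
    using assms by (intro powr_less_mono2) auto
  then show ?thesis using True by simp
qed

lemma powr_diff_le:
  fixes u v :: "'a::real_normed_vector"
  assumes "1 \<le> r"
  shows "norm (u - v) powr r \<le> 2 powr r * (norm u powr r + norm v powr r)"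
proof -
  have "norm (u - v) powr r \<le> (2 * ((norm u + norm v) / 2)) powr r"
    using norm_triangle_ineq4[of u v] assms by (intro powr_mono2) auto
  also have "\<dots> = 2 powr r * ((norm u + norm v) / 2) powr r"
    by (rule powr_mult) 
  also have "\<dots> \<le> 2 powr r * ((norm u powr r + norm v powr r) / 2)"
    using assms by (intro mult_left_mono powr_midpoint) auto
  also have "\<dots> \<le> 2 powr r * (norm u powr r + norm v powr r)"
    by (intro mult_left_mono) auto
  finally show ?thesis .
qed

text \<open>A compactness argument: both sides are homogeneous of degree \<open>r\<close>, and the
  quotient of the midpoint term by the mean is continuous and below 1 on the compact set of unit
  pairs that satisfy the hypothesis. So its maximum there is below 1.\<close>

lemma powr_norm_uniformly_convex:
  fixes r \<epsilon> :: real
  assumes "1 < r" "0 < \<epsilon>"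
  obtains \<delta> where "0 < \<delta>" "\<delta> < 1"
    "\<And>u v :: 'a::euclidean_space. norm (u - v) powr r \<ge> \<epsilon> * (norm u powr r + norm v powr r) \<Longrightarrow>
      norm ((1/2) *\<^sub>R (u + v)) powr r \<le> (1 - \<delta>) * ((norm u powr r + norm v powr r) / 2)"
proof -
  define p where "p = (\<lambda>z :: 'a \<times> 'a. norm (fst z) powr r + norm (snd z) powr r)"
  define d where "d = (\<lambda>z :: 'a \<times> 'a. norm (fst z - snd z) powr r)"
  define h where "h = (\<lambda>z :: 'a \<times> 'a. norm ((1/2) *\<^sub>R (fst z + snd z)) powr r)"
  have cont: "continuous_on UNIV p" "continuous_on UNIV d" "continuous_on UNIV h"
    unfolding p_def d_def h_def
    using assms by (auto intro!: continuous_intros continuous_on_powr')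
  have p0: "p z > 0" if "z \<noteq> 0" for z
  proof -
    have "fst z \<noteq> 0 \<or> snd z \<noteq> 0" using that by (auto simp: prod_eq_iff)
    then show ?thesis
      unfolding p_def by (auto intro: add_pos_nonneg add_nonneg_pos)
  qed
  define K where "K = sphere (0 :: 'a \<times> 'a) 1 \<inter> {z. \<epsilon> * p z \<le> d z}"
  have "closed {z. \<epsilon> * p z \<le> d z}"
    using cont by (intro closed_Collect_le continuous_intros) 
  then have K: "compact K"
    unfolding K_def by (intro compact_Int_closed compact_sphere)
  define F where "F = (\<lambda>z. h z / (p z / 2))"
  have Fcont: "continuous_on K F"
  proof -
    have "continuous_on K h" "continuous_on K (\<lambda>z. p z / 2)"
      using cont by (auto intro!: continuous_intros intro: continuous_on_subset)
    moreover have "\<forall>z\<in>K. p z / 2 \<noteq> 0"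
    proof
      fix z assume "z \<in> K"
      then have "z \<noteq> 0" by (auto simp: K_def)
      then show "p z / 2 \<noteq> 0" using p0[of z] by simp
    qed
    ultimately show ?thesis unfolding F_def by (rule continuous_on_divide)
  qed
  have F1: "F z < 1" if "z \<in> K" for z
  proof -
    have "z \<noteq> 0" using that by (auto simp: K_def)
    then have "p z > 0" by (rule p0)
    moreover have "fst z \<noteq> snd z"
    proof
      assume "fst z = snd z"
      then have "d z = 0" using assms by (simp add: d_def)
      moreover have "\<epsilon> * p z > 0" using \<open>p z > 0\<close> assms by simp
      ultimately show False using that by (auto simp: K_def)
    qed
    ultimately show ?thesis
      using norm_midpoint_powr_strict[OF assms(1), of "fst z" "snd z"] by (simp add: F_def h_def p_def)
  qed
  \<comment> \<open>The value 1/2 keeps the constant positive, and serves when no unit pair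
    satisfies the hypothesis.\<close>
  have "\<exists>c<1. c > 0 \<and> (\<forall>z\<in>K. F z \<le> c)"
  proof (cases "K = {}")
    case False
    then obtain z0 where "z0 \<in> K" "\<forall>z\<in>K. F z \<le> F z0"
      using continuous_attains_sup[OF K _ Fcont] by blast
    then show ?thesis using F1[of z0] by (intro exI[of _ "max (F z0) (1/2)"]) (auto simp: le_max_iff_disj)
  qed (auto intro: exI[of _ "1/2"])
  then obtain c where c: "c < 1" "c > 0" "\<And>z. z \<in> K \<Longrightarrow> F z \<le> c" by blast
  show ?thesis
  proof (rule that[of "1 - c"])
    fix u v :: 'a
    assume uv: "norm (u - v) powr r \<ge> \<epsilon> * (norm u powr r + norm v powr r)"
    show "norm ((1/2) *\<^sub>R (u + v)) powr r \<le> (1 - (1 - c)) * ((norm u powr r + norm v powr r) / 2)"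
    proof (cases "(u, v) = 0")
      case True
      then show ?thesis using assms by (simp add: zero_prod_def)
    next
      case False
      define t where "t = 1 / norm (u, v)"
      have t: "t > 0" using False by (simp add: t_def)
      define z where "z = t *\<^sub>R (u, v)"
      have "norm z = 1" using False by (simp add: z_def t_def del: scaleR_Pair)
      have pz: "p z = t powr r * p (u, v)" "d z = t powr r * d (u, v)"
        using t by (simp_all add: z_def p_def d_def powr_mult algebra_simps scaleR_diff_right[symmetric] del: scaleR_diff_right)
      have hz: "h z = t powr r * h (u, v)"
      proof -
        have "(1/2) *\<^sub>R (t *\<^sub>R u + t *\<^sub>R v) = t *\<^sub>R ((1/2) *\<^sub>R (u + v))"
          by (simp add: algebra_simps)
        then show ?thesis using t unfolding h_def z_def by (simp add: powr_mult[symmetric] del: scaleR_scaleR)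
      qed
      have "\<epsilon> * p z \<le> d z" using uv t unfolding pz by (simp add: p_def d_def)
      then have "F z \<le> c" using c(3)[of z] \<open>norm z = 1\<close> by (simp add: K_def)
      moreover have "F z = F (u, v)" using t by (simp add: F_def pz hz)
      ultimately have "F (u, v) \<le> c" by simp
      then have "h (u, v) \<le> c * (p (u, v) / 2)"
        using p0[OF False] by (simp add: F_def pos_divide_le_eq)
      then show ?thesis by (simp add: h_def p_def)
    qed
  qed (use c in auto)
qed

text \<open>In this form uniform convexity survives summation: \<open>X\<close>, \<open>Y\<close>, \<open>D\<close>, \<open>A\<close> stand for a
  modular at \<open>x\<close>, \<open>y\<close>, \<open>x - y\<close>, \<open>(x + y)/2\<close>.\<close>

lemma uniform_convexity_sum:
  fixes X Y D A :: "'i \<Rightarrow> real"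
  assumes "finite J" and C: "0 < C" and "0 < \<epsilon>" "0 \<le> \<delta>"
    and D: "\<And>j. j \<in> J \<Longrightarrow> D j \<le> C * (X j + Y j)"
    and A: "\<And>j. j \<in> J \<Longrightarrow> A j \<le> (X j + Y j) / 2"
    and uc: "\<And>j. j \<in> J \<Longrightarrow> D j \<ge> \<epsilon> / 2 * (X j + Y j) \<Longrightarrow> A j \<le> (1 - \<delta>) * ((X j + Y j) / 2)"
    and nonneg: "\<And>j. j \<in> J \<Longrightarrow> 0 \<le> X j" "\<And>j. j \<in> J \<Longrightarrow> 0 \<le> Y j"
    and big: "sum D J \<ge> \<epsilon> * (sum X J + sum Y J)"
  shows "sum A J \<le> (1 - \<delta> * \<epsilon> / (2 * C)) * ((sum X J + sum Y J) / 2)"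
proof -
  \<comment> \<open>The indices outside \<open>S\<close> carry at most half of the assumed lower
    bound for the sum of \<open>D\<close>, so \<open>S\<close> carries a fixed share of the sum of
    \<open>X + Y\<close>. Only there is the gain used.\<close>
  define S where "S = {j\<in>J. D j \<ge> \<epsilon> / 2 * (X j + Y j)}"
  have S: "S \<subseteq> J" "finite S" using assms(1) by (auto simp: S_def)
  define Z where "Z = (\<lambda>j. X j + Y j)"
  have Z: "sum X J + sum Y J = sum Z J" by (simp add: Z_def sum.distrib)
  have Z0: "0 \<le> Z j" if "j \<in> J" for j using nonneg that by (simp add: Z_def)
  have "sum D J = sum D S + sum D (J - S)"
    using sum.subset_diff[OF S(1) assms(1)] by (simp add: add.commute)
  also have "sum D S \<le> (\<Sum>j\<in>S. C * Z j)"
    using D S(1) by (intro sum_mono) (auto simp: Z_def)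
  also have "sum D (J - S) \<le> (\<Sum>j\<in>J - S. \<epsilon> / 2 * Z j)"
    by (intro sum_mono) (auto simp: S_def Z_def)
  also have "\<dots> \<le> (\<Sum>j\<in>J. \<epsilon> / 2 * Z j)"
    using assms Z0 by (intro sum_mono2) auto
  finally have "\<epsilon> * sum Z J \<le> C * sum Z S + \<epsilon> / 2 * sum Z J"
    using big by (simp add: Z sum_distrib_left)
  then have key: "\<epsilon> / (2 * C) * sum Z J \<le> sum Z S"
    using C by (simp add: field_simps)
  have "sum A J = sum A S + sum A (J - S)"
    using sum.subset_diff[OF S(1) assms(1)] by (simp add: add.commute)
  also have "sum A S \<le> (\<Sum>j\<in>S. (1 - \<delta>) * (Z j / 2))"
    using uc by (intro sum_mono) (auto simp: S_def Z_def)
  also have "sum A (J - S) \<le> (\<Sum>j\<in>J - S. Z j / 2)"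
    using A by (intro sum_mono) (auto simp: Z_def)
  also have "(\<Sum>j\<in>S. (1 - \<delta>) * (Z j / 2)) + (\<Sum>j\<in>J - S. Z j / 2) = sum Z J / 2 - \<delta> * (sum Z S / 2)"
  proof -
    have "sum Z J = sum Z S + sum Z (J - S)"
      using sum.subset_diff[OF S(1) assms(1)] by (simp add: add.commute)
    moreover have "(\<Sum>j\<in>S. (1 - \<delta>) * (Z j / 2)) = (1 - \<delta>) * (sum Z S / 2)"
      by (simp add: sum_distrib_left sum_divide_distrib)
    ultimately show ?thesis
      by (simp add: sum_divide_distrib[symmetric] left_diff_distrib add_divide_distrib)
  qed
  also have "\<dots> \<le> sum Z J / 2 - \<delta> * (\<epsilon> / (2 * C) * sum Z J / 2)"
    using key assms(4) by (intro diff_left_mono mult_left_mono divide_right_mono) auto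
  also have "\<dots> = (1 - \<delta> * \<epsilon> / (2 * C)) * (sum Z J / 2)"
    by (simp add: algebra_simps)
  finally show ?thesis by (simp add: Z)
qed

text \<open>Turns a modulus relative to the maximum of two norms into one relative to the mean of
  their \<open>q\<close>-th powers. If \<open>a\<close> and \<open>b\<close> are far apart, the
  scalar uniform convexity of \<open>t powr q\<close> already gains; if they are close, the maximum
  is almost the mean and the gain \<open>f e\<close> of the hypothesis is lost only in part.\<close>

lemma uniform_convexity_max_to_powr:
  fixes q \<epsilon> :: real and f :: "real \<Rightarrow> real"
  assumes q: "1 < q" and \<epsilon>: "0 < \<epsilon>" and f: "\<And>e. 0 < e \<Longrightarrow> 0 < f e \<and> f e < 1"
  shows "\<exists>\<delta>>0. \<delta> < 1 \<and> (\<forall>a b d h. 0 \<le> a \<longrightarrow> 0 \<le> b \<longrightarrow> 0 \<le> d \<longrightarrow> 0 \<le> h \<longrightarrow> h \<le> (a + b) / 2 \<longrightarrow>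
      (\<forall>e>0. d \<ge> e * max a b \<longrightarrow> h \<le> (1 - f e) * max a b) \<longrightarrow>
      d powr q \<ge> \<epsilon> * (a powr q + b powr q) \<longrightarrow>
      h powr q \<le> (1 - \<delta>) * ((a powr q + b powr q) / 2))"
proof -
  \<comment> \<open>\<open>e\<close> is chosen so that the hypothesis on \<open>d powr q\<close>
    gives \<open>d \<ge> e * max a b\<close>, \<open>\<tau>\<close> so that
    \<open>(1 - \<tau>) powr q = 1 - f e\<close>, and \<open>\<kappa>\<close> so that failure of the
    separation test for \<open>a\<close> and \<open>b\<close> means
    \<open>\<bar>a - b\<bar> \<le> \<tau> * max a b\<close>.\<close>
  define e where "e = \<epsilon> powr (1 / q)"
  have e: "e > 0" using \<epsilon> by (simp add: e_def)
  define \<tau> where "\<tau> = 1 - (1 - f e) powr (1 / q)"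
  have f1: "0 < f e" "f e < 1" using f[OF e] by auto
  have "(1 - f e) powr (1 / q) < 1"
    using f1 q powr_less_mono2[of "1/q" "1 - f e" 1] by simp
  then have \<tau>: "0 < \<tau>" "\<tau> \<le> 1" by (auto simp: \<tau>_def)
  define \<kappa> where "\<kappa> = \<tau> powr q / 2"
  have \<kappa>: "0 < \<kappa>" using \<tau> by (simp add: \<kappa>_def)
  obtain \<delta>1 where \<delta>1: "0 < \<delta>1" "\<delta>1 < 1"
    "\<And>u v :: real. norm (u - v) powr q \<ge> \<kappa> * (norm u powr q + norm v powr q) \<Longrightarrow>
      norm ((1/2) *\<^sub>R (u + v)) powr q \<le> (1 - \<delta>1) * ((norm u powr q + norm v powr q) / 2)"
    using powr_norm_uniformly_convex[OF q \<kappa>] by blast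
  show ?thesis
  proof (intro exI[of _ "min \<delta>1 (f e / 2)"] conjI allI impI)
    fix a b d h :: real
    assume nn: "0 \<le> a" "0 \<le> b" "0 \<le> d" "0 \<le> h" and hab: "h \<le> (a + b) / 2"
      and uc: "\<forall>e>0. d \<ge> e * max a b \<longrightarrow> h \<le> (1 - f e) * max a b"
      and big: "d powr q \<ge> \<epsilon> * (a powr q + b powr q)"
    define A where "A = (a powr q + b powr q) / 2"
    define m where "m = max a b"
    have A0: "0 \<le> A" by (simp add: A_def)
    have mq: "m powr q \<le> a powr q + b powr q" "m \<ge> 0" using nn by (auto simp: m_def max_def)
    have "h powr q \<le> (1 - \<delta>1) * A \<or> h powr q \<le> (1 - f e / 2) * A"
    proof (cases "\<bar>a - b\<bar> powr q \<ge> \<kappa> * (a powr q + b powr q)")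
      case True
      then have "norm ((1/2) *\<^sub>R (a + b)) powr q \<le> (1 - \<delta>1) * A"
        using \<delta>1(3)[of a b] nn by (simp add: A_def)
      moreover have "h powr q \<le> ((a + b) / 2) powr q"
        using hab nn q by (intro powr_mono2) auto
      ultimately show ?thesis using nn by simp
    next
      case False
      then have "\<bar>a - b\<bar> powr q \<le> \<kappa> * (2 * m powr q)"
      proof -
        have "a powr q \<le> m powr q" "b powr q \<le> m powr q"
          using nn q by (auto simp: m_def intro!: powr_mono2)
        then have "\<kappa> * (a powr q + b powr q) \<le> \<kappa> * (2 * m powr q)"
          using \<kappa> by (intro mult_left_mono) auto
        then show ?thesis using False by linarith
      qed
      also have "\<dots> = (\<tau> * m) powr q"
        using \<tau> mq by (simp add: \<kappa>_def powr_mult)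
      finally have "\<bar>a - b\<bar> \<le> \<tau> * m"
        using \<tau> mq q powr_less_mono2[of q "\<tau> * m" "\<bar>a - b\<bar>"] by (force simp: not_le[symmetric])
      then have minab: "(1 - \<tau>) * m \<le> min a b"
        by (auto simp: m_def algebra_simps max_def min_def abs_if split: if_splits)
      have "(1 - f e) * m powr q = ((1 - \<tau>) * m) powr q"
        using f1 mq q by (simp add: \<tau>_def powr_mult powr_powr)
      also have "\<dots> \<le> (min a b) powr q"
        using minab \<tau> mq q by (intro powr_mono2) auto
      finally have "m powr q + (1 - f e) * m powr q \<le> 2 * A"
        by (auto simp: A_def m_def max_def min_def split: if_splits)
      then have A: "(1 - f e / 2) * m powr q \<le> A" by (simp add: algebra_simps)
      have "(e * m) powr q = \<epsilon> * m powr q"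
        using \<epsilon> e mq q by (simp add: e_def powr_mult powr_powr)
      also have "\<dots> \<le> d powr q" using big mq \<epsilon> by (meson mult_left_mono order_trans less_imp_le)
      finally have "e * m \<le> d"
        using nn e mq q powr_less_mono2[of q d "e * m"] by (force simp: not_le[symmetric])
      then have "h \<le> (1 - f e) * m" using uc e by (simp add: m_def)
      then have "h powr q \<le> ((1 - f e) * m) powr q" using nn q by (intro powr_mono2) auto
      also have "\<dots> = (1 - f e) powr q * m powr q" using f1 mq by (simp add: powr_mult)
      also have "\<dots> \<le> (1 - f e) powr 1 * m powr q"
        using f1 q by (intro mult_right_mono powr_mono') auto
      also have "\<dots> = (1 - f e) * m powr q" using f1 by simp
      \<comment> \<open>One factor \<open>1 - f e / 2\<close> pays for replacing the maximum by the
        mean, the other remains as the gain.\<close>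
      also have "\<dots> \<le> (1 - f e / 2) * ((1 - f e / 2) * m powr q)"
      proof -
        have "1 - f e \<le> (1 - f e / 2) * (1 - f e / 2)" by (simp add: algebra_simps)
        then have "(1 - f e) * m powr q \<le> ((1 - f e / 2) * (1 - f e / 2)) * m powr q"
          by (intro mult_right_mono) auto
        then show ?thesis by (simp only: mult.assoc)
      qed
      also have "\<dots> \<le> (1 - f e / 2) * A"
        using A f1 by (intro mult_left_mono) auto
      finally show ?thesis by blast
    qed
    moreover have "(1 - \<delta>1) * A \<le> (1 - min \<delta>1 (f e / 2)) * A" "(1 - f e / 2) * A \<le> (1 - min \<delta>1 (f e / 2)) * A"
      using A0 by (auto intro!: mult_right_mono)
    ultimately show "h powr q \<le> (1 - min \<delta>1 (f e / 2)) * ((a powr q + b powr q) / 2)"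
      unfolding A_def by linarith
  qed (use \<delta>1 f1 in auto)
qed

subsection \<open>Luxemburg norms\<close>

lemma power_tangent_le:
  fixes a t :: real
  assumes "0 \<le> a" "0 \<le> t"
  shows "a ^ Suc m + real (Suc m) * a ^ m * (t - a) \<le> t ^ Suc m"
proof (induction m)
  case (Suc m)
  have "t * (a ^ Suc m + real (Suc m) * a ^ m * (t - a)) \<le> t * t ^ Suc m"
    using Suc assms by (intro mult_left_mono) auto
  \<comment> \<open>Multiplying the induction hypothesis by \<open>t\<close> overshoots the next
    tangent line by a non-negative multiple of a square.\<close>
  moreover have "t * (a ^ Suc m + real (Suc m) * a ^ m * (t - a)) -
      (a ^ Suc (Suc m) + real (Suc (Suc m)) * a ^ Suc m * (t - a)) = real (Suc m) * a ^ m * (t - a)\<^sup>2"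
    by (simp add: algebra_simps power2_eq_square)
  moreover have "0 \<le> real (Suc m) * a ^ m * (t - a)\<^sup>2" using assms by simp
  ultimately show ?case by simp
qed simp

text \<open>The linear branch is the tangent of \<open>t ^ Suc m\<close> at 1, which keeps the
  function convex. Composed with \<open>u powr r\<close> it gives an Orlicz function with exponent
  \<open>r * Suc m\<close> near 0 and only \<open>r\<close> at infinity.\<close>

definition power_linear :: "nat \<Rightarrow> real \<Rightarrow> real" where
  "power_linear m t = (if t \<le> 1 then t ^ Suc m else 1 + real (Suc m) * (t - 1))"

lemma power_linear_0 [simp]: "power_linear m 0 = 0"
  by (simp add: power_linear_def)

lemma power_linear_mono:
  assumes "0 \<le> s" "s \<le> t"
  shows "power_linear m s \<le> power_linear m t"
proof -
  have "s ^ Suc m \<le> 1" if "s \<le> 1" using that assms by (simp only: power_le_one)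
  then have "s ^ Suc m \<le> 1 + real (Suc m) * (t - 1)" if "s \<le> 1" "t > 1"
    using that by (smt (verit) mult_nonneg_nonneg of_nat_0_le_iff)
  then show ?thesis
    using assms power_mono[of s t "Suc m"]
    by (auto simp: power_linear_def simp del: power_Suc of_nat_Suc intro: mult_left_mono)
qed

lemma power_linear_nonneg: "0 \<le> t \<Longrightarrow> 0 \<le> power_linear m t"
  using power_linear_mono[of 0 t m] by simp

text \<open>The slope is the derivative, written for both branches at once. Convexity follows by
  supporting the graph at the convex combination.\<close>

lemma power_linear_tangent:
  assumes "0 \<le> a" "0 \<le> t"
  shows "power_linear m a + real (Suc m) * (min a 1) ^ m * (t - a) \<le> power_linear m t"
proof -
  have B: "1 + real (Suc m) * (t - 1) \<le> t ^ Suc m"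
    using power_tangent_le[of 1 t m] assms by simp
  consider "a \<le> 1" "t \<le> 1" | "a \<le> 1" "t > 1" | "a > 1" "t \<le> 1" | "a > 1" "t > 1" by linarith
  then show ?thesis
  proof cases
    case 1
    then show ?thesis using power_tangent_le[OF assms] by (simp add: power_linear_def del: power_Suc of_nat_Suc)
  next
    case 2
    have 1: "a ^ Suc m + real (Suc m) * a ^ m * (1 - a) \<le> 1"
      using power_tangent_le[OF assms(1), of 1 m] by simp
    have "a ^ m \<le> 1" using assms 2 by (simp add: power_le_one)
    then have "real (Suc m) * a ^ m * (t - 1) \<le> real (Suc m) * 1 * (t - 1)"
      using 2 by (intro mult_right_mono mult_left_mono) auto
    moreover have "real (Suc m) * a ^ m * (t - a) = real (Suc m) * a ^ m * (1 - a) + real (Suc m) * a ^ m * (t - 1)"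
      by (simp add: algebra_simps)
    ultimately have "a ^ Suc m + real (Suc m) * a ^ m * (t - a) \<le> 1 + real (Suc m) * (t - 1)"
      using 1 by linarith
    then show ?thesis using 2 by (simp add: power_linear_def del: power_Suc of_nat_Suc)
  next
    case 3
    then show ?thesis using B by (simp add: power_linear_def del: power_Suc of_nat_Suc) (simp add: algebra_simps)
  next
    case 4
    then show ?thesis by (simp add: power_linear_def) (simp add: algebra_simps)
  qed
qed

lemma power_linear_convex:
  assumes "0 \<le> x" "0 \<le> y" "0 \<le> t" "t \<le> 1"
  shows "power_linear m (t * x + (1 - t) * y) \<le> t * power_linear m x + (1 - t) * power_linear m y"
proof -
  define z where "z = t * x + (1 - t) * y"
  define g where "g = real (Suc m) * (min z 1) ^ m"
  have z: "0 \<le> z" using assms by (simp add: z_def)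
  have "t * (power_linear m z + g * (x - z)) + (1 - t) * (power_linear m z + g * (y - z))
      \<le> t * power_linear m x + (1 - t) * power_linear m y"
    using power_linear_tangent[OF z assms(1), of m] power_linear_tangent[OF z assms(2), of m] assms
    by (intro add_mono mult_left_mono) (auto simp: g_def)
  moreover have "t * (power_linear m z + g * (x - z)) + (1 - t) * (power_linear m z + g * (y - z)) = power_linear m z"
    by (simp add: z_def algebra_simps)
  ultimately show ?thesis by (simp add: z_def)
qed

lemma power_linear_scale_le:
  assumes "0 \<le> x" "0 \<le> t" "t \<le> 1"
  shows "power_linear m (t * x) \<le> t * power_linear m x"
  using power_linear_convex[of x 0 t m] assms by simp

lemma power_linear_le_power:
  assumes "0 \<le> t" shows "power_linear m t \<le> t ^ Suc m"
  using power_tangent_le[of 1 t m] assms by (simp add: power_linear_def del: power_Suc of_nat_Suc)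

lemma power_linear_le_linear:
  assumes "0 \<le> t" shows "power_linear m t \<le> real (Suc m) * t"
proof (cases "t \<le> 1")
  case True
  then have "t ^ Suc m \<le> t" using assms power_le_one[of t m] by (simp add: mult_left_le)
  moreover have "t \<le> real (Suc m) * t" using assms by (simp add: algebra_simps)
  ultimately show ?thesis using True by (simp add: power_linear_def del: power_Suc of_nat_Suc)
qed (simp add: power_linear_def algebra_simps)

text \<open>The Delta_2 condition. On the linear branch it rests on Bernoulli's inequality
  \<open>1 + Suc m * (c - 1) \<le> c ^ Suc m\<close>.\<close>

lemma power_linear_scale_ge:
  assumes "0 \<le> t" "1 \<le> c"
  shows "power_linear m (c * t) \<le> c ^ Suc m * power_linear m t"
proof (cases "t \<le> 1")
  case True
  have "power_linear m (c * t) \<le> (c * t) ^ Suc m"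
    using assms by (intro power_linear_le_power) auto
  then show ?thesis
    using True by (simp add: power_linear_def power_mult_distrib del: power_Suc of_nat_Suc)
next
  case False
  then have ct: "c * t > 1" using assms by (simp add: less_1_mult' mult_less_cancel_right2 less_le_trans[of 1 t])
  have c: "c \<le> c ^ Suc m" using assms self_le_power by simp
  have "1 + real (Suc m) * (c * t - 1) = (1 + real (Suc m) * (c - 1)) + c * (real (Suc m) * (t - 1))"
    by (simp add: algebra_simps)
  also have "\<dots> \<le> c ^ Suc m + c ^ Suc m * (real (Suc m) * (t - 1))"
    using power_tangent_le[of 1 c m] assms c False by (intro add_mono mult_right_mono) auto
  finally show ?thesis
    using False ct by (simp add: power_linear_def distrib_left del: power_Suc of_nat_Suc)
qed

section \<open>The Orlicz function and its uniform convexity\<close>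

locale orlicz =
  fixes r :: real and m :: nat
  assumes r: "1 < r"
begin

definition \<phi> :: "real \<Rightarrow> real" where "\<phi> u = power_linear m (u powr r)"

text \<open>The exponent near 0. A large \<open>m\<close> raises it at will while the exponent
  \<open>r\<close> at infinity stays close to 1.\<close>

definition p :: real where "p = r * real (Suc m)"

lemma p_pos: "0 < p" unfolding p_def using r by simp

lemma phi_0 [simp]: "\<phi> 0 = 0"
  by (simp add: \<phi>_def)

lemma phi_nonneg: "0 \<le> \<phi> u"
  by (simp add: \<phi>_def power_linear_nonneg)

lemma phi_mono: "0 \<le> u \<Longrightarrow> u \<le> v \<Longrightarrow> \<phi> u \<le> \<phi> v"
  unfolding \<phi>_def using r by (intro power_linear_mono powr_mono2) auto

lemma phi_convex:
  fixes u v :: "'a::real_normed_vector"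
  assumes "0 \<le> t" "t \<le> 1"
  shows "\<phi> (norm (t *\<^sub>R u + (1 - t) *\<^sub>R v)) \<le> t * \<phi> (norm u) + (1 - t) * \<phi> (norm v)"
proof -
  have "norm (t *\<^sub>R u + (1 - t) *\<^sub>R v) \<le> t * norm u + (1 - t) * norm v"
    using norm_triangle_ineq[of "t *\<^sub>R u" "(1 - t) *\<^sub>R v"] assms by simp
  then have "norm (t *\<^sub>R u + (1 - t) *\<^sub>R v) powr r \<le> (t * norm u + (1 - t) * norm v) powr r"
    using r by (intro powr_mono2) auto
  also have "\<dots> \<le> t * norm u powr r + (1 - t) * norm v powr r"
    using r assms by (intro powr_convex_combination) auto
  finally have "\<phi> (norm (t *\<^sub>R u + (1 - t) *\<^sub>R v)) \<le> power_linear m (t * norm u powr r + (1 - t) * norm v powr r)"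
    unfolding \<phi>_def by (intro power_linear_mono) auto
  also have "\<dots> \<le> t * \<phi> (norm u) + (1 - t) * \<phi> (norm v)"
    unfolding \<phi>_def using assms by (intro power_linear_convex) auto
  finally show ?thesis .
qed

lemma phi_scale_le:
  assumes "0 \<le> t" "t \<le> 1" "0 \<le> u"
  shows "\<phi> (t * u) \<le> t * \<phi> u"
  using phi_convex[of t u 0] assms by simp

lemma powr_r_power: "0 < c \<Longrightarrow> (c powr r) ^ Suc m = c powr p"
  using powr_realpow[of "c powr r" "Suc m"] by (simp add: p_def powr_powr del: power_Suc)

lemma phi_scale_ge:
  assumes "0 \<le> u" "1 \<le> c"
  shows "\<phi> (c * u) \<le> c powr p * \<phi> u"
proof -
  have "\<phi> (c * u) = power_linear m (c powr r * u powr r)"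
    using assms by (simp add: \<phi>_def powr_mult)
  also have "\<dots> \<le> (c powr r) ^ Suc m * power_linear m (u powr r)"
    using assms r by (intro power_linear_scale_ge ge_one_powr_ge_zero) auto
  also have "(c powr r) ^ Suc m = c powr p"
    using assms by (intro powr_r_power) auto
  finally show ?thesis by (simp add: \<phi>_def)
qed

text \<open>The normalisation that makes the modular an upper bound for the number of large
  coordinates.\<close>

lemma phi_gt_1:
  assumes "1 < u" shows "1 < \<phi> u"
proof -
  have "1 < u powr r" using assms r by simp
  then show ?thesis by (simp add: \<phi>_def power_linear_def)
qed

text \<open>The bound with the small exponent, good at large arguments; it handles the coordinates
  above a level. Its counterpart \<open>phi_le_power\<close> has the large exponent and handles
  those below.\<close>

lemma phi_le_linear: "\<phi> u \<le> real (Suc m) * u powr r"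
  unfolding \<phi>_def by (intro power_linear_le_linear) auto

lemma phi_le_power:
  assumes "0 \<le> u" shows "\<phi> u \<le> u powr p"
proof (cases "u = 0")
  case False
  have "(u powr r) ^ Suc m = u powr p"
    using False assms by (intro powr_r_power) auto
  then show ?thesis unfolding \<phi>_def using power_linear_le_power[of "u powr r" m] by simp
qed simp

lemma phi_midpoint:
  fixes u v :: "'a::real_normed_vector"
  shows "\<phi> (norm ((1/2) *\<^sub>R (u + v))) \<le> (\<phi> (norm u) + \<phi> (norm v)) / 2"
  using phi_convex[of "1/2" u v] by (simp add: scaleR_add_right)

lemma phi_diff:
  fixes u v :: "'a::real_normed_vector"
  shows "\<phi> (norm (u - v)) \<le> 2 powr p * (\<phi> (norm u) + \<phi> (norm v))"
proof -
  have "\<phi> (norm (u - v)) = \<phi> (2 * norm ((1/2) *\<^sub>R (u + - v)))" by simp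
  also have "\<dots> \<le> 2 powr p * \<phi> (norm ((1/2) *\<^sub>R (u + - v)))" by (rule phi_scale_ge) auto
  also have "\<dots> \<le> 2 powr p * ((\<phi> (norm u) + \<phi> (norm (- v))) / 2)"
    by (intro mult_left_mono phi_midpoint) auto
  also have "\<dots> \<le> 2 powr p * (\<phi> (norm u) + \<phi> (norm v))"
    using phi_nonneg[of "norm u"] phi_nonneg[of "norm v"] by (intro mult_left_mono) auto
  finally show ?thesis .
qed

text \<open>Scaling the argument by \<open>e \<le> 1\<close> shrinks \<open>power_linear\<close> at
  least by the factor \<open>e\<close>, so a large value of \<open>\<phi>\<close> at the difference
  forces a large \<open>r\<close>-th power there, and the uniform convexity of the power applies.
  Its gain passes through \<open>power_linear\<close> by the same scaling and by convexity.\<close>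

lemma phi_uniformly_convex:
  assumes "0 < \<epsilon>"
  obtains \<delta> where "0 < \<delta>" "\<delta> < 1"
    "\<And>u v :: 'a::euclidean_space. \<phi> (norm (u - v)) \<ge> \<epsilon> * (\<phi> (norm u) + \<phi> (norm v)) \<Longrightarrow>
      \<phi> (norm ((1/2) *\<^sub>R (u + v))) \<le> (1 - \<delta>) * ((\<phi> (norm u) + \<phi> (norm v)) / 2)"
proof -
  define e where "e = min (\<epsilon> / 2) 1"
  have e: "0 < e" "e \<le> 1" "e < \<epsilon>" using assms by (auto simp: e_def)
  obtain \<delta> where \<delta>: "0 < \<delta>" "\<delta> < 1"
    "\<And>u v :: 'a. norm (u - v) powr r \<ge> e / 2 * (norm u powr r + norm v powr r) \<Longrightarrow>
      norm ((1/2) *\<^sub>R (u + v)) powr r \<le> (1 - \<delta>) * ((norm u powr r + norm v powr r) / 2)"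
    using powr_norm_uniformly_convex[OF r, of "e / 2"] e by auto
  have pl0: "power_linear m x > 0" if "x > 0" for x
    using that by (auto simp: power_linear_def add_pos_nonneg)
  show ?thesis
  proof (rule that[OF \<delta>(1,2)])
    fix u v :: 'a
    assume big: "\<phi> (norm (u - v)) \<ge> \<epsilon> * (\<phi> (norm u) + \<phi> (norm v))"
    define x where "x = norm u powr r"
    define y where "y = norm v powr r"
    define d where "d = norm (u - v) powr r"
    have nn: "0 \<le> x" "0 \<le> y" "0 \<le> d" by (auto simp: x_def y_def d_def)
    have "d \<ge> e * max x y"
    proof (rule ccontr)
      assume less: "\<not> d \<ge> e * max x y"
      then have mx: "max x y > 0" using nn e
        by (smt (verit) mult_not_zero)
      have "power_linear m d \<le> power_linear m (e * max x y)"
        using less nn by (intro power_linear_mono) auto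
      also have "\<dots> \<le> e * power_linear m (max x y)"
        using e mx by (intro power_linear_scale_le) auto
      also have "\<dots> < \<epsilon> * power_linear m (max x y)"
        using e pl0[OF mx] by simp
      also have "\<dots> \<le> \<epsilon> * (power_linear m x + power_linear m y)"
        using assms nn power_linear_nonneg[of x m] power_linear_nonneg[of y m]
        by (intro mult_left_mono) (auto simp: max_def)
      finally show False using big by (simp add: \<phi>_def x_def y_def d_def)
    qed
    moreover have "e / 2 * (x + y) \<le> e * max x y"
      using e nn by (simp add: field_simps mult_left_mono max_def)
    ultimately have "norm ((1/2) *\<^sub>R (u + v)) powr r \<le> (1 - \<delta>) * ((x + y) / 2)"
      using \<delta>(3)[of u v] by (simp add: x_def y_def d_def)
    then have "\<phi> (norm ((1/2) *\<^sub>R (u + v))) \<le> power_linear m ((1 - \<delta>) * ((x + y) / 2))"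
      unfolding \<phi>_def by (intro power_linear_mono) auto
    also have "\<dots> \<le> (1 - \<delta>) * power_linear m ((x + y) / 2)"
      using \<delta> nn by (intro power_linear_scale_le) auto
    also have "power_linear m ((x + y) / 2) \<le> (power_linear m x + power_linear m y) / 2"
      using power_linear_convex[of x y "1/2" m] nn by (simp add: add_divide_distrib)
    finally show "\<phi> (norm ((1/2) *\<^sub>R (u + v))) \<le> (1 - \<delta>) * ((\<phi> (norm u) + \<phi> (norm v)) / 2)"
      using \<delta> by (simp add: \<phi>_def x_def y_def)
  qed
qed

section \<open>Luxemburg norms with a variable level\<close>

definition modular :: "nat \<Rightarrow> (nat \<Rightarrow> 'a::real_normed_vector) \<Rightarrow> real \<Rightarrow> real" where
  "modular n f l = (\<Sum>k<n. \<phi> (norm (f k) / l))"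

text \<open>The Luxemburg norm for counting measure with the level \<open>B\<close> in place of 1.
  For \<open>B = \<beta> ^ j\<close> it stands in for the \<open>B\<close>-th largest modulus. Only
  the first \<open>n\<close> coordinates enter, which keeps every modular a finite sum.\<close>

definition lux :: "real \<Rightarrow> nat \<Rightarrow> (nat \<Rightarrow> 'a::real_normed_vector) \<Rightarrow> real" where
  "lux B n f = Inf {l. 0 < l \<and> modular n f l \<le> B}"

lemma modular_mono: "n \<le> n' \<Longrightarrow> modular n f l \<le> modular n' f l"
  unfolding modular_def by (intro sum_mono2) (auto simp: phi_nonneg)

lemma modular_antimono: "0 < l \<Longrightarrow> l \<le> l' \<Longrightarrow> modular n f l' \<le> modular n f l"
  unfolding modular_def by (intro sum_mono phi_mono) (auto intro!: divide_left_mono)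

lemma modular_scale_ge:
  assumes "1 \<le> c" "0 < l" shows "modular n f (c * l) \<le> modular n f l / c"
proof -
  have "\<phi> (norm (f k) / (c * l)) \<le> \<phi> (norm (f k) / l) / c" for k
    using phi_scale_le[of "1 / c" "norm (f k) / l"] assms by simp
  then show ?thesis
    unfolding modular_def sum_divide_distrib by (intro sum_mono) auto
qed

lemma modular_scale_le:
  assumes "1 \<le> c" "0 < l" shows "modular n f (l / c) \<le> c powr p * modular n f l"
proof -
  have "\<phi> (norm (f k) / (l / c)) \<le> c powr p * \<phi> (norm (f k) / l)" for k
    using phi_scale_ge[of "norm (f k) / l" c] assms by (simp add: mult.commute)
  then show ?thesis
    unfolding modular_def sum_distrib_left by (intro sum_mono) auto
qed

lemma lux_nonempty:
  assumes "0 < B" shows "{l. 0 < l \<and> modular n f l \<le> B} \<noteq> {}"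
proof -
  define c where "c = max 1 (modular n f 1 / B)"
  have "modular n f (c * 1) \<le> modular n f 1 / c"
    by (rule modular_scale_ge) (auto simp: c_def)
  also have "\<dots> \<le> B"
    using assms by (auto simp: c_def divide_le_eq max_def field_simps)
  finally show ?thesis by (auto simp: c_def intro!: exI[of _ c])
qed

lemma lux_le: "0 < l \<Longrightarrow> modular n f l \<le> B \<Longrightarrow> lux B n f \<le> l"
  unfolding lux_def by (intro cInf_lower bdd_belowI[of _ 0]) auto

lemma modular_le_if_lux_less:
  assumes "0 < B" "lux B n f < l" shows "modular n f l \<le> B"
proof -
  obtain l' where "0 < l'" "modular n f l' \<le> B" "l' < l"
    using assms cInf_lessD[OF lux_nonempty[OF assms(1), of n f], of l] by (auto simp: lux_def)
  then show ?thesis using modular_antimono[of l' l n f] by simp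
qed

lemma lux_nonneg: "0 < B \<Longrightarrow> 0 \<le> lux B n f"
  unfolding lux_def by (intro cInf_greatest lux_nonempty) auto

lemma lux_leI:
  assumes "0 \<le> L" "\<And>l. L < l \<Longrightarrow> modular n f l \<le> B"
  shows "lux B n f \<le> L"
  by (rule dense_ge) (use assms lux_le[of _ n f B] in fastforce)

lemma lux_mono: 
  assumes "0 < B" "n \<le> n'" shows "lux B n f \<le> lux B n' f"
  using modular_le_if_lux_less[OF assms(1), of n' f] modular_mono[OF assms(2), of f]
  by (intro lux_leI lux_nonneg assms) (meson order_trans)

lemma lux_scale_le:
  assumes "0 < B" "0 \<le> c" "\<And>k. k < n \<Longrightarrow> norm (g k) \<le> c * norm (f k)"
  shows "lux B n g \<le> c * lux B n f"
proof (rule lux_leI)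
  show "0 \<le> c * lux B n f" by (intro mult_nonneg_nonneg lux_nonneg assms)
  fix l assume l: "c * lux B n f < l"
  have "0 < l" using l assms lux_nonneg[OF assms(1), of n f] by (smt (verit) mult_nonneg_nonneg)
  have ex: "\<exists>l'>lux B n f. c * l' \<le> l \<and> 0 < l'"
  proof (cases "c = 0")
    case True
    then show ?thesis using \<open>0 < l\<close> lux_nonneg[OF assms(1), of n f] by (intro exI[of _ "lux B n f + 1"]) auto
  next
    case False
    then show ?thesis using l assms lux_nonneg[OF assms(1), of n f] \<open>0 < l\<close>
      by (intro exI[of _ "l / c"]) (auto simp: field_simps)
  qed
  then obtain l' where l': "lux B n f < l'" "c * l' \<le> l" "0 < l'" by blast
  have "norm (g k) / l \<le> norm (f k) / l'" if "k < n" for k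
  proof -
    have "norm (g k) * l' \<le> c * norm (f k) * l'" using assms(3)[OF that] l' by (intro mult_right_mono) auto
    also have "\<dots> = norm (f k) * (c * l')" by simp
    also have "\<dots> \<le> norm (f k) * l" using l' by (intro mult_left_mono) auto
    finally show ?thesis using \<open>0 < l\<close> l' by (simp add: field_simps)
  qed
  then have "modular n g l \<le> modular n f l'"
    unfolding modular_def using \<open>0 < l\<close> by (intro sum_mono phi_mono) auto
  also have "\<dots> \<le> B" using modular_le_if_lux_less[OF assms(1) l'(1)] .
  finally show "modular n g l \<le> B" .
qed

lemma lux_scale:
  assumes "0 < B" "0 \<le> c" "\<And>k. k < n \<Longrightarrow> norm (g k) = c * norm (f k)"
  shows "lux B n g = c * lux B n f"
proof (cases "c = 0")
  case True
  then show ?thesis using lux_scale_le[OF assms(1,2), of n g f] assms lux_nonneg[OF assms(1), of n g] by auto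
next
  case False
  have "lux B n f \<le> (1 / c) * lux B n g"
    using assms False by (intro lux_scale_le) (auto simp: field_simps)
  then show ?thesis
    using lux_scale_le[OF assms(1,2), of n g f] assms False by (auto simp: field_simps)
qed

text \<open>The infimum need not be attained (it may be 0), so half of the slack is added to each
  norm before convexity is applied with the weights \<open>a / l\<close> and
  \<open>b / l\<close>.\<close>

lemma lux_triangle:
  assumes "0 < B" shows "lux B n (\<lambda>k. f k + g k) \<le> lux B n f + lux B n g"
proof (rule lux_leI)
  show "0 \<le> lux B n f + lux B n g" by (intro add_nonneg_nonneg lux_nonneg assms)
  fix l assume l: "lux B n f + lux B n g < l"
  define d where "d = (l - (lux B n f + lux B n g)) / 2"
  define a where "a = lux B n f + d"
  define b where "b = lux B n g + d"
  have ab: "0 < a" "0 < b" "a + b = l" "lux B n f < a" "lux B n g < b"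
    using l lux_nonneg[OF assms, of n f] lux_nonneg[OF assms, of n g]
    by (auto simp: a_def b_def d_def field_simps)
  define t where "t = a / l"
  have t: "0 \<le> t" "t \<le> 1" "1 - t = b / l" using ab by (auto simp: t_def field_simps)
  have "\<phi> (norm (f k + g k) / l) \<le> t * \<phi> (norm (f k) / a) + (1 - t) * \<phi> (norm (g k) / b)" for k
  proof -
    have "(1 / l) *\<^sub>R (f k + g k) = t *\<^sub>R ((1 / a) *\<^sub>R f k) + (1 - t) *\<^sub>R ((1 / b) *\<^sub>R g k)"
      using ab unfolding t(3) by (simp add: t_def scaleR_add_right)
    then have "norm (f k + g k) / l = norm (t *\<^sub>R ((1 / a) *\<^sub>R f k) + (1 - t) *\<^sub>R ((1 / b) *\<^sub>R g k))"
      using ab by (metis abs_of_pos add_pos_pos divide_inverse inverse_eq_divide mult.commute norm_scaleR positive_imp_inverse_positive)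
    also have "\<phi> \<dots> \<le> t * \<phi> (norm ((1 / a) *\<^sub>R f k)) + (1 - t) * \<phi> (norm ((1 / b) *\<^sub>R g k))"
      by (rule phi_convex) (use t in auto)
    finally show ?thesis using ab by simp
  qed
  then have "modular n (\<lambda>k. f k + g k) l \<le> t * modular n f a + (1 - t) * modular n g b"
    unfolding modular_def sum_distrib_left sum.distrib[symmetric] by (intro sum_mono)
  also have "\<dots> \<le> t * B + (1 - t) * B"
    using t ab modular_le_if_lux_less[OF assms] by (intro add_mono mult_left_mono) auto
  finally show "modular n (\<lambda>k. f k + g k) l \<le> B" by (simp add: algebra_simps)
qed

text \<open>For \<open>l < t\<close> each of the counted coordinates contributes more than 1 to the
  modular, which then exceeds \<open>B\<close>. This is how the Luxemburg norm dominates the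
  rearrangement at \<open>B\<close>.\<close>

lemma lux_ge:
  assumes "0 < B" "B \<le> real (card {k. k < n \<and> t < norm (f k)})" "0 \<le> t"
  shows "t \<le> lux B n f"
  unfolding lux_def
proof (rule cInf_greatest[OF lux_nonempty[OF assms(1)]], rule ccontr)
  fix l assume l: "l \<in> {l. 0 < l \<and> modular n f l \<le> B}" "\<not> t \<le> l"
  define S where "S = {k. k < n \<and> t < norm (f k)}"
  have "0 < card S" using assms by (simp add: S_def)
  then have S: "finite S" "S \<noteq> {}" "S \<subseteq> {..<n}" by (auto simp: S_def card_gt_0_iff)
  have "real (card S) = (\<Sum>k\<in>S. 1)" by simp
  also have "\<dots> < (\<Sum>k\<in>S. \<phi> (norm (f k) / l))"
    using S l by (intro sum_strict_mono phi_gt_1) (auto simp: S_def field_simps)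
  also have "\<dots> \<le> modular n f l"
    unfolding modular_def using S by (intro sum_mono2) (auto simp: phi_nonneg)
  finally show False using l assms(2) by (simp add: S_def)
qed

lemma lux_le_sup:
  assumes "0 < B" "0 \<le> t" "\<And>k. k < n \<Longrightarrow> norm (f k) \<le> t"
  shows "lux B n f \<le> max 1 (real n / B) * t"
proof -
  define K where "K = max 1 (real n / B)"
  have K: "1 \<le> K" "real n / B \<le> K" by (auto simp: K_def)
  have "lux B n (\<lambda>k. 1 :: real) \<le> K"
  proof (rule lux_le)
    have "modular n (\<lambda>k. 1 :: real) (K * 1) \<le> modular n (\<lambda>k. 1 :: real) 1 / K"
      using K by (intro modular_scale_ge) auto
    also have "modular n (\<lambda>k. 1 :: real) 1 = real n"
      by (simp add: modular_def \<phi>_def power_linear_def)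
    also have "real n / K \<le> B" using K assms by (simp add: field_simps)
    finally show "modular n (\<lambda>k. 1 :: real) K \<le> B" by simp
  qed (use K in auto)
  moreover have "lux B n f \<le> t * lux B n (\<lambda>k. 1 :: real)"
    using lux_scale_le[OF assms(1,2), of n f "\<lambda>k. 1 :: real"] assms(3)
    by simp
  ultimately show ?thesis using assms(2) by (smt (verit) K_def mult.commute mult_left_mono)
qed

text \<open>The modulus depends on neither \<open>B\<close> nor \<open>n\<close>, which lets it
  survive the sum over levels and the supremum over truncations. Norms become modulars and back by
  the Delta_2 condition, at the cost of \<open>p\<close>-th powers; in between,
  \<open>uniform_convexity_sum\<close> works coordinate by coordinate.\<close>

lemma lux_uniformly_convex_max:
  assumes "0 < \<epsilon>"
  shows "\<exists>\<delta>>0. \<delta> < 1 \<and> (\<forall>B n. \<forall>f g :: nat \<Rightarrow> 'a::euclidean_space. 0 < B \<longrightarrow>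
      lux B n (\<lambda>k. f k - g k) \<ge> \<epsilon> * max (lux B n f) (lux B n g) \<longrightarrow>
      lux B n (\<lambda>k. (1/2) *\<^sub>R (f k + g k)) \<le> (1 - \<delta>) * max (lux B n f) (lux B n g))"
proof -
  define e where "e = min \<epsilon> 1"
  have e: "0 < e" "e \<le> 1" "e \<le> \<epsilon>" using assms by (auto simp: e_def)
  define C :: real where "C = 2 powr p"
  have C: "1 \<le> C" using p_pos by (simp add: C_def ge_one_powr_ge_zero)
  \<comment> \<open>A difference of norm at least \<open>e * L\<close> has modular at least
    \<open>(e / 2) powr p * B\<close> at the scale \<open>L'\<close> used below. The last division
    by 2 accounts for \<open>f\<close> and \<open>g\<close> both contributing a modular of at most
    \<open>B\<close>.\<close>
  define \<epsilon>0 where "\<epsilon>0 = (e / 2) powr p / 2"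
  have "(e / 2) powr p \<le> 1" using e p_pos by (simp add: powr_le1)
  then have \<epsilon>0: "0 < \<epsilon>0" "\<epsilon>0 \<le> 1" using e by (auto simp: \<epsilon>0_def)
  obtain \<delta>1 where \<delta>1: "0 < \<delta>1" "\<delta>1 < 1"
    "\<And>u v :: 'a. \<phi> (norm (u - v)) \<ge> \<epsilon>0 / 2 * (\<phi> (norm u) + \<phi> (norm v)) \<Longrightarrow>
      \<phi> (norm ((1/2) *\<^sub>R (u + v))) \<le> (1 - \<delta>1) * ((\<phi> (norm u) + \<phi> (norm v)) / 2)"
    using phi_uniformly_convex[of "\<epsilon>0 / 2"] \<epsilon>0 by auto
  define \<delta>2 where "\<delta>2 = \<delta>1 * \<epsilon>0 / (2 * C)"
  have "\<delta>1 * \<epsilon>0 < 1" using \<delta>1 \<epsilon>0 by (smt (verit) mult_left_le)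
  then have \<delta>2: "0 < \<delta>2" "\<delta>2 < 1" using \<delta>1 \<epsilon>0 C by (auto simp: \<delta>2_def field_simps)
  define c where "c = (1 - \<delta>2) powr (1 / p)"
  have c: "0 < c" "c < 1" "c powr p = 1 - \<delta>2"
    using \<delta>2 p_pos powr_less_mono2[of "1 / p" "1 - \<delta>2" 1] by (auto simp: c_def powr_powr)
  show ?thesis
  proof (intro exI[of _ "1 - c"] conjI allI impI)
    fix B n and f g :: "nat \<Rightarrow> 'a"
    assume B: "0 < B" and big: "\<epsilon> * max (lux B n f) (lux B n g) \<le> lux B n (\<lambda>k. f k - g k)"
    define L where "L = max (lux B n f) (lux B n g)"
    define h where "h = (\<lambda>k. (1/2) *\<^sub>R (f k + g k))"
    have "0 \<le> L" using lux_nonneg[OF B, of n f] by (simp add: L_def)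
    show "lux B n h \<le> (1 - (1 - c)) * L"
    proof (cases "L = 0")
      case True
      have "lux B n h = (1/2) * lux B n (\<lambda>k. f k + g k)"
        by (rule lux_scale[OF B]) (auto simp: h_def)
      also have "\<dots> \<le> (1/2) * (lux B n f + lux B n g)"
        by (intro mult_left_mono lux_triangle B) auto
      also have "\<dots> \<le> L" by (auto simp: L_def)
      finally show ?thesis using True by simp
    next
      case False
      then have L: "0 < L" using \<open>0 \<le> L\<close> by simp
      \<comment> \<open>\<open>L'\<close> lies strictly above both norms so that the modulars at
        \<open>L'\<close> are at most \<open>B\<close>, and below \<open>2 * L\<close> so that
        \<open>l = e * L' / 2\<close> stays below \<open>e * L\<close>. The passage to
        \<open>L\<close> comes at the end.\<close>
      have step: "lux B n h \<le> c * L'" if L': "L < L'" "L' < 2 * L" for L'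
      proof -
        define X where "X = (\<lambda>k. \<phi> (norm (f k) / L'))"
        define Y where "Y = (\<lambda>k. \<phi> (norm (g k) / L'))"
        define D where "D = (\<lambda>k. \<phi> (norm (f k - g k) / L'))"
        define A where "A = (\<lambda>k. \<phi> (norm (h k) / L'))"
        have L'0: "0 < L'" using L L' by simp
        have sX: "sum X {..<n} \<le> B" "sum Y {..<n} \<le> B"
          using modular_le_if_lux_less[OF B, of n f L'] modular_le_if_lux_less[OF B, of n g L'] L'
          by (auto simp: modular_def X_def Y_def L_def)
        define l where "l = L' / (2 / e)"
        have l0: "0 < l" using L'0 e by (simp add: l_def)
        have "l < e * L" using L' e by (simp add: l_def field_simps)
        also have "\<dots> \<le> lux B n (\<lambda>k. f k - g k)"
          using big e L by (smt (verit) L_def mult_right_mono)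
        finally have "B < modular n (\<lambda>k. f k - g k) l"
          using lux_le[OF l0, of n "\<lambda>k. f k - g k" B] by force
        also have "\<dots> \<le> (2 / e) powr p * sum D {..<n}"
          using modular_scale_le[of "2 / e" L' n "\<lambda>k. f k - g k"] e L'0 unfolding l_def
          by (simp add: modular_def D_def)
        finally have "(e / 2) powr p * B \<le> (e / 2) powr p * ((2 / e) powr p * sum D {..<n})"
          by (intro mult_left_mono) auto
        also have "\<dots> = sum D {..<n}"
          using e by (simp add: mult.assoc[symmetric] powr_mult[symmetric])
        finally have "\<epsilon>0 * (B + B) \<le> sum D {..<n}" by (simp add: \<epsilon>0_def)
        moreover have "\<epsilon>0 * (sum X {..<n} + sum Y {..<n}) \<le> \<epsilon>0 * (B + B)"
          using sX \<epsilon>0 by (intro mult_left_mono) auto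
        ultimately have sD: "sum D {..<n} \<ge> \<epsilon>0 * (sum X {..<n} + sum Y {..<n})" by linarith
        define u where "u = (\<lambda>k. (1 / L') *\<^sub>R f k)"
        define v where "v = (\<lambda>k. (1 / L') *\<^sub>R g k)"
        have diff: "u k - v k = (1 / L') *\<^sub>R (f k - g k)" for k by (simp add: u_def v_def scaleR_diff_right)
        have mid: "(1/2) *\<^sub>R (u k + v k) = (1 / L') *\<^sub>R h k" for k
          by (simp add: u_def v_def h_def scaleR_add_right mult.commute)
        have XYuv: "X k = \<phi> (norm (u k))" "Y k = \<phi> (norm (v k))" "D k = \<phi> (norm (u k - v k))"
          "A k = \<phi> (norm ((1/2) *\<^sub>R (u k + v k)))" for k
          unfolding diff mid using L'0 by (simp_all add: X_def Y_def D_def A_def u_def v_def)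
        have "sum A {..<n} \<le> (1 - \<delta>1 * \<epsilon>0 / (2 * C)) * ((sum X {..<n} + sum Y {..<n}) / 2)"
          using sD \<epsilon>0 \<delta>1 C unfolding XYuv
          by (intro uniform_convexity_sum[where D = "\<lambda>k. \<phi> (norm (u k - v k))"] phi_midpoint \<delta>1(3))
            (auto simp: C_def phi_nonneg intro: phi_diff)
        also have "\<dots> \<le> (1 - \<delta>2) * B"
          using sX \<delta>2 unfolding \<delta>2_def[symmetric] by (intro mult_left_mono) auto
        finally have sA: "modular n h L' \<le> (1 - \<delta>2) * B" by (simp add: modular_def A_def)
        have "modular n h (L' / (1 / c)) \<le> (1 / c) powr p * modular n h L'"
          using c L'0 by (intro modular_scale_le) auto
        also have "\<dots> \<le> (1 / c) powr p * ((1 - \<delta>2) * B)"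
          using sA by (intro mult_left_mono) auto
        also have "\<dots> = B" using c \<delta>2 by (simp add: powr_divide)
        finally show ?thesis using L'0 c by (intro lux_le) (auto simp: mult.commute)
      qed
      have "lux B n h / c \<le> L"
      proof (rule dense_ge_bounded[of L "2 * L"])
        fix w assume "L < w" "w < 2 * L"
        then show "lux B n h / c \<le> w" using step[of w] c by (simp add: field_simps)
      qed (use L in simp)
      then show ?thesis using c by (simp add: field_simps)
    qed
  qed (use c in auto)
qed

end

subsection \<open>A uniformly convex renorming\<close>

locale lorentz_renorming = orlicz +
  fixes q :: real and \<beta> :: nat and \<sigma> :: "nat \<Rightarrow> real"
  assumes q: "1 < q" and beta: "1 \<le> \<beta>" and sigma_pos: "\<And>j. 0 < \<sigma> j"
begin

definition lam :: "nat \<Rightarrow> nat \<Rightarrow> (nat \<Rightarrow> 'a::real_normed_vector) \<Rightarrow> real" where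
  "lam n j f = \<sigma> j * lux (real (\<beta> ^ j)) n f"

text \<open>The single index \<open>n\<close> truncates levels and coordinates together, so
  everything is a finite sum that increases with \<open>n\<close>, and the norm is a
  supremum.\<close>

definition Phi :: "nat \<Rightarrow> (nat \<Rightarrow> 'a::real_normed_vector) \<Rightarrow> real" where
  "Phi n f = (\<Sum>j<n. lam n j f powr q)"

definition norm_upto :: "nat \<Rightarrow> (nat \<Rightarrow> 'a::real_normed_vector) \<Rightarrow> real" where
  "norm_upto n f = Phi n f powr (1 / q)"

definition renorm :: "(nat \<Rightarrow> 'a::real_normed_vector) \<Rightarrow> real" where
  "renorm f = (SUP n. norm_upto n f)"

definition norm_finite :: "(nat \<Rightarrow> 'a::real_normed_vector) \<Rightarrow> bool" where
  "norm_finite f \<longleftrightarrow> bdd_above (range (\<lambda>n. norm_upto n f))"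

lemma B_pos: "0 < real (\<beta> ^ j)"
  using beta by simp

lemma lam_nonneg: "0 \<le> lam n j f"
  unfolding lam_def by (intro mult_nonneg_nonneg lux_nonneg B_pos less_imp_le sigma_pos)

lemma Phi_nonneg: "0 \<le> Phi n f"
  by (simp add: Phi_def sum_nonneg)

lemma norm_upto_nonneg: "0 \<le> norm_upto n f"
  by (simp add: norm_upto_def)

lemma norm_upto_powr: "norm_upto n f powr q = Phi n f"
  using q Phi_nonneg[of n f] by (simp add: norm_upto_def powr_powr)

lemma norm_upto_le_iff: "0 \<le> c \<Longrightarrow> norm_upto n f \<le> c \<longleftrightarrow> Phi n f \<le> c powr q"
  using q norm_upto_powr[of n f] norm_upto_nonneg[of n f] powr_mono2[of q "norm_upto n f" c]
    powr_less_mono2[of q c "norm_upto n f"] by (auto simp: not_le[symmetric])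

lemma norm_upto_mono:
  assumes "n \<le> n'" shows "norm_upto n f \<le> norm_upto n' f"
proof -
  have "lam n j f \<le> lam n' j f" for j
    unfolding lam_def by (intro mult_left_mono lux_mono B_pos assms less_imp_le[OF sigma_pos])
  then have "Phi n f \<le> (\<Sum>j<n. lam n' j f powr q)"
    unfolding Phi_def using q lam_nonneg by (intro sum_mono powr_mono2) auto
  also have "\<dots> \<le> Phi n' f"
    unfolding Phi_def using assms by (intro sum_mono2) auto
  finally show ?thesis
    unfolding norm_upto_def using q Phi_nonneg by (intro powr_mono2) auto
qed

lemma Phi_scale:
  assumes "0 \<le> c" "\<And>k. norm (g k) = c * norm (f k)"
  shows "Phi n g = c powr q * Phi n f"
proof -
  have "lam n j g = c * lam n j f" for j
    unfolding lam_def using lux_scale[OF B_pos assms(1), of n g f] assms(2) by simp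
  then show ?thesis
    using assms(1) lam_nonneg by (simp add: Phi_def powr_mult sum_distrib_left)
qed

lemma norm_upto_scale:
  assumes "0 \<le> c" "\<And>k. norm (g k) = c * norm (f k)"
  shows "norm_upto n g = c * norm_upto n f"
  using q assms Phi_nonneg by (simp add: norm_upto_def Phi_scale[OF assms] powr_mult powr_powr)

lemma lam_triangle: "lam n j (\<lambda>k. f k + g k) \<le> lam n j f + lam n j g"
  unfolding lam_def distrib_left[symmetric]
  by (intro mult_left_mono lux_triangle B_pos less_imp_le sigma_pos)

lemma lam_scale:
  "0 \<le> c \<Longrightarrow> (\<And>k. norm (g k) = c * norm (f k)) \<Longrightarrow> lam n j g = c * lam n j f"
  unfolding lam_def using lux_scale[OF B_pos, of c n g f] by simp

text \<open>Minkowski's inequality for an \<open>l_q\<close>-sum of seminorms: normalise by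
  \<open>a\<close> and \<open>b\<close>, slightly above the two norms and hence positive, and use
  convexity of the power with the weights \<open>a / (a + b)\<close> and
  \<open>b / (a + b)\<close>.\<close>

lemma norm_upto_triangle: "norm_upto n (\<lambda>k. f k + g k) \<le> norm_upto n f + norm_upto n g"
proof (rule field_le_epsilon)
  fix e :: real assume e: "0 < e"
  define a where "a = norm_upto n f + e / 2"
  define b where "b = norm_upto n g + e / 2"
  have ab: "0 < a" "0 < b" "norm_upto n f \<le> a" "norm_upto n g \<le> b"
    using e norm_upto_nonneg[of n f] norm_upto_nonneg[of n g] by (auto simp: a_def b_def)
  define t where "t = a / (a + b)"
  have t: "0 \<le> t" "t \<le> 1" "1 - t = b / (a + b)" using ab by (auto simp: t_def field_simps)
  have "lam n j (\<lambda>k. f k + g k) powr q \<le> (a + b) powr q * (t * (lam n j f / a) powr q + (1 - t) * (lam n j g / b) powr q)" for j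
  proof -
    have "lam n j (\<lambda>k. f k + g k) \<le> lam n j f + lam n j g" by (rule lam_triangle)
    also have "\<dots> = (a + b) * (t * (lam n j f / a) + (1 - t) * (lam n j g / b))"
      unfolding t(3) using ab by (simp add: t_def distrib_left)
    finally have "lam n j (\<lambda>k. f k + g k) powr q \<le> ((a + b) * (t * (lam n j f / a) + (1 - t) * (lam n j g / b))) powr q"
      using q lam_nonneg by (intro powr_mono2) auto
    also have "\<dots> = (a + b) powr q * (t * (lam n j f / a) + (1 - t) * (lam n j g / b)) powr q"
      using powr_mult by blast
    also have "\<dots> \<le> (a + b) powr q * (t * (lam n j f / a) powr q + (1 - t) * (lam n j g / b) powr q)"
      using t ab q by (intro mult_left_mono powr_convex_combination) (auto simp: lam_nonneg)
    finally show ?thesis .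
  qed
  then have "Phi n (\<lambda>k. f k + g k) \<le> (\<Sum>j<n. (a + b) powr q * (t * (lam n j f / a) powr q + (1 - t) * (lam n j g / b) powr q))"
    unfolding Phi_def by (intro sum_mono)
  also have "\<dots> = (a + b) powr q * (t * (Phi n f / a powr q) + (1 - t) * (Phi n g / b powr q))"
    using ab lam_nonneg
    by (simp add: Phi_def sum_distrib_left[symmetric] sum.distrib powr_divide sum_divide_distrib[symmetric])
  also have "\<dots> \<le> (a + b) powr q * (t * 1 + (1 - t) * 1)"
    using ab t norm_upto_le_iff[of a n f] norm_upto_le_iff[of b n g]
    by (intro mult_left_mono add_mono) (auto simp: divide_le_eq)
  finally have "norm_upto n (\<lambda>k. f k + g k) \<le> a + b"
    using ab norm_upto_le_iff[of "a + b" n "\<lambda>k. f k + g k"] by simp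
  then show "norm_upto n (\<lambda>k. f k + g k) \<le> norm_upto n f + norm_upto n g + e"
    by (simp add: a_def b_def)
qed

text \<open>At level 0 the modular is bounded by 1, so a single coordinate already forces the
  Luxemburg norm up to its own size.\<close>

lemma norm_le_norm_upto:
  assumes "k < n" shows "\<sigma> 0 * norm (f k) \<le> norm_upto n f"
proof -
  have "norm (f k) \<le> lux 1 n f"
  proof (rule dense_le)
    fix t assume t: "t < norm (f k)"
    show "t \<le> lux 1 n f"
    proof (cases "0 \<le> t")
      case True
      have "card {k} \<le> card {k. k < n \<and> t < norm (f k)}"
        using t assms by (intro card_mono) auto
      then show ?thesis using True by (intro lux_ge) auto
    qed (use lux_nonneg[of 1 n f] in auto)
  qed
  then have "\<sigma> 0 * norm (f k) \<le> lam n 0 f"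
    using sigma_pos[of 0] by (simp add: lam_def mult_left_mono less_imp_le)
  also have "lam n 0 f = (lam n 0 f powr q) powr (1 / q)"
    using q lam_nonneg[of n 0 f] by (simp add: powr_powr)
  also have "\<dots> \<le> norm_upto n f"
    unfolding norm_upto_def Phi_def using q assms
    by (intro powr_mono2 member_le_sum) auto
  finally show ?thesis .
qed

lemma norm_upto_le_sup:
  "\<exists>K. \<forall>t\<ge>0. \<forall>f :: nat \<Rightarrow> 'a::real_normed_vector. (\<forall>k<n. norm (f k) \<le> t) \<longrightarrow> norm_upto n f \<le> K * t"
proof -
  define K where "K = (\<lambda>j. \<sigma> j * max 1 (real n / real (\<beta> ^ j)))"
  have K: "0 \<le> K j" for j using sigma_pos[of j] by (simp add: K_def)
  show ?thesis
  proof (intro exI[of _ "(\<Sum>j<n. K j powr q) powr (1/q)"] allI impI)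
    fix t :: real and f :: "nat \<Rightarrow> 'a" assume t: "0 \<le> t" and f: "\<forall>k<n. norm (f k) \<le> t"
    have "lam n j f \<le> K j * t" for j
      unfolding lam_def K_def mult.assoc using t f
      by (intro mult_left_mono lux_le_sup B_pos less_imp_le[OF sigma_pos]) auto
    then have "Phi n f \<le> (\<Sum>j<n. (K j * t) powr q)"
      unfolding Phi_def using q lam_nonneg by (intro sum_mono powr_mono2) auto
    also have "\<dots> = (\<Sum>j<n. K j powr q) * t powr q"
      using K t by (simp add: powr_mult sum_distrib_right)
    also have "\<dots> = ((\<Sum>j<n. K j powr q) powr (1/q) * t) powr q"
      using q t by (simp add: powr_mult powr_powr sum_nonneg)
    finally show "norm_upto n f \<le> (\<Sum>j<n. K j powr q) powr (1/q) * t"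
      by (subst norm_upto_le_iff) (use t in auto)
  qed
qed

text \<open>A truncated norm depends on \<open>n\<close> coordinates and is bounded by their
  maximum, up to a constant that may depend on \<open>n\<close>. So it is continuous for
  coordinatewise convergence, and completeness will rest on this.\<close>

lemma norm_upto_le_limit:
  assumes lim: "\<And>k. (\<lambda>i. g i k) \<longlonglongrightarrow> f k" and le: "\<forall>\<^sub>F i in sequentially. norm_upto n (g i) \<le> c"
  shows "norm_upto n f \<le> c"
proof (rule field_le_epsilon)
  fix e :: real assume e: "0 < e"
  obtain K where K: "\<And>t f. 0 \<le> t \<Longrightarrow> (\<forall>k<n. norm (f k :: 'a) \<le> t) \<Longrightarrow> norm_upto n f \<le> K * t"
    using norm_upto_le_sup by blast
  define t where "t = e / (\<bar>K\<bar> + 1)"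
  have "K * e \<le> \<bar>K\<bar> * e" using e by (intro mult_right_mono) auto
  moreover have "e * (\<bar>K\<bar> + 1) = \<bar>K\<bar> * e + e" by (simp add: distrib_left)
  ultimately have "K * e \<le> e * (\<bar>K\<bar> + 1)" using e by linarith
  then have t: "0 < t" "K * t \<le> e" using e by (auto simp: t_def pos_divide_le_eq)
  have "\<forall>\<^sub>F i in sequentially. norm (f k - g i k) \<le> t" for k
    using tendstoD[OF lim t(1), of k] by eventually_elim (simp add: dist_norm norm_minus_commute)
  then have "\<forall>\<^sub>F i in sequentially. \<forall>k\<in>{..<n}. norm (f k - g i k) \<le> t"
    by (intro eventually_ball_finite) auto
  from eventually_happens[OF eventually_conj[OF this le]]
  obtain i where i: "\<forall>k<n. norm (f k - g i k) \<le> t" "norm_upto n (g i) \<le> c" by auto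
  have "norm_upto n f \<le> norm_upto n (g i) + norm_upto n (\<lambda>k. f k - g i k)"
    using norm_upto_triangle[of n "g i" "\<lambda>k. f k - g i k"] by simp
  then show "norm_upto n f \<le> c + e" using i K[of t "\<lambda>k. f k - g i k"] t by simp
qed

text \<open>The weights \<open>\<sigma> j\<close> cancel from the Luxemburg estimate, so one modulus
  serves all levels. It is converted to \<open>q\<close>-th powers level by level and then
  summed.\<close>

lemma Phi_uniformly_convex:
  assumes "0 < \<epsilon>"
  shows "\<exists>\<delta>>0. \<delta> < 1 \<and> (\<forall>n. \<forall>f g :: nat \<Rightarrow> 'a::euclidean_space.
      Phi n (\<lambda>k. f k - g k) \<ge> \<epsilon> * (Phi n f + Phi n g) \<longrightarrow>
      Phi n (\<lambda>k. (1/2) *\<^sub>R (f k + g k)) \<le> (1 - \<delta>) * ((Phi n f + Phi n g) / 2))"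
proof -
  define good where "good = (\<lambda>e \<delta>. 0 < \<delta> \<and> \<delta> < 1 \<and> (\<forall>B n. \<forall>f g :: nat \<Rightarrow> 'a. 0 < B \<longrightarrow>
      lux B n (\<lambda>k. f k - g k) \<ge> e * max (lux B n f) (lux B n g) \<longrightarrow>
      lux B n (\<lambda>k. (1/2) *\<^sub>R (f k + g k)) \<le> (1 - \<delta>) * max (lux B n f) (lux B n g)))"
  have "\<exists>\<delta>. good e \<delta>" if "0 < e" for e
    using lux_uniformly_convex_max[OF that, where ?'a = 'a] unfolding good_def .
  then have "\<forall>e. \<exists>\<delta>. 0 < e \<longrightarrow> good e \<delta>" by blast
  \<comment> \<open>A modulus for every separation at once is required because
    \<open>uniform_convexity_max_to_powr\<close> picks its own \<open>e\<close>.\<close>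
  from choice[OF this] obtain F where good: "\<And>e. 0 < e \<Longrightarrow> good e (F e)" by blast
  have F: "0 < F e \<and> F e < 1" if "0 < e" for e
    using good[OF that] by (simp add: good_def)
  have F2: "lux B n (\<lambda>k. (1/2) *\<^sub>R (f k + g k)) \<le> (1 - F e) * max (lux B n f) (lux B n g)"
    if "0 < e" "0 < B" "lux B n (\<lambda>k. f k - g k) \<ge> e * max (lux B n f) (lux B n g)"
    for e B n and f g :: "nat \<Rightarrow> 'a"
    using good[OF that(1)] that(2,3) unfolding good_def by blast
  have lam_max: "lam n j (\<lambda>k. (1/2) *\<^sub>R (f k + g k)) \<le> (1 - F e) * max (lam n j f) (lam n j g)"
    if "0 < e" "lam n j (\<lambda>k. f k - g k) \<ge> e * max (lam n j f) (lam n j g)" for n j e and f g :: "nat \<Rightarrow> 'a"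
  proof -
    have mx: "max (lam n j f) (lam n j g) = \<sigma> j * max (lux (\<beta> ^ j) n f) (lux (\<beta> ^ j) n g)"
      using sigma_pos[of j] by (simp add: lam_def max_mult_distrib_left)
    have "lux (\<beta> ^ j) n (\<lambda>k. f k - g k) \<ge> e * max (lux (\<beta> ^ j) n f) (lux (\<beta> ^ j) n g)"
      using that(2) sigma_pos[of j] unfolding mx by (simp add: lam_def mult.left_commute)
    from F2[OF that(1) B_pos this] show ?thesis
      using sigma_pos[of j] unfolding mx by (simp add: lam_def mult.left_commute)
  qed
  define C :: real where "C = 2 powr q"
  have C: "1 \<le> C" using q by (simp add: C_def ge_one_powr_ge_zero)
  define \<epsilon>' where "\<epsilon>' = min \<epsilon> 1"
  have \<epsilon>': "0 < \<epsilon>'" "\<epsilon>' \<le> 1" "\<epsilon>' \<le> \<epsilon>" using assms by (auto simp: \<epsilon>'_def)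
  then have "0 < \<epsilon>' / 2" by simp
  obtain \<delta> where \<delta>: "0 < \<delta>" "\<delta> < 1"
    and h_le: "\<And>a b d h. 0 \<le> a \<Longrightarrow> 0 \<le> b \<Longrightarrow> 0 \<le> d \<Longrightarrow> 0 \<le> h \<Longrightarrow> h \<le> (a + b) / 2 \<Longrightarrow>
      \<forall>e>0. d \<ge> e * max a b \<longrightarrow> h \<le> (1 - F e) * max a b \<Longrightarrow>
      d powr q \<ge> \<epsilon>' / 2 * (a powr q + b powr q) \<Longrightarrow>
      h powr q \<le> (1 - \<delta>) * ((a powr q + b powr q) / 2)"
    using uniform_convexity_max_to_powr[where f = F, OF q \<open>0 < \<epsilon>' / 2\<close> F] by metis
  have "\<delta> * \<epsilon>' < 1" using \<delta> \<epsilon>' by (smt (verit) mult_left_le)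
  then have \<delta>': "0 < \<delta> * \<epsilon>' / (2 * C)" "\<delta> * \<epsilon>' / (2 * C) < 1" using \<delta> \<epsilon>' C by (auto simp: field_simps)
  show ?thesis
  proof (intro exI[of _ "\<delta> * \<epsilon>' / (2 * C)"] conjI allI impI)
    fix n and f g :: "nat \<Rightarrow> 'a"
    assume big: "\<epsilon> * (Phi n f + Phi n g) \<le> Phi n (\<lambda>k. f k - g k)"
    have mid: "lam n j (\<lambda>k. (1/2) *\<^sub>R (f k + g k)) \<le> (lam n j f + lam n j g) / 2" for j
      using lam_scale[of "1/2" "\<lambda>k. (1/2) *\<^sub>R (f k + g k)" "\<lambda>k. f k + g k" n j] lam_triangle[of n j f g] by simp
    have neg: "lam n j (\<lambda>k. - g k) = lam n j g" for j
      using lam_scale[of 1 "\<lambda>k. - g k" g n j] by simp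
    have diff: "lam n j (\<lambda>k. f k - g k) powr q \<le> C * (lam n j f powr q + lam n j g powr q)" for j
    proof -
      have "lam n j (\<lambda>k. f k - g k) \<le> lam n j f + lam n j g"
        using lam_triangle[of n j f "\<lambda>k. - g k"] neg by simp
      then have "lam n j (\<lambda>k. f k - g k) powr q \<le> (lam n j f + lam n j g) powr q"
        using q lam_nonneg by (intro powr_mono2) auto
      also have "\<dots> \<le> C * (lam n j f powr q + lam n j g powr q)"
        using powr_diff_le[of q "lam n j f" "- lam n j g"] q lam_nonneg[of n j f] lam_nonneg[of n j g]
        by (simp add: C_def)
      finally show ?thesis .
    qed
    have "\<epsilon>' * (Phi n f + Phi n g) \<le> \<epsilon> * (Phi n f + Phi n g)"
      using \<epsilon>' Phi_nonneg[of n f] Phi_nonneg[of n g] by (intro mult_right_mono) auto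
    with big have big': "\<epsilon>' * (Phi n f + Phi n g) \<le> Phi n (\<lambda>k. f k - g k)" by linarith
    show "Phi n (\<lambda>k. (1/2) *\<^sub>R (f k + g k)) \<le> (1 - \<delta> * \<epsilon>' / (2 * C)) * ((Phi n f + Phi n g) / 2)"
      unfolding Phi_def
    proof (rule uniform_convexity_sum[where D = "\<lambda>j. lam n j (\<lambda>k. f k - g k) powr q"])
      fix j
      show "lam n j (\<lambda>k. f k - g k) powr q \<le> C * (lam n j f powr q + lam n j g powr q)" by (rule diff)
      have "lam n j (\<lambda>k. (1/2) *\<^sub>R (f k + g k)) powr q \<le> ((lam n j f + lam n j g) / 2) powr q"
        using q lam_nonneg mid by (intro powr_mono2) auto
      also have "\<dots> \<le> (lam n j f powr q + lam n j g powr q) / 2"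
        using q lam_nonneg by (intro powr_midpoint) auto
      finally show "lam n j (\<lambda>k. (1/2) *\<^sub>R (f k + g k)) powr q \<le> (lam n j f powr q + lam n j g powr q) / 2" .
      assume "lam n j (\<lambda>k. f k - g k) powr q \<ge> \<epsilon>' / 2 * (lam n j f powr q + lam n j g powr q)"
      then show "lam n j (\<lambda>k. (1/2) *\<^sub>R (f k + g k)) powr q \<le> (1 - \<delta>) * ((lam n j f powr q + lam n j g powr q) / 2)"
        using lam_max by (intro h_le[OF lam_nonneg lam_nonneg lam_nonneg lam_nonneg mid]) blast+
    qed (use C \<epsilon>' \<delta> big' in \<open>auto simp: Phi_def\<close>)
  qed (use \<delta>' in auto)
qed

lemma norm_upto_le_renorm: "norm_finite f \<Longrightarrow> norm_upto n f \<le> renorm f"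
  unfolding renorm_def norm_finite_def by (rule cSUP_upper) auto

lemma renorm_le: "(\<And>n. norm_upto n f \<le> c) \<Longrightarrow> renorm f \<le> c"
  unfolding renorm_def by (rule cSUP_least) auto

lemma norm_finiteI: "(\<And>n. norm_upto n f \<le> c) \<Longrightarrow> norm_finite f"
  unfolding norm_finite_def by (rule bdd_aboveI) auto

lemma renorm_nonneg: "norm_finite f \<Longrightarrow> 0 \<le> renorm f"
  using norm_upto_le_renorm[of f 0] norm_upto_nonneg[of 0 f] by linarith

text \<open>The truncated norms increase with \<open>n\<close>, so one index \<open>n0\<close> at
  which the difference exceeds \<open>\<epsilon> / 2\<close> makes the modulus available for all
  larger \<open>n\<close>, always with the same gain.\<close>

lemma renorm_uniformly_convex:
  assumes "0 < \<epsilon>"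
  shows "\<exists>\<delta>>0. \<forall>f g :: nat \<Rightarrow> 'a::euclidean_space. norm_finite f \<longrightarrow> norm_finite g \<longrightarrow>
      renorm f \<le> 1 \<longrightarrow> renorm g \<le> 1 \<longrightarrow> renorm (\<lambda>k. f k - g k) \<ge> \<epsilon> \<longrightarrow>
      renorm (\<lambda>k. f k + g k) \<le> 2 * (1 - \<delta>)"
proof -
  \<comment> \<open>On the unit ball \<open>Phi n f + Phi n g \<le> 2\<close>, so this
    \<open>e\<close> turns a difference of norm above \<open>\<epsilon> / 2\<close> into the
    relative separation that \<open>Phi_uniformly_convex\<close> asks for.\<close>
  define e where "e = (\<epsilon> / 2) powr q / 2"
  have "0 < e" using assms by (simp add: e_def)
  then obtain \<delta> where \<delta>: "0 < \<delta>" "\<delta> < 1"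
    "\<And>n (f :: nat \<Rightarrow> 'a) g. Phi n (\<lambda>k. f k - g k) \<ge> e * (Phi n f + Phi n g) \<Longrightarrow>
      Phi n (\<lambda>k. (1/2) *\<^sub>R (f k + g k)) \<le> (1 - \<delta>) * ((Phi n f + Phi n g) / 2)"
    using Phi_uniformly_convex[where ?'a = 'a] by blast
  define c where "c = (1 - \<delta>) powr (1 / q)"
  have c: "0 < c" "c < 1" "c powr q = 1 - \<delta>"
    using \<delta> q powr_less_mono2[of "1 / q" "1 - \<delta>" 1] by (auto simp: c_def powr_powr)
  show ?thesis
  proof (intro exI[of _ "1 - c"] conjI allI impI)
    fix f g :: "nat \<Rightarrow> 'a"
    assume fg: "norm_finite f" "norm_finite g" "renorm f \<le> 1" "renorm g \<le> 1"
      and big: "\<epsilon> \<le> renorm (\<lambda>k. f k - g k)"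
    have "\<exists>n0. \<epsilon> / 2 < norm_upto n0 (\<lambda>k. f k - g k)"
    proof (rule ccontr)
      assume "\<nexists>n0. \<epsilon> / 2 < norm_upto n0 (\<lambda>k. f k - g k)"
      then have "renorm (\<lambda>k. f k - g k) \<le> \<epsilon> / 2" by (intro renorm_le) (auto simp: not_less)
      then show False using big assms by simp
    qed
    then obtain n0 where n0: "\<epsilon> / 2 < norm_upto n0 (\<lambda>k. f k - g k)" by blast
    have mid: "norm_upto n (\<lambda>k. (1/2) *\<^sub>R (f k + g k)) = 1/2 * norm_upto n (\<lambda>k. f k + g k)" for n
      by (rule norm_upto_scale) auto
    have *: "norm_upto n (\<lambda>k. f k + g k) \<le> 2 * c" if "n0 \<le> n" for n
    proof -
      have 1: "Phi n f \<le> 1" "Phi n g \<le> 1"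
        using fg norm_upto_le_renorm[OF fg(1), of n] norm_upto_le_renorm[OF fg(2), of n]
          norm_upto_le_iff[of 1 n f] norm_upto_le_iff[of 1 n g] by auto
      have "\<epsilon> / 2 < norm_upto n (\<lambda>k. f k - g k)"
        using n0 norm_upto_mono[OF that, of "\<lambda>k. f k - g k"] by linarith
      then have "(\<epsilon> / 2) powr q \<le> norm_upto n (\<lambda>k. f k - g k) powr q"
        using assms q by (intro powr_mono2) auto
      then have "e * 2 \<le> Phi n (\<lambda>k. f k - g k)" by (simp add: e_def norm_upto_powr)
      moreover have "e * (Phi n f + Phi n g) \<le> e * 2" using 1 \<open>0 < e\<close> by (intro mult_left_mono) auto
      ultimately have "Phi n (\<lambda>k. (1/2) *\<^sub>R (f k + g k)) \<le> (1 - \<delta>) * ((Phi n f + Phi n g) / 2)"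
        by (intro \<delta>(3)) linarith
      also have "\<dots> \<le> (1 - \<delta>) * 1" using 1 \<delta> by (intro mult_left_mono) auto
      finally have "norm_upto n (\<lambda>k. (1/2) *\<^sub>R (f k + g k)) \<le> c"
        using c norm_upto_le_iff[of c n "\<lambda>k. (1/2) *\<^sub>R (f k + g k)"] by simp
      then show ?thesis by (simp add: mid)
    qed
    have "norm_upto n (\<lambda>k. f k + g k) \<le> 2 * c" for n
      using *[of "max n n0"] norm_upto_mono[of n "max n n0" "\<lambda>k. f k + g k"] by simp
    then show "renorm (\<lambda>k. f k + g k) \<le> 2 * (1 - (1 - c))" by (intro renorm_le) simp
  qed (use c in auto)
qed

end

subsection \<open>Equivalence with the Lorentz quasi-norm\<close>

lemma finite_superlevel:
  fixes f :: "nat \<Rightarrow> 'a::real_normed_vector"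
  assumes "f \<longlonglongrightarrow> 0" "0 < t" shows "finite {k. t < norm (f k)}"
proof -
  have "\<forall>\<^sub>F k in sequentially. norm (f k) < t"
    using tendstoD[OF assms] by simp
  then obtain n where "\<And>k. k \<ge> n \<Longrightarrow> norm (f k) < t" by (auto simp: eventually_sequentially)
  then have "{k. t < norm (f k)} \<subseteq> {..<n}" by (force simp: not_less[symmetric])
  then show ?thesis by (rule finite_subset) simp
qed

lemma rearrangement_le:
  assumes "0 \<le> t" "finite {k. t < norm (f k)}" "card {k. t < norm (f k)} < n"
  shows "rearrangement f n \<le> t"
  unfolding rearrangement_def using assms by (intro cInf_lower bdd_belowI[of _ 0]) auto

lemma rearrangement_nonempty:
  assumes "f \<longlonglongrightarrow> 0" "1 \<le> n"
  shows "{t. 0 \<le> t \<and> finite {k. t < norm (f k)} \<and> card {k. t < norm (f k)} < n} \<noteq> {}"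
proof -
  have "Bseq f" using assms(1) by (intro convergent_imp_Bseq convergentI)
  then obtain K where "0 < K" "\<And>k. norm (f k) \<le> K" by (auto simp: Bseq_def)
  then have K: "0 < K" "{k. K < norm (f k)} = {}" by (auto simp: not_less)
  have "0 \<le> K \<and> finite {k. K < norm (f k)} \<and> card {k. K < norm (f k)} < n"
    unfolding K(2) using K(1) assms(2) by auto
  then show ?thesis by blast
qed

lemma rearrangement_nonneg:
  assumes "f \<longlonglongrightarrow> 0" "1 \<le> n" shows "0 \<le> rearrangement f n"
  unfolding rearrangement_def using rearrangement_nonempty[OF assms] by (intro cInf_greatest) auto

lemma card_superlevel_if_rearrangement_less:
  assumes "f \<longlonglongrightarrow> 0" "1 \<le> n" "rearrangement f n < t"
  shows "finite {k. t < norm (f k)}" "card {k. t < norm (f k)} < n"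
proof -
  obtain t' where t': "t' < t" "finite {k. t' < norm (f k)}" "card {k. t' < norm (f k)} < n"
    using cInf_lessD[OF rearrangement_nonempty[OF assms(1,2)], of t] assms(3)
    unfolding rearrangement_def by blast
  have sub: "{k. t < norm (f k)} \<subseteq> {k. t' < norm (f k)}" using t'(1) by auto
  show "finite {k. t < norm (f k)}" using finite_subset[OF sub t'(2)] .
  show "card {k. t < norm (f k)} < n" using card_mono[OF t'(2) sub] t'(3) by linarith
qed

text \<open>The infimum is attained: if \<open>n\<close> coordinates were strictly above it, any
  threshold between it and the smallest of them would be exceeded by fewer than \<open>n\<close>
  coordinates and by all of these \<open>n\<close>.\<close>

lemma card_above_rearrangement:
  assumes "f \<longlonglongrightarrow> 0" "1 \<le> n"
  shows "finite {k. rearrangement f n < norm (f k)}" "card {k. rearrangement f n < norm (f k)} < n"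
proof -
  define S where "S = {k. rearrangement f n < norm (f k)}"
  have "\<not> (infinite S \<or> n \<le> card S)"
  proof
    assume "infinite S \<or> n \<le> card S"
    then obtain A where A: "A \<subseteq> S" "card A = n" "finite A"
      using infinite_arbitrarily_large[of S n] obtain_subset_with_card_n[of n S] by metis
    then have "A \<noteq> {}" using assms(2) by auto
    define \<mu> where "\<mu> = Min ((\<lambda>k. norm (f k)) ` A)"
    have mu: "rearrangement f n < \<mu>" "\<And>k. k \<in> A \<Longrightarrow> \<mu> \<le> norm (f k)"
      using A \<open>A \<noteq> {}\<close> by (auto simp: \<mu>_def S_def)
    obtain t where t: "rearrangement f n < t" "t < \<mu>" using dense mu(1) by blast
    have "A \<subseteq> {k. t < norm (f k)}" using t mu(2) by fastforce
    then have "card A < n"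
      using card_superlevel_if_rearrangement_less[OF assms t(1)] card_mono by (meson le_less_trans)
    then show False using A by simp
  qed
  then show "finite {k. rearrangement f n < norm (f k)}" "card {k. rearrangement f n < norm (f k)} < n"
    by (auto simp: S_def)
qed

lemma rearrangement_antimono:
  assumes "f \<longlonglongrightarrow> 0" "1 \<le> n" "n \<le> n'"
  shows "rearrangement f n' \<le> rearrangement f n"
  using card_above_rearrangement[OF assms(1,2)] rearrangement_nonneg[OF assms(1,2)] assms(3)
  by (intro rearrangement_le) auto

lemma rearrangement_scale_le:
  assumes "f \<longlonglongrightarrow> 0" "1 \<le> n" "0 \<le> c" "\<And>k. norm (g k) \<le> c * norm (f k)"
  shows "rearrangement g n \<le> c * rearrangement f n"
proof (rule rearrangement_le)
  have sub: "{k. c * rearrangement f n < norm (g k)} \<subseteq> {k. rearrangement f n < norm (f k)}"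
    using assms(3,4) by (smt (verit) Collect_mono mult_left_mono)
  show "finite {k. c * rearrangement f n < norm (g k)}" "card {k. c * rearrangement f n < norm (g k)} < n"
    using card_above_rearrangement[OF assms(1,2)] sub card_mono[OF _ sub] finite_subset[OF sub] by auto
qed (use rearrangement_nonneg[OF assms(1,2)] assms in auto)

lemma rearrangement_scale:
  assumes "f \<longlonglongrightarrow> 0" "g \<longlonglongrightarrow> 0" "1 \<le> n" "0 \<le> c" "\<And>k. norm (g k) = c * norm (f k)"
  shows "rearrangement g n = c * rearrangement f n"
proof (cases "c = 0")
  case True
  then show ?thesis
    using rearrangement_scale_le[OF assms(1,3,4), of g] rearrangement_nonneg[OF assms(2,3)] assms(5) by auto
next
  case False
  have "rearrangement f n \<le> (1 / c) * rearrangement g n"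
    using assms False by (intro rearrangement_scale_le) auto
  then show ?thesis
    using rearrangement_scale_le[OF assms(1,3,4), of g] assms(4,5) False by (auto simp: field_simps)
qed

lemma le_card_if_less_rearrangement:
  assumes "0 \<le> t" "t < rearrangement f n" "finite {k. t < norm (f k)}"
  shows "n \<le> card {k. t < norm (f k)}"
  using rearrangement_le[OF assms(1,3), of n] assms(2) by linarith

lemma rearrangement_eventually_less:
  assumes "f \<longlonglongrightarrow> 0" "0 < t"
  shows "\<exists>n0. \<forall>n\<ge>n0. rearrangement f n \<le> t"
  using rearrangement_le[of t f] finite_superlevel[OF assms] assms(2)
  by (intro exI[of _ "Suc (card {k. t < norm (f k)})"]) auto

lemma sum_from_1_split:
  fixes T :: "nat \<Rightarrow> real"
  assumes "m \<le> n" shows "sum T {1..n} = sum T {1..m} + sum T {m<..n}"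
proof -
  have "{1..n} = {1..m} \<union> {m<..n}" using assms by auto
  moreover have "sum T ({1..m} \<union> {m<..n}) = sum T {1..m} + sum T {m<..n}"
    by (rule sum.union_disjoint) auto
  ultimately show ?thesis by simp
qed

lemma sum_power_le:
  fixes x :: real assumes "0 \<le> x" "x < 1" shows "(\<Sum>k<n. x ^ k) \<le> 1 / (1 - x)"
proof -
  have "(\<Sum>k<n. x ^ k) * (1 - x) = 1 - x ^ n"
    by (simp add: sum_gp_strict assms)
  then show ?thesis using assms by (simp add: pos_le_divide_eq)
qed

text \<open>With truncated subtraction the exponent is the distance of \<open>i\<close> and
  \<open>j\<close>. Each of the two sides of \<open>j\<close> gives a geometric series.\<close>

lemma sum_power_dist_le:
  fixes x :: real assumes "0 \<le> x" "x < 1"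
  shows "(\<Sum>i<I. x ^ ((i - j) + (j - i))) \<le> 2 / (1 - x)"
proof -
  have "(\<Sum>i<I. x ^ ((i - j) + (j - i))) = (\<Sum>i\<in>{..<I} \<inter> {..<j}. x ^ (j - i)) + (\<Sum>i\<in>{..<I} - {..<j}. x ^ (i - j))"
    by (subst sum.Int_Diff[of _ _ "{..<j}"]) (auto intro!: arg_cong2[of _ _ _ _ "(+)"] sum.cong)
  also have "(\<Sum>i\<in>{..<I} \<inter> {..<j}. x ^ (j - i)) = (\<Sum>k\<in>(\<lambda>i. j - i) ` ({..<I} \<inter> {..<j}). x ^ k)"
    by (subst sum.reindex) (auto simp: inj_on_def)
  also have "\<dots> \<le> (\<Sum>k<Suc j. x ^ k)"
    using assms by (intro sum_mono2) auto
  also have "(\<Sum>i\<in>{..<I} - {..<j}. x ^ (i - j)) = (\<Sum>k\<in>(\<lambda>i. i - j) ` ({..<I} - {..<j}). x ^ k)"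
    by (subst sum.reindex) (auto simp: inj_on_def)
  also have "\<dots> \<le> (\<Sum>k<I. x ^ k)"
    using assms by (intro sum_mono2) auto
  finally show ?thesis
    using sum_power_le[OF assms, of "Suc j"] sum_power_le[OF assms, of I] by simp
qed

section \<open>Weights and geometric blocks\<close>

locale weight =
  fixes w :: "nat \<Rightarrow> real"
  assumes weight: "is_weight w"
begin

abbreviation s :: "nat \<Rightarrow> real" where "s \<equiv> primitive_seq w"

lemma w_nonneg: "1 \<le> n \<Longrightarrow> 0 \<le> w n"
  using weight by (simp add: is_weight_def)

lemma s_mono: "n \<le> n' \<Longrightarrow> s n \<le> s n'"
  unfolding primitive_seq_def by (intro sum_mono2) (auto simp: w_nonneg)

lemma s_pos: "1 \<le> n \<Longrightarrow> 0 < s n"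
  using s_mono[of 1 n] weight by (simp add: is_weight_def primitive_seq_def)

lemma term_eq:
  assumes "f \<longlonglongrightarrow> 0" "1 \<le> n"
  shows "lorentz_term w q f n = rearrangement f n powr q * (s n powr (q - 1) * w n)"
  using rearrangement_nonneg[OF assms] s_pos[OF assms(2)]
  by (simp add: lorentz_term_def powr_mult powr_diff)

lemma term_nonneg:
  assumes "f \<longlonglongrightarrow> 0" "1 \<le> n" shows "0 \<le> lorentz_term w q f n"
  unfolding term_eq[OF assms] using w_nonneg[OF assms(2)] by simp

lemma s_diff: "m \<le> n \<Longrightarrow> (\<Sum>k\<in>{m<..n}. w k) = s n - s m"
proof -
  assume "m \<le> n"
  then have "s n = s m + (\<Sum>k\<in>{m<..n}. w k)"
    unfolding primitive_seq_def by (intro sum_from_1_split) 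
  then show ?thesis by simp
qed

end

locale regular_weight = weight +
  fixes q :: real and \<beta> :: nat
  assumes q1: "1 < q" and beta2: "2 \<le> \<beta>"
    and lrp: "\<And>n. 1 \<le> n \<Longrightarrow> 2 * primitive_seq w n \<le> primitive_seq w (\<beta> * n)"
    and urp: "\<And>n. 1 \<le> n \<Longrightarrow> primitive_seq w (\<beta> * n) \<le> real \<beta> / 2 * primitive_seq w n"
begin

definition \<sigma> :: "nat \<Rightarrow> real" where "\<sigma> j = s (\<beta> ^ j)"

definition block :: "(nat \<Rightarrow> 'k::real_normed_field) \<Rightarrow> nat \<Rightarrow> real" where
  "block f i = \<sigma> i * rearrangement f (\<beta> ^ i)"

lemma beta_pow_ge: "1 \<le> \<beta> ^ i"
  using beta2 by simp

lemma sigma_pos: "0 < \<sigma> j"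
  unfolding \<sigma>_def by (rule s_pos[OF beta_pow_ge])

lemma sigma_Suc: "2 * \<sigma> j \<le> \<sigma> (Suc j)" "\<sigma> (Suc j) \<le> real \<beta> / 2 * \<sigma> j"
  using lrp[OF beta_pow_ge, of j] urp[OF beta_pow_ge, of j] by (simp_all add: \<sigma>_def)

lemma sigma_add: "2 ^ d * \<sigma> j \<le> \<sigma> (j + d)" "\<sigma> (j + d) \<le> (real \<beta> / 2) ^ d * \<sigma> j"
proof -
  show "2 ^ d * \<sigma> j \<le> \<sigma> (j + d)"
  proof (induction d)
    case (Suc d)
    then show ?case using sigma_Suc(1)[of "j + d"] by simp
  qed simp
  show "\<sigma> (j + d) \<le> (real \<beta> / 2) ^ d * \<sigma> j"
  proof (induction d)
    case (Suc d)
    have "\<sigma> (j + Suc d) \<le> real \<beta> / 2 * \<sigma> (j + d)" using sigma_Suc(2)[of "j + d"] by simp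
    also have "\<dots> \<le> real \<beta> / 2 * ((real \<beta> / 2) ^ d * \<sigma> j)" using Suc by (intro mult_left_mono) auto
    finally show ?case by simp
  qed simp
qed

lemma block_nonneg: "f \<longlonglongrightarrow> 0 \<Longrightarrow> 0 \<le> block f i"
  unfolding block_def by (intro mult_nonneg_nonneg less_imp_le[OF sigma_pos] rearrangement_nonneg beta_pow_ge)

text \<open>Between \<open>\<beta> ^ I\<close> and \<open>\<beta> ^ Suc I\<close> the rearrangement
  is at least its value at the right end. The LRP makes the increment of \<open>s\<close> there at
  least half of \<open>\<sigma> (Suc I)\<close>, and the URP compares
  \<open>\<sigma> (Suc I)\<close> with \<open>\<sigma> I\<close> in the power \<open>q - 1\<close>;
  these are the two factors of \<open>C\<close>.\<close>

lemma sum_blocks_le_terms: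
  obtains C where "0 < C"
    "\<And>(f :: nat \<Rightarrow> 'k::real_normed_field) I. f \<longlonglongrightarrow> 0 \<Longrightarrow> (\<Sum>i<Suc I. block f i powr q) \<le> C * (\<Sum>n=1..\<beta> ^ I. lorentz_term w q f n)"
proof -
  define C where "C = 2 * (real \<beta> / 2) powr (q - 1)"
  have C: "1 \<le> C"
  proof -
    have "1 \<le> (real \<beta> / 2) powr (q - 1)" using beta2 q1 by (intro ge_one_powr_ge_zero) auto
    then show ?thesis by (simp add: C_def)
  qed
  show ?thesis
  proof (rule that[of C])
    fix f :: "nat \<Rightarrow> 'k" and I assume f: "f \<longlonglongrightarrow> 0"
    show "(\<Sum>i<Suc I. block f i powr q) \<le> C * (\<Sum>n=1..\<beta> ^ I. lorentz_term w q f n)"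
    proof (induction I)
      case 0
      have w1: "0 < w 1" using weight by (simp add: is_weight_def)
      then have "block f 0 powr q = lorentz_term w q f 1"
        by (simp add: block_def \<sigma>_def lorentz_term_def primitive_seq_def mult.commute)
      moreover have "lorentz_term w q f 1 \<le> C * lorentz_term w q f 1"
        using C term_nonneg[OF f, of 1] mult_right_mono[of 1 C] by simp
      ultimately show ?case by simp
    next
      case (Suc I)
      have I: "\<beta> ^ I \<le> \<beta> ^ Suc I" using beta2 by simp
      define T where "T = lorentz_term w q f"
      define \<alpha> where "\<alpha> = rearrangement f (\<beta> ^ Suc I)"
      have \<alpha>: "0 \<le> \<alpha>" unfolding \<alpha>_def by (rule rearrangement_nonneg[OF f beta_pow_ge])
      have "\<alpha> powr q * (\<sigma> I powr (q - 1) * w n) \<le> T n" if "n \<in> {\<beta> ^ I<..\<beta> ^ Suc I}" for n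
      proof -
        have n: "1 \<le> n" using that by simp
        have "\<alpha> \<le> rearrangement f n" unfolding \<alpha>_def using that n by (intro rearrangement_antimono f) auto
        moreover have "\<sigma> I \<le> s n" unfolding \<sigma>_def using that by (intro s_mono) auto
        ultimately show ?thesis
          unfolding T_def term_eq[OF f n] using \<alpha> q1 sigma_pos[of I] w_nonneg[OF n]
          by (intro mult_mono powr_mono2) auto
      qed
      then have "(\<Sum>n\<in>{\<beta> ^ I<..\<beta> ^ Suc I}. \<alpha> powr q * (\<sigma> I powr (q - 1) * w n)) \<le> sum T {\<beta> ^ I<..\<beta> ^ Suc I}"
        by (intro sum_mono)
      then have 1: "\<alpha> powr q * (\<sigma> I powr (q - 1) * (\<sigma> (Suc I) - \<sigma> I)) \<le> sum T {\<beta> ^ I<..\<beta> ^ Suc I}"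
        unfolding sum_distrib_left[symmetric] s_diff[OF I] \<sigma>_def[symmetric] .
      have "\<sigma> (Suc I) powr (q - 1) \<le> (real \<beta> / 2 * \<sigma> I) powr (q - 1)"
        using sigma_Suc(2)[of I] sigma_pos[of "Suc I"] q1 by (intro powr_mono2) auto
      also have "\<dots> = (real \<beta> / 2) powr (q - 1) * \<sigma> I powr (q - 1)"
        by (rule powr_mult)
      finally have 2: "\<sigma> (Suc I) powr (q - 1) \<le> (real \<beta> / 2) powr (q - 1) * \<sigma> I powr (q - 1)" .
      have "block f (Suc I) powr q = \<alpha> powr q * (\<sigma> (Suc I) powr (q - 1) * \<sigma> (Suc I))"
        using \<alpha> sigma_pos[of "Suc I"] by (simp add: block_def \<alpha>_def powr_mult powr_diff)
      also have "\<dots> \<le> \<alpha> powr q * (((real \<beta> / 2) powr (q - 1) * \<sigma> I powr (q - 1)) * (2 * (\<sigma> (Suc I) - \<sigma> I)))"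
        using 2 sigma_Suc(1)[of I] sigma_pos[of I] sigma_pos[of "Suc I"] by (intro mult_left_mono mult_mono) auto
      also have "\<dots> = C * (\<alpha> powr q * (\<sigma> I powr (q - 1) * (\<sigma> (Suc I) - \<sigma> I)))"
        by (simp add: C_def)
      also have "\<dots> \<le> C * sum T {\<beta> ^ I<..\<beta> ^ Suc I}"
        using 1 C by (intro mult_left_mono) auto
      finally have 3: "block f (Suc I) powr q \<le> C * sum T {\<beta> ^ I<..\<beta> ^ Suc I}" .
      have "sum T {1..\<beta> ^ Suc I} = sum T {1..\<beta> ^ I} + sum T {\<beta> ^ I<..\<beta> ^ Suc I}"
        by (rule sum_from_1_split[OF I])
      then show ?case using Suc.IH 3 by (simp add: T_def distrib_left)
    qed
  qed (use C in auto)
qed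

text \<open>Now the value at the left end is the bound, so the terms between
  \<open>\<beta> ^ I\<close> and \<open>\<beta> ^ Suc I\<close> are charged to the index
  \<open>I\<close>, and the first term to the index 0. The URP pays for passing from
  \<open>\<sigma> (Suc I)\<close> to \<open>\<sigma> I\<close>.\<close>

lemma sum_terms_le_blocks:
  obtains C where "0 < C"
    "\<And>(f :: nat \<Rightarrow> 'k::real_normed_field) I. f \<longlonglongrightarrow> 0 \<Longrightarrow> (\<Sum>n=1..\<beta> ^ I. lorentz_term w q f n) \<le> C * (\<Sum>i<Suc I. block f i powr q)"
proof -
  define C where "C = (real \<beta> / 2) powr q"
  have C: "1 \<le> C" using beta2 q1 unfolding C_def by (intro ge_one_powr_ge_zero) auto
  show ?thesis
  proof (rule that[of "1 + C"])
    fix f :: "nat \<Rightarrow> 'k" and I assume f: "f \<longlonglongrightarrow> 0"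
    have w1: "0 < w 1" using weight by (simp add: is_weight_def)
    then have B0: "block f 0 powr q = lorentz_term w q f 1"
      by (simp add: block_def \<sigma>_def lorentz_term_def primitive_seq_def mult.commute)
    have "(\<Sum>n=1..\<beta> ^ I. lorentz_term w q f n) \<le> block f 0 powr q + C * (\<Sum>i<I. block f i powr q)"
    proof (induction I)
      case 0
      then show ?case using B0 by simp
    next
      case (Suc I)
      have I: "\<beta> ^ I \<le> \<beta> ^ Suc I" using beta2 by simp
      define T where "T = lorentz_term w q f"
      define \<alpha> where "\<alpha> = rearrangement f (\<beta> ^ I)"
      have \<alpha>: "0 \<le> \<alpha>" unfolding \<alpha>_def by (rule rearrangement_nonneg[OF f beta_pow_ge])
      have "T n \<le> \<alpha> powr q * (\<sigma> (Suc I) powr (q - 1) * w n)" if "n \<in> {\<beta> ^ I<..\<beta> ^ Suc I}" for n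
      proof -
        have n: "1 \<le> n" using that by simp
        have "rearrangement f n \<le> \<alpha>" unfolding \<alpha>_def using that by (intro rearrangement_antimono f beta_pow_ge) auto
        moreover have "s n \<le> \<sigma> (Suc I)" unfolding \<sigma>_def using that by (intro s_mono) auto
        ultimately show ?thesis
          unfolding T_def term_eq[OF f n] using q1 s_pos[OF n] w_nonneg[OF n] rearrangement_nonneg[OF f n]
          by (intro mult_mono powr_mono2) auto
      qed
      then have "sum T {\<beta> ^ I<..\<beta> ^ Suc I} \<le> (\<Sum>n\<in>{\<beta> ^ I<..\<beta> ^ Suc I}. \<alpha> powr q * (\<sigma> (Suc I) powr (q - 1) * w n))"
        by (intro sum_mono)
      also have "\<dots> = \<alpha> powr q * (\<sigma> (Suc I) powr (q - 1) * (\<sigma> (Suc I) - \<sigma> I))"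
        unfolding sum_distrib_left[symmetric] s_diff[OF I] \<sigma>_def[symmetric] ..
      also have "\<dots> \<le> \<alpha> powr q * (\<sigma> (Suc I) powr (q - 1) * \<sigma> (Suc I))"
        using sigma_pos[of I] by (intro mult_left_mono) auto
      also have "\<dots> = \<alpha> powr q * \<sigma> (Suc I) powr q"
        using sigma_pos[of "Suc I"] by (simp add: powr_diff)
      also have "\<dots> \<le> \<alpha> powr q * (real \<beta> / 2 * \<sigma> I) powr q"
        using sigma_Suc(2)[of I] sigma_pos[of "Suc I"] q1 by (intro mult_left_mono powr_mono2) auto
      also have "\<dots> = C * block f I powr q"
        using sigma_pos[of I] \<alpha> by (simp add: C_def block_def \<alpha>_def powr_mult powr_divide)
      finally have 3: "sum T {\<beta> ^ I<..\<beta> ^ Suc I} \<le> C * block f I powr q" .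
      have "sum T {1..\<beta> ^ Suc I} = sum T {1..\<beta> ^ I} + sum T {\<beta> ^ I<..\<beta> ^ Suc I}"
        by (rule sum_from_1_split[OF I])
      then show ?case using Suc.IH 3 by (simp add: T_def distrib_left)
    qed
    also have "block f 0 powr q \<le> (\<Sum>i<Suc I. block f i powr q)"
      by (rule member_le_sum) auto
    also have "C * (\<Sum>i<I. block f i powr q) \<le> C * (\<Sum>i<Suc I. block f i powr q)"
      using C by (intro mult_left_mono) auto
    finally show "(\<Sum>n=1..\<beta> ^ I. lorentz_term w q f n) \<le> (1 + C) * (\<Sum>i<Suc I. block f i powr q)"
      by (simp add: algebra_simps)
  qed (use C in auto)
qed

end

section \<open>Comparison of the new norm with the quasi-norm\<close>

lemma power_powr_commute: "0 < a \<Longrightarrow> (a ^ d) powr c = (a powr c) ^ d" for a c :: real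
  by (simp add: powr_realpow[symmetric] powr_powr mult.commute)

text \<open>Per unit of distance between two levels, \<open>\<rho>\<close> is the decay reserved for
  the \<open>l_q\<close>-sum over levels and \<open>\<eta>\<close> the decay reserved for the sum
  inside a modular. The two exponent conditions say that \<open>\<phi>\<close> grows slowly enough
  at infinity and vanishes fast enough at 0 to leave both.\<close>

locale regular_lorentz = regular_weight w q \<beta> + orlicz r m
  for w q \<beta> r m +
  fixes \<rho> \<eta> :: real
  assumes rho: "0 < \<rho>" "\<rho> < 1" and eta: "0 < \<eta>" "\<eta> < 1"
    and lower_exponent: "(\<beta> / (2 * \<rho>)) powr r \<le> \<eta> * \<beta>"
    and upper_exponent: "\<beta> \<le> \<eta> * (2 * \<rho>) powr p"
begin

sublocale lorentz_renorming r m q \<beta> \<sigma>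
  by unfold_locales (use q1 beta2 sigma_pos in auto)

text \<open>Each nonzero coordinate falls between two consecutive values of the rearrangement along
  the powers of \<open>\<beta>\<close>: it is at most the value at \<open>\<beta> ^ i\<close>, and
  fewer than \<open>\<beta> ^ Suc i\<close> coordinates exceed the next value. The assumption on
  \<open>I\<close> says that the first \<open>I\<close> steps catch all nonzero coordinates below
  \<open>n\<close>.\<close>

lemma modular_le_blocks:
  fixes f :: "nat \<Rightarrow> 'k::real_normed_field"
  assumes f: "f \<longlonglongrightarrow> 0"
    and I: "\<And>k. k < n \<Longrightarrow> f k \<noteq> 0 \<Longrightarrow> rearrangement f (\<beta> ^ I) < norm (f k)" and "0 < l"
  shows "modular n f l \<le> (\<Sum>i<I. real (\<beta> ^ Suc i) * \<phi> (rearrangement f (\<beta> ^ i) / l))"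
proof -
  define \<alpha> where "\<alpha> = (\<lambda>i. rearrangement f (\<beta> ^ i))"
  define T where "T = (\<lambda>i k. if \<alpha> (Suc i) < norm (f k) then \<phi> (\<alpha> i / l) else 0)"
  have T0: "0 \<le> T i k" for i k by (simp add: T_def phi_nonneg)
  have card_above: "finite {k. \<alpha> i < norm (f k)}" "card {k. \<alpha> i < norm (f k)} < \<beta> ^ i" for i
    unfolding \<alpha>_def by (rule card_above_rearrangement[OF f beta_pow_ge])+
  have "\<phi> (norm (f k) / l) \<le> (\<Sum>i<I. T i k)" if k: "k < n" for k
  proof (cases "f k = 0")
    case True
    then show ?thesis using T0 by (simp add: sum_nonneg)
  next
    case False
    define i where "i = (LEAST i. \<alpha> i < norm (f k))"
    have aI: "\<alpha> I < norm (f k)" using I[OF k False] by (simp add: \<alpha>_def)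
    have ai: "\<alpha> i < norm (f k)" "i \<le> I"
      unfolding i_def using aI by (rule LeastI, rule Least_le)
    \<comment> \<open>Fewer than \<open>\<beta> ^ 0 = 1\<close> coordinates exceed
      \<open>\<alpha> 0\<close>, so the least level \<open>i\<close> is not 0 and has a
      predecessor.\<close>
    have "{k. \<alpha> 0 < norm (f k)} = {}" using card_above[of 0] by simp
    then have "\<not> \<alpha> 0 < norm (f k)" by blast
    then have "i \<noteq> 0" using ai by (metis)
    then obtain i' where i': "i = Suc i'" using not0_implies_Suc by blast
    have "\<not> \<alpha> i' < norm (f k)" using not_less_Least[of i' "\<lambda>i. \<alpha> i < norm (f k)"] i' by (simp add: i_def)
    then have "\<phi> (norm (f k) / l) \<le> T i' k"
      using ai i' assms(3) by (auto simp: T_def intro!: phi_mono divide_right_mono)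
    also have "\<dots> \<le> (\<Sum>i<I. T i k)"
      using T0 ai i' by (intro member_le_sum) auto
    finally show ?thesis .
  qed
  then have "modular n f l \<le> (\<Sum>k<n. \<Sum>i<I. T i k)"
    unfolding modular_def by (intro sum_mono) auto
  also have "\<dots> = (\<Sum>i<I. \<Sum>k<n. T i k)" by (rule sum.swap)
  also have "\<dots> \<le> (\<Sum>i<I. real (\<beta> ^ Suc i) * \<phi> (\<alpha> i / l))"
  proof (rule sum_mono)
    fix i
    have "(\<Sum>k<n. T i k) = (\<Sum>k\<in>{k\<in>{..<n}. \<alpha> (Suc i) < norm (f k)}. \<phi> (\<alpha> i / l))"
      unfolding T_def by (rule sum.inter_filter[symmetric]) simp
    also have "\<dots> = real (card {k\<in>{..<n}. \<alpha> (Suc i) < norm (f k)}) * \<phi> (\<alpha> i / l)"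
      by simp
    also have "card {k\<in>{..<n}. \<alpha> (Suc i) < norm (f k)} \<le> card {k. \<alpha> (Suc i) < norm (f k)}"
      using card_above[of "Suc i"] by (intro card_mono) auto
    also have "\<dots> \<le> \<beta> ^ Suc i" using card_above[of "Suc i"] by simp
    finally show "(\<Sum>k<n. T i k) \<le> real (\<beta> ^ Suc i) * \<phi> (\<alpha> i / l)"
      using phi_nonneg by (simp add: mult_right_mono)
  qed
  finally show ?thesis by (simp add: \<alpha>_def)
qed

text \<open>Chosen so that \<open>\<beta> * Suc m / K\<close> times the bound
  \<open>2 / (1 - \<eta>)\<close> for the geometric sum is exactly 1.\<close>

definition K :: real where "K = 2 * real \<beta> * real (Suc m) / (1 - \<eta>)"

lemma K_ge_1: "1 \<le> K"
proof -
  have "1 - \<eta> \<le> 1 * 1 * 1" using eta by simp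
  also have "\<dots> \<le> 2 * real \<beta> * real (Suc m)" using beta2 by (intro mult_mono) auto
  finally show ?thesis using eta by (simp add: K_def pos_le_divide_eq)
qed

text \<open>Here \<open>u\<close> will be the rearrangement at level \<open>i\<close> divided by a
  candidate for the Luxemburg norm at level \<open>j\<close>. For \<open>i \<le> j\<close> the URP
  bounds \<open>\<sigma> j / \<sigma> i\<close> and the exponent \<open>r\<close> at infinity is
  used; for \<open>j < i\<close> it is the LRP and the exponent \<open>p\<close> at 0. Both leave a
  factor \<open>\<eta>\<close> per unit of distance.\<close>

lemma weighted_phi_le:
  assumes "0 \<le> u" "u * (\<rho> ^ ((i - j) + (j - i))) \<le> \<sigma> j / \<sigma> i / K"
  shows "real (\<beta> ^ Suc i) * \<phi> u \<le> real (\<beta> ^ j) * (real \<beta> * real (Suc m) / K * \<eta> ^ ((i - j) + (j - i)))"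
proof -
  have b0: "0 < real \<beta>" using beta2 by simp
  have K0: "0 < K" using K_ge_1 by simp
  show ?thesis
  proof (cases "i \<le> j")
    case True
    define d where "d = j - i"
    have j: "j = i + d" using True by (simp add: d_def)
    have "\<sigma> j / \<sigma> i \<le> (real \<beta> / 2) ^ d"
      using sigma_add(2)[of i d] sigma_pos[of i] by (simp add: j divide_le_eq)
    then have "\<sigma> j / \<sigma> i / K \<le> (real \<beta> / 2) ^ d / K" using K0 by (intro divide_right_mono) auto
    moreover have "u * \<rho> ^ d \<le> \<sigma> j / \<sigma> i / K" using assms(2) True by (simp add: d_def)
    ultimately have "u * \<rho> ^ d \<le> (real \<beta> / 2) ^ d / K" by linarith
    then have "u \<le> (real \<beta> / 2) ^ d / K / \<rho> ^ d" using rho by (simp only: pos_le_divide_eq zero_less_power)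
    also have "\<dots> = (\<beta> / (2 * \<rho>)) ^ d / K" by (simp add: power_divide power_mult_distrib)
    finally have u: "u \<le> (\<beta> / (2 * \<rho>)) ^ d / K" .
    have "\<phi> u \<le> real (Suc m) * u powr r" by (rule phi_le_linear)
    also have "u powr r \<le> ((\<beta> / (2 * \<rho>)) ^ d / K) powr r"
      using u assms(1) r by (intro powr_mono2) auto
    also have "\<dots> = ((\<beta> / (2 * \<rho>)) powr r) ^ d / K powr r"
    proof -
      have "((\<beta> / (2 * \<rho>)) ^ d) powr r = ((\<beta> / (2 * \<rho>)) powr r) ^ d"
        using b0 rho by (simp add: powr_realpow[symmetric] powr_powr mult.commute)
      then show ?thesis using b0 rho K0 by (simp add: powr_divide)
    qed
    also have "\<dots> \<le> (\<eta> * \<beta>) ^ d / K powr 1"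
    proof (rule frac_le)
      show "((\<beta> / (2 * \<rho>)) powr r) ^ d \<le> (\<eta> * \<beta>) ^ d"
        using lower_exponent by (intro power_mono) auto
      show "K powr 1 \<le> K powr r" using K_ge_1 r by (intro powr_mono) auto
    qed (use K0 eta b0 in auto)
    finally have "real (\<beta> ^ Suc i) * \<phi> u \<le> real (\<beta> ^ Suc i) * (real (Suc m) * ((\<eta> * \<beta>) ^ d / K))"
      using K0 by (intro mult_left_mono) (auto simp: mult_left_mono)
    also have "\<dots> = real (\<beta> ^ j) * (real \<beta> * real (Suc m) / K * \<eta> ^ d)"
      by (simp add: j power_add power_mult_distrib)
    finally show ?thesis using True by (simp add: d_def)
  next
    case False
    define d where "d = i - j"
    have i: "i = j + d" using False by (simp add: d_def)
    have "\<sigma> j / \<sigma> i \<le> 1 / 2 ^ d"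
      using sigma_add(1)[of d j] sigma_pos[of i] by (simp add: i field_simps)
    then have "\<sigma> j / \<sigma> i / K \<le> 1 / 2 ^ d / K" using K0 by (intro divide_right_mono) auto
    moreover have "u * \<rho> ^ d \<le> \<sigma> j / \<sigma> i / K" using assms(2) False by (simp add: d_def)
    ultimately have "u * \<rho> ^ d \<le> 1 / 2 ^ d / K" by linarith
    then have "u \<le> 1 / 2 ^ d / K / \<rho> ^ d" using rho by (simp only: pos_le_divide_eq zero_less_power)
    also have "\<dots> = 1 / (2 * \<rho>) ^ d / K" by (simp add: power_mult_distrib)
    finally have u: "u \<le> 1 / (2 * \<rho>) ^ d / K" .
    have "\<phi> u \<le> u powr p" by (rule phi_le_power[OF assms(1)])
    also have "u powr p \<le> (1 / (2 * \<rho>) ^ d / K) powr p"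
      using u assms(1) p_pos by (intro powr_mono2) auto
    also have "\<dots> = 1 / ((2 * \<rho>) powr p) ^ d / K powr p"
    proof -
      have "((2 * \<rho>) ^ d) powr p = ((2 * \<rho>) powr p) ^ d"
        using rho by (intro power_powr_commute) auto
      then show ?thesis by (simp only: powr_divide powr_one_eq_one)
    qed
    also have "\<dots> \<le> (\<eta> / \<beta>) ^ d / K powr 1"
    proof (rule frac_le)
      have "(\<beta> / \<eta>) ^ d \<le> ((2 * \<rho>) powr p) ^ d"
      proof (rule power_mono)
        show "\<beta> / \<eta> \<le> (2 * \<rho>) powr p"
          using upper_exponent eta by (subst pos_divide_le_eq) (auto simp only: mult.commute)
      qed (use b0 eta in auto)
      then have "1 / ((2 * \<rho>) powr p) ^ d \<le> 1 / (\<beta> / \<eta>) ^ d"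
        using b0 eta rho by (intro divide_left_mono) auto
      then show "1 / ((2 * \<rho>) powr p) ^ d \<le> (\<eta> / \<beta>) ^ d" by (simp add: power_divide)
      have "1 * 1 \<le> r * real (Suc m)" using r by (intro mult_mono) auto
      then have "1 \<le> p" by (simp add: p_def)
      then show "K powr 1 \<le> K powr p" using K_ge_1 by (intro powr_mono) auto
    qed (use K0 eta b0 in auto)
    finally have "\<phi> u \<le> (\<eta> / \<beta>) ^ d / K" using K0 by simp
    then have "real (\<beta> ^ Suc i) * \<phi> u \<le> real (\<beta> ^ Suc i) * ((\<eta> / \<beta>) ^ d / K)"
      by (intro mult_left_mono) auto
    also have "\<dots> = real (\<beta> ^ j) * (real \<beta> * 1 / K * \<eta> ^ d)"
      using b0 by (simp add: i power_add power_divide)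
    also have "\<dots> \<le> real (\<beta> ^ j) * (real \<beta> * real (Suc m) / K * \<eta> ^ d)"
      using K0 eta by (intro mult_left_mono mult_right_mono divide_right_mono) auto
    finally show ?thesis using False by (simp add: d_def)
  qed
qed

text \<open>The Luxemburg norm at level \<open>j\<close> is controlled by all blocks, each
  discounted by \<open>\<rho>\<close> to the distance; \<open>S j\<close> collects them. Summed over
  \<open>j\<close>, every block is counted with a convergent geometric weight, as in Young's
  inequality for convolutions.\<close>

lemma Phi_le_blocks:
  obtains C where "0 < C"
    "\<And>(f :: nat \<Rightarrow> 'k::real_normed_field) n. f \<longlonglongrightarrow> 0 \<Longrightarrow> \<exists>I. Phi n f \<le> C * (\<Sum>i<I. block f i powr q)"
proof -
  define x where "x = \<rho> powr q"
  have x: "0 < x" "x < 1" using rho q powr_less_mono2[of q \<rho> 1] by (auto simp: x_def)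
  have xd: "(\<rho> ^ d) powr q = x ^ d" for d
    using rho by (simp add: x_def powr_realpow[symmetric] powr_powr mult.commute)
  have K0: "0 < K" using K_ge_1 by simp
  show ?thesis
  proof (rule that[of "K powr q * (2 / (1 - x))"])
    fix f :: "nat \<Rightarrow> 'k" and n assume f: "f \<longlonglongrightarrow> 0"
    define \<alpha> where "\<alpha> = (\<lambda>i. rearrangement f (\<beta> ^ i))"
    have \<alpha>: "0 \<le> \<alpha> i" for i unfolding \<alpha>_def by (rule rearrangement_nonneg[OF f beta_pow_ge])
    have "\<forall>\<^sub>F I in sequentially. f k \<noteq> 0 \<longrightarrow> \<alpha> I < norm (f k)" for k
    proof (cases "f k = 0")
      case False
      then obtain n0 where n0: "\<And>n. n \<ge> n0 \<Longrightarrow> rearrangement f n \<le> norm (f k) / 2"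
        using rearrangement_eventually_less[OF f, of "norm (f k) / 2"] by auto
      have "\<alpha> I < norm (f k)" if "n0 \<le> I" for I
      proof -
        have "I < \<beta> ^ I" using beta2 by (intro power_gt_expt) auto
        then have "\<alpha> I \<le> norm (f k) / 2" unfolding \<alpha>_def using that by (intro n0) auto
        also have "\<dots> < norm (f k)" using False by simp
        finally show ?thesis .
      qed
      then show ?thesis by (auto simp: eventually_sequentially)
    qed simp
    then have "\<forall>\<^sub>F I in sequentially. \<forall>k\<in>{..<n}. f k \<noteq> 0 \<longrightarrow> \<alpha> I < norm (f k)"
      by (intro eventually_ball_finite) auto
    \<comment> \<open>The rearrangement tends to 0, so far enough out it lies below each of the
      finitely many nonzero coordinates in question, as \<open>modular_le_blocks\<close>
      requires.\<close>
    from eventually_happens[OF this] obtain I where I: "\<And>k. k < n \<Longrightarrow> f k \<noteq> 0 \<Longrightarrow> \<alpha> I < norm (f k)"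
      by auto
    define d where "d = (\<lambda>i j :: nat. (i - j) + (j - i))"
    define S where "S = (\<lambda>j. \<Sum>i<I. (\<rho> ^ d i j * block f i) powr q)"
    have S0: "0 \<le> S j" for j by (simp add: S_def sum_nonneg)
    have lam_le: "lam n j f powr q \<le> K powr q * S j" for j
    proof -
      define L where "L = K * S j powr (1 / q) / \<sigma> j"
      have L0: "0 \<le> L" using K0 sigma_pos[of j] by (simp add: L_def)
      have "lux (real (\<beta> ^ j)) n f \<le> L"
      proof (rule lux_leI[OF L0])
        fix l assume l: "L < l"
        then have l0: "0 < l" using L0 by simp
        have "real (\<beta> ^ Suc i) * \<phi> (\<alpha> i / l) \<le> real (\<beta> ^ j) * (real \<beta> * real (Suc m) / K * \<eta> ^ d i j)" if i: "i < I" for i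
          unfolding d_def
        proof (rule weighted_phi_le)
          show "0 \<le> \<alpha> i / l" using \<alpha> l0 by simp
          have "\<rho> ^ d i j * block f i = ((\<rho> ^ d i j * block f i) powr q) powr (1 / q)"
            using q rho block_nonneg[OF f, of i] by (simp add: powr_powr)
          also have "\<dots> \<le> S j powr (1 / q)"
            unfolding S_def using i q by (intro powr_mono2 member_le_sum) auto
          also have "\<dots> \<le> \<sigma> j * l / K"
            using l K0 sigma_pos[of j] by (simp add: L_def field_simps)
          finally have "\<rho> ^ d i j * (\<sigma> i * \<alpha> i) \<le> \<sigma> j * l / K" by (simp add: block_def \<alpha>_def)
          then show "\<alpha> i / l * \<rho> ^ (i - j + (j - i)) \<le> \<sigma> j / \<sigma> i / K"
            using l0 K0 sigma_pos[of i] unfolding d_def by (simp add: field_simps)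
        qed
        then have "(\<Sum>i<I. real (\<beta> ^ Suc i) * \<phi> (\<alpha> i / l)) \<le> (\<Sum>i<I. real (\<beta> ^ j) * (real \<beta> * real (Suc m) / K * \<eta> ^ d i j))"
          by (intro sum_mono) auto
        also have "\<dots> = real (\<beta> ^ j) * (real \<beta> * real (Suc m) / K * (\<Sum>i<I. \<eta> ^ d i j))"
          by (simp only: sum_distrib_left)
        also have "\<dots> \<le> real (\<beta> ^ j) * (real \<beta> * real (Suc m) / K * (2 / (1 - \<eta>)))"
          unfolding d_def using eta K0 by (intro mult_left_mono sum_power_dist_le) auto
        also have "real \<beta> * real (Suc m) / K * (2 / (1 - \<eta>)) = 1"
          using eta beta2 by (simp add: K_def del: of_nat_Suc)
        finally have "(\<Sum>i<I. real (\<beta> ^ Suc i) * \<phi> (\<alpha> i / l)) \<le> real (\<beta> ^ j)" by simp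
        then show "modular n f l \<le> real (\<beta> ^ j)"
          using modular_le_blocks[OF f, of n I l] I l0 by (simp add: \<alpha>_def)
      qed
      then have "lam n j f \<le> \<sigma> j * L"
        unfolding lam_def using sigma_pos[of j] by (intro mult_left_mono) auto
      also have "\<dots> = K * S j powr (1 / q)" using sigma_pos[of j] by (simp add: L_def)
      finally have "lam n j f powr q \<le> (K * S j powr (1 / q)) powr q"
        using q lam_nonneg by (intro powr_mono2) auto
      also have "\<dots> = K powr q * S j" using q K0 S0[of j] by (simp add: powr_mult powr_powr)
      finally show ?thesis .
    qed
    have "Phi n f \<le> (\<Sum>j<n. K powr q * S j)"
      unfolding Phi_def using lam_le by (intro sum_mono)
    also have "\<dots> = K powr q * (\<Sum>j<n. \<Sum>i<I. x ^ d i j * block f i powr q)"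
      using block_nonneg[OF f] rho by (simp add: sum_distrib_left S_def powr_mult xd)
    also have "(\<Sum>j<n. \<Sum>i<I. x ^ d i j * block f i powr q) = (\<Sum>i<I. block f i powr q * (\<Sum>j<n. x ^ d j i))"
      by (subst sum.swap) (simp add: sum_distrib_left mult.commute d_def add.commute)
    also have "\<dots> \<le> (\<Sum>i<I. block f i powr q * (2 / (1 - x)))"
      unfolding d_def using x by (intro sum_mono mult_left_mono sum_power_dist_le) auto
    also have "\<dots> = (2 / (1 - x)) * (\<Sum>i<I. block f i powr q)"
      by (subst sum_distrib_left) (simp only: mult.commute)
    finally show "\<exists>I. Phi n f \<le> K powr q * (2 / (1 - x)) * (\<Sum>i<I. block f i powr q)"
      by (intro exI[of _ I]) (simp add: mult_left_mono mult.assoc)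
  qed (use x K0 in auto)
qed

text \<open>Half of the rearrangement at \<open>\<beta> ^ i\<close> is exceeded by at least
  \<open>\<beta> ^ i\<close> coordinates, and by finitely many, so \<open>lux_ge\<close> applies
  once the truncation contains them. Hence the factor 2.\<close>

lemma blocks_le_Phi:
  fixes f :: "nat \<Rightarrow> 'k::real_normed_field"
  assumes f: "f \<longlonglongrightarrow> 0"
  shows "\<exists>n. (\<Sum>i<J. block f i powr q) \<le> 2 powr q * Phi n f"
proof -
  have "\<forall>\<^sub>F n in sequentially. block f i \<le> 2 * lam n i f" for i
  proof (cases "rearrangement f (\<beta> ^ i) = 0")
    case True
    then show ?thesis by (simp add: block_def lam_nonneg)
  next
    case False
    define t where "t = rearrangement f (\<beta> ^ i) / 2"
    have t: "0 < t" "t < rearrangement f (\<beta> ^ i)"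
      using False rearrangement_nonneg[OF f beta_pow_ge, of i] by (auto simp: t_def)
    define A where "A = {k. t < norm (f k)}"
    have A: "finite A" "\<beta> ^ i \<le> card A"
      unfolding A_def using finite_superlevel[OF f t(1)] le_card_if_less_rearrangement[OF _ t(2)] t by auto
    obtain n0 where n0: "A \<subseteq> {..<n0}" using A(1) finite_nat_iff_bounded by blast
    have "block f i \<le> 2 * lam n i f" if "n0 \<le> n" for n
    proof -
      have "A = {k. k < n \<and> t < norm (f k)}" using n0 that by (auto simp: A_def)
      then have "t \<le> lux (real (\<beta> ^ i)) n f"
        using A t beta_pow_ge[of i] by (intro lux_ge B_pos) auto
      then have "\<sigma> i * t \<le> lam n i f"
        unfolding lam_def using sigma_pos[of i] by (intro mult_left_mono) auto
      then show ?thesis by (simp add: block_def t_def)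
    qed
    then show ?thesis by (auto simp: eventually_sequentially)
  qed
  then have "\<forall>\<^sub>F n in sequentially. \<forall>i\<in>{..<J}. block f i \<le> 2 * lam n i f"
    by (intro eventually_ball_finite) auto
  from eventually_happens[OF eventually_conj[OF this eventually_ge_at_top[of J]]]
  obtain n where n: "\<And>i. i < J \<Longrightarrow> block f i \<le> 2 * lam n i f" "J \<le> n" by auto
  have "(\<Sum>i<J. block f i powr q) \<le> (\<Sum>i<J. (2 * lam n i f) powr q)"
    using n q block_nonneg[OF f] by (intro sum_mono powr_mono2) auto
  also have "\<dots> = 2 powr q * (\<Sum>i<J. lam n i f powr q)"
    using lam_nonneg by (simp add: powr_mult sum_distrib_left)
  also have "\<dots> \<le> 2 powr q * Phi n f"
    unfolding Phi_def using n by (intro mult_left_mono sum_mono2) auto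
  finally show ?thesis by blast
qed

lemma renorm_equivalent:
  obtains C where "0 < C"
    "\<And>f :: nat \<Rightarrow> 'k::real_normed_field. f \<longlonglongrightarrow> 0 \<Longrightarrow> f \<in> lorentz_set w (ereal q) \<longleftrightarrow> norm_finite f"
    "\<And>f :: nat \<Rightarrow> 'k. f \<in> lorentz_set w (ereal q) \<Longrightarrow>
      renorm f \<le> C * lorentz_norm w (ereal q) f \<and> lorentz_norm w (ereal q) f \<le> C * renorm f"
proof -
  obtain C1 where C1: "0 < C1"
    "\<And>(f :: nat \<Rightarrow> 'k) n. f \<longlonglongrightarrow> 0 \<Longrightarrow> \<exists>I. Phi n f \<le> C1 * (\<Sum>i<I. block f i powr q)"
    using Phi_le_blocks by blast
  obtain C3 where C3: "0 < C3"
    "\<And>(f :: nat \<Rightarrow> 'k) I. f \<longlonglongrightarrow> 0 \<Longrightarrow> (\<Sum>i<Suc I. block f i powr q) \<le> C3 * (\<Sum>n=1..\<beta> ^ I. lorentz_term w q f n)"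
    using sum_blocks_le_terms by blast
  obtain C4 where C4: "0 < C4"
    "\<And>(f :: nat \<Rightarrow> 'k) I. f \<longlonglongrightarrow> 0 \<Longrightarrow> (\<Sum>n=1..\<beta> ^ I. lorentz_term w q f n) \<le> C4 * (\<Sum>i<Suc I. block f i powr q)"
    using sum_terms_le_blocks by blast
  define T where "T = (\<lambda>(f :: nat \<Rightarrow> 'k) i. lorentz_term w q f (Suc i))"
  have shift: "(\<Sum>n=1..N. lorentz_term w q f n) = (\<Sum>i<N. T f i)" for f :: "nat \<Rightarrow> 'k" and N
    unfolding T_def using sum.shift_bounds_Suc_ivl[of "lorentz_term w q f" 0 N]
    by (simp add: atLeastLessThanSuc_atLeastAtMost lessThan_atLeast0 numeral_eq_Suc)
  have T0: "0 \<le> T f i" if "f \<longlonglongrightarrow> 0" for f :: "nat \<Rightarrow> 'k" and i unfolding T_def using that by (intro term_nonneg) auto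
  have mem: "f \<in> lorentz_set w (ereal q) \<longleftrightarrow> f \<longlonglongrightarrow> 0 \<and> summable (T f)" for f :: "nat \<Rightarrow> 'k"
    by (simp add: lorentz_set_def T_def)
  have nrm: "lorentz_norm w (ereal q) f = suminf (T f) powr (1 / q)" for f :: "nat \<Rightarrow> 'k"
    by (simp add: lorentz_norm_def T_def)
  have A: "norm_upto n f \<le> (C1 * C3) powr (1 / q) * lorentz_norm w (ereal q) f"
    if f: "f \<longlonglongrightarrow> 0" "summable (T f)" for f :: "nat \<Rightarrow> 'k" and n
  proof -
    obtain I where "Phi n f \<le> C1 * (\<Sum>i<I. block f i powr q)" using C1(2)[OF f(1)] by blast
    also have "(\<Sum>i<I. block f i powr q) \<le> (\<Sum>i<Suc I. block f i powr q)" by simp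
    also have "\<dots> \<le> C3 * (\<Sum>i<\<beta> ^ I. T f i)" using C3(2)[OF f(1)] by (simp only: shift)
    also have "(\<Sum>i<\<beta> ^ I. T f i) \<le> suminf (T f)" using T0 f by (intro sum_le_suminf) auto
    finally have "Phi n f \<le> C1 * C3 * suminf (T f)" using C1(1) C3(1) by (simp add: mult_left_mono mult.assoc)
    then have "norm_upto n f \<le> (C1 * C3 * suminf (T f)) powr (1 / q)"
      unfolding norm_upto_def using q Phi_nonneg by (intro powr_mono2) auto
    also have "\<dots> = (C1 * C3) powr (1 / q) * suminf (T f) powr (1 / q)"
      by (rule powr_mult)
    finally show ?thesis by (simp add: nrm)
  qed
  have B: "(\<Sum>i<N. T f i) \<le> C4 * 2 powr q * renorm f powr q" if f: "f \<longlonglongrightarrow> 0" "norm_finite f" for f :: "nat \<Rightarrow> 'k" and N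
  proof -
    \<comment> \<open>The block estimates concern sums up to powers of \<open>\<beta>\<close>; any
      partial sum lies below one of these.\<close>
    have "N < \<beta> ^ N" using beta2 by (intro power_gt_expt) auto
    then have "(\<Sum>i<N. T f i) \<le> (\<Sum>i<\<beta> ^ N. T f i)" using T0[OF f(1)] by (intro sum_mono2) auto
    also have "\<dots> \<le> C4 * (\<Sum>i<Suc N. block f i powr q)" using C4(2)[OF f(1), of N] by (simp only: shift)
    also obtain n where "(\<Sum>i<Suc N. block f i powr q) \<le> 2 powr q * Phi n f" using blocks_le_Phi[OF f(1)] by blast
    also have "Phi n f \<le> renorm f powr q"
      using norm_upto_le_renorm[OF f(2), of n] q norm_upto_nonneg[of n f]
      unfolding norm_upto_powr[symmetric] by (intro powr_mono2) auto
    finally show ?thesis using C4(1) by (simp add: mult_left_mono mult.assoc)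
  qed
  have iff: "f \<in> lorentz_set w (ereal q) \<longleftrightarrow> norm_finite f" if f: "f \<longlonglongrightarrow> 0" for f :: "nat \<Rightarrow> 'k"
  proof
    assume "f \<in> lorentz_set w (ereal q)"
    then have "summable (T f)" by (simp add: mem)
    from norm_finiteI[OF A[OF f this]] show "norm_finite f" .
  next
    assume "norm_finite f"
    then have "summable (T f)"
      using B[OF f] T0[OF f] by (intro summableI_nonneg_bounded) auto
    then show "f \<in> lorentz_set w (ereal q)" using f by (simp add: mem)
  qed
  have A': "renorm f \<le> (C1 * C3) powr (1 / q) * lorentz_norm w (ereal q) f" if "f \<in> lorentz_set w (ereal q)" for f :: "nat \<Rightarrow> 'k"
    using A that by (intro renorm_le) (auto simp: mem)
  have B': "lorentz_norm w (ereal q) f \<le> (C4 * 2 powr q) powr (1 / q) * renorm f" if "f \<in> lorentz_set w (ereal q)" for f :: "nat \<Rightarrow> 'k"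
  proof -
    have f: "f \<longlonglongrightarrow> 0" "summable (T f)" using that by (auto simp: mem)
    then have fin: "norm_finite f" using iff that by simp
    have "suminf (T f) \<le> C4 * 2 powr q * renorm f powr q"
      using B[OF f(1) fin] f(2) by (intro suminf_le_const) auto
    then have "lorentz_norm w (ereal q) f \<le> (C4 * 2 powr q * renorm f powr q) powr (1 / q)"
      unfolding nrm using q T0[OF f(1)] f(2) by (intro powr_mono2 suminf_nonneg) auto
    also have "\<dots> = (C4 * 2 powr q) powr (1 / q) * (renorm f powr q) powr (1 / q)"
      by (rule powr_mult)
    finally show ?thesis using q renorm_nonneg[OF fin] by (simp add: powr_powr)
  qed
  define C where "C = max ((C1 * C3) powr (1 / q)) ((C4 * 2 powr q) powr (1 / q))"
  show ?thesis
  proof (rule that[of C])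
    show "0 < C" using C1 C3 by (simp add: C_def less_max_iff_disj)
    fix f :: "nat \<Rightarrow> 'k"
    show "f \<in> lorentz_set w (ereal q) \<longleftrightarrow> norm_finite f" if "f \<longlonglongrightarrow> 0" using iff[OF that] .
    assume f: "f \<in> lorentz_set w (ereal q)"
    then have "0 \<le> renorm f" using iff by (intro renorm_nonneg) (auto simp: mem)
    moreover have "0 \<le> lorentz_norm w (ereal q) f" by (simp add: nrm)
    ultimately have "(C1 * C3) powr (1 / q) * lorentz_norm w (ereal q) f \<le> C * lorentz_norm w (ereal q) f"
      "(C4 * 2 powr q) powr (1 / q) * renorm f \<le> C * renorm f"
      by (auto simp: C_def intro!: mult_right_mono)
    then show "renorm f \<le> C * lorentz_norm w (ereal q) f \<and> lorentz_norm w (ereal q) f \<le> C * renorm f"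
      using A'[OF f] B'[OF f] by linarith
  qed
qed

end

subsection \<open>Uniformly convex spaces are reflexive\<close>

lemma scalar_ring_simps [simp]:
  "carrier (scalar_ring :: 'k::real_normed_field ring) = UNIV"
  "\<one>\<^bsub>scalar_ring\<^esub> = (1 :: 'k)" "\<zero>\<^bsub>scalar_ring\<^esub> = (0 :: 'k)"
  "a \<oplus>\<^bsub>scalar_ring\<^esub> b = (a + b :: 'k)" "a \<otimes>\<^bsub>scalar_ring\<^esub> b = (a * b :: 'k)"
  by (simp_all add: scalar_ring_def)

lemma cring_scalar_ring: "cring (scalar_ring :: 'k::real_normed_field ring)"
  by (rule cringI, rule abelian_groupI)
    (auto intro!: monoid.intro comm_monoid.intro comm_monoid_axioms.intro
      simp: algebra_simps exI[of _ "- x" for x] add_eq_0_iff)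

lemma nspace_neg_eq:
  assumes "Module.module scalar_ring Y" "y \<in> carrier Y"
  shows "\<ominus>\<^bsub>Y\<^esub> y = (-1) \<odot>\<^bsub>Y\<^esub> y"
proof -
  interpret Module.module scalar_ring Y by (rule assms(1))
  have 1: "(-1) \<odot>\<^bsub>Y\<^esub> y \<in> carrier Y" using smult_closed[of "-1" y] assms(2) by simp
  have "(-1) \<odot>\<^bsub>Y\<^esub> y \<oplus>\<^bsub>Y\<^esub> y = (-1 + 1) \<odot>\<^bsub>Y\<^esub> y"
    using smult_l_distr[of "-1" 1 y] smult_one[of y] assms(2) by simp
  also have "\<dots> = \<zero>\<^bsub>Y\<^esub>" using smult_l_null[of y] assms(2) by simp
  finally show ?thesis
    using M.minus_equality[of "(-1) \<odot>\<^bsub>Y\<^esub> y" y] assms(2) 1 by simp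
qed

lemma nspace_minus_eq:
  assumes "Module.module scalar_ring Y" "y \<in> carrier Y"
  shows "x \<ominus>\<^bsub>Y\<^esub> y = x \<oplus>\<^bsub>Y\<^esub> (-1) \<odot>\<^bsub>Y\<^esub> y"
  by (simp add: a_minus_def nspace_neg_eq[OF assms])

section \<open>Bounded functionals on a normed space\<close>

locale normed_nspace =
  fixes Y :: "('k::{real_normed_field, euclidean_space}, 'v) nspace"
  assumes is_module: "Module.module scalar_ring Y" and is_norm: "is_norm Y"
begin

sublocale mod: Module.module scalar_ring Y
  by (rule is_module)

lemma smult_closed: "x \<in> carrier Y \<Longrightarrow> c \<odot>\<^bsub>Y\<^esub> x \<in> carrier Y"
  by (rule mod.smult_closed) auto

lemma vnorm_nonneg: "x \<in> carrier Y \<Longrightarrow> 0 \<le> vnorm Y x"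
  and vnorm_eq_0_iff: "x \<in> carrier Y \<Longrightarrow> vnorm Y x = 0 \<longleftrightarrow> x = \<zero>\<^bsub>Y\<^esub>"
  and vnorm_smult: "x \<in> carrier Y \<Longrightarrow> vnorm Y (c \<odot>\<^bsub>Y\<^esub> x) = norm c * vnorm Y x"
  and vnorm_triangle: "x \<in> carrier Y \<Longrightarrow> y \<in> carrier Y \<Longrightarrow> vnorm Y (x \<oplus>\<^bsub>Y\<^esub> y) \<le> vnorm Y x + vnorm Y y"
  using is_norm by (auto simp: is_norm_def is_quasinorm_def)

lemmas minus_eq = nspace_minus_eq[OF is_module]

abbreviation dual where "dual \<equiv> carrier (dual_nspace Y)"

abbreviation dnorm where "dnorm \<equiv> vnorm (dual_nspace Y)"

lemma dual_iff: "\<phi> \<in> dual \<longleftrightarrow> (\<forall>y. y \<notin> carrier Y \<longrightarrow> \<phi> y = 0) \<and>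
    (\<forall>y\<in>carrier Y. \<forall>z\<in>carrier Y. \<phi> (y \<oplus>\<^bsub>Y\<^esub> z) = \<phi> y + \<phi> z) \<and>
    (\<forall>c. \<forall>y\<in>carrier Y. \<phi> (c \<odot>\<^bsub>Y\<^esub> y) = c * \<phi> y) \<and>
    (\<exists>C. \<forall>y\<in>carrier Y. norm (\<phi> y) \<le> C * vnorm Y y)"
  by (simp add: dual_nspace_def)

lemma dnorm_eq: "dnorm \<phi> = Sup {norm (\<phi> y) | y. y \<in> carrier Y \<and> vnorm Y y \<le> 1}"
  by (simp add: dual_nspace_def)

lemma dual_add: "\<phi> \<in> dual \<Longrightarrow> y \<in> carrier Y \<Longrightarrow> z \<in> carrier Y \<Longrightarrow> \<phi> (y \<oplus>\<^bsub>Y\<^esub> z) = \<phi> y + \<phi> z"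
  and dual_smult: "\<phi> \<in> dual \<Longrightarrow> y \<in> carrier Y \<Longrightarrow> \<phi> (c \<odot>\<^bsub>Y\<^esub> y) = c * \<phi> y"
  by (auto simp: dual_iff)

lemma dual_zero_value: "\<phi> \<in> dual \<Longrightarrow> \<phi> \<zero>\<^bsub>Y\<^esub> = 0"
  using dual_smult[of \<phi> "\<zero>\<^bsub>Y\<^esub>" 0] mod.smult_l_null[of "\<zero>\<^bsub>Y\<^esub>"] by simp

lemma zero_in_ball: "0 \<in> {norm (\<phi> y) | y. y \<in> carrier Y \<and> vnorm Y y \<le> 1}" if "\<phi> \<in> dual"
  using dual_zero_value[OF that] vnorm_eq_0_iff[of "\<zero>\<^bsub>Y\<^esub>"]
  by (intro CollectI exI[of _ "\<zero>\<^bsub>Y\<^esub>"]) auto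

lemma bdd_ball:
  assumes "\<phi> \<in> dual" shows "bdd_above {norm (\<phi> y) | y. y \<in> carrier Y \<and> vnorm Y y \<le> 1}"
proof -
  obtain C where C: "\<And>y. y \<in> carrier Y \<Longrightarrow> norm (\<phi> y) \<le> C * vnorm Y y"
    using assms unfolding dual_iff by blast
  show ?thesis
  proof (rule bdd_aboveI, clarify)
    fix y assume y: "y \<in> carrier Y" "vnorm Y y \<le> 1"
    have "C * vnorm Y y \<le> \<bar>C\<bar> * 1" using y vnorm_nonneg by (intro mult_mono) auto
    then show "norm (\<phi> y) \<le> \<bar>C\<bar>" using C[OF y(1)] by simp
  qed
qed

lemma dnorm_nonneg: "\<phi> \<in> dual \<Longrightarrow> 0 \<le> dnorm \<phi>"
  unfolding dnorm_eq using zero_in_ball bdd_ball by (intro cSup_upper)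

lemma dnorm_le:
  assumes "\<phi> \<in> dual" "\<And>y. y \<in> carrier Y \<Longrightarrow> vnorm Y y \<le> 1 \<Longrightarrow> norm (\<phi> y) \<le> c"
  shows "dnorm \<phi> \<le> c"
  unfolding dnorm_eq using zero_in_ball[OF assms(1)] assms(2) by (intro cSup_least) auto

lemma norm_le_dnorm:
  assumes "\<phi> \<in> dual" "y \<in> carrier Y" shows "norm (\<phi> y) \<le> dnorm \<phi> * vnorm Y y"
proof (cases "vnorm Y y = 0")
  case True
  then show ?thesis using vnorm_eq_0_iff[OF assms(2)] dual_zero_value[OF assms(1)] by simp
next
  case False
  define t where "t = vnorm Y y"
  have t: "0 < t" using False vnorm_nonneg[OF assms(2)] by (simp add: t_def)
  define z where "z = of_real (1 / t) \<odot>\<^bsub>Y\<^esub> y"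
  have z: "z \<in> carrier Y" "vnorm Y z \<le> 1"
    using t vnorm_smult[OF assms(2)] smult_closed[OF assms(2)] by (simp_all add: z_def norm_divide t_def)
  have "norm (\<phi> z) \<le> dnorm \<phi>"
    unfolding dnorm_eq using z bdd_ball[OF assms(1)] by (intro cSup_upper) auto
  moreover have "norm (\<phi> z) = norm (\<phi> y) / t"
    using t dual_smult[OF assms] by (simp add: z_def norm_mult norm_divide)
  ultimately show ?thesis using t by (simp add: t_def[symmetric] divide_le_eq)
qed

lemma dual_linear_combination:
  fixes n :: nat
  assumes "\<And>i. i < n \<Longrightarrow> \<phi> i \<in> dual"
  shows "(\<lambda>y. \<Sum>i<n. c i * \<phi> i y) \<in> dual"
proof -
  have "norm (\<Sum>i<n. c i * \<phi> i y) \<le> (\<Sum>i<n. norm (c i) * dnorm (\<phi> i)) * vnorm Y y" if "y \<in> carrier Y" for y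
    unfolding sum_distrib_right using norm_le_dnorm[OF assms that]
    by (intro order_trans[OF norm_sum] sum_mono) (auto simp: norm_mult mult.assoc mult_left_mono)
  then have "\<exists>C. \<forall>y\<in>carrier Y. norm (\<Sum>i<n. c i * \<phi> i y) \<le> C * vnorm Y y" by blast
  moreover have "(\<Sum>i<n. c i * \<phi> i y) = 0" if "y \<notin> carrier Y" for y
    using assms that by (intro sum.neutral) (auto simp: dual_iff)
  moreover have "(\<Sum>i<n. c i * \<phi> i (y \<oplus>\<^bsub>Y\<^esub> z)) = (\<Sum>i<n. c i * \<phi> i y) + (\<Sum>i<n. c i * \<phi> i z)"
    if "y \<in> carrier Y" "z \<in> carrier Y" for y z
    unfolding sum.distrib[symmetric] using that assms
    by (intro sum.cong) (auto simp: dual_add algebra_simps)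
  moreover have "(\<Sum>i<n. c i * \<phi> i (a \<odot>\<^bsub>Y\<^esub> y)) = a * (\<Sum>i<n. c i * \<phi> i y)" if "y \<in> carrier Y" for y a
    unfolding sum_distrib_left using that assms
    by (intro sum.cong) (auto simp: dual_smult algebra_simps)
  ultimately show ?thesis unfolding dual_iff by blast
qed

lemma bidual_linear:
  fixes n :: nat
  assumes \<Phi>: "\<Phi> \<in> carrier (dual_nspace (dual_nspace Y))"
    and "\<And>i. i < n \<Longrightarrow> \<phi> i \<in> dual"
  shows "\<Phi> (\<lambda>y. \<Sum>i<n. c i * \<phi> i y) = (\<Sum>i<n. c i * \<Phi> (\<phi> i))"
proof -
  have add: "\<Phi> (\<lambda>y. \<phi> y + \<psi> y) = \<Phi> \<phi> + \<Phi> \<psi>" if "\<phi> \<in> dual" "\<psi> \<in> dual" for \<phi> \<psi>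
    using \<Phi> that unfolding dual_nspace_def[of "dual_nspace Y"] by (simp add: dual_nspace_def)
  have sm: "\<Phi> (\<lambda>y. c * \<phi> y) = c * \<Phi> \<phi>" if "\<phi> \<in> dual" for \<phi> c
    using \<Phi> that unfolding dual_nspace_def[of "dual_nspace Y"] by (simp add: dual_nspace_def)
  show ?thesis using assms(2)
  proof (induction n)
    case 0
    have "(\<lambda>y. 0) \<in> dual" using dual_linear_combination[of 0] by simp
    from sm[OF this, of 0] show ?case by simp
  next
    case (Suc n)
    have "(\<lambda>y. c n * \<phi> n y) \<in> dual"
      using dual_linear_combination[of 1 "\<lambda>_. \<phi> n" "\<lambda>_. c n"] Suc.prems by simp
    then show ?case
      using add[OF dual_linear_combination, of n \<phi> "\<lambda>y. c n * \<phi> n y" c] sm[of "\<phi> n"] Suc by simp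
  qed
qed

end

text \<open>The difference is written with \<open>(-1) \<odot>\<close> because linear maps on a
  subspace are only required to respect addition and scalar multiplication.\<close>

definition unif_convex :: "('k::real_normed_field, 'v) nspace \<Rightarrow> bool" where
  "unif_convex X \<longleftrightarrow> (\<forall>\<epsilon>>0. \<exists>\<delta>>0. \<forall>x\<in>carrier X. \<forall>y\<in>carrier X. vnorm X x \<le> 1 \<longrightarrow> vnorm X y \<le> 1 \<longrightarrow>
      vnorm X (x \<oplus>\<^bsub>X\<^esub> (-1) \<odot>\<^bsub>X\<^esub> y) \<ge> \<epsilon> \<longrightarrow> vnorm X (x \<oplus>\<^bsub>X\<^esub> y) \<le> 2 * (1 - \<delta>))"

text \<open>Polarisation reduces it to the multiplicativity of the norm.\<close>

lemma inner_mult_mult: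
  fixes a x y :: "'k::{real_normed_field, real_inner}"
  shows "(a * x) \<bullet> (a * y) = (norm a)\<^sup>2 * (x \<bullet> y)"
proof -
  have polar: "4 * (u \<bullet> v) = (norm (u + v))\<^sup>2 - (norm (u - v))\<^sup>2" for u v :: 'k
    by (simp add: power2_norm_eq_inner inner_add inner_diff inner_commute)
  have "4 * ((a * x) \<bullet> (a * y)) = (norm (a * (x + y)))\<^sup>2 - (norm (a * (x - y)))\<^sup>2"
    unfolding polar by (simp only: distrib_left right_diff_distrib)
  also have "\<dots> = (norm a)\<^sup>2 * (4 * (x \<bullet> y))"
    unfolding polar norm_mult power_mult_distrib by (rule right_diff_distrib[symmetric])
  finally show ?thesis by simp
qed

text \<open>Conjugation, read off from the product of a scalar and its conjugate being the squared
  norm. At 0 the value is 0.\<close>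

definition conj_scalar :: "'k \<Rightarrow> 'k::{real_normed_field, real_inner}" where
  "conj_scalar r = (norm r)\<^sup>2 *\<^sub>R inverse r"

text \<open>The norm of a normed field determines its inner product, so real and complex scalars can be
  treated together, with \<open>1 \<bullet> x\<close> in the role of the real part.\<close>

lemma inner_conj_scalar: "1 \<bullet> (conj_scalar r * x) = r \<bullet> x"
proof (cases "r = 0")
  case False
  have "r \<bullet> x = (r * 1) \<bullet> (r * (inverse r * x))" using False by (simp add: mult.assoc[symmetric])
  then show ?thesis unfolding inner_mult_mult by (simp add: conj_scalar_def)
qed (simp add: conj_scalar_def)

lemma unimodular_multiple:
  fixes x :: "'k::{real_normed_field, real_inner}"
  obtains c where "norm c = 1" "1 \<bullet> (c * x) = norm x"
proof (cases "x = 0")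
  case True
  then show ?thesis using that[of 1] by simp
next
  case False
  have one: "(1::'k) \<bullet> 1 = 1" using power2_norm_eq_inner[of "1::'k"] by simp
  show ?thesis
    using False one by (intro that[of "of_real (norm x) * inverse x"])
      (simp_all add: norm_mult norm_inverse mult.assoc of_real_def)
qed

lemma norm_diff_scaleR_square:
  fixes a b :: "'a::real_inner"
  shows "(norm (a - t *\<^sub>R b))\<^sup>2 = (norm a)\<^sup>2 - 2 * t * (a \<bullet> b) + t\<^sup>2 * (norm b)\<^sup>2"
  unfolding power2_norm_eq_inner inner_diff inner_scaleR_left inner_scaleR_right
  by (simp add: inner_commute power2_eq_square algebra_simps)

lemma inner_one_le_norm: "1 \<bullet> x \<le> norm (x :: 'k::{real_normed_field, real_inner})"
  using norm_cauchy_schwarz[of 1 x] by simp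

context normed_nspace
begin

text \<open>Minimise \<open>\<Sum>i. (norm (\<Phi> (\<phi> i) - \<phi> i y))\<^sup>2\<close> over the ball: the first variation at an almost
  minimiser bounds the norm of the functional \<open>\<psi>\<close> and forces the minimum to be 0.\<close>

lemma goldstine:
  fixes n :: nat
  assumes \<Phi>: "\<Phi> \<in> carrier (dual_nspace (dual_nspace Y))" and L: "0 \<le> L"
    and bound: "\<And>\<phi>. \<phi> \<in> dual \<Longrightarrow> norm (\<Phi> \<phi>) \<le> L * dnorm \<phi>"
    and \<phi>: "\<And>i. i < n \<Longrightarrow> \<phi> i \<in> dual" and e: "0 < e"
  shows "\<exists>y\<in>carrier Y. vnorm Y y \<le> L \<and> (\<forall>i<n. norm (\<Phi> (\<phi> i) - \<phi> i y) < e)"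
proof (rule ccontr)
  assume neg: "\<not> ?thesis"
  define A where "A = {y \<in> carrier Y. vnorm Y y \<le> L}"
  define Q where "Q = (\<lambda>y. \<Sum>i<n. (norm (\<Phi> (\<phi> i) - \<phi> i y))\<^sup>2)"
  have zero: "\<zero>\<^bsub>Y\<^esub> \<in> A" using vnorm_eq_0_iff[of "\<zero>\<^bsub>Y\<^esub>"] L by (simp add: A_def)
  have Qe: "e\<^sup>2 \<le> Q y" if "y \<in> A" for y
  proof -
    obtain i where i: "i < n" "e \<le> norm (\<Phi> (\<phi> i) - \<phi> i y)"
      using neg \<open>y \<in> A\<close> by (force simp: A_def)
    have "e\<^sup>2 \<le> (norm (\<Phi> (\<phi> i) - \<phi> i y))\<^sup>2" using i e by (intro power_mono) auto
    also have "\<dots> \<le> Q y" unfolding Q_def using i by (intro member_le_sum) auto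
    finally show ?thesis .
  qed
  \<comment> \<open>If no point of the ball approximates within \<open>e\<close>, then
    \<open>Q\<close> is at least \<open>e\<^sup>2\<close> there, so its infimum is positive.\<close>
  define d where "d = Inf (Q ` A)"
  have bdd: "bdd_below (Q ` A)" using Qe by (intro bdd_belowI[of _ "e\<^sup>2"]) auto
  have d_le: "d \<le> Q y" if "y \<in> A" for y unfolding d_def using that bdd by (intro cInf_lower) auto
  have "e\<^sup>2 \<le> d" unfolding d_def using zero Qe by (intro cInf_greatest) auto
  then have d: "0 < d" using e by (smt (verit) zero_less_power)
  define M where "M = (\<Sum>i<n. (2 * L * dnorm (\<phi> i))\<^sup>2)"
  have M0: "0 \<le> M" by (simp add: M_def sum_nonneg)
  have M: "(\<Sum>i<n. (norm (\<phi> i z - \<phi> i y))\<^sup>2) \<le> M" if "y \<in> A" "z \<in> A" for y z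
  proof -
    have "norm (\<phi> i z - \<phi> i y) \<le> 2 * L * dnorm (\<phi> i)" if "i < n" for i
    proof -
      have "norm (\<phi> i x) \<le> dnorm (\<phi> i) * L" if "x \<in> A" for x
        using norm_le_dnorm[OF \<phi>[OF \<open>i < n\<close>], of x] that dnorm_nonneg[OF \<phi>[OF \<open>i < n\<close>]]
        by (auto simp: A_def intro: order_trans mult_left_mono)
      from this[OF \<open>y \<in> A\<close>] this[OF \<open>z \<in> A\<close>]
      have "norm (\<phi> i z - \<phi> i y) \<le> dnorm (\<phi> i) * L + dnorm (\<phi> i) * L"
        using norm_triangle_ineq4[of "\<phi> i z" "\<phi> i y"] by linarith
      then show ?thesis by (simp add: mult_ac)
    qed
    then show ?thesis unfolding M_def by (intro sum_mono power_mono) auto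
  qed
  \<comment> \<open>The step length balances two errors of the first variation: \<open>y\<close>
    below is a minimiser only up to \<open>t * d\<close>, and the quadratic term is at most
    \<open>t\<^sup>2 * M\<close>. Divided by \<open>2 * t\<close> they give a
    \<open>\<delta>\<close> below \<open>d\<close>.\<close>
  define t where "t = min 1 (d / (M + 1))"
  have t: "0 < t" "t \<le> 1" "t \<le> d / (M + 1)" using d M0 by (auto simp: t_def)
  have "Inf (Q ` A) < d + t * d" using d t by (simp add: d_def)
  then obtain y where y: "y \<in> A" "Q y < d + t * d"
    using cInf_lessD[of "Q ` A"] zero by blast
  define r where "r = (\<lambda>i. \<Phi> (\<phi> i) - \<phi> i y)"
  \<comment> \<open>Up to the factor -2, \<open>1 \<bullet> \<psi> z\<close> is the derivative of
    \<open>Q\<close> at \<open>y\<close> in the direction \<open>z\<close>.\<close>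
  define \<psi> where "\<psi> = (\<lambda>y. \<Sum>i<n. conj_scalar (r i) * \<phi> i y)"
  have \<psi>: "\<psi> \<in> dual" unfolding \<psi>_def using \<phi> by (rule dual_linear_combination)
  have re_\<psi>: "1 \<bullet> \<psi> z = (\<Sum>i<n. r i \<bullet> \<phi> i z)" for z
    by (simp add: \<psi>_def inner_sum_right inner_conj_scalar)
  define \<delta> where "\<delta> = (t * d + t\<^sup>2 * M) / (2 * t)"
  have "\<delta> = d / 2 + t * M / 2" using t by (simp add: \<delta>_def field_simps power2_eq_square)
  also have "t * M < d"
  proof -
    have "t * M \<le> d / (M + 1) * M" using t M0 by (intro mult_right_mono) auto
    also have "\<dots> < d" using d M0 by (simp add: field_simps)
    finally show ?thesis .
  qed
  finally have \<delta>: "\<delta> < d" by simp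
  have var: "1 \<bullet> \<psi> z \<le> 1 \<bullet> \<psi> y + \<delta>" if z: "z \<in> A" for z
  proof -
    define u where "u = of_real (1 - t) \<odot>\<^bsub>Y\<^esub> y \<oplus>\<^bsub>Y\<^esub> of_real t \<odot>\<^bsub>Y\<^esub> z"
    have yz: "y \<in> carrier Y" "z \<in> carrier Y" "vnorm Y y \<le> L" "vnorm Y z \<le> L"
      using y z by (auto simp: A_def)
    have "vnorm Y u \<le> (1 - t) * vnorm Y y + t * vnorm Y z"
      using vnorm_triangle[of "of_real (1 - t) \<odot>\<^bsub>Y\<^esub> y" "of_real t \<odot>\<^bsub>Y\<^esub> z"] yz t
      by (simp add: u_def smult_closed vnorm_smult del: of_real_diff)
    also have "\<dots> \<le> (1 - t) * L + t * L"
      using yz t by (intro add_mono mult_left_mono) auto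
    finally have "u \<in> A" using yz by (simp add: A_def u_def smult_closed algebra_simps)
    have \<phi>u: "\<Phi> (\<phi> i) - \<phi> i u = r i - t *\<^sub>R (\<phi> i z - \<phi> i y)" if "i < n" for i
      using yz \<phi>[OF that] by (simp add: u_def dual_add dual_smult smult_closed r_def algebra_simps scaleR_conv_of_real)
    have "d \<le> Q u" by (rule d_le[OF \<open>u \<in> A\<close>])
    also have "Q u = (\<Sum>i<n. (norm (r i))\<^sup>2 - 2 * t * (r i \<bullet> (\<phi> i z - \<phi> i y)) + t\<^sup>2 * (norm (\<phi> i z - \<phi> i y))\<^sup>2)"
      unfolding Q_def
      by (intro sum.cong) (auto simp: \<phi>u norm_diff_scaleR_square)
    also have "\<dots> = Q y - 2 * t * (1 \<bullet> \<psi> z - 1 \<bullet> \<psi> y) + t\<^sup>2 * (\<Sum>i<n. (norm (\<phi> i z - \<phi> i y))\<^sup>2)"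
      unfolding re_\<psi> by (simp add: Q_def r_def sum.distrib sum_subtractf sum_distrib_left inner_diff_right algebra_simps)
    also have "\<dots> \<le> (d + t * d) - 2 * t * (1 \<bullet> \<psi> z - 1 \<bullet> \<psi> y) + t\<^sup>2 * M"
      using M[OF y(1) z] y(2) t by (intro add_mono mult_left_mono diff_mono) auto
    finally have "2 * t * (1 \<bullet> \<psi> z - 1 \<bullet> \<psi> y) \<le> t * d + t\<^sup>2 * M" by simp
    then show ?thesis using t by (simp add: \<delta>_def field_simps)
  qed
  \<comment> \<open>The ball is invariant under scalars of modulus 1, so a bound for the real part
    of \<open>\<psi>\<close> on it is a bound for \<open>L * dnorm \<psi>\<close>.\<close>
  have "L * dnorm \<psi> \<le> 1 \<bullet> \<psi> y + \<delta>"
  proof (cases "L = 0")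
    case True
    then show ?thesis using var[OF zero] dual_zero_value[OF \<psi>] by simp
  next
    case False
    then have L0: "0 < L" using L by simp
    have "dnorm \<psi> \<le> (1 \<bullet> \<psi> y + \<delta>) / L"
    proof (rule dnorm_le[OF \<psi>])
      fix x assume x: "x \<in> carrier Y" "vnorm Y x \<le> 1"
      obtain c where c: "norm c = 1" "1 \<bullet> (c * \<psi> x) = norm (\<psi> x)" using unimodular_multiple by blast
      define z where "z = (of_real L * c) \<odot>\<^bsub>Y\<^esub> x"
      have "z \<in> A"
        using x c L0 by (simp add: A_def z_def smult_closed vnorm_smult norm_mult mult_left_le)
      then have "1 \<bullet> \<psi> z \<le> 1 \<bullet> \<psi> y + \<delta>" by (rule var)
      moreover have "1 \<bullet> \<psi> z = L * norm (\<psi> x)"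
        using c(2) by (simp add: z_def dual_smult[OF \<psi> x(1)] mult.assoc scaleR_conv_of_real[symmetric])
      ultimately show "norm (\<psi> x) \<le> (1 \<bullet> \<psi> y + \<delta>) / L"
        using L0 by (simp add: pos_le_divide_eq mult.commute)
    qed
    then show ?thesis using L0 by (simp add: pos_le_divide_eq mult.commute)
  qed
  moreover have "1 \<bullet> \<Phi> \<psi> = Q y + 1 \<bullet> \<psi> y"
  proof -
    have "\<Phi> \<psi> = (\<Sum>i<n. conj_scalar (r i) * \<Phi> (\<phi> i))"
      unfolding \<psi>_def by (rule bidual_linear[OF \<Phi> \<phi>])
    then have "1 \<bullet> \<Phi> \<psi> = (\<Sum>i<n. r i \<bullet> \<Phi> (\<phi> i))" by (simp add: inner_sum_right inner_conj_scalar)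
    also have "\<dots> = (\<Sum>i<n. (norm (r i))\<^sup>2 + r i \<bullet> \<phi> i y)"
      by (intro sum.cong) (auto simp: r_def power2_norm_eq_inner inner_diff)
    finally show ?thesis by (simp add: re_\<psi> Q_def r_def sum.distrib)
  qed
  moreover have "1 \<bullet> \<Phi> \<psi> \<le> L * dnorm \<psi>"
    using inner_one_le_norm[of "\<Phi> \<psi>"] bound[OF \<psi>] by linarith
  \<comment> \<open>The three estimates combine to
    \<open>Q y \<le> \<delta> < d \<le> Q y\<close>.\<close>
  ultimately show False using d_le[OF y(1)] \<delta> by linarith
qed

lemma unif_convex_ball:
  assumes "unif_convex Y" "0 < L" "0 < \<epsilon>"
  obtains \<delta> where "0 < \<delta>" "\<And>x y. x \<in> carrier Y \<Longrightarrow> y \<in> carrier Y \<Longrightarrow> vnorm Y x \<le> L \<Longrightarrow> vnorm Y y \<le> L \<Longrightarrow>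
    vnorm Y (x \<ominus>\<^bsub>Y\<^esub> y) \<ge> \<epsilon> \<Longrightarrow> vnorm Y (x \<oplus>\<^bsub>Y\<^esub> y) \<le> 2 * L * (1 - \<delta>)"
proof -
  obtain \<delta> where \<delta>: "0 < \<delta>" "\<And>x y. x \<in> carrier Y \<Longrightarrow> y \<in> carrier Y \<Longrightarrow> vnorm Y x \<le> 1 \<Longrightarrow> vnorm Y y \<le> 1 \<Longrightarrow>
    vnorm Y (x \<oplus>\<^bsub>Y\<^esub> (-1) \<odot>\<^bsub>Y\<^esub> y) \<ge> \<epsilon> / L \<Longrightarrow> vnorm Y (x \<oplus>\<^bsub>Y\<^esub> y) \<le> 2 * (1 - \<delta>)"
    using assms(1)[unfolded unif_convex_def, rule_format, of "\<epsilon> / L"] assms(2,3) by auto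
  show ?thesis
  proof (rule that[OF \<delta>(1)])
    fix x y assume xy: "x \<in> carrier Y" "y \<in> carrier Y" "vnorm Y x \<le> L" "vnorm Y y \<le> L"
      and big: "vnorm Y (x \<ominus>\<^bsub>Y\<^esub> y) \<ge> \<epsilon>"
    define c :: 'k where "c = of_real (1 / L)"
    have c: "norm c = 1 / L" using assms(2) by (simp add: c_def norm_divide)
    have mv: "(-1) \<odot>\<^bsub>Y\<^esub> (c \<odot>\<^bsub>Y\<^esub> y) = c \<odot>\<^bsub>Y\<^esub> ((-1) \<odot>\<^bsub>Y\<^esub> y)"
      using mod.smult_assoc1[of "-1" c y] mod.smult_assoc1[of c "-1" y] xy by simp
    have 1: "c \<odot>\<^bsub>Y\<^esub> x \<oplus>\<^bsub>Y\<^esub> (-1) \<odot>\<^bsub>Y\<^esub> (c \<odot>\<^bsub>Y\<^esub> y) = c \<odot>\<^bsub>Y\<^esub> (x \<ominus>\<^bsub>Y\<^esub> y)"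
      unfolding minus_eq[OF xy(2)] mv using mod.smult_r_distr[of c x "(-1) \<odot>\<^bsub>Y\<^esub> y"] xy smult_closed by simp
    have 2: "c \<odot>\<^bsub>Y\<^esub> x \<oplus>\<^bsub>Y\<^esub> c \<odot>\<^bsub>Y\<^esub> y = c \<odot>\<^bsub>Y\<^esub> (x \<oplus>\<^bsub>Y\<^esub> y)"
      using mod.smult_r_distr[of c x y] xy by simp
    have "vnorm Y (c \<odot>\<^bsub>Y\<^esub> x \<oplus>\<^bsub>Y\<^esub> c \<odot>\<^bsub>Y\<^esub> y) \<le> 2 * (1 - \<delta>)"
    proof (rule \<delta>(2))
      show "vnorm Y (c \<odot>\<^bsub>Y\<^esub> x \<oplus>\<^bsub>Y\<^esub> (-1) \<odot>\<^bsub>Y\<^esub> (c \<odot>\<^bsub>Y\<^esub> y)) \<ge> \<epsilon> / L"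
        unfolding 1 using xy big assms(2) by (simp add: vnorm_smult c divide_right_mono)
    qed (use xy assms(2) in \<open>auto simp: smult_closed vnorm_smult c divide_le_eq\<close>)
    then show "vnorm Y (x \<oplus>\<^bsub>Y\<^esub> y) \<le> 2 * L * (1 - \<delta>)"
      unfolding 2 using xy assms(2) by (simp add: vnorm_smult c divide_le_eq mult.commute mult.left_commute)
  qed
qed

text \<open>The functionals \<open>\<phi> n\<close> almost attain the norm \<open>L\<close> of
  \<open>\<Phi>\<close>. Points of the ball of radius \<open>L\<close> that approximate
  \<open>\<Phi>\<close> on them have midpoints of norm close to \<open>L\<close>, so uniform
  convexity makes these points a Cauchy sequence. To represent \<open>\<Phi>\<close> on one more
  functional the sequence is built anew; that its limit is always the same point is again uniform
  convexity.\<close>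

lemma milman_pettis:
  assumes complete: "complete_nspace Y" and uc: "unif_convex Y"
  shows "reflexive_nspace Y"
  unfolding reflexive_nspace_def
proof
  fix \<Phi> assume \<Phi>: "\<Phi> \<in> carrier (dual_nspace (dual_nspace Y))"
  then have "\<exists>C. \<forall>\<phi>\<in>dual. norm (\<Phi> \<phi>) \<le> C * dnorm \<phi>"
    unfolding dual_nspace_def[of "dual_nspace Y"] by simp
  then obtain C where C: "\<And>\<phi>. \<phi> \<in> dual \<Longrightarrow> norm (\<Phi> \<phi>) \<le> C * dnorm \<phi>" by blast
  define S where "S = {norm (\<Phi> \<phi>) | \<phi>. \<phi> \<in> dual \<and> dnorm \<phi> \<le> 1}"
  define L where "L = Sup S"
  have bdd: "bdd_above S"
  proof (rule bdd_aboveI)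
    fix x assume "x \<in> S"
    then obtain \<phi> where \<phi>: "x = norm (\<Phi> \<phi>)" "\<phi> \<in> dual" "dnorm \<phi> \<le> 1" by (auto simp: S_def)
    have "C * dnorm \<phi> \<le> \<bar>C\<bar> * 1" using \<phi> dnorm_nonneg by (intro mult_mono) auto
    then show "x \<le> \<bar>C\<bar>" using C[OF \<phi>(2)] \<phi>(1) by simp
  qed
  have scale: "(\<lambda>y. c * \<phi> y) \<in> dual" "\<Phi> (\<lambda>y. c * \<phi> y) = c * \<Phi> \<phi>" if "\<phi> \<in> dual" for c \<phi>
    using dual_linear_combination[of 1 "\<lambda>_. \<phi>" "\<lambda>_. c"] bidual_linear[OF \<Phi>, of 1 "\<lambda>_. \<phi>" "\<lambda>_. c"] that by auto
  have zero: "0 \<in> S"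
  proof -
    have z: "(\<lambda>y. 0) \<in> dual" "\<Phi> (\<lambda>y. 0) = 0"
      using dual_linear_combination[of 0] bidual_linear[OF \<Phi>, of 0] by auto
    moreover have "dnorm (\<lambda>y. 0) \<le> 1" by (rule dnorm_le[OF z(1)]) simp
    ultimately show ?thesis unfolding S_def by force
  qed
  have L: "0 \<le> L" unfolding L_def by (rule cSup_upper[OF zero bdd])
  have bound: "norm (\<Phi> \<phi>) \<le> L * dnorm \<phi>" if \<phi>: "\<phi> \<in> dual" for \<phi>
  proof (cases "dnorm \<phi> = 0")
    case True
    then show ?thesis using C[OF \<phi>] by simp
  next
    case False
    define t where "t = dnorm \<phi>"
    have t: "0 < t" using False dnorm_nonneg[OF \<phi>] by (simp add: t_def)
    define \<psi> where "\<psi> = (\<lambda>y. of_real (1 / t) * \<phi> y)"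
    have \<psi>: "\<psi> \<in> dual" unfolding \<psi>_def by (rule scale[OF \<phi>])
    have "dnorm \<psi> \<le> 1"
    proof (rule dnorm_le[OF \<psi>])
      fix y assume y: "y \<in> carrier Y" "vnorm Y y \<le> 1"
      have "norm (\<phi> y) \<le> t * 1"
        using norm_le_dnorm[OF \<phi> y(1), folded t_def] mult_left_mono[OF y(2), of t] t by linarith
      then show "norm (\<psi> y) \<le> 1" using t by (simp add: \<psi>_def norm_mult norm_divide divide_le_eq)
    qed
    then have "norm (\<Phi> \<psi>) \<le> L" unfolding L_def using \<psi> bdd by (intro cSup_upper) (auto simp: S_def)
    moreover have "norm (\<Phi> \<psi>) = norm (\<Phi> \<phi>) / t"
      unfolding \<psi>_def scale(2)[OF \<phi>] using t by (simp add: norm_mult norm_divide)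
    ultimately show ?thesis using t by (simp add: divide_le_eq t_def[symmetric])
  qed
  show "\<exists>y\<in>carrier Y. \<forall>\<phi>\<in>dual. \<Phi> \<phi> = \<phi> y"
  proof (cases "L = 0")
    case True
    then show ?thesis using bound by (intro bexI[of _ "\<zero>\<^bsub>Y\<^esub>"]) (auto simp: dual_zero_value)
  next
    case False
    then have L0: "0 < L" using L by simp
    have "\<exists>\<phi>. \<phi> \<in> dual \<and> dnorm \<phi> \<le> 1 \<and> L - L / (real n + 1) < norm (\<Phi> \<phi>)" for n :: nat
    proof -
      have "L - L / (real n + 1) < Sup S" using L0 by (simp add: L_def)
      then obtain x where "x \<in> S" "L - L / (real n + 1) < x"
        using less_cSup_iff[OF _ bdd] zero by blast
      then show ?thesis by (auto simp: S_def)
    qed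
    then obtain \<phi> where \<phi>: "\<And>n. \<phi> n \<in> dual" "\<And>n. dnorm (\<phi> n) \<le> 1"
      "\<And>n :: nat. L - L / (real n + 1) < norm (\<Phi> (\<phi> n))" by metis
    have phi_le: "norm (\<phi> n x) \<le> vnorm Y x" if "x \<in> carrier Y" for n x
    proof -
      have "norm (\<phi> n x) \<le> dnorm (\<phi> n) * vnorm Y x" by (rule norm_le_dnorm[OF \<phi>(1) that])
      also have "\<dots> \<le> 1 * vnorm Y x" using \<phi>(2) vnorm_nonneg[OF that] by (rule mult_right_mono)
      finally show ?thesis by simp
    qed
    have claim: "\<exists>y\<in>carrier Y. vnorm Y y \<le> L \<and> (\<forall>i. \<phi> i y = \<Phi> (\<phi> i)) \<and> \<psi> y = \<Phi> \<psi>" if \<psi>: "\<psi> \<in> dual" for \<psi>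
    proof -
      \<comment> \<open>\<open>\<psi>\<close> is put in front of the norming sequence so that the
        limit also represents \<open>\<Phi>\<close> at \<open>\<psi>\<close>. The bound
        \<open>n + 2\<close> below covers \<open>\<psi>\<close> and \<open>\<phi> 0\<close> to
        \<open>\<phi> n\<close>.\<close>
      define \<xi> where "\<xi> = case_nat \<psi> \<phi>"
      have \<xi>: "\<xi> i \<in> dual" for i using \<psi> \<phi>(1) by (cases i) (auto simp: \<xi>_def)
      have "\<exists>y\<in>carrier Y. vnorm Y y \<le> L \<and> (\<forall>i<n + 2. norm (\<Phi> (\<xi> i) - \<xi> i y) < 1 / (real n + 1))" for n
        by (rule goldstine[OF \<Phi> L bound \<xi>]) auto
      then obtain u where u: "\<And>n. u n \<in> carrier Y" "\<And>n. vnorm Y (u n) \<le> L"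
        "\<And>n i. i < n + 2 \<Longrightarrow> norm (\<Phi> (\<xi> i) - \<xi> i (u n)) < 1 / (real n + 1)" by metis
      have lim\<xi>: "(\<lambda>n. \<xi> i (u n)) \<longlonglongrightarrow> \<Phi> (\<xi> i)" for i
      proof -
        have "(\<lambda>n. 1 / (real n + 1)) \<longlonglongrightarrow> 0"
          using LIMSEQ_inverse_real_of_nat by (simp add: inverse_eq_divide add.commute)
        moreover have "\<forall>\<^sub>F n in sequentially. norm (\<xi> i (u n) - \<Phi> (\<xi> i)) \<le> 1 / (real n + 1)"
          unfolding eventually_sequentially
        proof (intro exI[of _ i] allI impI)
          fix n assume "i \<le> n"
          then have "norm (\<Phi> (\<xi> i) - \<xi> i (u n)) < 1 / (real n + 1)" by (intro u(3)) simp
          then show "norm (\<xi> i (u n) - \<Phi> (\<xi> i)) \<le> 1 / (real n + 1)" by (simp add: norm_minus_commute)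
        qed
        ultimately have "(\<lambda>n. \<xi> i (u n) - \<Phi> (\<xi> i)) \<longlonglongrightarrow> 0" by (rule Lim_null_comparison[rotated])
        then show ?thesis by (rule LIM_zero_cancel)
      qed
      have cauchy: "\<exists>M. \<forall>i\<ge>M. \<forall>j\<ge>M. vnorm Y (u i \<ominus>\<^bsub>Y\<^esub> u j) < \<epsilon>" if "0 < \<epsilon>" for \<epsilon>
      proof -
        obtain \<delta> where \<delta>: "0 < \<delta>" "\<And>x y. x \<in> carrier Y \<Longrightarrow> y \<in> carrier Y \<Longrightarrow> vnorm Y x \<le> L \<Longrightarrow> vnorm Y y \<le> L \<Longrightarrow>
          vnorm Y (x \<ominus>\<^bsub>Y\<^esub> y) \<ge> \<epsilon> \<Longrightarrow> vnorm Y (x \<oplus>\<^bsub>Y\<^esub> y) \<le> 2 * L * (1 - \<delta>)"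
          using unif_convex_ball[OF uc L0 \<open>0 < \<epsilon>\<close>] by blast
        \<comment> \<open>\<open>N\<close> is so large that the defect \<open>L / (N + 1)\<close> of
          \<open>\<phi> N\<close> and the approximation error \<open>1 / (N + 1)\<close> together
          stay below the gain \<open>L * \<delta>\<close>.\<close>
        obtain N :: nat where N: "(L + 1) / (L * \<delta>) < real N" using reals_Archimedean2 by blast
        have N1: "L + 1 < L * \<delta> * (real N + 1)"
        proof -
          have "L + 1 < real N * (L * \<delta>)" using N L0 \<delta>(1) by (simp add: pos_divide_less_eq)
          moreover have "0 < L * \<delta>" using L0 \<delta>(1) by simp
          ultimately show ?thesis by (simp add: algebra_simps)
        qed
        show ?thesis
        proof (intro exI[of _ N] allI impI, rule ccontr)
          fix i j assume ij: "N \<le> i" "N \<le> j" and "\<not> vnorm Y (u i \<ominus>\<^bsub>Y\<^esub> u j) < \<epsilon>"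
          then have 1: "vnorm Y (u i \<oplus>\<^bsub>Y\<^esub> u j) \<le> 2 * L * (1 - \<delta>)" using u by (intro \<delta>(2)) auto
          define h where "h = 1 / (real N + 1)"
          have near: "norm (\<Phi> (\<phi> N) - \<phi> N (u k)) \<le> h" if "N \<le> k" for k
          proof -
            have "norm (\<Phi> (\<phi> N) - \<phi> N (u k)) < 1 / (real k + 1)"
              using u(3)[of "Suc N" k] that by (simp add: \<xi>_def)
            also have "\<dots> \<le> h" unfolding h_def using that by (intro divide_left_mono) auto
            finally show ?thesis by simp
          qed
          have "\<Phi> (\<phi> N) + \<Phi> (\<phi> N) = \<phi> N (u i \<oplus>\<^bsub>Y\<^esub> u j) + ((\<Phi> (\<phi> N) - \<phi> N (u i)) + (\<Phi> (\<phi> N) - \<phi> N (u j)))"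
            using dual_add[OF \<phi>(1) u(1) u(1)] by simp
          then have "norm (\<Phi> (\<phi> N) + \<Phi> (\<phi> N)) \<le> norm (\<phi> N (u i \<oplus>\<^bsub>Y\<^esub> u j)) +
              (norm (\<Phi> (\<phi> N) - \<phi> N (u i)) + norm (\<Phi> (\<phi> N) - \<phi> N (u j)))"
            by (simp only:) (intro order_trans[OF norm_triangle_ineq] add_left_mono norm_triangle_ineq)
          then have "norm (\<Phi> (\<phi> N) + \<Phi> (\<phi> N)) \<le> norm (\<phi> N (u i \<oplus>\<^bsub>Y\<^esub> u j)) + (h + h)"
            using near[OF ij(1)] near[OF ij(2)] by linarith
          moreover have "norm (\<Phi> (\<phi> N) + \<Phi> (\<phi> N)) = 2 * norm (\<Phi> (\<phi> N))"
            unfolding mult_2[symmetric] by (simp add: norm_mult)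
          moreover have "norm (\<phi> N (u i \<oplus>\<^bsub>Y\<^esub> u j)) \<le> vnorm Y (u i \<oplus>\<^bsub>Y\<^esub> u j)"
            using u by (intro phi_le) auto
          moreover have "L - L * h < norm (\<Phi> (\<phi> N))" using \<phi>(3)[of N] by (simp add: h_def)
          ultimately have "L * \<delta> < (L + 1) * h" using 1 by (simp add: algebra_simps)
          then show False using N1 by (simp add: h_def field_simps)
        qed
      qed
      obtain y where y: "y \<in> carrier Y" "(\<lambda>i. vnorm Y (u i \<ominus>\<^bsub>Y\<^esub> y)) \<longlonglongrightarrow> 0"
        using complete[unfolded complete_nspace_def, rule_format, of u] u(1) cauchy by blast
      have limy: "(\<lambda>n. \<xi> i (u n)) \<longlonglongrightarrow> \<xi> i y" for i
      proof -
        have "norm (\<xi> i (u n) - \<xi> i y) \<le> dnorm (\<xi> i) * vnorm Y (u n \<ominus>\<^bsub>Y\<^esub> y)" for n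
        proof -
          have "\<xi> i (u n \<ominus>\<^bsub>Y\<^esub> y) = \<xi> i (u n) - \<xi> i y"
            unfolding minus_eq[OF y(1)] using y u(1) by (simp add: dual_add[OF \<xi>] dual_smult[OF \<xi>] smult_closed)
          then show ?thesis using norm_le_dnorm[OF \<xi>, of "u n \<ominus>\<^bsub>Y\<^esub> y" i] y u(1) by simp
        qed
        then have "\<forall>\<^sub>F n in sequentially. norm (\<xi> i (u n) - \<xi> i y) \<le> dnorm (\<xi> i) * vnorm Y (u n \<ominus>\<^bsub>Y\<^esub> y)"
          by (intro always_eventually allI)
        moreover have "(\<lambda>n. dnorm (\<xi> i) * vnorm Y (u n \<ominus>\<^bsub>Y\<^esub> y)) \<longlonglongrightarrow> 0"
          by (rule tendsto_mult_right_zero[OF y(2)])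
        ultimately have "(\<lambda>n. \<xi> i (u n) - \<xi> i y) \<longlonglongrightarrow> 0" by (rule Lim_null_comparison)
        then show ?thesis by (rule LIM_zero_cancel)
      qed
      have val: "\<xi> i y = \<Phi> (\<xi> i)" for i using LIMSEQ_unique[OF limy lim\<xi>] .
      have "vnorm Y y \<le> L"
      proof (rule field_le_epsilon)
        fix e :: real assume "0 < e"
        then have "\<forall>\<^sub>F i in sequentially. vnorm Y (u i \<ominus>\<^bsub>Y\<^esub> y) < e" using y(2) order_tendstoD(2) by blast
        then obtain i where i: "vnorm Y (u i \<ominus>\<^bsub>Y\<^esub> y) < e" by (auto simp: eventually_sequentially)
        have eq: "y = u i \<oplus>\<^bsub>Y\<^esub> (-1) \<odot>\<^bsub>Y\<^esub> (u i \<ominus>\<^bsub>Y\<^esub> y)"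
        proof -
          have "(-1) \<odot>\<^bsub>Y\<^esub> (u i \<ominus>\<^bsub>Y\<^esub> y) = (-1) \<odot>\<^bsub>Y\<^esub> u i \<oplus>\<^bsub>Y\<^esub> y"
            unfolding minus_eq[OF y(1)]
            using mod.smult_r_distr[of "-1" "u i" "(-1) \<odot>\<^bsub>Y\<^esub> y"] mod.smult_assoc1[of "-1" "-1" y]
              mod.smult_one[of y] y u(1) smult_closed by simp
          moreover have "u i \<oplus>\<^bsub>Y\<^esub> ((-1) \<odot>\<^bsub>Y\<^esub> u i \<oplus>\<^bsub>Y\<^esub> y) = (u i \<ominus>\<^bsub>Y\<^esub> u i) \<oplus>\<^bsub>Y\<^esub> y"
            unfolding minus_eq[OF u(1)] using y u(1) smult_closed by (simp add: mod.M.a_assoc)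
          ultimately show ?thesis using y u(1) by (simp add: a_minus_def mod.M.r_neg)
        qed
        have "vnorm Y y \<le> vnorm Y (u i) + vnorm Y ((-1) \<odot>\<^bsub>Y\<^esub> (u i \<ominus>\<^bsub>Y\<^esub> y))"
          by (subst eq) (intro vnorm_triangle smult_closed mod.M.minus_closed u(1) y(1))
        also have "\<dots> = vnorm Y (u i) + vnorm Y (u i \<ominus>\<^bsub>Y\<^esub> y)"
          using y u(1) by (simp add: vnorm_smult)
        also have "\<dots> \<le> L + e" using u(2)[of i] i by simp
        finally show "vnorm Y y \<le> L + e" .
      qed
      moreover have "\<phi> i y = \<Phi> (\<phi> i)" for i using val[of "Suc i"] by (simp add: \<xi>_def)
      moreover have "\<psi> y = \<Phi> \<psi>" using val[of 0] by (simp add: \<xi>_def)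
      ultimately show ?thesis using y(1) by blast
    qed
    \<comment> \<open>At the midpoint of two such points every \<open>\<phi> N\<close> still takes
      the value \<open>\<Phi> (\<phi> N)\<close>, of modulus close to \<open>L\<close> for large
      \<open>N\<close>. If the points differed, the norm of the midpoint would be below
      \<open>L\<close> by a fixed amount.\<close>
    have uniq: "y = z" if y: "y \<in> carrier Y" "vnorm Y y \<le> L" "\<And>i. \<phi> i y = \<Phi> (\<phi> i)"
      and z: "z \<in> carrier Y" "vnorm Y z \<le> L" "\<And>i. \<phi> i z = \<Phi> (\<phi> i)" for y z
    proof (rule ccontr)
      assume "y \<noteq> z"
      then have "y \<ominus>\<^bsub>Y\<^esub> z \<noteq> \<zero>\<^bsub>Y\<^esub>"
        using mod.M.minus_equality[of y "\<ominus>\<^bsub>Y\<^esub> z"] y z by (auto simp: a_minus_def)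
      then have "0 < vnorm Y (y \<ominus>\<^bsub>Y\<^esub> z)"
        using vnorm_eq_0_iff[of "y \<ominus>\<^bsub>Y\<^esub> z"] vnorm_nonneg[of "y \<ominus>\<^bsub>Y\<^esub> z"] y z by force
      then obtain \<delta> where \<delta>: "0 < \<delta>" "vnorm Y (y \<oplus>\<^bsub>Y\<^esub> z) \<le> 2 * L * (1 - \<delta>)"
        using unif_convex_ball[OF uc L0, of "vnorm Y (y \<ominus>\<^bsub>Y\<^esub> z)"] y z by (metis order_refl)
      obtain N :: nat where N: "1 / \<delta> < real N" using reals_Archimedean2 by blast
      have "2 * norm (\<Phi> (\<phi> N)) = norm (\<phi> N (y \<oplus>\<^bsub>Y\<^esub> z))"
        using y z by (simp add: dual_add[OF \<phi>(1)] mult_2[symmetric] norm_mult)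
      also have "\<dots> \<le> 2 * L * (1 - \<delta>)" using phi_le[of "y \<oplus>\<^bsub>Y\<^esub> z" N] y z \<delta>(2) by simp
      finally have "L - L / (real N + 1) < L * (1 - \<delta>)" using \<phi>(3)[of N] by simp
      then have "L * \<delta> < L * (1 / (real N + 1))" by (simp add: algebra_simps)
      then have "\<delta> < 1 / (real N + 1)" using L0 by (simp only: mult_less_cancel_left_pos)
      then have "\<delta> * (real N + 1) < 1" by (simp add: pos_less_divide_eq)
      moreover have "1 < \<delta> * real N" using N \<delta>(1) by (simp add: pos_divide_less_eq mult.commute)
      ultimately show False using \<delta>(1) by (simp add: algebra_simps)
    qed
    obtain y0 where y0: "y0 \<in> carrier Y" "vnorm Y y0 \<le> L" "\<And>i. \<phi> i y0 = \<Phi> (\<phi> i)"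
      using claim[OF \<phi>(1)[of 0]] by blast
    show ?thesis
    proof (intro bexI[of _ y0] ballI)
      fix \<psi> assume "\<psi> \<in> dual"
      from claim[OF this] obtain y where "y \<in> carrier Y" "vnorm Y y \<le> L" "\<And>i. \<phi> i y = \<Phi> (\<phi> i)" "\<psi> y = \<Phi> \<psi>"
        by blast
      moreover from this have "y = y0" using y0 by (intro uniq)
      ultimately show "\<Phi> \<psi> = \<psi> y0" by simp
    qed (rule y0)
  qed
qed

end

section \<open>Spans and finite representability\<close>

abbreviation nspan :: "('k::real_normed_field, 'v) nspace \<Rightarrow> 'v set \<Rightarrow> 'v set" where
  "nspan Y B \<equiv> (\<lambda>S. submodule S scalar_ring Y) hull B"

lemma nspan_least: "submodule S scalar_ring Y \<Longrightarrow> B \<subseteq> S \<Longrightarrow> nspan Y B \<subseteq> S"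
  by (rule hull_minimal)

lemma nspan_superset: "B \<subseteq> nspan Y B"
  by (rule hull_subset)

lemma nspan_closed:
  assumes "Module.module scalar_ring Y"
  shows "x \<in> nspan Y B \<Longrightarrow> y \<in> nspan Y B \<Longrightarrow> x \<oplus>\<^bsub>Y\<^esub> y \<in> nspan Y B"
    and "x \<in> nspan Y B \<Longrightarrow> c \<odot>\<^bsub>Y\<^esub> x \<in> nspan Y B"
    and "B \<subseteq> carrier Y \<Longrightarrow> nspan Y B \<subseteq> carrier Y"
    and "\<zero>\<^bsub>Y\<^esub> \<in> nspan Y B"
    and "B \<subseteq> carrier Y \<Longrightarrow> submodule (nspan Y B) scalar_ring Y"
proof -
  interpret Module.module scalar_ring Y by (rule assms)
  show 1: "x \<in> nspan Y B \<Longrightarrow> y \<in> nspan Y B \<Longrightarrow> x \<oplus>\<^bsub>Y\<^esub> y \<in> nspan Y B" for x y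
    by (auto simp: hull_def dest: submoduleE(5))
  show 2: "c \<odot>\<^bsub>Y\<^esub> x \<in> nspan Y B" if x: "x \<in> nspan Y B" for x c
    unfolding hull_def
  proof (rule InterI, clarify)
    fix S assume S: "submodule S scalar_ring Y" "B \<subseteq> S"
    then have "x \<in> S" using nspan_least x by blast
    then show "c \<odot>\<^bsub>Y\<^esub> x \<in> S" using submoduleE(4)[OF S(1), of c x] by simp
  qed
  show 3: "B \<subseteq> carrier Y \<Longrightarrow> nspan Y B \<subseteq> carrier Y"
    by (rule nspan_least[OF carrier_is_submodule])
  show 4: "\<zero>\<^bsub>Y\<^esub> \<in> nspan Y B"
    unfolding hull_def
  proof (rule InterI, clarify)
    fix S assume S: "submodule S scalar_ring Y"
    then obtain x where "x \<in> S" using submoduleE(2) by blast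
    then have "0 \<odot>\<^bsub>Y\<^esub> x \<in> S" "x \<in> carrier Y" using submoduleE(1,4)[OF S] by auto
    then show "\<zero>\<^bsub>Y\<^esub> \<in> S" using smult_l_null[of x] by simp
  qed
  show "submodule (nspan Y B) scalar_ring Y" if "B \<subseteq> carrier Y"
  proof (rule submoduleI)
    fix a assume a: "a \<in> nspan Y B"
    then have ac: "a \<in> carrier Y" using 3[OF that] by blast
    show "\<ominus>\<^bsub>Y\<^esub> a \<in> nspan Y B" unfolding nspace_neg_eq[OF assms ac] by (rule 2[OF a])
  qed (use 1 2 3[OF that] 4 in auto)
qed

text \<open>Uniform convexity involves two vectors at a time, so an embedding of their span is
  enough. Half of the gain is given up for the distortion.\<close>

lemma (in normed_nspace) unif_convex_if_finitely_representable:
  assumes fr: "finitely_representable Y X" and uc: "unif_convex X"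
  shows "unif_convex Y"
  unfolding unif_convex_def
proof (intro allI impI)
  fix \<epsilon> :: real assume \<epsilon>: "0 < \<epsilon>"
  obtain \<delta>' where \<delta>': "0 < \<delta>'" "\<And>x y. x \<in> carrier X \<Longrightarrow> y \<in> carrier X \<Longrightarrow> vnorm X x \<le> 1 \<Longrightarrow> vnorm X y \<le> 1 \<Longrightarrow>
    vnorm X (x \<oplus>\<^bsub>X\<^esub> (-1) \<odot>\<^bsub>X\<^esub> y) \<ge> \<epsilon> / 2 \<Longrightarrow> vnorm X (x \<oplus>\<^bsub>X\<^esub> y) \<le> 2 * (1 - \<delta>')"
    using uc[unfolded unif_convex_def, rule_format, of "\<epsilon> / 2"] \<epsilon> by auto
  \<comment> \<open>The bound 1 keeps the distortion below 2, so the separation shrinks at most to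
    \<open>\<epsilon> / 2\<close>.\<close>
  define \<delta> where "\<delta> = min \<delta>' 1"
  have \<delta>: "0 < \<delta>" "\<delta> \<le> 1" "\<delta> \<le> \<delta>'" using \<delta>' by (auto simp: \<delta>_def)
  show "\<exists>\<delta>>0. \<forall>x\<in>carrier Y. \<forall>y\<in>carrier Y. vnorm Y x \<le> 1 \<longrightarrow> vnorm Y y \<le> 1 \<longrightarrow>
      vnorm Y (x \<oplus>\<^bsub>Y\<^esub> (-1) \<odot>\<^bsub>Y\<^esub> y) \<ge> \<epsilon> \<longrightarrow> vnorm Y (x \<oplus>\<^bsub>Y\<^esub> y) \<le> 2 * (1 - \<delta>)"
  proof (intro exI[of _ "\<delta> / 2"] conjI ballI impI)
    fix x y assume xy: "x \<in> carrier Y" "y \<in> carrier Y" "vnorm Y x \<le> 1" "vnorm Y y \<le> 1"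
      and big: "vnorm Y (x \<oplus>\<^bsub>Y\<^esub> (-1) \<odot>\<^bsub>Y\<^esub> y) \<ge> \<epsilon>"
    define E where "E = nspan Y {x, y}"
    have E1: "x \<in> E" "y \<in> E" unfolding E_def using nspan_superset[of "{x, y}" Y] by auto
    have E2: "u \<oplus>\<^bsub>Y\<^esub> v \<in> E" if "u \<in> E" "v \<in> E" for u v
      using that unfolding E_def by (rule nspan_closed(1)[OF is_module])
    have E3: "c \<odot>\<^bsub>Y\<^esub> u \<in> E" if "u \<in> E" for u c
      using that unfolding E_def by (rule nspan_closed(2)[OF is_module])
    have E4: "E \<subseteq> carrier Y"
      unfolding E_def using xy by (intro nspan_closed(3)[OF is_module]) auto
    note E = E1 E2 E3 E4
    have "finite_dim_subspace Y E"
      unfolding finite_dim_subspace_def E_def using xy by (intro exI[of _ "{x, y}"]) auto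
    moreover have "0 < \<delta> / 2" using \<delta> by simp
    ultimately obtain T a b where T: "linear_on_nspace E Y X T" "0 < a" "b / a < 1 + \<delta> / 2"
      "\<And>z. z \<in> E \<Longrightarrow> a * vnorm Y z \<le> vnorm X (T z)" "\<And>z. z \<in> E \<Longrightarrow> vnorm X (T z) \<le> b * vnorm Y z"
      using fr unfolding finitely_representable_def by blast
    define d where "d = x \<oplus>\<^bsub>Y\<^esub> (-1) \<odot>\<^bsub>Y\<^esub> y"
    have d: "d \<in> E" "0 < vnorm Y d" using E big \<epsilon> by (auto simp: d_def)
    \<comment> \<open>Positivity of \<open>b\<close> is not part of finite representability; the
      nonzero vector \<open>d\<close> provides it.\<close>
    have "a * vnorm Y d \<le> b * vnorm Y d" using T(4,5)[OF d(1)] by linarith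
    then have ab: "a \<le> b" using d(2) by simp
    then have b: "0 < b" using T(2) by simp
    define c :: 'k where "c = of_real (1 / b)"
    have c: "norm c = 1 / b" using b by (simp add: c_def norm_divide)
    define u where "u = c \<odot>\<^bsub>Y\<^esub> x"
    define v where "v = c \<odot>\<^bsub>Y\<^esub> y"
    have uv: "u \<in> E" "v \<in> E" using E by (auto simp: u_def v_def)
    have mv: "(-1) \<odot>\<^bsub>Y\<^esub> (c \<odot>\<^bsub>Y\<^esub> y) = c \<odot>\<^bsub>Y\<^esub> ((-1) \<odot>\<^bsub>Y\<^esub> y)"
      using mod.smult_assoc1[of "-1" c y] mod.smult_assoc1[of c "-1" y] xy by simp
    have ud: "u \<oplus>\<^bsub>Y\<^esub> (-1) \<odot>\<^bsub>Y\<^esub> v = c \<odot>\<^bsub>Y\<^esub> d"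
      unfolding u_def v_def mv d_def using mod.smult_r_distr[of c x "(-1) \<odot>\<^bsub>Y\<^esub> y"] xy smult_closed by simp
    have us: "u \<oplus>\<^bsub>Y\<^esub> v = c \<odot>\<^bsub>Y\<^esub> (x \<oplus>\<^bsub>Y\<^esub> y)"
      unfolding u_def v_def using mod.smult_r_distr[of c x y] xy by simp
    have Tl: "T w \<in> carrier X" "T (w \<oplus>\<^bsub>Y\<^esub> z) = T w \<oplus>\<^bsub>X\<^esub> T z" "T (k \<odot>\<^bsub>Y\<^esub> w) = k \<odot>\<^bsub>X\<^esub> T w"
      if "w \<in> E" "z \<in> E" for w z k
      using T(1) that by (auto simp: linear_on_nspace_def)
    have small: "vnorm X (T (c \<odot>\<^bsub>Y\<^esub> w)) \<le> 1" if "w \<in> E" "vnorm Y w \<le> 1" for w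
    proof -
      have "vnorm X (T (c \<odot>\<^bsub>Y\<^esub> w)) \<le> b * vnorm Y (c \<odot>\<^bsub>Y\<^esub> w)" using that E by (intro T(5)) auto
      also have "\<dots> = vnorm Y w" using that E b by (simp add: vnorm_smult subsetD c)
      finally show ?thesis using that by simp
    qed
    have "vnorm X (T u \<oplus>\<^bsub>X\<^esub> T v) \<le> 2 * (1 - \<delta>')"
    proof (rule \<delta>'(2))
      have "\<epsilon> / 2 \<le> a / b * \<epsilon>"
      proof -
        have "b < a * (1 + \<delta> / 2)" using T(2,3) by (simp add: pos_divide_less_eq mult.commute)
        also have "\<dots> \<le> a * 2" using T(2) \<delta> by (intro mult_left_mono) auto
        finally show ?thesis using b \<epsilon> by (simp add: field_simps)
      qed
      also have "\<dots> \<le> a / b * vnorm Y d" using big T(2) b by (intro mult_left_mono) (auto simp: d_def)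
      also have "\<dots> = a * vnorm Y (c \<odot>\<^bsub>Y\<^esub> d)" using d E b by (simp add: vnorm_smult subsetD c)
      also have "\<dots> \<le> vnorm X (T (c \<odot>\<^bsub>Y\<^esub> d))" using d E by (intro T(4)) auto
      also have "T (c \<odot>\<^bsub>Y\<^esub> d) = T u \<oplus>\<^bsub>X\<^esub> (-1) \<odot>\<^bsub>X\<^esub> T v"
        unfolding ud[symmetric] using uv E by (simp add: Tl)
      finally show "\<epsilon> / 2 \<le> vnorm X (T u \<oplus>\<^bsub>X\<^esub> (-1) \<odot>\<^bsub>X\<^esub> T v)" .
    qed (use uv small xy E in \<open>auto simp: Tl(1) u_def v_def\<close>)
    moreover have "a / b * vnorm Y (x \<oplus>\<^bsub>Y\<^esub> y) \<le> vnorm X (T u \<oplus>\<^bsub>X\<^esub> T v)"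
    proof -
      have "a / b * vnorm Y (x \<oplus>\<^bsub>Y\<^esub> y) = a * vnorm Y (c \<odot>\<^bsub>Y\<^esub> (x \<oplus>\<^bsub>Y\<^esub> y))"
        using xy b by (simp add: vnorm_smult c)
      also have "\<dots> \<le> vnorm X (T (c \<odot>\<^bsub>Y\<^esub> (x \<oplus>\<^bsub>Y\<^esub> y)))" using E by (intro T(4)) auto
      finally show ?thesis unfolding us[symmetric] using uv by (simp add: Tl)
    qed
    ultimately have "a / b * vnorm Y (x \<oplus>\<^bsub>Y\<^esub> y) \<le> 2 * (1 - \<delta>')" by linarith
    then have "b / a * (a / b * vnorm Y (x \<oplus>\<^bsub>Y\<^esub> y)) \<le> b / a * (2 * (1 - \<delta>'))"
      using b T(2) by (intro mult_left_mono) auto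
    then have "vnorm Y (x \<oplus>\<^bsub>Y\<^esub> y) \<le> b / a * (2 * (1 - \<delta>'))"
      using b T(2) by simp
    also have "\<dots> \<le> b / a * (2 * (1 - \<delta>))" using \<delta> b T(2) by (intro mult_left_mono) auto
    also have "\<dots> \<le> (1 + \<delta> / 2) * (2 * (1 - \<delta>))" using T(3) \<delta> by (intro mult_right_mono) auto
    also have "\<dots> \<le> 2 * (1 - \<delta> / 2)" using \<delta> by (simp add: algebra_simps)
    finally show "vnorm Y (x \<oplus>\<^bsub>Y\<^esub> y) \<le> 2 * (1 - \<delta> / 2)" .
  qed (use \<delta> in simp)
qed

subsection \<open>Spaces of sequences as ultralimits\<close>

text \<open>Lying below \<open>sequentially\<close> makes the ultrafilter free.\<close>

definition ultra :: "nat filter \<Rightarrow> bool" where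
  "ultra U \<longleftrightarrow> U \<noteq> bot \<and> U \<le> sequentially \<and> (\<forall>P. eventually P U \<or> eventually (\<lambda>x. \<not> P x) U)"

text \<open>Zorn's lemma for families of sets all of whose finite intersections are infinite.
  Infinitude instead of mere non-emptiness forces the complements of finite sets into a maximal
  family.\<close>

lemma ultra_exists: "\<exists>U. ultra U"
proof -
  define A where "A = {\<G> :: nat set set. \<forall>\<F>. finite \<F> \<longrightarrow> \<F> \<subseteq> \<G> \<longrightarrow> infinite (\<Inter>\<F>)}"
  have "\<exists>M\<in>A. \<forall>X\<in>A. M \<subseteq> X \<longrightarrow> X = M"
  proof (rule subset_Zorn)
    fix C assume C: "subset.chain A C"
    show "\<exists>U\<in>A. \<forall>X\<in>C. X \<subseteq> U"
    proof (cases "C = {}")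
      case True
      then show ?thesis by (intro bexI[of _ "{}"]) (auto simp: A_def)
    next
      case False
      have "\<Union>C \<in> A" unfolding A_def
      proof (intro CollectI allI impI)
        fix \<F> assume "finite \<F>" "\<F> \<subseteq> \<Union>C"
        then obtain X where "X \<in> C" "\<F> \<subseteq> X"
          using finite_subset_Union_chain[OF _ _ False C] by blast
        moreover have "X \<in> A" using C \<open>X \<in> C\<close> by (auto simp: subset.chain_def)
        ultimately show "infinite (\<Inter>\<F>)" using \<open>finite \<F>\<close> by (auto simp: A_def)
      qed
      then show ?thesis by blast
    qed
  qed
  then obtain M where M: "M \<in> A" "\<And>X. X \<in> A \<Longrightarrow> M \<subseteq> X \<Longrightarrow> X = M" by blast
  have fip: "infinite (\<Inter>\<F>)" if "finite \<F>" "\<F> \<subseteq> M" for \<F> using M(1) that by (auto simp: A_def)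
  \<comment> \<open>By maximality, a set outside \<open>M\<close> meets some finite intersection of
    members in a finite set only.\<close>
  have notin: "\<exists>\<F>. finite \<F> \<and> \<F> \<subseteq> M \<and> finite (S \<inter> \<Inter>\<F>)" if "S \<notin> M" for S
  proof -
    have "insert S M \<notin> A" using M(2)[of "insert S M"] that by blast
    then obtain \<F> where F: "finite \<F>" "\<F> \<subseteq> insert S M" "finite (\<Inter>\<F>)" by (auto simp: A_def)
    have "S \<inter> \<Inter>(\<F> - {S}) \<subseteq> \<Inter>\<F>" by blast
    then have "finite (S \<inter> \<Inter>(\<F> - {S}))" using F(3) finite_subset by blast
    then show ?thesis using F by (intro exI[of _ "\<F> - {S}"]) auto
  qed
  have dich: "S \<in> M \<or> - S \<in> M" for S
  proof (rule ccontr)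
    assume "\<not> ?thesis"
    then obtain F1 F2 where F: "finite F1" "F1 \<subseteq> M" "finite (S \<inter> \<Inter>F1)" "finite F2" "F2 \<subseteq> M" "finite (- S \<inter> \<Inter>F2)"
      using notin[of S] notin[of "- S"] by blast
    have "\<Inter>(F1 \<union> F2) \<subseteq> (S \<inter> \<Inter>F1) \<union> (- S \<inter> \<Inter>F2)" by blast
    then have "finite (\<Inter>(F1 \<union> F2))" using F finite_subset by blast
    then show False using fip[of "F1 \<union> F2"] F by auto
  qed
  have inter: "S \<inter> T \<in> M" if "S \<in> M" "T \<in> M" for S T
  proof (rule ccontr)
    assume "S \<inter> T \<notin> M"
    then have "{S, T, - (S \<inter> T)} \<subseteq> M" using dich that by blast
    then have "infinite (\<Inter>{S, T, - (S \<inter> T)})" by (intro fip) auto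
    moreover have "\<Inter>{S, T, - (S \<inter> T)} = {}" by blast
    ultimately show False by simp
  qed
  have inf: "infinite S" if "S \<in> M" for S using fip[of "{S}"] that by simp
  have "UNIV \<in> M" using dich[of UNIV] inf[of "- UNIV"] by auto
  then have ev: "eventually P (INF S\<in>M. principal S) \<longleftrightarrow> (\<exists>S\<in>M. \<forall>x\<in>S. P x)" for P
    using inter by (subst eventually_INF_base) (auto simp: eventually_principal)
  show ?thesis
  proof (intro exI[of _ "INF S\<in>M. principal S"], unfold ultra_def, intro conjI allI)
    show "(INF S\<in>M. principal S) \<noteq> bot"
      unfolding trivial_limit_def ev using inf by (metis finite.emptyI all_not_in_conv)
    show "(INF S\<in>M. principal S) \<le> sequentially"
    proof (rule filter_leI)
      fix P assume "eventually P sequentially"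
      then obtain n where n: "\<forall>k\<ge>n. P k" by (auto simp: eventually_sequentially)
      have "- {n..} \<notin> M" using inf[of "- {n..}"] by auto
      then have "{n..} \<in> M" using dich[of "{n..}"] by blast
      then show "eventually P (INF S\<in>M. principal S)" unfolding ev using n by (intro bexI[of _ "{n..}"]) auto
    qed
    fix P show "eventually P (INF S\<in>M. principal S) \<or> eventually (\<lambda>x. \<not> P x) (INF S\<in>M. principal S)"
      unfolding ev using dich[of "Collect P"] by auto
  qed
qed

text \<open>Compactness gives a cluster point, and a cluster point of an ultrafilter is a
  limit.\<close>

lemma ultra_limit:
  fixes f :: "nat \<Rightarrow> 'a::heine_borel"
  assumes U: "ultra U" and b: "bounded (range f)"
  shows "\<exists>l. (f \<longlongrightarrow> l) U"
proof -
  define K where "K = closure (range f)"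
  have K: "compact K" using b by (simp add: K_def compact_closure)
  have ev: "eventually (\<lambda>x. x \<in> K) (filtermap f U)"
    by (auto simp: eventually_filtermap K_def intro!: always_eventually closure_subset[THEN subsetD])
  have "filtermap f U \<noteq> bot" using U by (simp add: ultra_def filtermap_bot_iff)
  then obtain l where l: "inf (nhds l) (filtermap f U) \<noteq> bot"
    using K ev unfolding compact_filter by (metis le_principal)
  have "(f \<longlongrightarrow> l) U"
  proof (rule topological_tendstoI)
    fix S assume S: "open S" "l \<in> S"
    show "\<forall>\<^sub>F x in U. f x \<in> S"
    proof (rule ccontr)
      assume "\<not> ?thesis"
      then have "\<forall>\<^sub>F x in U. f x \<notin> S" using U by (auto simp: ultra_def)
      then have 1: "eventually (\<lambda>y. y \<notin> S) (filtermap f U)" by (simp add: eventually_filtermap)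
      have 2: "eventually (\<lambda>y. y \<in> S) (nhds l)" using S by (rule eventually_nhds_in_open)
      have "eventually (\<lambda>_. False) (inf (nhds l) (filtermap f U))"
        unfolding eventually_inf using 1 2 by blast
      then show False using l by (simp add: trivial_limit_def)
    qed
  qed
  then show ?thesis by blast
qed

section \<open>Spaces of sequences with a given norm\<close>

definition fspace :: "(nat \<Rightarrow> 'k) set \<Rightarrow> ((nat \<Rightarrow> 'k) \<Rightarrow> real) \<Rightarrow> ('k::real_normed_field, nat \<Rightarrow> 'k) nspace" where
  "fspace V N = \<lparr>carrier = V, mult = (\<lambda>f g k. f k * g k), one = (\<lambda>k. 1), zero = (\<lambda>k. 0),
     add = (\<lambda>f g k. f k + g k), smult = (\<lambda>c f k. c * f k), vnorm = N\<rparr>"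

lemma fspace_simps [simp]:
  "carrier (fspace V N) = V" "\<zero>\<^bsub>fspace V N\<^esub> = (\<lambda>k. 0)" "f \<oplus>\<^bsub>fspace V N\<^esub> g = (\<lambda>k. f k + g k)"
  "c \<odot>\<^bsub>fspace V N\<^esub> f = (\<lambda>k. c * f k)" "vnorm (fspace V N) = N"
  by (simp_all add: fspace_def)

lemma fspace_vnorm_update [simp]: "(fspace V N)\<lparr>vnorm := N'\<rparr> = fspace V N'"
  by (simp add: fspace_def)

lemma lorentz_space_eq_fspace: "lorentz_space w q = fspace (lorentz_set w q) (lorentz_norm w q)"
  by (simp add: lorentz_space_def fspace_def)

definition function_subspace :: "(nat \<Rightarrow> 'k::real_normed_field) set \<Rightarrow> bool" where
  "function_subspace V \<longleftrightarrow> (\<lambda>k. 0) \<in> V \<and> (\<forall>f\<in>V. \<forall>g\<in>V. (\<lambda>k. f k + g k) \<in> V) \<and> (\<forall>c. \<forall>f\<in>V. (\<lambda>k. c * f k) \<in> V)"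

lemma function_subspaceD:
  assumes "function_subspace V"
  shows "(\<lambda>k. 0) \<in> V" and "f \<in> V \<Longrightarrow> g \<in> V \<Longrightarrow> (\<lambda>k. f k + g k) \<in> V"
    and "f \<in> V \<Longrightarrow> (\<lambda>k. c * f k) \<in> V"
  using assms by (simp_all add: function_subspace_def)

lemma module_fspace_iff: "Module.module scalar_ring (fspace V N) \<longleftrightarrow> function_subspace V"
proof
  assume "Module.module scalar_ring (fspace V N)"
  then interpret Module.module scalar_ring "fspace V N" .
  show "function_subspace V"
    unfolding function_subspace_def
    using M.zero_closed M.a_closed smult_closed by simp
next
  assume V: "function_subspace V"
  show "Module.module scalar_ring (fspace V N)"
  proof (rule moduleI[OF cring_scalar_ring])
    show "abelian_group (fspace V N)"
    proof (rule abelian_groupI)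
      fix f assume f: "f \<in> carrier (fspace V N)"
      then have "(\<lambda>k. (-1) * f k) \<in> V" by (intro function_subspaceD(3)[OF V]) simp
      then show "\<exists>g\<in>carrier (fspace V N). g \<oplus>\<^bsub>fspace V N\<^esub> f = \<zero>\<^bsub>fspace V N\<^esub>"
        by (intro bexI[of _ "\<lambda>k. (-1) * f k"]) auto
    qed (use V in \<open>auto simp: function_subspace_def algebra_simps\<close>)
  qed (use V in \<open>auto simp: function_subspace_def algebra_simps\<close>)
qed

lemma function_subspace_diff:
  assumes "function_subspace V" "f \<in> V" "g \<in> V" shows "(\<lambda>k. f k - g k) \<in> V"
proof -
  have "(\<lambda>k. f k + (-1) * g k) \<in> V" by (intro function_subspaceD[OF assms(1)] assms)
  then show ?thesis by simp
qed

lemma fspace_minus: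
  assumes "function_subspace V" "g \<in> V"
  shows "f \<ominus>\<^bsub>fspace V N\<^esub> g = (\<lambda>k. f k - g k)"
  using nspace_minus_eq[of "fspace V N" g f] assms by (simp add: module_fspace_iff)

lemma nspan_insert_fspace:
  assumes V: "function_subspace V" and B: "insert b B \<subseteq> V" and x: "x \<in> nspan (fspace V N) (insert b B)"
  shows "\<exists>c. \<exists>z\<in>nspan (fspace V N) B. x = (\<lambda>k. c * b k + z k)"
proof -
  let ?Y = "fspace V N"
  have m: "Module.module scalar_ring ?Y" using V by (simp add: module_fspace_iff)
  define S where "S = {(\<lambda>k. c * b k + z k) | c z. z \<in> nspan ?Y B}"
  note cl = nspan_closed(1,2,4)[OF m, where B = B, simplified]
  have sub: "nspan ?Y B \<subseteq> V" using nspan_closed(3)[OF m, of B] B by simp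
  have "submodule S scalar_ring ?Y"
  proof (rule module.submoduleI[OF m])
    show "S \<subseteq> carrier ?Y"
      using V B sub by (auto simp: S_def function_subspace_def)
    show "\<zero>\<^bsub>?Y\<^esub> \<in> S" using cl(3) by (auto simp: S_def intro!: exI[of _ 0])
    show add: "u \<oplus>\<^bsub>?Y\<^esub> v \<in> S" if uv: "u \<in> S" "v \<in> S" for u v
    proof -
      obtain c z where u: "u = (\<lambda>k. c * b k + z k)" "z \<in> nspan ?Y B" using uv by (auto simp: S_def)
      obtain d y where v: "v = (\<lambda>k. d * b k + y k)" "y \<in> nspan ?Y B" using uv by (auto simp: S_def)
      show ?thesis
        unfolding S_def u(1) v(1) using cl(1)[OF u(2) v(2)]
        by (intro CollectI exI[of _ "c + d"] exI[of _ "\<lambda>k. z k + y k"]) (auto simp: algebra_simps)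
    qed
    show sm: "a \<odot>\<^bsub>?Y\<^esub> u \<in> S" if u: "u \<in> S" for a u
    proof -
      obtain c z where u: "u = (\<lambda>k. c * b k + z k)" "z \<in> nspan ?Y B" using u by (auto simp: S_def)
      show ?thesis
        unfolding S_def u(1) using cl(2)[OF u(2), of a]
        by (intro CollectI exI[of _ "a * c"] exI[of _ "\<lambda>k. a * z k"]) (auto simp: algebra_simps)
    qed
    fix u assume u: "u \<in> S"
    have uV: "u \<in> carrier ?Y" using u V B sub by (auto simp: S_def function_subspace_def)
    show "\<ominus>\<^bsub>?Y\<^esub> u \<in> S" unfolding nspace_neg_eq[OF m uV] by (rule sm[OF u])
  qed
  moreover have "insert b B \<subseteq> S"
  proof -
    have "b \<in> S" using cl(3) unfolding S_def by (intro CollectI exI[of _ 1] exI[of _ "\<lambda>k. 0"]) auto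
    moreover have "B \<subseteq> S" using nspan_superset[of B ?Y] unfolding S_def by (force intro!: exI[of _ 0])
    ultimately show ?thesis by simp
  qed
  ultimately have "x \<in> S" using nspan_least[of S ?Y "insert b B"] x by blast
  then show ?thesis by (auto simp: S_def)
qed

lemma normed_fspaceI:
  fixes N :: "(nat \<Rightarrow> 'k::real_normed_field) \<Rightarrow> real"
  assumes "\<And>f. f \<in> V \<Longrightarrow> 0 \<le> N f" "N (\<lambda>k. 0) = 0" "\<And>f. f \<in> V \<Longrightarrow> N f = 0 \<Longrightarrow> f = (\<lambda>k. 0)"
    "\<And>c f. f \<in> V \<Longrightarrow> N (\<lambda>k. c * f k) = norm c * N f"
    "\<And>f g. f \<in> V \<Longrightarrow> g \<in> V \<Longrightarrow> N (\<lambda>k. f k + g k) \<le> N f + N g"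
  shows "is_norm (fspace V N)"
proof -
  have "\<exists>K. \<forall>f\<in>V. \<forall>g\<in>V. N (\<lambda>k. f k + g k) \<le> K * (N f + N g)"
    using assms(5) by (intro exI[of _ 1]) auto
  then show ?thesis
    using assms by (auto simp: is_norm_def is_quasinorm_def)
qed

lemma normed_fspaceD:
  fixes N :: "(nat \<Rightarrow> 'k::real_normed_field) \<Rightarrow> real"
  assumes "is_norm (fspace V N)"
  shows "f \<in> V \<Longrightarrow> 0 \<le> N f" and "f \<in> V \<Longrightarrow> N f = 0 \<longleftrightarrow> f = (\<lambda>k. 0)"
    and "f \<in> V \<Longrightarrow> N (\<lambda>k. c * f k) = norm c * N f"
    and "f \<in> V \<Longrightarrow> g \<in> V \<Longrightarrow> N (\<lambda>k. f k + g k) \<le> N f + N g"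
  using assms by (auto simp: is_norm_def is_quasinorm_def)

lemma normed_fspace_diff_commute:
  assumes "function_subspace V" "is_norm (fspace V N)" "f \<in> V" "g \<in> V"
  shows "N (\<lambda>k. f k - g k) = N (\<lambda>k. g k - f k)"
  using normed_fspaceD(3)[OF assms(2) function_subspace_diff[OF assms(1,4,3)], of "-1"] by simp

lemma normed_fspace_diff_le:
  assumes "function_subspace V" "is_norm (fspace V N)" "f \<in> V" "g \<in> V"
  shows "\<bar>N f - N g\<bar> \<le> N (\<lambda>k. f k - g k)"
proof -
  have "N f \<le> N (\<lambda>k. f k - g k) + N g"
    using normed_fspaceD(4)[OF assms(2) function_subspace_diff[OF assms(1,3,4)] assms(4)] by simp
  moreover have "N g \<le> N (\<lambda>k. g k - f k) + N f"
    using normed_fspaceD(4)[OF assms(2) function_subspace_diff[OF assms(1,4,3)] assms(3)] by simp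
  ultimately show ?thesis using normed_fspace_diff_commute[OF assms] by simp
qed

lemma linear_on_nspace_subset: "linear_on_nspace E Y X T \<Longrightarrow> E' \<subseteq> E \<Longrightarrow> linear_on_nspace E' Y X T"
  unfolding linear_on_nspace_def by blast

lemma nspan_fspace_sub:
  assumes "function_subspace V" "B \<subseteq> V" shows "nspan (fspace V N) B \<subseteq> V"
  using nspan_closed(3)[of "fspace V N" B] assms by (simp add: module_fspace_iff)

text \<open>Compactness of bounded sets in finite dimension, by induction on the generators. If
  \<open>b\<close> is not in the span of the others, its distance \<open>d\<close> from that span is
  positive, for otherwise the induction hypothesis would put \<open>b\<close> into the span as a
  limit. So the coefficients of \<open>b\<close> are bounded and converge along
  \<open>U\<close>.\<close>

lemma ultra_limit_in_span:
  fixes \<nu> :: "(nat \<Rightarrow> 'k::{real_normed_field, euclidean_space}) \<Rightarrow> real"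
  assumes U: "ultra U" and V: "function_subspace V" and norm: "is_norm (fspace V \<nu>)"
    and "finite B" "B \<subseteq> V"
  shows "(\<And>n. u n \<in> nspan (fspace V \<nu>) B) \<Longrightarrow> (\<And>n. \<nu> (u n) \<le> K) \<Longrightarrow>
    \<exists>y\<in>nspan (fspace V \<nu>) B. ((\<lambda>n. \<nu> (\<lambda>k. u n k - y k)) \<longlongrightarrow> 0) U"
  using assms(4,5)
proof (induction B arbitrary: u K rule: finite_induct)
  case empty
  have m: "Module.module scalar_ring (fspace V \<nu>)" using V by (simp add: module_fspace_iff)
  have "submodule {\<lambda>k. 0} scalar_ring (fspace V \<nu>)"
    by (rule module.submoduleI[OF m])
      (use function_subspaceD(1)[OF V] in \<open>auto simp: nspace_neg_eq[OF m]\<close>)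
  then have "nspan (fspace V \<nu>) {} \<subseteq> {\<lambda>k. 0}" by (rule nspan_least) simp
  then have "u n = (\<lambda>k. 0)" for n using empty.prems(1)[of n] by blast
  moreover have "\<nu> (\<lambda>k. 0) = 0" using normed_fspaceD(2)[OF norm function_subspaceD(1)[OF V]] by simp
  ultimately show ?case
    using empty.prems(1)[of 0] by (intro bexI[of _ "\<lambda>k. 0"]) auto
next
  case (insert b B)
  let ?H = "nspan (fspace V \<nu>) B"
  have m: "Module.module scalar_ring (fspace V \<nu>)" using V by (simp add: module_fspace_iff)
  note cl = nspan_closed(1,2)[OF m, simplified]
  have bV: "b \<in> V" and BV: "B \<subseteq> V" using insert.prems by auto
  have HV: "?H \<subseteq> V" by (rule nspan_fspace_sub[OF V BV])
  have sub: "?H \<subseteq> nspan (fspace V \<nu>) (insert b B)"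
    by (rule nspan_least[OF nspan_closed(5)[OF m]]) (use bV BV nspan_superset[of "insert b B" "fspace V \<nu>"] in auto)
  have bH: "b \<in> nspan (fspace V \<nu>) (insert b B)"
    using nspan_superset[of "insert b B" "fspace V \<nu>"] by blast
  have "\<forall>n. \<exists>c. \<exists>z. z \<in> ?H \<and> u n = (\<lambda>k. c * b k + z k)"
    using nspan_insert_fspace[OF V _ insert.prems(1)] bV BV by blast
  from choice[OF this] obtain c where "\<forall>n. \<exists>z. z \<in> ?H \<and> u n = (\<lambda>k. c n * b k + z k)" by blast
  from choice[OF this] obtain z where z: "\<And>n. z n \<in> ?H" "\<And>n. u n = (\<lambda>k. c n * b k + z n k)" by blast
  show ?case
  proof (cases "b \<in> ?H")
    case True
    have "u n \<in> ?H" for n unfolding z(2) by (intro cl z True)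
    from insert.IH[of u K, OF this insert.prems(2) BV] show ?thesis using sub by blast
  next
    case False
    have "\<exists>d>0. \<forall>y\<in>?H. d \<le> \<nu> (\<lambda>k. b k - y k)"
    proof (rule ccontr)
      assume "\<not> ?thesis"
      then have neg: "\<exists>y\<in>?H. \<nu> (\<lambda>k. b k - y k) < d" if "0 < d" for d
        using that by (auto simp: not_le)
      have "\<forall>n. \<exists>y. y \<in> ?H \<and> \<nu> (\<lambda>k. b k - y k) < 1 / (real n + 1)"
        using neg by (auto simp: Bex_def)
      from choice[OF this] obtain v where v: "\<And>n. v n \<in> ?H" "\<And>n. \<nu> (\<lambda>k. b k - v n k) < 1 / (real n + 1)" by blast
      have vV: "v n \<in> V" for n using v(1) HV by blast
      have "\<nu> (v n) \<le> \<nu> b + 1" for n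
      proof -
        have "\<nu> (\<lambda>k. b k - v n k) < 1 / (real n + 1)" by (rule v)
        also have "\<dots> \<le> 1" by simp
        finally show ?thesis using normed_fspace_diff_le[OF V norm bV vV, of n] by linarith
      qed
      from insert.IH[of v "\<nu> b + 1", OF v(1) this BV] obtain y where y: "y \<in> ?H" "((\<lambda>n. \<nu> (\<lambda>k. v n k - y k)) \<longlongrightarrow> 0) U" by blast
      have yV: "y \<in> V" using y(1) HV by blast
      have "(\<lambda>n. 1 / (real n + 1)) \<longlonglongrightarrow> 0"
        using LIMSEQ_inverse_real_of_nat by (simp add: inverse_eq_divide add.commute)
      then have "((\<lambda>n. 1 / (real n + 1)) \<longlongrightarrow> 0) U"
        using U by (auto simp: ultra_def intro: tendsto_mono)
      from tendsto_add[OF this y(2)] have lim: "((\<lambda>n. 1 / (real n + 1) + \<nu> (\<lambda>k. v n k - y k)) \<longlongrightarrow> 0) U" by simp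
      have "\<nu> (\<lambda>k. b k - y k) \<le> 1 / (real n + 1) + \<nu> (\<lambda>k. v n k - y k)" for n
        using normed_fspaceD(4)[OF norm function_subspace_diff[OF V bV vV[of n]] function_subspace_diff[OF V vV[of n] yV]] v(2)[of n]
        by simp
      then have "\<nu> (\<lambda>k. b k - y k) \<le> 0"
        using U by (intro tendsto_lowerbound[OF lim]) (auto simp: ultra_def)
      then have "\<nu> (\<lambda>k. b k - y k) = 0"
        using normed_fspaceD(1)[OF norm function_subspace_diff[OF V bV yV]] by simp
      then have "(\<lambda>k. b k - y k) = (\<lambda>k. 0)"
        using normed_fspaceD(2)[OF norm function_subspace_diff[OF V bV yV]] by simp
      then have "b k - y k = 0" for k by (rule fun_cong)
      then have "b = y" by auto
      then show False using y(1) False by simp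
    qed
    then obtain d where d: "0 < d" "\<And>y. y \<in> ?H \<Longrightarrow> d \<le> \<nu> (\<lambda>k. b k - y k)" by blast
    have c_le: "norm (c n) \<le> K / d" for n
    proof (cases "c n = 0")
      case True
      have "0 \<le> K" using normed_fspaceD(1)[OF norm, of "u n"] insert.prems(2)[of n]
          insert.prems(1)[of n] nspan_fspace_sub[OF V, of "insert b B"] insert.prems(3) by force
      then show ?thesis using True d by simp
    next
      case False
      define y where "y = (\<lambda>k. (- inverse (c n)) * z n k)"
      have y: "y \<in> ?H" unfolding y_def by (intro cl z)
      have "u n = (\<lambda>k. c n * (b k - y k))" unfolding z(2) y_def using False by (auto simp: algebra_simps)
      then have "\<nu> (u n) = norm (c n) * \<nu> (\<lambda>k. b k - y k)"
        using normed_fspaceD(3)[OF norm function_subspace_diff[OF V bV], of y "c n"] y HV by auto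
      moreover have "norm (c n) * d \<le> norm (c n) * \<nu> (\<lambda>k. b k - y k)"
        using d(2)[OF y] by (intro mult_left_mono) auto
      ultimately have "norm (c n) * d \<le> K" using insert.prems(2)[of n] by linarith
      then show ?thesis using d(1) by (simp add: pos_le_divide_eq)
    qed
    then have "bounded (range c)" by (intro boundedI[of _ "K / d"]) auto
    from ultra_limit[OF U this] obtain c0 where c0: "(c \<longlongrightarrow> c0) U" by blast
    have "\<nu> (z n) \<le> K + K / d * \<nu> b" for n
    proof -
      have zV: "z n \<in> V" using z(1) HV by blast
      have cbV: "(\<lambda>k. (- c n) * b k) \<in> V" by (rule function_subspaceD(3)[OF V bV])
      have uV: "u n \<in> V" using insert.prems(1)[of n] nspan_fspace_sub[OF V, of "insert b B"] bV BV by auto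
      have "z n = (\<lambda>k. u n k + (- c n) * b k)" unfolding z(2) by simp
      then have "\<nu> (z n) \<le> \<nu> (u n) + \<nu> (\<lambda>k. (- c n) * b k)" using normed_fspaceD(4)[OF norm uV cbV] by simp
      also have "\<nu> (\<lambda>k. (- c n) * b k) = norm (c n) * \<nu> b" using normed_fspaceD(3)[OF norm bV, of "- c n"] by simp
      also have "\<dots> \<le> K / d * \<nu> b" using c_le normed_fspaceD(1)[OF norm bV] by (intro mult_right_mono) auto
      finally show ?thesis using insert.prems(2)[of n] by linarith
    qed
    from insert.IH[of z "K + K / d * \<nu> b", OF z(1) this BV] obtain y where y: "y \<in> ?H" "((\<lambda>n. \<nu> (\<lambda>k. z n k - y k)) \<longlongrightarrow> 0) U" by blast
    have yV: "y \<in> V" using y(1) HV by blast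
    define x where "x = (\<lambda>k. c0 * b k + y k)"
    have x: "x \<in> nspan (fspace V \<nu>) (insert b B)"
      unfolding x_def using sub y(1) bH by (intro cl) auto
    have le: "\<nu> (\<lambda>k. u n k - x k) \<le> norm (c n - c0) * \<nu> b + \<nu> (\<lambda>k. z n k - y k)" for n
    proof -
      have zV: "z n \<in> V" using z(1) HV by blast
      have cbV: "(\<lambda>k. (c n - c0) * b k) \<in> V" by (rule function_subspaceD(3)[OF V bV])
      have "(\<lambda>k. u n k - x k) = (\<lambda>k. (c n - c0) * b k + (z n k - y k))"
        unfolding z(2) x_def by (auto simp: algebra_simps)
      then show ?thesis
        using normed_fspaceD(4)[OF norm cbV function_subspace_diff[OF V zV yV]] normed_fspaceD(3)[OF norm bV, of "c n - c0"] by simp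
    qed
    have "((\<lambda>n. norm (c n - c0) * \<nu> b + \<nu> (\<lambda>k. z n k - y k)) \<longlongrightarrow> 0 * \<nu> b + 0) U"
      using c0 y(2) by (intro tendsto_add tendsto_mult tendsto_const) (simp_all add: tendsto_norm_zero_iff LIM_zero)
    then have lim: "((\<lambda>n. norm (c n - c0) * \<nu> b + \<nu> (\<lambda>k. z n k - y k)) \<longlongrightarrow> 0) U" by simp
    have nn: "0 \<le> \<nu> (\<lambda>k. u n k - x k)" for n
      using insert.prems(1)[of n] x nspan_fspace_sub[OF V insert.prems(3)] by (intro normed_fspaceD(1)[OF norm] function_subspace_diff[OF V]) auto
    have "((\<lambda>n. \<nu> (\<lambda>k. u n k - x k)) \<longlongrightarrow> 0) U"
      by (rule tendsto_sandwich[OF _ _ tendsto_const lim]) (auto intro!: always_eventually nn le)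
    then show ?thesis using x by blast
  qed
qed

text \<open>The norms \<open>N (T n y)\<close> converge to \<open>\<nu> y\<close> for each
  \<open>y\<close> separately. They are uniformly Lipschitz, and the unit sphere of a
  finite-dimensional \<open>E\<close> is compact, so the convergence is uniform there and some
  \<open>T n\<close> is almost isometric on \<open>E\<close>.\<close>

lemma finitely_representable_ultralimit:
  fixes \<nu> :: "(nat \<Rightarrow> 'k::{real_normed_field, euclidean_space}) \<Rightarrow> real"
  assumes U: "ultra U"
    and V: "function_subspace V" and norm: "is_norm (fspace V \<nu>)"
    and S: "function_subspace S" and N: "is_norm (fspace S N)"
    and T: "\<And>n. linear_on_nspace V (fspace V \<nu>) (fspace S N) (T n)"
    and C: "\<And>n y. y \<in> V \<Longrightarrow> N (T n y) \<le> C * \<nu> y"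
    and lim: "\<And>y. y \<in> V \<Longrightarrow> ((\<lambda>n. N (T n y)) \<longlongrightarrow> \<nu> y) U"
  shows "finitely_representable (fspace V \<nu>) (fspace S N)"
  unfolding finitely_representable_def
proof (intro allI impI)
  fix E :: "(nat \<Rightarrow> 'k) set" and \<epsilon> :: real
  assume "finite_dim_subspace (fspace V \<nu>) E" and \<epsilon>: "0 < \<epsilon>"
  then obtain B where B: "finite B" "B \<subseteq> V" and E: "E = nspan (fspace V \<nu>) B"
    by (auto simp: finite_dim_subspace_def)
  have m: "Module.module scalar_ring (fspace V \<nu>)" using V by (simp add: module_fspace_iff)
  have EV: "E \<subseteq> V" unfolding E by (rule nspan_fspace_sub[OF V B(2)])
  \<comment> \<open>Small enough for
    \<open>(1 + \<delta>) / (1 - \<delta>) < 1 + \<epsilon>\<close>.\<close>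
  define \<delta> where "\<delta> = min (1/2) (\<epsilon> / 8)"
  have \<delta>: "0 < \<delta>" "\<delta> \<le> 1/2" "\<delta> \<le> \<epsilon> / 8" using \<epsilon> by (auto simp: \<delta>_def)
  have TS: "T n y \<in> S" "T n (\<lambda>k. y k + z k) = (\<lambda>k. T n y k + T n z k)" "T n (\<lambda>k. c * y k) = (\<lambda>k. c * T n y k)"
    if "y \<in> V" "z \<in> V" for n y z c
    using T[of n] that by (auto simp: linear_on_nspace_def)
  have Tdiff: "\<bar>N (T n y) - N (T n z)\<bar> \<le> C * \<nu> (\<lambda>k. y k - z k)" if "y \<in> V" "z \<in> V" for n y z
  proof -
    have "T n (\<lambda>k. y k + (-1) * z k) = (\<lambda>k. T n y k + (-1) * T n z k)"
      using TS(2)[of y "\<lambda>k. (-1) * z k" n] TS(3)[OF that(2,2), of n "-1"] function_subspaceD(3)[OF V that(2), of "-1"] that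
      by simp
    then have "T n (\<lambda>k. y k - z k) = (\<lambda>k. T n y k - T n z k)" by simp
    then show ?thesis
      using normed_fspace_diff_le[OF S N TS(1)[OF that(1,1)] TS(1)[OF that(2,2)], of n n]
        C[OF function_subspace_diff[OF V that], of n] by simp
  qed
  have "\<exists>n. \<forall>y\<in>E. (1 - \<delta>) * \<nu> y \<le> N (T n y) \<and> N (T n y) \<le> (1 + \<delta>) * \<nu> y"
  proof (rule ccontr)
    assume "\<not> ?thesis"
    then have "\<exists>y\<in>E. \<delta> * \<nu> y < \<bar>N (T n y) - \<nu> y\<bar>" for n
      by (simp add: not_le abs_if algebra_simps) (smt (verit))
    then obtain y where y: "\<And>n. y n \<in> E" "\<And>n. \<delta> * \<nu> (y n) < \<bar>N (T n (y n)) - \<nu> (y n)\<bar>" by metis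
    have yV: "y n \<in> V" for n using y(1) EV by blast
    have y0: "0 < \<nu> (y n)" for n
    proof (rule ccontr)
      assume "\<not> 0 < \<nu> (y n)"
      then have "\<nu> (y n) = 0" using normed_fspaceD(1)[OF norm yV, of n] by simp
      moreover have "N (T n (y n)) = 0"
        using C[OF yV, of n n] normed_fspaceD(1)[OF N TS(1)[OF yV yV], of n n] calculation by simp
      ultimately show False using y(2)[of n] by simp
    qed
    define u where "u = (\<lambda>n k. of_real (1 / \<nu> (y n)) * y n k)"
    have uE: "u n \<in> E" for n
      using nspan_closed(2)[OF m y(1)[of n, unfolded E], of "of_real (1 / \<nu> (y n))"] unfolding u_def E fspace_simps .
    have uV: "u n \<in> V" for n using uE EV by blast
    have "\<nu> (u n) = norm (of_real (1 / \<nu> (y n)) :: 'k) * \<nu> (y n)" for n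
      unfolding u_def by (rule normed_fspaceD(3)[OF norm yV])
    then have u1: "\<nu> (u n) = 1" for n using y0[of n] by (simp add: norm_divide)
    have "N (T n (u n)) = norm (of_real (1 / \<nu> (y n)) :: 'k) * N (T n (y n))" for n
      unfolding u_def TS(3)[OF yV[of n] yV[of n]] by (rule normed_fspaceD(3)[OF N TS(1)[OF yV[of n] yV[of n]]])
    then have Tu: "N (T n (u n)) = N (T n (y n)) / \<nu> (y n)" for n using y0[of n] by (simp add: norm_divide)
    have big: "\<delta> < \<bar>N (T n (u n)) - 1\<bar>" for n
    proof -
      have "N (T n (u n)) - 1 = (N (T n (y n)) - \<nu> (y n)) / \<nu> (y n)"
        unfolding Tu using y0[of n] by (simp add: diff_divide_distrib)
      then have "\<bar>N (T n (u n)) - 1\<bar> = \<bar>N (T n (y n)) - \<nu> (y n)\<bar> / \<nu> (y n)" using y0[of n] by simp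
      then show ?thesis using y(2)[of n] y0[of n] by (simp add: pos_less_divide_eq)
    qed
    \<comment> \<open>The limit \<open>x\<close> of the bad unit vectors reduces their failure to
      the one vector \<open>x\<close>, at which convergence is assumed.\<close>
    obtain x where x: "x \<in> E" "((\<lambda>n. \<nu> (\<lambda>k. u n k - x k)) \<longlongrightarrow> 0) U"
      using ultra_limit_in_span[OF U V norm B, of u 1] uE u1 unfolding E by auto
    have xV: "x \<in> V" using x EV by blast
    have "((\<lambda>n. C * \<nu> (\<lambda>k. u n k - x k)) \<longlongrightarrow> 0) U" by (rule tendsto_mult_right_zero[OF x(2)])
    moreover have "((\<lambda>n. \<bar>N (T n x) - \<nu> x\<bar>) \<longlongrightarrow> 0) U"
      using lim[OF xV] by (simp add: LIM_zero tendsto_rabs_zero)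
    ultimately have "((\<lambda>n. C * \<nu> (\<lambda>k. u n k - x k) + \<bar>N (T n x) - \<nu> x\<bar> + \<nu> (\<lambda>k. u n k - x k)) \<longlongrightarrow> 0 + 0 + 0) U"
      using x(2) by (intro tendsto_add)
    then have "((\<lambda>n. C * \<nu> (\<lambda>k. u n k - x k) + \<bar>N (T n x) - \<nu> x\<bar> + \<nu> (\<lambda>k. u n k - x k)) \<longlongrightarrow> 0) U" by simp
    from order_tendstoD(2)[OF this \<delta>(1)]
    have "\<forall>\<^sub>F n in U. C * \<nu> (\<lambda>k. u n k - x k) + \<bar>N (T n x) - \<nu> x\<bar> + \<nu> (\<lambda>k. u n k - x k) < \<delta>" .
    moreover have "U \<noteq> bot" using U by (simp add: ultra_def)
    ultimately obtain n where n: "C * \<nu> (\<lambda>k. u n k - x k) + \<bar>N (T n x) - \<nu> x\<bar> + \<nu> (\<lambda>k. u n k - x k) < \<delta>"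
      using eventually_happens by blast
    have "\<bar>N (T n (u n)) - 1\<bar> \<le> \<bar>N (T n (u n)) - N (T n x)\<bar> + \<bar>N (T n x) - \<nu> x\<bar> + \<bar>\<nu> (u n) - \<nu> x\<bar>"
      unfolding u1 by linarith
    then show False
      using big[of n] n Tdiff[OF uV xV, of n n] normed_fspace_diff_le[OF V norm uV xV, of n] by linarith
  qed
  then obtain n where n: "\<And>y. y \<in> E \<Longrightarrow> (1 - \<delta>) * \<nu> y \<le> N (T n y)" "\<And>y. y \<in> E \<Longrightarrow> N (T n y) \<le> (1 + \<delta>) * \<nu> y"
    by blast
  have "linear_on_nspace E (fspace V \<nu>) (fspace S N) (T n)"
    using T[of n] EV by (rule linear_on_nspace_subset)
  moreover have "(1 + \<delta>) / (1 - \<delta>) < 1 + \<epsilon>"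
  proof -
    have "0 < \<epsilon> - 2 * \<delta> - \<delta> * \<epsilon>"
    proof -
      have "\<delta> * \<epsilon> \<le> 1/2 * \<epsilon>" using \<delta> \<epsilon> by (intro mult_right_mono) auto
      then show ?thesis using \<delta> \<epsilon> by linarith
    qed
    then show ?thesis using \<delta> by (simp add: pos_divide_less_eq algebra_simps)
  qed
  ultimately show "\<exists>T a b. linear_on_nspace E (fspace V \<nu>) (fspace S N) T \<and> 0 < a \<and> b / a < 1 + \<epsilon> \<and>
      (\<forall>y\<in>E. a * vnorm (fspace V \<nu>) y \<le> vnorm (fspace S N) (T y) \<and> vnorm (fspace S N) (T y) \<le> b * vnorm (fspace V \<nu>) y)"
    using n \<delta> by (intro exI[of _ "T n"] exI[of _ "1 - \<delta>"] exI[of _ "1 + \<delta>"]) auto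
qed

section \<open>Copies of a space in another type\<close>

definition transport :: "('v \<Rightarrow> 'u) \<Rightarrow> ('k::real_normed_field, 'v) nspace \<Rightarrow> ('k, 'u) nspace" where
  "transport e Y = \<lparr>carrier = e ` carrier Y, mult = (\<lambda>a b. a), one = e \<zero>\<^bsub>Y\<^esub>, zero = e \<zero>\<^bsub>Y\<^esub>,
     add = (\<lambda>a b. e (inv_into UNIV e a \<oplus>\<^bsub>Y\<^esub> inv_into UNIV e b)), smult = (\<lambda>c a. e (c \<odot>\<^bsub>Y\<^esub> inv_into UNIV e a)),
     vnorm = (\<lambda>a. vnorm Y (inv_into UNIV e a))\<rparr>"

text \<open>Superreflexivity speaks of spaces inside the type \<open>'v\<close>, so \<open>Y\<close>
  is moved there along \<open>e\<close>. The copy \<open>Z\<close> is finitely representable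
  wherever \<open>Y\<close> is, and its dual and bidual are those of \<open>Y\<close> up to
  composition with \<open>e\<close>.\<close>

lemma reflexive_if_superreflexive:
  fixes X :: "('k::{real_normed_field, euclidean_space}, 'u) nspace" and Y :: "('k, 'w) nspace" and e :: "'w \<Rightarrow> 'v"
  assumes sr: "superreflexive_banach TYPE('v) X" and e: "inj e"
    and Y: "banach_nspace Y" and fr: "finitely_representable Y X"
  shows "reflexive_nspace Y"
proof -
  have mY: "Module.module scalar_ring Y" and nY: "is_norm Y" and cY: "complete_nspace Y"
    using Y by (auto simp: banach_nspace_def)
  interpret Y: Module.module scalar_ring Y by (rule mY)
  define Z where "Z = transport e Y"
  have ie: "inv_into UNIV e (e x) = x" for x using e by simp
  have Z: "carrier Z = e ` carrier Y" "\<zero>\<^bsub>Z\<^esub> = e \<zero>\<^bsub>Y\<^esub>" "e x \<oplus>\<^bsub>Z\<^esub> e y = e (x \<oplus>\<^bsub>Y\<^esub> y)" "c \<odot>\<^bsub>Z\<^esub> e x = e (c \<odot>\<^bsub>Y\<^esub> x)"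
    "vnorm Z (e x) = vnorm Y x" for x y c
    by (simp_all add: Z_def transport_def ie)
  have sY: "c \<odot>\<^bsub>Y\<^esub> x \<in> carrier Y" if "x \<in> carrier Y" for c x using Y.smult_closed[of c x] that by simp
  have mZ: "Module.module scalar_ring Z"
  proof (rule moduleI[OF cring_scalar_ring])
    show "abelian_group Z"
    proof (rule abelian_groupI)
      fix a assume "a \<in> carrier Z"
      then obtain x where x: "a = e x" "x \<in> carrier Y" by (auto simp: Z)
      then show "\<exists>b\<in>carrier Z. b \<oplus>\<^bsub>Z\<^esub> a = \<zero>\<^bsub>Z\<^esub>"
        by (intro bexI[of _ "e (\<ominus>\<^bsub>Y\<^esub> x)"]) (auto simp: Z Y.M.l_neg)
    qed (auto simp: Z Y.M.a_ac)
  qed (use Y.smult_l_distr Y.smult_r_distr Y.smult_assoc1 Y.smult_one in \<open>auto simp: Z sY\<close>)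
  have minus: "e x \<ominus>\<^bsub>Z\<^esub> e y = e (x \<ominus>\<^bsub>Y\<^esub> y)" if "y \<in> carrier Y" for x y
    using nspace_minus_eq[OF mZ, of "e y" "e x"] nspace_minus_eq[OF mY that, of x] that by (simp add: Z)
  have nZ: "is_norm Z"
    using nY unfolding is_norm_def is_quasinorm_def Z(1) by (simp add: Z inj_eq[OF e])
  have cZ: "complete_nspace Z"
    unfolding complete_nspace_def
  proof (intro allI impI, elim conjE)
    fix u :: "nat \<Rightarrow> 'v" assume u: "\<forall>i. u i \<in> carrier Z" and cauchy: "\<forall>\<epsilon>>0. \<exists>M. \<forall>i\<ge>M. \<forall>j\<ge>M. vnorm Z (u i \<ominus>\<^bsub>Z\<^esub> u j) < \<epsilon>"
    then have "\<exists>x. x \<in> carrier Y \<and> u i = e x" for i by (auto simp: Z)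
    then obtain v where v: "\<And>i. v i \<in> carrier Y" "\<And>i. u i = e (v i)" by metis
    have "\<forall>\<epsilon>>0. \<exists>M. \<forall>i\<ge>M. \<forall>j\<ge>M. vnorm Y (v i \<ominus>\<^bsub>Y\<^esub> v j) < \<epsilon>"
      using cauchy by (simp add: v minus Z)
    then obtain x where x: "x \<in> carrier Y" "(\<lambda>i. vnorm Y (v i \<ominus>\<^bsub>Y\<^esub> x)) \<longlonglongrightarrow> 0"
      using cY v(1) unfolding complete_nspace_def by blast
    then show "\<exists>x\<in>carrier Z. (\<lambda>i. vnorm Z (u i \<ominus>\<^bsub>Z\<^esub> x)) \<longlonglongrightarrow> 0"
      by (intro bexI[of _ "e x"]) (auto simp: v minus Z)
  qed
  have frZ: "finitely_representable Z X"
    unfolding finitely_representable_def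
  proof (intro allI impI)
    fix E' \<epsilon> assume "finite_dim_subspace Z E'" and \<epsilon>: "(0::real) < \<epsilon>"
    then obtain B' where B': "finite B'" "B' \<subseteq> e ` carrier Y" and E': "E' = nspan Z B'"
      by (auto simp: finite_dim_subspace_def Z)
    then obtain B where B: "finite B" "B \<subseteq> carrier Y" "B' = e ` B"
      by (meson finite_subset_image)
    define E where "E = nspan Y B"
    have E: "E \<subseteq> carrier Y" unfolding E_def by (rule nspan_closed(3)[OF mY B(2)])
    have "submodule (e ` E) scalar_ring Z"
    proof (rule module.submoduleI[OF mZ])
      show "e ` E \<subseteq> carrier Z" using E by (auto simp: Z)
      show "\<zero>\<^bsub>Z\<^esub> \<in> e ` E" using nspan_closed(4)[OF mY] by (simp add: Z E_def)
      show "a \<oplus>\<^bsub>Z\<^esub> b \<in> e ` E" if "a \<in> e ` E" "b \<in> e ` E" for a b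
        using that nspan_closed(1)[OF mY] by (auto simp: Z E_def)
      show sm: "c \<odot>\<^bsub>Z\<^esub> a \<in> e ` E" if "a \<in> e ` E" for c a
        using that nspan_closed(2)[OF mY] by (auto simp: Z E_def)
      show "\<ominus>\<^bsub>Z\<^esub> a \<in> e ` E" if "a \<in> e ` E" for a
        using sm[OF that, of "-1"] nspace_neg_eq[OF mZ, of a] that E by (auto simp: Z(1))
    qed
    \<comment> \<open>One inclusion between the two spans is enough, since embeddings restrict to
      smaller subspaces.\<close>
    then have E'E: "E' \<subseteq> e ` E"
      unfolding E' by (rule nspan_least) (use nspan_superset[of B Y] in \<open>auto simp: B(3) E_def\<close>)
    have "finite_dim_subspace Y E" unfolding finite_dim_subspace_def E_def using B by blast
    then obtain T a b where T: "linear_on_nspace E Y X T" "0 < a" "b / a < 1 + \<epsilon>"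
      "\<forall>y\<in>E. a * vnorm Y y \<le> vnorm X (T y) \<and> vnorm X (T y) \<le> b * vnorm Y y"
      using fr \<epsilon> unfolding finitely_representable_def by blast
    have "linear_on_nspace (e ` E) Z X (\<lambda>x. T (inv_into UNIV e x))"
      using T(1) unfolding linear_on_nspace_def by (simp add: Z ie)
    then have "linear_on_nspace E' Z X (\<lambda>x. T (inv_into UNIV e x))"
      using E'E by (rule linear_on_nspace_subset)
    moreover have "\<forall>y\<in>e ` E. a * vnorm Z y \<le> vnorm X (T (inv_into UNIV e y)) \<and> vnorm X (T (inv_into UNIV e y)) \<le> b * vnorm Z y"
      using T(4) by (simp add: Z ie)
    ultimately show "\<exists>T a b. linear_on_nspace E' Z X T \<and> 0 < a \<and> b / a < 1 + \<epsilon> \<and>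
        (\<forall>y\<in>E'. a * vnorm Z y \<le> vnorm X (T y) \<and> vnorm X (T y) \<le> b * vnorm Z y)"
      using T(2,3) E'E by blast
  qed
  have "reflexive_nspace Z"
    using sr mZ nZ cZ frZ unfolding superreflexive_banach_def banach_nspace_def by blast
  interpret nY: normed_nspace Y by (rule normed_nspace.intro[OF mY nY])
  interpret nZ: normed_nspace Z by (rule normed_nspace.intro[OF mZ nZ])
  have pull: "(\<lambda>y. \<psi> (e y)) \<in> nY.dual" "nY.dnorm (\<lambda>y. \<psi> (e y)) = nZ.dnorm \<psi>" if "\<psi> \<in> nZ.dual" for \<psi>
  proof -
    have *: "\<And>y. y \<notin> carrier Z \<Longrightarrow> \<psi> y = 0" "\<exists>C. \<forall>y\<in>carrier Z. norm (\<psi> y) \<le> C * vnorm Z y"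
      using that unfolding nZ.dual_iff by blast+
    show "(\<lambda>y. \<psi> (e y)) \<in> nY.dual"
      unfolding nY.dual_iff
    proof (intro conjI allI impI ballI)
      show "\<psi> (e y) = 0" if "y \<notin> carrier Y" for y
        using *(1)[of "e y"] that by (auto simp: Z(1) inj_image_mem_iff[OF e])
      show "\<psi> (e (y \<oplus>\<^bsub>Y\<^esub> z)) = \<psi> (e y) + \<psi> (e z)" if "y \<in> carrier Y" "z \<in> carrier Y" for y z
        using nZ.dual_add[OF \<open>\<psi> \<in> nZ.dual\<close>, of "e y" "e z"] that by (simp add: Z)
      show "\<psi> (e (c \<odot>\<^bsub>Y\<^esub> y)) = c * \<psi> (e y)" if "y \<in> carrier Y" for c y
        using nZ.dual_smult[OF \<open>\<psi> \<in> nZ.dual\<close>, of "e y" c] that by (simp add: Z)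
      show "\<exists>C. \<forall>y\<in>carrier Y. norm (\<psi> (e y)) \<le> C * vnorm Y y" using *(2) by (simp add: Z)
    qed
    have "{norm (\<psi> y) | y. y \<in> carrier Z \<and> vnorm Z y \<le> 1} = {norm (\<psi> (e y)) | y. y \<in> carrier Y \<and> vnorm Y y \<le> 1}"
      by (auto simp: Z)
    then show "nY.dnorm (\<lambda>y. \<psi> (e y)) = nZ.dnorm \<psi>" unfolding nY.dnorm_eq nZ.dnorm_eq by simp
  qed
  have push: "\<exists>\<psi>\<in>nZ.dual. \<phi> = (\<lambda>y. \<psi> (e y))" if "\<phi> \<in> nY.dual" for \<phi>
  proof (intro bexI)
    have *: "\<And>y. y \<notin> carrier Y \<Longrightarrow> \<phi> y = 0" "\<exists>C. \<forall>y\<in>carrier Y. norm (\<phi> y) \<le> C * vnorm Y y"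
      using that unfolding nY.dual_iff by blast+
    show "\<phi> = (\<lambda>y. (\<lambda>a. if a \<in> carrier Z then \<phi> (inv_into UNIV e a) else 0) (e y))"
      using *(1) by (auto simp: Z(1) ie inj_image_mem_iff[OF e] fun_eq_iff)
    show "(\<lambda>a. if a \<in> carrier Z then \<phi> (inv_into UNIV e a) else 0) \<in> nZ.dual"
      unfolding nZ.dual_iff using nY.dual_add[OF that] nY.dual_smult[OF that] *(2)
      by (auto simp: Z ie sY)
  qed
  show ?thesis
    unfolding reflexive_nspace_def
  proof
    fix \<Phi> assume \<Phi>: "\<Phi> \<in> carrier (dual_nspace (dual_nspace Y))"
    define \<Psi> where "\<Psi> = (\<lambda>\<psi>. if \<psi> \<in> nZ.dual then \<Phi> (\<lambda>y. \<psi> (e y)) else 0)"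
    have dual_ops: "x \<oplus>\<^bsub>dual_nspace Z\<^esub> y = (\<lambda>a. x a + y a)" "c \<odot>\<^bsub>dual_nspace Z\<^esub> x = (\<lambda>a. c * x a)" for x y c
      by (simp_all add: dual_nspace_def)
    have dual_opsY: "x \<oplus>\<^bsub>dual_nspace Y\<^esub> y = (\<lambda>a. x a + y a)" "c \<odot>\<^bsub>dual_nspace Y\<^esub> x = (\<lambda>a. c * x a)" for x y c
      by (simp_all add: dual_nspace_def)
    have dd: "\<Phi> \<in> carrier (dual_nspace W) \<longleftrightarrow>
          (\<forall>y. y \<notin> carrier W \<longrightarrow> \<Phi> y = 0) \<and>
          (\<forall>y\<in>carrier W. \<forall>z\<in>carrier W. \<Phi> (y \<oplus>\<^bsub>W\<^esub> z) = \<Phi> y + \<Phi> z) \<and>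
          (\<forall>c. \<forall>y\<in>carrier W. \<Phi> (c \<odot>\<^bsub>W\<^esub> y) = c * \<Phi> y) \<and>
          (\<exists>C. \<forall>y\<in>carrier W. norm (\<Phi> y) \<le> C * vnorm W y)"
      for \<Phi> and W :: "('k, 'x) nspace" by (simp add: dual_nspace_def)
    note \<Phi>' = \<Phi>[unfolded dd[of _ "dual_nspace Y"] dual_opsY]
    obtain C where C: "\<And>\<phi>. \<phi> \<in> nY.dual \<Longrightarrow> norm (\<Phi> \<phi>) \<le> C * nY.dnorm \<phi>" using \<Phi>' by blast
    have addZ: "(\<lambda>a. x a + y a) \<in> nZ.dual" if "x \<in> nZ.dual" "y \<in> nZ.dual" for x y
      using nZ.dual_linear_combination[of 2 "\<lambda>i. if i = 0 then x else y" "\<lambda>_. 1"] that by (simp add: numeral_2_eq_2)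
    have smZ: "(\<lambda>a. c * x a) \<in> nZ.dual" if "x \<in> nZ.dual" for x c
      using nZ.dual_linear_combination[of 1 "\<lambda>i. x" "\<lambda>_. c"] that by simp
    have "\<Psi> \<in> carrier (dual_nspace (dual_nspace Z))"
      unfolding dd[of _ "dual_nspace Z"] dual_ops
    proof (intro conjI allI impI ballI)
      show "\<Psi> y = 0" if "y \<notin> nZ.dual" for y using that by (simp add: \<Psi>_def)
      show "\<Psi> (\<lambda>a. y a + z a) = \<Psi> y + \<Psi> z" if "y \<in> nZ.dual" "z \<in> nZ.dual" for y z
        using that addZ[OF that] \<Phi>' pull(1) by (simp add: \<Psi>_def)
      show "\<Psi> (\<lambda>a. c * y a) = c * \<Psi> y" if "y \<in> nZ.dual" for c y
        using that smZ[OF that] \<Phi>' pull(1) by (simp add: \<Psi>_def)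
      show "\<exists>C. \<forall>y\<in>nZ.dual. norm (\<Psi> y) \<le> C * nZ.dnorm y"
      proof (intro exI[of _ C] ballI)
        fix \<psi> assume d: "\<psi> \<in> nZ.dual"
        have "norm (\<Phi> (\<lambda>y. \<psi> (e y))) \<le> C * nY.dnorm (\<lambda>y. \<psi> (e y))" by (rule C[OF pull(1)[OF d]])
        then show "norm (\<Psi> \<psi>) \<le> C * nZ.dnorm \<psi>" using pull(2)[OF d] d by (simp add: \<Psi>_def)
      qed
    qed
    then obtain a where a: "a \<in> carrier Z" "\<And>\<psi>. \<psi> \<in> nZ.dual \<Longrightarrow> \<Psi> \<psi> = \<psi> a"
      using \<open>reflexive_nspace Z\<close> unfolding reflexive_nspace_def by blast
    then obtain y where y: "a = e y" "y \<in> carrier Y" by (auto simp: Z)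
    show "\<exists>y\<in>carrier Y. \<forall>\<phi>\<in>nY.dual. \<Phi> \<phi> = \<phi> y"
    proof (intro bexI[OF _ y(2)] ballI)
      fix \<phi> assume "\<phi> \<in> nY.dual"
      then obtain \<psi> where "\<psi> \<in> nZ.dual" "\<phi> = (\<lambda>y. \<psi> (e y))" using push by blast
      then show "\<Phi> \<phi> = \<phi> y" using a(2)[of \<psi>] y by (simp add: \<Psi>_def)
    qed
  qed
qed

text \<open>A common frame for three complete spaces of null sequences: \<open>c_0\<close>,
  \<open>l_1\<close> and the renormed Lorentz space. The norm is the supremum of the seminorms
  \<open>p n\<close>; \<open>p_coord\<close> makes the coordinates continuous, and
  \<open>p_limit\<close> is the Fatou property from which completeness follows.\<close>

locale seminorm_family =
  fixes p :: "nat \<Rightarrow> (nat \<Rightarrow> 'k::{real_normed_field, euclidean_space}) \<Rightarrow> real" and c :: real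
  assumes p_nonneg: "0 \<le> p n f"
    and p_scale: "p n (\<lambda>k. a * f k) = norm a * p n f"
    and p_triangle: "p n (\<lambda>k. f k + g k) \<le> p n f + p n g"
    and c_pos: "0 < c" and p_coord: "\<exists>n. c * norm (f k) \<le> p n f"
    and p_limit: "(\<And>k. (\<lambda>i. u i k) \<longlonglongrightarrow> f k) \<Longrightarrow> (\<forall>\<^sub>F i in sequentially. p n (u i) \<le> b) \<Longrightarrow> p n f \<le> b"
begin

definition V :: "(nat \<Rightarrow> 'k) set" where
  "V = {f. f \<longlonglongrightarrow> 0 \<and> bdd_above (range (\<lambda>n. p n f))}"

definition \<mu> :: "(nat \<Rightarrow> 'k) \<Rightarrow> real" where "\<mu> f = (SUP n. p n f)"

lemma VI: "f \<longlonglongrightarrow> 0 \<Longrightarrow> (\<And>n. p n f \<le> b) \<Longrightarrow> f \<in> V"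
  unfolding V_def by (auto intro!: bdd_aboveI)

lemma p_le: "f \<in> V \<Longrightarrow> p n f \<le> \<mu> f"
  unfolding V_def \<mu>_def by (auto intro: cSUP_upper)

lemma mu_le: "(\<And>n. p n f \<le> b) \<Longrightarrow> \<mu> f \<le> b"
  unfolding \<mu>_def by (rule cSUP_least) auto

lemma V_tendsto: "f \<in> V \<Longrightarrow> f \<longlonglongrightarrow> 0"
  by (simp add: V_def)

lemma mu_nonneg: "f \<in> V \<Longrightarrow> 0 \<le> \<mu> f"
  using p_le[of f 0] p_nonneg[of 0 f] by linarith

lemma coord_le:
  assumes "f \<in> V" shows "c * norm (f k) \<le> \<mu> f"
proof -
  obtain n where "c * norm (f k) \<le> p n f" using p_coord by blast
  also have "\<dots> \<le> \<mu> f" by (rule p_le[OF assms])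
  finally show ?thesis .
qed

lemma V_add: "f \<in> V \<Longrightarrow> g \<in> V \<Longrightarrow> (\<lambda>k. f k + g k) \<in> V"
  and mu_triangle: "f \<in> V \<Longrightarrow> g \<in> V \<Longrightarrow> \<mu> (\<lambda>k. f k + g k) \<le> \<mu> f + \<mu> g"
proof -
  assume fg: "f \<in> V" "g \<in> V"
  have *: "p n (\<lambda>k. f k + g k) \<le> \<mu> f + \<mu> g" for n
    using p_triangle[of n f g] p_le[OF fg(1), of n] p_le[OF fg(2), of n] by linarith
  show "(\<lambda>k. f k + g k) \<in> V"
    using tendsto_add[OF V_tendsto[OF fg(1)] V_tendsto[OF fg(2)]] by (intro VI[OF _ *]) simp
  show "\<mu> (\<lambda>k. f k + g k) \<le> \<mu> f + \<mu> g" by (rule mu_le[OF *])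
qed

lemma V_scale:
  assumes "f \<in> V" shows "(\<lambda>k. a * f k) \<in> V" and "\<mu> (\<lambda>k. a * f k) = norm a * \<mu> f"
proof -
  have *: "p n (\<lambda>k. a * f k) \<le> norm a * \<mu> f" for n
    unfolding p_scale by (intro mult_left_mono p_le assms) auto
  show V: "(\<lambda>k. a * f k) \<in> V"
    using tendsto_mult_right_zero[OF V_tendsto[OF assms]] by (intro VI[OF _ *])
  have "norm a * \<mu> f \<le> \<mu> (\<lambda>k. a * f k)"
  proof (cases "a = 0")
    case True
    then show ?thesis using mu_nonneg[OF V] by simp
  next
    case False
    have "\<mu> f \<le> \<mu> (\<lambda>k. a * f k) / norm a"
    proof (rule mu_le)
      fix n
      have "norm a * p n f \<le> \<mu> (\<lambda>k. a * f k)" using p_le[OF V, of n] by (simp only: p_scale)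
      then show "p n f \<le> \<mu> (\<lambda>k. a * f k) / norm a"
        using False by (simp add: pos_le_divide_eq mult.commute)
    qed
    then show ?thesis using False by (simp add: pos_le_divide_eq mult.commute)
  qed
  then show "\<mu> (\<lambda>k. a * f k) = norm a * \<mu> f" using mu_le[OF *] by (intro antisym)
qed

lemma zero_in_V: "(\<lambda>k. 0) \<in> V" and mu_zero: "\<mu> (\<lambda>k. 0) = 0"
proof -
  have 0: "p n (\<lambda>k. 0) = 0" for n using p_scale[of n 0 "\<lambda>k. 0"] by simp
  show "(\<lambda>k. 0) \<in> V" by (rule VI[of _ 0]) (auto simp: 0)
  show "\<mu> (\<lambda>k. 0) = 0" by (simp add: \<mu>_def 0)
qed

lemma subspace_V: "function_subspace V"
  unfolding function_subspace_def using zero_in_V V_add V_scale(1) by blast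

lemma is_norm_mu: "is_norm (fspace V \<mu>)"
proof (rule normed_fspaceI)
  fix f assume f: "f \<in> V" "\<mu> f = 0"
  have "f k = 0" for k using coord_le[OF f(1), of k] c_pos by (simp add: f(2) mult_le_0_iff)
  then show "f = (\<lambda>k. 0)" by auto
qed (use mu_nonneg mu_zero V_scale mu_triangle in auto)

text \<open>The candidate is the coordinatewise limit, and \<open>p_limit\<close> carries the Cauchy
  estimate over to it. That it is a null sequence again comes from the uniform control of all
  coordinates.\<close>

lemma complete_mu: "complete_nspace (fspace V \<mu>)"
  unfolding complete_nspace_def
proof (intro allI impI, elim conjE)
  fix u :: "nat \<Rightarrow> nat \<Rightarrow> 'k"
  assume "\<forall>i. u i \<in> carrier (fspace V \<mu>)"
    and cauchy: "\<forall>e>0. \<exists>M. \<forall>i\<ge>M. \<forall>j\<ge>M. vnorm (fspace V \<mu>) (u i \<ominus>\<^bsub>fspace V \<mu>\<^esub> u j) < e"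
  then have u: "u i \<in> V" for i by simp
  note dV = function_subspace_diff[OF subspace_V]
  have C: "\<exists>M. \<forall>i\<ge>M. \<forall>j\<ge>M. \<mu> (\<lambda>k. u i k - u j k) < e" if "0 < e" for e
    using cauchy that by (simp add: fspace_minus[OF subspace_V u])
  have "Cauchy (\<lambda>i. u i k)" for k
  proof (rule metric_CauchyI)
    fix e :: real assume "0 < e"
    then have "0 < c * e" using c_pos by simp
    then obtain M where M: "\<forall>i\<ge>M. \<forall>j\<ge>M. \<mu> (\<lambda>k. u i k - u j k) < c * e" using C by blast
    show "\<exists>M. \<forall>i\<ge>M. \<forall>j\<ge>M. dist (u i k) (u j k) < e"
    proof (intro exI[of _ M] allI impI)
      fix i j assume "M \<le> i" "M \<le> j"
      then have "c * norm (u i k - u j k) < c * e"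
        using M coord_le[OF dV[OF u[of i] u[of j]], of k] by fastforce
      then show "dist (u i k) (u j k) < e" using c_pos by (simp add: dist_norm)
    qed
  qed
  then have "\<forall>k. \<exists>l. (\<lambda>i. u i k) \<longlonglongrightarrow> l" using Cauchy_convergent convergent_def by blast
  from choice[OF this] obtain f where f: "\<And>k. (\<lambda>i. u i k) \<longlonglongrightarrow> f k" by blast
  have near: "p n (\<lambda>k. u i k - f k) \<le> e" if M: "\<forall>i\<ge>M. \<forall>j\<ge>M. \<mu> (\<lambda>k. u i k - u j k) < e" and "M \<le> i" for M e i n
  proof (rule p_limit)
    show "(\<lambda>j. u i k - u j k) \<longlonglongrightarrow> u i k - f k" for k by (intro tendsto_diff tendsto_const f)
    show "\<forall>\<^sub>F j in sequentially. p n (\<lambda>k. u i k - u j k) \<le> e"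
      unfolding eventually_sequentially
    proof (intro exI[of _ M] allI impI)
      fix j assume "M \<le> j"
      then show "p n (\<lambda>k. u i k - u j k) \<le> e"
        using p_le[OF dV[OF u[of i] u[of j]], of n] M \<open>M \<le> i\<close> by fastforce
    qed
  qed
  have small: "\<exists>M. \<forall>i\<ge>M. \<forall>n. p n (\<lambda>k. u i k - f k) \<le> e" if "0 < e" for e
    using C[OF that] near by blast
  have f0: "f \<longlonglongrightarrow> 0"
  proof (rule tendstoI)
    fix e :: real assume e: "0 < e"
    then have "0 < c * (e / 2)" using c_pos by simp
    then obtain M where M: "\<And>n. p n (\<lambda>k. u M k - f k) \<le> c * (e / 2)" using small by blast
    have "\<forall>\<^sub>F k in sequentially. dist (u M k) 0 < e / 2"
      using tendstoD[OF V_tendsto[OF u[of M]], of "e / 2"] e by simp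
    then show "\<forall>\<^sub>F k in sequentially. dist (f k) 0 < e"
    proof eventually_elim
      fix k assume k: "dist (u M k) 0 < e / 2"
      obtain n where "c * norm (u M k - f k) \<le> p n (\<lambda>k. u M k - f k)" using p_coord[of "\<lambda>k. u M k - f k" k] by blast
      then have "c * norm (u M k - f k) \<le> c * (e / 2)" using M[of n] by linarith
      then have "norm (u M k - f k) \<le> e / 2" using c_pos by simp
      then show "dist (f k) 0 < e" using k norm_triangle_ineq2[of "f k" "u M k"] by (simp add: norm_minus_commute)
    qed
  qed
  have uf: "(\<lambda>k. u i k - f k) \<longlonglongrightarrow> 0" for i
    using tendsto_diff[OF V_tendsto[OF u[of i]] f0] by simp
  obtain M where M: "\<And>i n. M \<le> i \<Longrightarrow> p n (\<lambda>k. u i k - f k) \<le> 1" using small[of 1] by auto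
  have "(\<lambda>k. u M k - f k) \<in> V" by (rule VI[OF uf M]) simp
  from dV[OF u this, of M] have fV: "f \<in> V" by simp
  have "(\<lambda>i. \<mu> (\<lambda>k. u i k - f k)) \<longlonglongrightarrow> 0"
  proof (rule LIMSEQ_I)
    fix e :: real assume "0 < e"
    then obtain M where M: "\<And>i n. M \<le> i \<Longrightarrow> p n (\<lambda>k. u i k - f k) \<le> e / 2" using small[of "e / 2"] by auto
    have "norm (\<mu> (\<lambda>k. u i k - f k) - 0) < e" if "M \<le> i" for i
      using mu_le[OF M[OF that]] mu_nonneg[OF dV[OF u fV], of i] \<open>0 < e\<close> by simp
    then show "\<exists>M. \<forall>i\<ge>M. norm (\<mu> (\<lambda>k. u i k - f k) - 0) < e" by blast
  qed
  then show "\<exists>x\<in>carrier (fspace V \<mu>). (\<lambda>i. vnorm (fspace V \<mu>) (u i \<ominus>\<^bsub>fspace V \<mu>\<^esub> x)) \<longlonglongrightarrow> 0"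
    using fV by (intro bexI[of _ f]) (simp_all add: fspace_minus[OF subspace_V fV])
qed

end

subsection \<open>Uniform copies of finite-dimensional sequence spaces\<close>

text \<open>The limit \<open>\<nu>\<close> of the pulled-back norms is equivalent to
  \<open>\<mu>\<close> and makes \<open>V\<close> finitely representable in \<open>S\<close>, hence
  reflexive. The assignment \<open>\<phi> \<mapsto> lim \<phi> (z n)\<close> along \<open>U\<close>
  belongs to the bidual, so a bounded sequence has a weak limit in \<open>V\<close>. As the norms
  are equivalent, functionals bounded with respect to \<open>\<mu>\<close> may be tested.\<close>

lemma superreflexive_weak_limit:
  fixes e :: "(nat \<Rightarrow> 'k::{real_normed_field, euclidean_space}) \<Rightarrow> 'v" and V S :: "(nat \<Rightarrow> 'k) set"
  assumes sr: "superreflexive_banach TYPE('v) (fspace S N)" and e: "inj e"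
    and V: "function_subspace V" and norm: "is_norm (fspace V \<mu>)" and compl: "complete_nspace (fspace V \<mu>)"
    and T: "\<And>n. linear_on_nspace V (fspace V \<mu>) (fspace S N) (T n)" and C: "0 < C"
    and upper: "\<And>n y. y \<in> V \<Longrightarrow> N (T n y) \<le> C * \<mu> y"
    and lower: "\<And>y. y \<in> V \<Longrightarrow> \<forall>\<^sub>F n in sequentially. \<mu> y \<le> C * N (T n y)"
    and U: "ultra U" and z: "\<And>n. z n \<in> V" "\<And>n. \<mu> (z n) \<le> K"
  shows "\<exists>y\<in>V. \<forall>\<phi>. (\<forall>f\<in>V. \<forall>g\<in>V. \<phi> (\<lambda>k. f k + g k) = \<phi> f + \<phi> g) \<longrightarrow> (\<forall>a. \<forall>f\<in>V. \<phi> (\<lambda>k. a * f k) = a * \<phi> f) \<longrightarrow>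
    (\<exists>D. \<forall>f\<in>V. norm (\<phi> f) \<le> D * \<mu> f) \<longrightarrow> ((\<lambda>n. \<phi> (z n)) \<longlongrightarrow> \<phi> y) U"
proof -
  have Ub: "U \<noteq> bot" and Us: "U \<le> sequentially" using U by (auto simp: ultra_def)
  have S: "function_subspace S" and NS: "is_norm (fspace S N)"
    using sr by (auto simp: superreflexive_banach_def banach_nspace_def module_fspace_iff)
  have TS: "T n y \<in> S" "T n (\<lambda>k. y k + x k) = (\<lambda>k. T n y k + T n x k)" "T n (\<lambda>k. c * y k) = (\<lambda>k. c * T n y k)"
    if "y \<in> V" "x \<in> V" for n y x c
    using T[of n] that by (auto simp: linear_on_nspace_def)
  have "\<exists>l. ((\<lambda>n. N (T n y)) \<longlongrightarrow> l) U" if y: "y \<in> V" for y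
  proof (rule ultra_limit[OF U])
    show "bounded (range (\<lambda>n. N (T n y)))"
      using upper[OF y] normed_fspaceD(1)[OF NS TS(1)[OF y y]] by (intro boundedI[of _ "C * \<mu> y"]) auto
  qed
  then have "\<forall>y. \<exists>l. y \<in> V \<longrightarrow> ((\<lambda>n. N (T n y)) \<longlongrightarrow> l) U" by blast
  from choice[OF this] obtain \<nu> where \<nu>: "\<And>y. y \<in> V \<Longrightarrow> ((\<lambda>n. N (T n y)) \<longlongrightarrow> \<nu> y) U" by blast
  have nu_upper: "\<nu> y \<le> C * \<mu> y" if y: "y \<in> V" for y
    using \<nu>[OF y] upper[OF y] by (intro tendsto_upperbound[OF _ _ Ub]) auto
  have nu_lower: "\<mu> y \<le> C * \<nu> y" if y: "y \<in> V" for y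
  proof (rule tendsto_lowerbound[OF _ _ Ub])
    show "((\<lambda>n. C * N (T n y)) \<longlongrightarrow> C * \<nu> y) U" by (intro tendsto_mult tendsto_const \<nu> y)
    show "\<forall>\<^sub>F n in U. \<mu> y \<le> C * N (T n y)" using lower[OF y] Us by (rule filter_leD[rotated])
  qed
  note normD = normed_fspaceD[OF norm]
  have normnu: "is_norm (fspace V \<nu>)"
  proof (rule normed_fspaceI)
    show nn: "0 \<le> \<nu> f" if "f \<in> V" for f
      using nu_lower[OF that] normD(1)[OF that] C by (smt (verit) mult_pos_neg)
    show "\<nu> (\<lambda>k. 0) = 0"
      using nu_upper[OF function_subspaceD(1)[OF V]] nn[OF function_subspaceD(1)[OF V]]
        normD(2)[OF function_subspaceD(1)[OF V]] by simp
    show "f = (\<lambda>k. 0)" if "f \<in> V" "\<nu> f = 0" for f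
      using nu_lower[OF that(1)] that(2) normD(1,2)[OF that(1)] by simp
    show "\<nu> (\<lambda>k. c * f k) = norm c * \<nu> f" if f: "f \<in> V" for c f
    proof (rule tendsto_unique[OF Ub \<nu>[OF function_subspaceD(3)[OF V f]]])
      have "N (T n (\<lambda>k. c * f k)) = norm c * N (T n f)" for n
        unfolding TS(3)[OF f f] by (rule normed_fspaceD(3)[OF NS TS(1)[OF f f]])
      then show "((\<lambda>n. N (T n (\<lambda>k. c * f k))) \<longlongrightarrow> norm c * \<nu> f) U"
        using tendsto_mult[OF tendsto_const \<nu>[OF f], of "norm c"] by simp
    qed
    show "\<nu> (\<lambda>k. f k + g k) \<le> \<nu> f + \<nu> g" if f: "f \<in> V" and g: "g \<in> V" for f g
    proof (rule tendsto_le[OF Ub tendsto_add[OF \<nu>[OF f] \<nu>[OF g]] \<nu>[OF function_subspaceD(2)[OF V f g]]])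
      have "N (T n (\<lambda>k. f k + g k)) \<le> N (T n f) + N (T n g)" for n
        unfolding TS(2)[OF f g] by (rule normed_fspaceD(4)[OF NS TS(1)[OF f f] TS(1)[OF g g]])
      then show "\<forall>\<^sub>F n in U. N (T n (\<lambda>k. f k + g k)) \<le> N (T n f) + N (T n g)" by simp
    qed
  qed
  note dV = function_subspace_diff[OF V]
  have complnu: "complete_nspace (fspace V \<nu>)"
    unfolding complete_nspace_def
  proof (intro allI impI, elim conjE)
    fix u :: "nat \<Rightarrow> nat \<Rightarrow> 'k"
    assume "\<forall>i. u i \<in> carrier (fspace V \<nu>)"
      and cauchy: "\<forall>e>0. \<exists>M. \<forall>i\<ge>M. \<forall>j\<ge>M. vnorm (fspace V \<nu>) (u i \<ominus>\<^bsub>fspace V \<nu>\<^esub> u j) < e"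
    then have u: "u i \<in> V" for i by simp
    have "\<forall>e>0. \<exists>M. \<forall>i\<ge>M. \<forall>j\<ge>M. vnorm (fspace V \<mu>) (u i \<ominus>\<^bsub>fspace V \<mu>\<^esub> u j) < e"
    proof (intro allI impI)
      fix e :: real assume "0 < e"
      then have "0 < e / C" using C by simp
      then obtain M where M: "\<forall>i\<ge>M. \<forall>j\<ge>M. \<nu> (\<lambda>k. u i k - u j k) < e / C"
        using cauchy by (auto simp: fspace_minus[OF V u])
      have "\<mu> (\<lambda>k. u i k - u j k) < e" if ij: "M \<le> i" "M \<le> j" for i j
      proof -
        have "\<nu> (\<lambda>k. u i k - u j k) < e / C" using M ij by blast
        then have "C * \<nu> (\<lambda>k. u i k - u j k) < e" using C by (simp add: pos_less_divide_eq mult.commute)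
        then show ?thesis using nu_lower[OF dV[OF u[of i] u[of j]]] by linarith
      qed
      then show "\<exists>M. \<forall>i\<ge>M. \<forall>j\<ge>M. vnorm (fspace V \<mu>) (u i \<ominus>\<^bsub>fspace V \<mu>\<^esub> u j) < e"
        by (auto simp: fspace_minus[OF V u])
    qed
    then obtain x where x: "x \<in> V" "(\<lambda>i. \<mu> (\<lambda>k. u i k - x k)) \<longlonglongrightarrow> 0"
      using compl[unfolded complete_nspace_def, rule_format, of u] u by (auto simp: fspace_minus[OF V])
    have "(\<lambda>i. \<nu> (\<lambda>k. u i k - x k)) \<longlonglongrightarrow> 0"
    proof (rule tendsto_sandwich[OF _ _ tendsto_const tendsto_mult_right_zero[OF x(2), of C]])
      show "\<forall>\<^sub>F i in sequentially. 0 \<le> \<nu> (\<lambda>k. u i k - x k)"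
        by (intro always_eventually allI normed_fspaceD(1)[OF normnu] dV u x)
      show "\<forall>\<^sub>F i in sequentially. \<nu> (\<lambda>k. u i k - x k) \<le> C * \<mu> (\<lambda>k. u i k - x k)"
        by (intro always_eventually allI nu_upper dV u x)
    qed
    then show "\<exists>x\<in>carrier (fspace V \<nu>). (\<lambda>i. vnorm (fspace V \<nu>) (u i \<ominus>\<^bsub>fspace V \<nu>\<^esub> x)) \<longlonglongrightarrow> 0"
      using x(1) by (intro bexI[of _ x]) (simp_all add: fspace_minus[OF V x(1)])
  qed
  have Tnu: "linear_on_nspace V (fspace V \<nu>) (fspace S N) (T n)" for n
    using T[of n] by (simp add: linear_on_nspace_def)
  have "N (T n y) \<le> (C * C) * \<nu> y" if y: "y \<in> V" for n y
  proof -
    have "N (T n y) \<le> C * \<mu> y" by (rule upper[OF y])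
    also have "\<dots> \<le> C * (C * \<nu> y)" using nu_lower[OF y] C by (intro mult_left_mono) auto
    finally show ?thesis by simp
  qed
  from finitely_representable_ultralimit[OF U V normnu S NS Tnu this \<nu>]
  have fr: "finitely_representable (fspace V \<nu>) (fspace S N)" .
  have refl: "reflexive_nspace (fspace V \<nu>)"
    using normnu complnu V
    by (intro reflexive_if_superreflexive[OF sr e _ fr]) (simp add: banach_nspace_def module_fspace_iff)
  interpret Y: normed_nspace "fspace V \<nu>"
    by (rule normed_nspace.intro) (use V normnu in \<open>auto simp: module_fspace_iff\<close>)
  have val: "norm (\<phi> (z n)) \<le> Y.dnorm \<phi> * (C * K)" if "\<phi> \<in> Y.dual" for \<phi> n
  proof -
    have "norm (\<phi> (z n)) \<le> Y.dnorm \<phi> * \<nu> (z n)" using Y.norm_le_dnorm[OF that, of "z n"] z(1) by simp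
    also have "\<nu> (z n) \<le> C * K" using nu_upper[OF z(1)[of n]] z(2)[of n] C by (meson mult_left_mono less_imp_le order_trans)
    finally show ?thesis using Y.dnorm_nonneg[OF that] by (simp add: mult_left_mono)
  qed
  have "\<exists>l. ((\<lambda>n. \<phi> (z n)) \<longlongrightarrow> l) U" if "\<phi> \<in> Y.dual" for \<phi>
    using val[OF that] by (intro ultra_limit[OF U] boundedI[of _ "Y.dnorm \<phi> * (C * K)"]) auto
  then have "\<forall>\<phi>. \<exists>l. \<phi> \<in> Y.dual \<longrightarrow> ((\<lambda>n. \<phi> (z n)) \<longlongrightarrow> l) U" by blast
  from choice[OF this] obtain L where L: "\<And>\<phi>. \<phi> \<in> Y.dual \<Longrightarrow> ((\<lambda>n. \<phi> (z n)) \<longlongrightarrow> L \<phi>) U" by blast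
  define \<Phi> where "\<Phi> = (\<lambda>\<phi>. if \<phi> \<in> Y.dual then L \<phi> else 0)"
  have add: "(\<lambda>f. \<phi> f + \<psi> f) \<in> Y.dual" if "\<phi> \<in> Y.dual" "\<psi> \<in> Y.dual" for \<phi> \<psi>
    using Y.dual_linear_combination[of 2 "\<lambda>i. if i = 0 then \<phi> else \<psi>" "\<lambda>_. 1"] that by (simp add: numeral_2_eq_2)
  have sm: "(\<lambda>f. a * \<phi> f) \<in> Y.dual" if "\<phi> \<in> Y.dual" for \<phi> a
    using Y.dual_linear_combination[of 1 "\<lambda>i. \<phi>" "\<lambda>_. a"] that by simp
  have "\<Phi> \<in> carrier (dual_nspace (dual_nspace (fspace V \<nu>)))"
    unfolding dual_nspace_def[of "dual_nspace (fspace V \<nu>)"]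
  proof (simp only: partial_object.simps mem_Collect_eq, intro conjI allI impI ballI)
    show "\<Phi> \<phi> = 0" if "\<phi> \<notin> Y.dual" for \<phi> using that by (simp add: \<Phi>_def)
    show "\<Phi> (\<phi> \<oplus>\<^bsub>dual_nspace (fspace V \<nu>)\<^esub> \<psi>) = \<Phi> \<phi> + \<Phi> \<psi>" if d: "\<phi> \<in> Y.dual" "\<psi> \<in> Y.dual" for \<phi> \<psi>
    proof -
      have "L (\<lambda>f. \<phi> f + \<psi> f) = L \<phi> + L \<psi>"
        by (rule tendsto_unique[OF Ub L[OF add[OF d]] tendsto_add[OF L[OF d(1)] L[OF d(2)]]])
      moreover have "\<phi> \<oplus>\<^bsub>dual_nspace (fspace V \<nu>)\<^esub> \<psi> = (\<lambda>f. \<phi> f + \<psi> f)" by (simp add: dual_nspace_def)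
      ultimately show ?thesis using d add[OF d] by (simp add: \<Phi>_def)
    qed
    show "\<Phi> (a \<odot>\<^bsub>dual_nspace (fspace V \<nu>)\<^esub> \<phi>) = a * \<Phi> \<phi>" if d: "\<phi> \<in> Y.dual" for a \<phi>
    proof -
      have "L (\<lambda>f. a * \<phi> f) = a * L \<phi>"
        by (rule tendsto_unique[OF Ub L[OF sm[OF d]] tendsto_mult[OF tendsto_const L[OF d]]])
      moreover have "a \<odot>\<^bsub>dual_nspace (fspace V \<nu>)\<^esub> \<phi> = (\<lambda>f. a * \<phi> f)" by (simp add: dual_nspace_def)
      ultimately show ?thesis using d sm[OF d] by (simp add: \<Phi>_def)
    qed
    have "norm (\<Phi> \<phi>) \<le> (C * K) * Y.dnorm \<phi>" if d: "\<phi> \<in> Y.dual" for \<phi>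
    proof -
      have "norm (L \<phi>) \<le> Y.dnorm \<phi> * (C * K)"
        by (rule tendsto_upperbound[OF tendsto_norm[OF L[OF d]] _ Ub]) (simp add: val[OF d])
      then show ?thesis using d by (simp add: \<Phi>_def mult.commute)
    qed
    then show "\<exists>C. \<forall>\<phi>\<in>Y.dual. norm (\<Phi> \<phi>) \<le> C * Y.dnorm \<phi>" by blast
  qed
  then obtain y where y: "y \<in> V" "\<And>\<phi>. \<phi> \<in> Y.dual \<Longrightarrow> \<Phi> \<phi> = \<phi> y"
    using refl unfolding reflexive_nspace_def by auto
  show ?thesis
  proof (intro bexI[OF _ y(1)] allI impI)
    fix \<phi> :: "(nat \<Rightarrow> 'k) \<Rightarrow> 'k"
    assume a: "\<forall>f\<in>V. \<forall>g\<in>V. \<phi> (\<lambda>k. f k + g k) = \<phi> f + \<phi> g" "\<forall>a. \<forall>f\<in>V. \<phi> (\<lambda>k. a * f k) = a * \<phi> f"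
      and "\<exists>D. \<forall>f\<in>V. norm (\<phi> f) \<le> D * \<mu> f"
    then obtain D where D: "\<And>f. f \<in> V \<Longrightarrow> norm (\<phi> f) \<le> D * \<mu> f" by blast
    define \<psi> where "\<psi> = (\<lambda>f. if f \<in> V then \<phi> f else 0)"
    have "norm (\<phi> f) \<le> (\<bar>D\<bar> * C) * \<nu> f" if f: "f \<in> V" for f
    proof -
      have "D * \<mu> f \<le> \<bar>D\<bar> * (C * \<nu> f)"
        using nu_lower[OF f] normD(1)[OF f] by (intro mult_mono) auto
      then show ?thesis using D[OF f] by simp
    qed
    then have \<psi>: "\<psi> \<in> Y.dual"
      unfolding Y.dual_iff using a function_subspaceD[OF V] by (auto simp: \<psi>_def)
    have "L \<psi> = \<psi> y" using y(2)[OF \<psi>] \<psi> by (simp add: \<Phi>_def)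
    then have "((\<lambda>n. \<psi> (z n)) \<longlongrightarrow> \<psi> y) U" using L[OF \<psi>] by simp
    then show "((\<lambda>n. \<phi> (z n)) \<longlongrightarrow> \<phi> y) U" using z(1) y(1) by (simp add: \<psi>_def)
  qed
qed

lemma function_subspace_sum:
  assumes "function_subspace S" "\<And>i. i < (b::nat) \<Longrightarrow> x i \<in> S"
  shows "(\<lambda>k. \<Sum>i<b. c i * x i k) \<in> S"
  using assms(2)
proof (induction b)
  case 0
  then show ?case using function_subspaceD(1)[OF assms(1)] by simp
next
  case (Suc b)
  have "(\<lambda>k. (\<Sum>i<b. c i * x i k) + c b * x b k) \<in> S"
    by (intro function_subspaceD(2,3)[OF assms(1)] Suc) (use Suc.prems in auto)
  then show ?case by simp
qed

lemma normed_fspace_sum_le: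
  assumes "function_subspace S" "is_norm (fspace S N)" "\<And>i. i < (b::nat) \<Longrightarrow> x i \<in> S"
  shows "N (\<lambda>k. \<Sum>i<b. c i * x i k) \<le> (\<Sum>i<b. norm (c i) * N (x i))"
  using assms(3)
proof (induction b)
  case 0
  then show ?case using normed_fspaceD(2)[OF assms(2) function_subspaceD(1)[OF assms(1)]] by simp
next
  case (Suc b)
  have xb: "x b \<in> S" using Suc.prems by simp
  have sb: "(\<lambda>k. \<Sum>i<b. c i * x i k) \<in> S" using Suc.prems by (intro function_subspace_sum assms(1)) auto
  have "N (\<lambda>k. (\<Sum>i<b. c i * x i k) + c b * x b k) \<le> N (\<lambda>k. \<Sum>i<b. c i * x i k) + N (\<lambda>k. c b * x b k)"
    by (rule normed_fspaceD(4)[OF assms(2) sb function_subspaceD(3)[OF assms(1) xb]])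
  also have "N (\<lambda>k. c b * x b k) = norm (c b) * N (x b)" by (rule normed_fspaceD(3)[OF assms(2) xb])
  finally show ?case using Suc by simp
qed

lemma linear_on_block_sum:
  assumes "function_subspace S" "\<And>i. i < (n::nat) \<Longrightarrow> x i \<in> S"
  shows "linear_on_nspace V (fspace V \<mu>) (fspace S N) (\<lambda>y k. \<Sum>i<n. y i * x i k)"
  unfolding linear_on_nspace_def using function_subspace_sum[OF assms]
  by (simp add: distrib_right sum.distrib sum_distrib_left mult.assoc)

text \<open>The \<open>n\<close>-th map sends the first \<open>n\<close> coordinates to the
  \<open>n\<close>-th system of blocks, so that \<open>c_0\<close> is embedded in the limit. The
  indicators of \<open>{0..n}\<close> are bounded in \<open>c_0\<close> and converge coordinatewise
  to the constant 1, which is not a null sequence, so they have no weak limit there.\<close>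

lemma not_superreflexive_if_linf_blocks:
  fixes e :: "(nat \<Rightarrow> 'k::{real_normed_field, euclidean_space}) \<Rightarrow> 'v" and S :: "(nat \<Rightarrow> 'k) set"
  assumes sr: "superreflexive_banach TYPE('v) (fspace S N)" and e: "inj e" and C: "0 < C"
    and blocks: "\<forall>b::nat. \<exists>x. (\<forall>i<b. x i \<in> S) \<and> (\<forall>c. (\<forall>i<b. norm (c i) \<le> C * N (\<lambda>k. \<Sum>i<b. c i * x i k)) \<and>
      (\<forall>t\<ge>0. (\<forall>i<b. norm (c i) \<le> t) \<longrightarrow> N (\<lambda>k. \<Sum>i<b. c i * x i k) \<le> C * t))"
  shows False
proof -
  have S: "function_subspace S" and NS: "is_norm (fspace S N)"
    using sr by (auto simp: superreflexive_banach_def banach_nspace_def module_fspace_iff)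
  define good where "good = (\<lambda>(b::nat) x. (\<forall>i<b. x i \<in> S) \<and> (\<forall>c. (\<forall>i<b. norm (c i) \<le> C * N (\<lambda>k. \<Sum>i<b. c i * x i k)) \<and>
      (\<forall>t\<ge>0. (\<forall>i<b. norm (c i) \<le> t) \<longrightarrow> N (\<lambda>k. \<Sum>i<b. c i * x i k) \<le> C * t)))"
  have "\<forall>b. \<exists>x. good b x" using blocks unfolding good_def .
  from choice[OF this] obtain x where good: "\<And>b. good b (x b)" by blast
  have x: "\<And>b i. i < b \<Longrightarrow> x b i \<in> S"
    "\<And>b c i. i < b \<Longrightarrow> norm (c i) \<le> C * N (\<lambda>k. \<Sum>i<b. c i * x b i k)"
    "\<And>b c t. 0 \<le> t \<Longrightarrow> \<forall>i<b. norm (c i) \<le> t \<Longrightarrow> N (\<lambda>k. \<Sum>i<b. c i * x b i k) \<le> C * t"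
    using good by (auto simp: good_def)
  interpret seminorm_family "\<lambda>n (f :: nat \<Rightarrow> 'k). norm (f n)" 1
  proof
    show "norm (f n) \<le> b" if "\<And>k. (\<lambda>i. u i k) \<longlonglongrightarrow> f k" "\<forall>\<^sub>F i in sequentially. norm (u i n) \<le> b"
      for u and f :: "nat \<Rightarrow> 'k" and n b
      by (rule tendsto_upperbound[OF tendsto_norm[OF that(1)] that(2)]) simp
    show "\<exists>n. 1 * norm (f k) \<le> norm (f n)" for f :: "nat \<Rightarrow> 'k" and k by auto
  qed (auto simp: norm_mult norm_triangle_ineq)
  have V: "f \<in> V \<longleftrightarrow> f \<longlonglongrightarrow> 0" for f
  proof
    assume "f \<longlonglongrightarrow> 0"
    moreover from this have "Bseq f" by (intro convergent_imp_Bseq convergentI)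
    then obtain K where "\<And>n. norm (f n) \<le> K" by (auto simp: Bseq_def)
    ultimately show "f \<in> V" by (intro VI)
  qed (rule V_tendsto)
  obtain U where U: "ultra U" using ultra_exists by blast
  have Ub: "U \<noteq> bot" and Us: "U \<le> sequentially" using U by (auto simp: ultra_def)
  define z :: "nat \<Rightarrow> nat \<Rightarrow> 'k" where "z = (\<lambda>n k. if k \<le> n then 1 else 0)"
  have zV: "z n \<in> V" for n
  proof -
    have "\<forall>\<^sub>F k in sequentially. z n k = 0"
      using eventually_gt_at_top[of n] by eventually_elim (simp add: z_def)
    then show ?thesis unfolding V by (rule tendsto_eventually)
  qed
  have "\<exists>y\<in>V. \<forall>\<phi>. (\<forall>f\<in>V. \<forall>g\<in>V. \<phi> (\<lambda>k. f k + g k) = \<phi> f + \<phi> g) \<longrightarrow> (\<forall>a. \<forall>f\<in>V. \<phi> (\<lambda>k. a * f k) = a * \<phi> f) \<longrightarrow>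
    (\<exists>D. \<forall>f\<in>V. norm (\<phi> f) \<le> D * \<mu> f) \<longrightarrow> ((\<lambda>n. \<phi> (z n)) \<longlongrightarrow> \<phi> y) U"
  proof (rule superreflexive_weak_limit[OF sr e subspace_V is_norm_mu complete_mu _ _ _ _ U zV, where C = "2 * C" and K = 1
        and T = "\<lambda>n y k. \<Sum>i<n. y i * x n i k"])
    show "linear_on_nspace V (fspace V \<mu>) (fspace S N) (\<lambda>y k. \<Sum>i<n. y i * x n i k)" for n
      by (rule linear_on_block_sum[OF S x(1)])
    show "N (\<lambda>k. \<Sum>i<n. y i * x n i k) \<le> 2 * C * \<mu> y" if "y \<in> V" for n y
    proof -
      have "N (\<lambda>k. \<Sum>i<n. y i * x n i k) \<le> C * \<mu> y"
        using that p_le by (intro x(3) mu_nonneg) auto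
      moreover have "0 \<le> C * \<mu> y" using C mu_nonneg[OF that] by simp
      ultimately show ?thesis by simp
    qed
    show "\<forall>\<^sub>F n in sequentially. \<mu> y \<le> 2 * C * N (\<lambda>k. \<Sum>i<n. y i * x n i k)" if y: "y \<in> V" for y
    proof (cases "\<mu> y = 0")
      case True
      have "0 \<le> N (\<lambda>k. \<Sum>i<n. y i * x n i k)" for n
        by (rule normed_fspaceD(1)[OF NS function_subspace_sum[OF S x(1)]])
      then show ?thesis using C by (simp add: True)
    next
      case False
      \<comment> \<open>Some coordinate exceeds half of the supremum; this is the factor 2 in the
        constant.\<close>
      then have "\<mu> y / 2 < \<mu> y" using mu_nonneg[OF y] by simp
      then have "\<exists>k. \<mu> y / 2 < norm (y k)"
        using mu_le[of y "\<mu> y / 2"] by (force simp: not_less[symmetric])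
      then obtain k where k: "\<mu> y / 2 < norm (y k)" by blast
      show ?thesis
        using eventually_gt_at_top[of k]
      proof eventually_elim
        case (elim n)
        then show ?case using x(2)[OF elim, of y] k by simp
      qed
    qed
    show "\<mu> (z n) \<le> 1" for n by (rule mu_le) (simp add: z_def)
  qed (use C in simp)
  then obtain y where y: "y \<in> V" and lim: "\<And>\<phi>. (\<forall>f\<in>V. \<forall>g\<in>V. \<phi> (\<lambda>k. f k + g k) = \<phi> f + \<phi> g) \<Longrightarrow> (\<forall>a. \<forall>f\<in>V. \<phi> (\<lambda>k. a * f k) = a * \<phi> f) \<Longrightarrow>
    (\<exists>D. \<forall>f\<in>V. norm (\<phi> f) \<le> D * \<mu> f) \<Longrightarrow> ((\<lambda>n. \<phi> (z n)) \<longlongrightarrow> \<phi> y) U" by blast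
  have "y k = 1" for k
  proof (rule tendsto_unique[OF Ub])
    show "((\<lambda>n. z n k) \<longlongrightarrow> y k) U"
      using p_le by (intro lim[of "\<lambda>f. f k"]) (auto intro!: exI[of _ 1])
    have "\<forall>\<^sub>F n in sequentially. z n k = 1"
      using eventually_ge_at_top[of k] by eventually_elim (simp add: z_def)
    then show "((\<lambda>n. z n k) \<longlongrightarrow> 1) U"
      using Us by (intro tendsto_eventually) (rule filter_leD)
  qed
  then have "y = (\<lambda>k. 1)" by auto
  then have "(\<lambda>k::nat. 1 :: 'k) \<longlonglongrightarrow> 0" using y V by simp
  then show False using LIMSEQ_const_iff[of "1::'k" 0] by simp
qed

text \<open>Now \<open>l_1\<close> is embedded, and the sequence consists of the unit vectors.
  Coordinates send it to 0 in the limit, so a weak limit would vanish, but the sum functional is 1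
  on each of them.\<close>

lemma not_superreflexive_if_l1_blocks:
  fixes e :: "(nat \<Rightarrow> 'k::{real_normed_field, euclidean_space}) \<Rightarrow> 'v" and S :: "(nat \<Rightarrow> 'k) set"
  assumes sr: "superreflexive_banach TYPE('v) (fspace S N)" and e: "inj e" and C: "0 < C"
    and blocks: "\<forall>b::nat. \<exists>x. (\<forall>i<b. x i \<in> S) \<and> (\<forall>c. (\<Sum>i<b. norm (c i)) \<le> C * N (\<lambda>k. \<Sum>i<b. c i * x i k) \<and>
      N (\<lambda>k. \<Sum>i<b. c i * x i k) \<le> C * (\<Sum>i<b. norm (c i)))"
  shows False
proof -
  have S: "function_subspace S" and NS: "is_norm (fspace S N)"
    using sr by (auto simp: superreflexive_banach_def banach_nspace_def module_fspace_iff)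
  define good where "good = (\<lambda>(b::nat) x. (\<forall>i<b. x i \<in> S) \<and> (\<forall>c. (\<Sum>i<b. norm (c i)) \<le> C * N (\<lambda>k. \<Sum>i<b. c i * x i k) \<and>
      N (\<lambda>k. \<Sum>i<b. c i * x i k) \<le> C * (\<Sum>i<b. norm (c i))))"
  have "\<forall>b. \<exists>x. good b x" using blocks unfolding good_def .
  from choice[OF this] obtain x where good: "\<And>b. good b (x b)" by blast
  have x: "\<And>b i. i < b \<Longrightarrow> x b i \<in> S"
    "\<And>b c. (\<Sum>i<b. norm (c i)) \<le> C * N (\<lambda>k. \<Sum>i<b. c i * x b i k)"
    "\<And>b c. N (\<lambda>k. \<Sum>i<b. c i * x b i k) \<le> C * (\<Sum>i<b. norm (c i))"
    using good by (auto simp: good_def)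
  interpret seminorm_family "\<lambda>n (f :: nat \<Rightarrow> 'k). \<Sum>k<n. norm (f k)" 1
  proof
    show "(\<Sum>k<n. norm (f k)) \<le> b" if "\<And>k. (\<lambda>i. u i k) \<longlonglongrightarrow> f k" "\<forall>\<^sub>F i in sequentially. (\<Sum>k<n. norm (u i k)) \<le> b"
      for u and f :: "nat \<Rightarrow> 'k" and n b
      by (rule tendsto_upperbound[OF _ that(2)]) (auto intro!: tendsto_sum tendsto_norm that(1))
    show "\<exists>n. 1 * norm (f k) \<le> (\<Sum>k<n. norm (f k))" for f :: "nat \<Rightarrow> 'k" and k
      by (intro exI[of _ "Suc k"]) (simp add: sum_nonneg)
    show "(\<Sum>k<n. norm (f k + g k)) \<le> (\<Sum>k<n. norm (f k)) + (\<Sum>k<n. norm (g k))" for f g :: "nat \<Rightarrow> 'k" and n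
      unfolding sum.distrib[symmetric] by (intro sum_mono norm_triangle_ineq)
  qed (auto simp: norm_mult sum_distrib_left sum_nonneg)
  have summ: "summable (\<lambda>k. norm (f k))" "(\<Sum>k. norm (f k)) \<le> \<mu> f" if "f \<in> V" for f
  proof -
    show s: "summable (\<lambda>k. norm (f k))" using p_le[OF that] by (intro summableI_nonneg_bounded[of _ "\<mu> f"]) auto
    show "(\<Sum>k. norm (f k)) \<le> \<mu> f" using p_le[OF that] by (intro suminf_le_const s) auto
  qed
  obtain U where U: "ultra U" using ultra_exists by blast
  have Ub: "U \<noteq> bot" and Us: "U \<le> sequentially" using U by (auto simp: ultra_def)
  define z :: "nat \<Rightarrow> nat \<Rightarrow> 'k" where "z = (\<lambda>n k. if k = n then 1 else 0)"
  have z1: "(\<Sum>k<m. norm (z n k)) \<le> 1" for n m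
  proof -
    have "(\<Sum>k<m. norm (z n k)) = (\<Sum>k<m. if k = n then 1 else 0)" by (intro sum.cong) (auto simp: z_def)
    also have "\<dots> \<le> 1" by (simp add: sum.delta)
    finally show ?thesis .
  qed
  have zV: "z n \<in> V" for n
  proof (rule VI[OF _ z1])
    have "\<forall>\<^sub>F k in sequentially. z n k = 0"
      using eventually_gt_at_top[of n] by eventually_elim (simp add: z_def)
    then show "z n \<longlonglongrightarrow> 0" by (rule tendsto_eventually)
  qed
  have "\<exists>y\<in>V. \<forall>\<phi>. (\<forall>f\<in>V. \<forall>g\<in>V. \<phi> (\<lambda>k. f k + g k) = \<phi> f + \<phi> g) \<longrightarrow> (\<forall>a. \<forall>f\<in>V. \<phi> (\<lambda>k. a * f k) = a * \<phi> f) \<longrightarrow>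
    (\<exists>D. \<forall>f\<in>V. norm (\<phi> f) \<le> D * \<mu> f) \<longrightarrow> ((\<lambda>n. \<phi> (z n)) \<longlongrightarrow> \<phi> y) U"
  proof (rule superreflexive_weak_limit[OF sr e subspace_V is_norm_mu complete_mu _ _ _ _ U zV, where C = "2 * C" and K = 1
        and T = "\<lambda>n y k. \<Sum>i<n. y i * x n i k"])
    show "linear_on_nspace V (fspace V \<mu>) (fspace S N) (\<lambda>y k. \<Sum>i<n. y i * x n i k)" for n
      by (rule linear_on_block_sum[OF S x(1)])
    show "N (\<lambda>k. \<Sum>i<n. y i * x n i k) \<le> 2 * C * \<mu> y" if "y \<in> V" for n y
    proof -
      have "N (\<lambda>k. \<Sum>i<n. y i * x n i k) \<le> C * (\<Sum>i<n. norm (y i))" by (rule x(3))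
      also have "\<dots> \<le> C * \<mu> y" using p_le[OF that] C by (intro mult_left_mono) auto
      finally have "N (\<lambda>k. \<Sum>i<n. y i * x n i k) \<le> C * \<mu> y" .
      moreover have "0 \<le> C * \<mu> y" using C mu_nonneg[OF that] by simp
      ultimately show ?thesis by simp
    qed
    show "\<forall>\<^sub>F n in sequentially. \<mu> y \<le> 2 * C * N (\<lambda>k. \<Sum>i<n. y i * x n i k)" if y: "y \<in> V" for y
    proof (cases "\<mu> y = 0")
      case True
      have "0 \<le> N (\<lambda>k. \<Sum>i<n. y i * x n i k)" for n
        by (rule normed_fspaceD(1)[OF NS function_subspace_sum[OF S x(1)]])
      then show ?thesis using C by (simp add: True)
    next
      case False
      then have "\<mu> y / 2 < \<mu> y" using mu_nonneg[OF y] by simp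
      then have "\<exists>m. \<mu> y / 2 < (\<Sum>k<m. norm (y k))"
        using mu_le[of y "\<mu> y / 2"] by (force simp: not_less[symmetric])
      then obtain m where m: "\<mu> y / 2 < (\<Sum>k<m. norm (y k))" by blast
      show ?thesis
        using eventually_ge_at_top[of m]
      proof eventually_elim
        case (elim n)
        have "(\<Sum>k<m. norm (y k)) \<le> (\<Sum>k<n. norm (y k))" using elim by (intro sum_mono2) auto
        then show ?case using x(2)[of y n] m by simp
      qed
    qed
    show "\<mu> (z n) \<le> 1" for n by (rule mu_le[OF z1])
  qed (use C in simp)
  then obtain y where y: "y \<in> V" and lim: "\<And>\<phi>. (\<forall>f\<in>V. \<forall>g\<in>V. \<phi> (\<lambda>k. f k + g k) = \<phi> f + \<phi> g) \<Longrightarrow> (\<forall>a. \<forall>f\<in>V. \<phi> (\<lambda>k. a * f k) = a * \<phi> f) \<Longrightarrow>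
    (\<exists>D. \<forall>f\<in>V. norm (\<phi> f) \<le> D * \<mu> f) \<Longrightarrow> ((\<lambda>n. \<phi> (z n)) \<longlongrightarrow> \<phi> y) U" by blast
  have "y k = 0" for k
  proof (rule tendsto_unique[OF Ub])
    show "((\<lambda>n. z n k) \<longlongrightarrow> y k) U"
      using coord_le[of _ k] by (intro lim[of "\<lambda>f. f k"]) (auto intro!: exI[of _ 1])
    have "\<forall>\<^sub>F n in sequentially. z n k = 0"
      using eventually_gt_at_top[of k] by eventually_elim (simp add: z_def)
    then show "((\<lambda>n. z n k) \<longlongrightarrow> 0) U"
      using Us by (intro tendsto_eventually) (rule filter_leD)
  qed
  then have y0: "y = (\<lambda>k. 0)" by auto
  have "((\<lambda>n. suminf (z n)) \<longlongrightarrow> suminf y) U"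
  proof (rule lim)
    note sc = summable_norm_cancel[OF summ(1)]
    show "\<forall>f\<in>V. \<forall>g\<in>V. (\<Sum>k. f k + g k) = suminf f + suminf g" by (simp add: suminf_add sc)
    show "\<forall>a. \<forall>f\<in>V. (\<Sum>k. a * f k) = a * suminf f" by (simp add: suminf_mult sc)
    show "\<exists>D. \<forall>f\<in>V. norm (suminf f) \<le> D * \<mu> f"
      using summable_norm[OF summ(1)] summ(2) by (intro exI[of _ 1]) (force intro: order_trans)
  qed
  moreover have "suminf (z n) = 1" for n
    using suminf_finite[of "{n}" "z n"] by (simp add: z_def)
  ultimately have "((\<lambda>n. 1 :: 'k) \<longlongrightarrow> 0) U" by (simp add: y0)
  then show False using tendsto_unique[OF Ub tendsto_const] by fastforce
qed

subsection \<open>Superreflexive Lorentz spaces are regular\<close>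

text \<open>The mean value theorem; it will compare increments of \<open>s powr r\<close> with the
  terms of \<open>W\<close>.\<close>

lemma powr_diff_tangent:
  fixes x y r :: real
  assumes "1 \<le> r" "0 \<le> x" "x \<le> y"
  shows "y powr r - x powr r \<le> r * y powr (r - 1) * (y - x)"
proof (cases "x = y")
  case False
  then have xy: "x < y" using assms by simp
  have "continuous_on {x..y} (\<lambda>t. t powr r)"
    using assms by (auto intro!: continuous_intros continuous_on_powr')
  moreover have "((\<lambda>t. t powr r) has_real_derivative r * t powr (r - 1)) (at t)" if "x < t" for t
    using that assms by (auto intro!: derivative_eq_intros)
  ultimately obtain l z where z: "x < z" "z < y" "((\<lambda>t. t powr r) has_real_derivative l) (at z)"
    "y powr r - x powr r = (y - x) * l"
    using MVT[OF xy, of "\<lambda>t. t powr r"] by (auto simp: real_differentiable_def)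
  have "((\<lambda>t. t powr r) has_real_derivative r * z powr (r - 1)) (at z)"
    using z assms by (auto intro!: derivative_eq_intros)
  then have "l = r * z powr (r - 1)" using DERIV_unique[OF z(3)] by blast
  moreover have "z powr (r - 1) \<le> y powr (r - 1)" using z assms by (intro powr_mono2) auto
  ultimately have "(y - x) * l \<le> (y - x) * (r * y powr (r - 1))"
    using xy assms by (intro mult_left_mono) auto
  then show ?thesis using z(4) by (simp add: mult_ac)
qed simp

text \<open>The inclusion of \<open>l_r\<close> in \<open>l_1\<close>: each \<open>a i\<close> is at
  most the \<open>l_r\<close>-norm \<open>t\<close>, so \<open>a i = a i powr r * a i powr (1 - r)
  \<le> a i powr r * t powr (1 - r)\<close>.\<close>

lemma sum_le_powr_sum:
  fixes a :: "nat \<Rightarrow> real"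
  assumes "0 < r" "r \<le> 1" "\<And>i. i < b \<Longrightarrow> 0 \<le> a i"
  shows "(\<Sum>i<b. a i) \<le> (\<Sum>i<b. a i powr r) powr (1 / r)"
proof -
  define t where "t = (\<Sum>i<b. a i powr r) powr (1 / r)"
  have tr: "t powr r = (\<Sum>i<b. a i powr r)" using assms(1) by (simp add: t_def powr_powr sum_nonneg)
  have le: "a i \<le> a i powr r * t powr (1 - r)" if i: "i < b" for i
  proof (cases "a i = 0")
    case False
    then have a: "0 < a i" using assms(3)[OF i] by simp
    have "a i = (a i powr r) powr (1 / r)" using a assms(1) by (simp add: powr_powr)
    also have "\<dots> \<le> t"
      unfolding t_def using assms(1) i by (intro powr_mono2 member_le_sum) auto
    finally have "a i powr (1 - r) \<le> t powr (1 - r)" using a assms by (intro powr_mono2) auto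
    then have "a i powr r * a i powr (1 - r) \<le> a i powr r * t powr (1 - r)" by (intro mult_left_mono) auto
    then show ?thesis using a by (simp add: powr_add[symmetric])
  qed simp
  have "(\<Sum>i<b. a i) \<le> (\<Sum>i<b. a i powr r * t powr (1 - r))" using le by (intro sum_mono) auto
  also have "\<dots> = t powr r * t powr (1 - r)" by (simp only: sum_distrib_right[symmetric] tr)
  also have "\<dots> = t" by (simp add: powr_add[symmetric] t_def)
  finally show ?thesis by (simp add: t_def)
qed

lemma rearrangement_ge:
  assumes "f \<longlonglongrightarrow> 0" "1 \<le> n" "finite A" "n \<le> card A" "\<And>k. k \<in> A \<Longrightarrow> t \<le> norm (f k)"
  shows "t \<le> rearrangement f n"
proof (rule ccontr)
  assume "\<not> ?thesis"
  then have "A \<subseteq> {k. rearrangement f n < norm (f k)}" using assms(5) by fastforce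
  then have "card A < n"
    using card_above_rearrangement[OF assms(1,2)] card_mono by (meson le_less_trans)
  then show False using assms(4) by simp
qed

lemma rearrangement_eq_if_card_eq:
  assumes "\<And>t. 0 \<le> t \<Longrightarrow> finite {k. t < norm (f k)} \<and> finite {k. t < norm (g k)} \<and>
      card {k. t < norm (f k)} = card {k. t < norm (g k)}"
  shows "rearrangement f n = rearrangement g n"
  unfolding rearrangement_def using assms by (intro arg_cong[of _ _ Inf] Collect_cong) auto

lemma tendsto_zero_if_finite_support:
  assumes "finite {k :: nat. f k \<noteq> 0}" shows "f \<longlonglongrightarrow> 0"
proof -
  obtain n where "{k. f k \<noteq> 0} \<subseteq> {..<n}" using assms finite_nat_iff_bounded by blast
  then have "\<forall>\<^sub>F k in sequentially. f k = 0"
    unfolding eventually_sequentially by (intro exI[of _ n]) (force simp: not_less[symmetric])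
  then show ?thesis by (rule tendsto_eventually)
qed

section \<open>Partitions of the coordinates into blocks\<close>

lemma sum_rotate:
  fixes h :: "nat \<Rightarrow> 'a::comm_monoid_add"
  shows "(\<Sum>l<b. h ((a + l) mod b)) = (\<Sum>i<b. h i)"
proof (cases "b = 0")
  case False
  have "inj_on (\<lambda>l. (a + l) mod b) {..<b}"
  proof (rule linorder_inj_onI)
    fix l l' assume l: "l < l'" "l \<in> {..<b}" "l' \<in> {..<b}"
    show "(a + l) mod b \<noteq> (a + l') mod b"
    proof
      assume "(a + l) mod b = (a + l') mod b"
      then have "b dvd (a + l') - (a + l)" using l(1) by (subst mod_eq_dvd_iff_nat[symmetric]) auto
      then have "b dvd l' - l" by simp
      then show False using l by (auto dest: dvd_imp_le)
    qed
  qed auto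
  moreover have "(\<lambda>l. (a + l) mod b) ` {..<b} \<subseteq> {..<b}" using False by auto
  ultimately have "bij_betw (\<lambda>l. (a + l) mod b) {..<b} {..<b}"
    by (simp add: bij_betw_def endo_inj_surj)
  then show ?thesis by (rule sum.reindex_bij_betw)
qed simp

text \<open>Interleaves \<open>b\<close> blocks of \<open>n\<close> coordinates each; the index
  \<open>b\<close> marks the coordinates beyond them.\<close>

definition residue_block :: "nat \<Rightarrow> nat \<Rightarrow> nat \<Rightarrow> nat" where
  "residue_block b n k = (if k < b * n then k mod b else b)"

lemma residue_block_less: "residue_block b n k < b \<longleftrightarrow> k < b * n"
  by (auto simp: residue_block_def) (metis mod_less_divisor mult_0 not_gr_zero not_less_zero)

lemma card_residue_block:
  assumes "i < b" shows "card {k. residue_block b n k = i} = n"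
proof -
  have "{k. residue_block b n k = i} = (\<lambda>j. b * j + i) ` {..<n}"
  proof (intro equalityI subsetI)
    fix k assume "k \<in> {k. residue_block b n k = i}"
    then have k: "k < b * n" "k mod b = i" using assms by (auto simp: residue_block_def split: if_splits)
    then have "k = b * (k div b) + i" "k div b < n" 
      by (auto simp: less_mult_imp_div_less mult.commute)
    then show "k \<in> (\<lambda>j. b * j + i) ` {..<n}" by blast
  next
    fix k assume "k \<in> (\<lambda>j. b * j + i) ` {..<n}"
    then obtain j where j: "k = b * j + i" "j < n" by auto
    have "b * j + i < b * Suc j" using assms by simp
    also have "\<dots> \<le> b * n" using j by (intro mult_left_mono) auto
    finally show "k \<in> {k. residue_block b n k = i}" using j assms by (simp add: residue_block_def)
  qed
  moreover have "inj_on (\<lambda>j. b * j + i) {..<n}" using assms by (auto simp: inj_on_def)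
  ultimately show ?thesis by (simp add: card_image)
qed

text \<open>Consecutive intervals, for blocks of different lengths; \<open>M i\<close> is meant as
  the first coordinate of block \<open>i\<close>.\<close>

definition interval_block :: "(nat \<Rightarrow> nat) \<Rightarrow> nat \<Rightarrow> nat" where
  "interval_block M k = (LEAST i. k < M (Suc i))"

lemma interval_block_iff:
  assumes "strict_mono M" "M 0 = 0"
  shows "interval_block M k = i \<longleftrightarrow> M i \<le> k \<and> k < M (Suc i)"
proof -
  have "k < M (Suc k)" using strict_mono_imp_increasing[OF assms(1), of "Suc k"] by simp
  then have L: "k < M (Suc (interval_block M k))" unfolding interval_block_def by (rule LeastI)
  have "M (interval_block M k) \<le> k"
  proof (cases "interval_block M k")
    case (Suc j)
    then show ?thesis using not_less_Least[of j "\<lambda>i. k < M (Suc i)"] by (simp add: interval_block_def not_less)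
  qed (simp add: assms)
  moreover have "i = j" if "M i \<le> k" "k < M (Suc i)" "M j \<le> k" "k < M (Suc j)" for i j
  proof (rule ccontr)
    assume "i \<noteq> j"
    then have "Suc i \<le> j \<or> Suc j \<le> i" by linarith
    then have "M (Suc i) \<le> M j \<or> M (Suc j) \<le> M i" using strict_mono_less_eq[OF assms(1)] by blast
    then show False using that by linarith
  qed
  ultimately show ?thesis using L by blast
qed

locale lorentz_superreflexive = weight +
  fixes q :: ereal and N :: "(nat \<Rightarrow> 'k::{real_normed_field, euclidean_space}) \<Rightarrow> real" and K :: real
    and e :: "(nat \<Rightarrow> 'k) \<Rightarrow> 'v"
  assumes q_pos: "0 < q" and sr: "superreflexive_banach TYPE('v) (fspace (lorentz_set w q) N)"
    and e: "inj e" and K: "0 < K"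
    and N_le: "f \<in> lorentz_set w q \<Longrightarrow> N f \<le> K * lorentz_norm w q f"
    and lor_le: "f \<in> lorentz_set w q \<Longrightarrow> lorentz_norm w q f \<le> K * N f"
begin

abbreviation S :: "(nat \<Rightarrow> 'k) set" where "S \<equiv> lorentz_set w q"
abbreviation lor :: "(nat \<Rightarrow> 'k) \<Rightarrow> real" where "lor \<equiv> lorentz_norm w q"
abbreviation r :: real where "r \<equiv> real_of_ereal q"

definition W :: "nat \<Rightarrow> real" where "W m = (\<Sum>n=1..m. s n powr (r - 1) * w n)"

text \<open>The fundamental function: the quasi-norm of the indicator of \<open>m\<close>
  coordinates.\<close>

definition F :: "nat \<Rightarrow> real" where "F m = (if q = \<infinity> then s m else W m powr (1 / r))"

lemma S: "function_subspace S" and NS: "is_norm (fspace S N)"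
  using sr by (auto simp: superreflexive_banach_def banach_nspace_def module_fspace_iff)

lemma r_pos: "q \<noteq> \<infinity> \<Longrightarrow> 0 < r"
  using q_pos by (cases q) auto

lemma W_mono: "m \<le> n \<Longrightarrow> W m \<le> W n"
  unfolding W_def by (intro sum_mono2) (auto simp: w_nonneg)

lemma W_nonneg: "0 \<le> W m"
  unfolding W_def by (intro sum_nonneg) (auto simp: w_nonneg)

lemma W_pos: "1 \<le> m \<Longrightarrow> 0 < W m"
proof -
  assume m: "1 \<le> m"
  have "0 < w 1" using weight by (simp add: is_weight_def)
  then have "0 < W 1" using s_pos[of 1] by (simp add: W_def)
  then show ?thesis using W_mono[OF m] by linarith
qed

lemma F_pos: "1 \<le> m \<Longrightarrow> 0 < F m"
  using W_pos[of m] s_pos[of m] by (simp add: F_def)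

lemma F_nonneg: "0 \<le> F m"
  using s_mono[of 0 m] by (simp add: F_def primitive_seq_def)

lemma S_tendsto: "f \<in> S \<Longrightarrow> f \<longlonglongrightarrow> 0"
  by (simp add: lorentz_set_def)

lemma S_summable: "f \<in> S \<Longrightarrow> q \<noteq> \<infinity> \<Longrightarrow> summable (\<lambda>i. lorentz_term w r f (Suc i))"
  by (simp add: lorentz_set_def)

lemma lor_finite: "q \<noteq> \<infinity> \<Longrightarrow> lor f = (\<Sum>i. lorentz_term w r f (Suc i)) powr (1 / r)"
  by (simp add: lorentz_norm_def)

lemma lor_infinite: "q = \<infinity> \<Longrightarrow> lor f = Sup {rearrangement f n * s n | n. n \<ge> 1}"
  by (simp add: lorentz_norm_def)

lemma rearrangement_zero:
  assumes "finite {k. f k \<noteq> 0}" "card {k. f k \<noteq> 0} < n"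
  shows "rearrangement f n = 0"
proof (rule antisym)
  have "{k. 0 < norm (f k)} = {k. f k \<noteq> 0}" by auto
  then show "rearrangement f n \<le> 0" using assms by (intro rearrangement_le) auto
  show "0 \<le> rearrangement f n"
    using assms by (intro rearrangement_nonneg tendsto_zero_if_finite_support) auto
qed

lemma finite_support_in_S:
  assumes "finite {k. f k \<noteq> 0}" shows "f \<in> S"
proof -
  define m where "m = card {k. f k \<noteq> 0}"
  have z: "rearrangement f n = 0" if "m < n" for n
    using that assms by (intro rearrangement_zero) (auto simp: m_def)
  have "bdd_above {rearrangement f n * s n | n. n \<ge> 1}"
  proof (rule bdd_above_mono)
    show "bdd_above (insert 0 ((\<lambda>n. rearrangement f n * s n) ` {1..m}))" by simp
    show "{rearrangement f n * s n | n. n \<ge> 1} \<subseteq> insert 0 ((\<lambda>n. rearrangement f n * s n) ` {1..m})"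
      using z by (force simp: not_less[symmetric])
  qed
  moreover have "summable (\<lambda>i. lorentz_term w r f (Suc i))"
    by (rule summable_finite[of "{..<m}"]) (auto simp: lorentz_term_def z)
  ultimately show ?thesis
    using tendsto_zero_if_finite_support[OF assms] by (simp add: lorentz_set_def)
qed

lemma lor_upper:
  assumes A: "finite A" "{k. f k \<noteq> 0} \<subseteq> A" "card A \<le> m" and t: "0 \<le> t" "\<And>k. norm (f k) \<le> t"
  shows "lor f \<le> t * F m"
proof -
  have fin: "finite {k. f k \<noteq> 0}" using A finite_subset by blast
  note f0 = tendsto_zero_if_finite_support[OF fin]
  have "card {k. f k \<noteq> 0} \<le> m" using card_mono[OF A(1,2)] A(3) by linarith
  then have z: "rearrangement f n = 0" if "m < n" for n
    using that fin by (intro rearrangement_zero) auto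
  have le: "rearrangement f n \<le> t" if "1 \<le> n" for n
    using t that by (intro rearrangement_le) (auto simp: not_less[symmetric])
  show ?thesis
  proof (cases "q = \<infinity>")
    case True
    have s0: "0 \<le> s n" for n using s_mono[of 0 n] by (simp add: primitive_seq_def)
    have "rearrangement f n * s n \<le> t * s m" if "1 \<le> n" for n
    proof (cases "n \<le> m")
      case True
      then show ?thesis using le[OF that] t s_mono[of n m] s0 by (intro mult_mono) auto
    next
      case False
      then show ?thesis using z[of n] t s0[of m] by simp
    qed
    then show ?thesis unfolding lor_infinite[OF True] F_def using True by (auto intro!: cSup_least)
  next
    case False
    have "(\<Sum>i. lorentz_term w r f (Suc i)) = (\<Sum>i<m. lorentz_term w r f (Suc i))"
      by (rule suminf_finite) (auto simp: lorentz_term_def z)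
    also have "\<dots> \<le> (\<Sum>i<m. t powr r * (s (Suc i) powr (r - 1) * w (Suc i)))"
    proof (rule sum_mono)
      fix i
      have "lorentz_term w r f (Suc i) = rearrangement f (Suc i) powr r * (s (Suc i) powr (r - 1) * w (Suc i))"
        by (rule term_eq[OF f0]) simp
      also have "\<dots> \<le> t powr r * (s (Suc i) powr (r - 1) * w (Suc i))"
        using le[of "Suc i"] rearrangement_nonneg[OF f0, of "Suc i"] r_pos[OF False] w_nonneg[of "Suc i"]
        by (intro mult_right_mono powr_mono2) auto
      finally show "lorentz_term w r f (Suc i) \<le> t powr r * (s (Suc i) powr (r - 1) * w (Suc i))" .
    qed
    also have "\<dots> = t powr r * W m"
      unfolding sum_distrib_left[symmetric] W_def
      using sum.shift_bounds_Suc_ivl[of "\<lambda>n. s n powr (r - 1) * w n" 0 m]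
      by (simp add: atLeastLessThanSuc_atLeastAtMost lessThan_atLeast0)
    finally have "(\<Sum>i. lorentz_term w r f (Suc i)) \<le> t powr r * W m" .
    then have "lor f \<le> (t powr r * W m) powr (1 / r)"
      unfolding lor_finite[OF False] using r_pos[OF False] term_nonneg[OF f0]
        S_summable[OF finite_support_in_S[OF fin] False]
      by (intro powr_mono2 suminf_nonneg) auto
    also have "\<dots> = t * F m"
      using r_pos[OF False] t False by (simp add: F_def powr_mult powr_powr)
    finally show ?thesis .
  qed
qed

lemma lor_nonneg: "f \<in> S \<Longrightarrow> 0 \<le> lor f"
proof -
  assume f: "f \<in> S"
  show ?thesis
  proof (cases "q = \<infinity>")
    case True
    have "rearrangement f 1 * s 1 \<le> lor f"
      unfolding lor_infinite[OF True] using f True by (intro cSup_upper) (auto simp: lorentz_set_def)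
    moreover have "0 \<le> rearrangement f 1 * s 1"
      using rearrangement_nonneg[OF S_tendsto[OF f], of 1] s_pos[of 1] by simp
    ultimately show ?thesis by linarith
  qed (simp add: lor_finite)
qed

lemma sum_le_lor:
  assumes f: "f \<in> S" and "q \<noteq> \<infinity>"
  shows "(\<Sum>n=1..m. rearrangement f n powr r * (s n powr (r - 1) * w n)) \<le> lor f powr r"
proof -
  note f0 = S_tendsto[OF f]
  have "(\<Sum>n=1..m. rearrangement f n powr r * (s n powr (r - 1) * w n)) = (\<Sum>n=1..m. lorentz_term w r f n)"
    by (intro sum.cong refl term_eq[symmetric, OF f0]) auto
  also have "\<dots> = (\<Sum>i<m. lorentz_term w r f (Suc i))"
    using sum.shift_bounds_Suc_ivl[of "lorentz_term w r f" 0 m]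
    by (simp add: atLeastLessThanSuc_atLeastAtMost lessThan_atLeast0)
  also have "\<dots> \<le> (\<Sum>i. lorentz_term w r f (Suc i))"
    using S_summable[OF assms] term_nonneg[OF f0] by (intro sum_le_suminf) auto
  also have "\<dots> = lor f powr r"
    using r_pos[OF assms(2)] S_summable[OF assms] term_nonneg[OF f0]
    by (simp add: lor_finite[OF assms(2)] powr_powr suminf_nonneg)
  finally show ?thesis .
qed

lemma lor_lower:
  assumes f: "f \<in> S" and A: "finite A" "m \<le> card A" "\<And>k. k \<in> A \<Longrightarrow> t \<le> norm (f k)" and t: "0 \<le> t"
  shows "t * F m \<le> lor f"
proof -
  note f0 = S_tendsto[OF f]
  have ge: "t \<le> rearrangement f n" if "1 \<le> n" "n \<le> m" for n
    using that A by (intro rearrangement_ge[OF f0]) auto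
  show ?thesis
  proof (cases "q = \<infinity>")
    case True
    then have Fm: "F m = s m" by (intro trans[OF F_def if_P])
    show ?thesis
    proof (cases "1 \<le> m")
      case m: True
      have "t * s m \<le> rearrangement f m * s m" using ge[OF m] s_pos[OF m] by (intro mult_right_mono) auto
      also have "\<dots> \<le> lor f"
        unfolding lor_infinite[OF True] using f True m by (intro cSup_upper) (auto simp: lorentz_set_def)
      finally show ?thesis by (simp only: Fm)
    next
      case False
      then show ?thesis using lor_nonneg[OF f] by (simp add: Fm primitive_seq_def)
    qed
  next
    case False
    have "t powr r * W m = (\<Sum>n=1..m. t powr r * (s n powr (r - 1) * w n))"
      by (simp add: W_def sum_distrib_left)
    also have "\<dots> \<le> (\<Sum>n=1..m. rearrangement f n powr r * (s n powr (r - 1) * w n))"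
      using ge t r_pos[OF False] w_nonneg by (intro sum_mono mult_right_mono powr_mono2) auto
    also have "\<dots> \<le> lor f powr r" by (rule sum_le_lor[OF f False])
    finally have "(t powr r * W m) powr (1 / r) \<le> (lor f powr r) powr (1 / r)"
      using r_pos[OF False] W_nonneg[of m] by (intro powr_mono2) auto
    then show ?thesis
      using r_pos[OF False] t False lor_nonneg[OF f] by (simp add: F_def powr_mult powr_powr)
  qed
qed

lemma block_sum:
  fixes idx :: "nat \<Rightarrow> nat" and c v :: "nat \<Rightarrow> 'k"
  shows "(\<Sum>i<b. c i * (if idx k = i then v i else 0)) = (if idx k < b then c (idx k) * v (idx k) else 0)"
proof -
  have "(\<Sum>i<b. c i * (if idx k = i then v i else 0)) = (\<Sum>i<b. if i = idx k then c i * v i else 0)"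
    by (intro sum.cong) auto
  then show ?thesis by (simp add: sum.delta)
qed

text \<open>Take \<open>b\<close> blocks of \<open>n\<close> ones each, divided by
  \<open>F n\<close>. A single block has quasi-norm 1 and all of them together
  \<open>F (b * n) / F n \<le> D\<close>, so they span a copy of the \<open>b\<close>-dimensional
  \<open>l_inf\<close> with constants independent of \<open>b\<close>.\<close>

lemma not_linf:
  assumes "0 < D" "\<forall>b. \<exists>n\<ge>1. F (b * n) \<le> D * F n"
  shows False
proof (rule not_superreflexive_if_linf_blocks[OF sr e, of "K * (1 + D)"])
  show "0 < K * (1 + D)" using K assms by simp
  show "\<forall>b::nat. \<exists>x. (\<forall>i<b. x i \<in> S) \<and> (\<forall>c. (\<forall>i<b. norm (c i) \<le> K * (1 + D) * N (\<lambda>k. \<Sum>i<b. c i * x i k)) \<and>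
      (\<forall>t\<ge>0. (\<forall>i<b. norm (c i) \<le> t) \<longrightarrow> N (\<lambda>k. \<Sum>i<b. c i * x i k) \<le> K * (1 + D) * t))"
  proof
    fix b :: nat
    obtain n where n: "1 \<le> n" "F (b * n) \<le> D * F n" using assms by blast
    have Fn: "0 < F n" by (rule F_pos[OF n(1)])
    define idx where "idx = residue_block b n"
    define v :: 'k where "v = of_real (1 / F n)"
    have v: "norm v = 1 / F n" using Fn by (simp add: v_def norm_divide)
    define x where "x = (\<lambda>i k. if idx k = i then v else 0)"
    define f where "f = (\<lambda>c k. \<Sum>i<b. c i * x i k)"
    have f: "f c k = (if idx k < b then c (idx k) * v else 0)" for c k
      unfolding f_def x_def by (rule block_sum)
    have idx: "idx k < b \<longleftrightarrow> k < b * n" for k by (simp add: idx_def residue_block_less)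
    have supp: "{k. f c k \<noteq> 0} \<subseteq> {..<b * n}" for c by (auto simp: f idx split: if_splits)
    have fS: "f c \<in> S" for c
      using supp finite_subset by (intro finite_support_in_S) blast
    have xS: "x i \<in> S" if "i < b" for i
    proof (rule finite_support_in_S)
      have "{k. x i k \<noteq> 0} \<subseteq> {..<b * n}" using that idx by (auto simp: x_def split: if_splits)
      then show "finite {k. x i k \<noteq> 0}" by (rule finite_subset) simp
    qed
    have lower: "norm (c i) \<le> K * (1 + D) * N (f c)" if "i < b" for c i
    proof -
      have "card {k. idx k = i} = n" unfolding idx_def by (rule card_residue_block[OF that])
      moreover from this have "finite {k. idx k = i}" using n by (intro card_ge_0_finite) simp
      ultimately have "norm (c i) / F n * F n \<le> lor (f c)"
        using that Fn by (intro lor_lower[OF fS, of "{k. idx k = i}"]) (auto simp: f norm_mult v)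
      also have "\<dots> \<le> K * N (f c)" by (rule lor_le[OF fS])
      also have "\<dots> \<le> K * (1 + D) * N (f c)"
        using K assms(1) normed_fspaceD(1)[OF NS fS] by (intro mult_right_mono) auto
      finally show ?thesis using Fn by simp
    qed
    have upper: "N (f c) \<le> K * (1 + D) * t" if t: "0 \<le> t" "\<forall>i<b. norm (c i) \<le> t" for c t
    proof -
      have "N (f c) \<le> K * lor (f c)" by (rule N_le[OF fS])
      also have "lor (f c) \<le> t / F n * F (b * n)"
        using t Fn supp[of c] by (intro lor_upper[of "{..<b * n}"]) (auto simp: f norm_mult v divide_right_mono)
      also have "\<dots> \<le> t / F n * (D * F n)" using n t Fn by (intro mult_left_mono) auto
      also have "\<dots> = D * t" using Fn by simp
      also have "\<dots> \<le> (1 + D) * t" using t by (intro mult_right_mono) auto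
      finally show ?thesis using K by (simp add: mult_left_mono mult.assoc)
    qed
    show "\<exists>x. (\<forall>i<b. x i \<in> S) \<and> (\<forall>c. (\<forall>i<b. norm (c i) \<le> K * (1 + D) * N (\<lambda>k. \<Sum>i<b. c i * x i k)) \<and>
      (\<forall>t\<ge>0. (\<forall>i<b. norm (c i) \<le> t) \<longrightarrow> N (\<lambda>k. \<Sum>i<b. c i * x i k) \<le> K * (1 + D) * t))"
      using xS lower upper unfolding f_def by (intro exI[of _ x]) blast
  qed
qed

text \<open>The lower estimate averages over the cyclic shifts of the blocks, which do not change the
  Lorentz norm and add up to a multiple of the indicator function of all blocks.\<close>

lemma not_l1:
  assumes "0 < D" "\<forall>b. \<exists>n\<ge>1. real b * F n \<le> D * F (b * n)"
  shows False
proof (rule not_superreflexive_if_l1_blocks[OF sr e, of "K + D * K ^ 3"])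
  show C0: "0 < K + D * K ^ 3" using K assms by (simp add: add_pos_nonneg)
  show "\<forall>b::nat. \<exists>x. (\<forall>i<b. x i \<in> S) \<and> (\<forall>c. (\<Sum>i<b. norm (c i)) \<le> (K + D * K ^ 3) * N (\<lambda>k. \<Sum>i<b. c i * x i k) \<and>
      N (\<lambda>k. \<Sum>i<b. c i * x i k) \<le> (K + D * K ^ 3) * (\<Sum>i<b. norm (c i)))"
  proof
    fix b :: nat
    obtain n where n: "1 \<le> n" "real b * F n \<le> D * F (b * n)" using assms by blast
    have Fn: "0 < F n" by (rule F_pos[OF n(1)])
    define idx where "idx = residue_block b n"
    define v :: 'k where "v = of_real (1 / F n)"
    have v: "norm v = 1 / F n" using Fn by (simp add: v_def norm_divide)
    define x where "x = (\<lambda>i k. if idx k = i then v else 0)"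
    define f where "f = (\<lambda>c k. \<Sum>i<b. c i * x i k)"
    have f: "f c k = (if idx k < b then c (idx k) * v else 0)" for c k
      unfolding f_def x_def by (rule block_sum)
    have idx: "idx k < b \<longleftrightarrow> k < b * n" for k by (simp add: idx_def residue_block_less)
    have card_idx: "card {k. idx k = i} = n" "finite {k. idx k = i}" if "i < b" for i
    proof -
      show "card {k. idx k = i} = n" unfolding idx_def by (rule card_residue_block[OF that])
      then show "finite {k. idx k = i}" using n by (intro card_ge_0_finite) simp
    qed
    have supp: "{k. f c k \<noteq> 0} \<subseteq> {..<b * n}" for c by (auto simp: f idx split: if_splits)
    have fS: "f c \<in> S" for c
      using supp finite_subset by (intro finite_support_in_S) blast
    have xS: "x i \<in> S" if "i < b" for i
    proof (rule finite_support_in_S)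
      have "{k. x i k \<noteq> 0} \<subseteq> {..<b * n}" using that idx by (auto simp: x_def split: if_splits)
      then show "finite {k. x i k \<noteq> 0}" by (rule finite_subset) simp
    qed
    have upper: "N (f c) \<le> K * (\<Sum>i<b. norm (c i))" for c
    proof -
      have "N (x i) \<le> K" if "i < b" for i
      proof -
        have "N (x i) \<le> K * lor (x i)" by (rule N_le[OF xS[OF that]])
        also have "lor (x i) \<le> 1 / F n * F n"
          using card_idx[OF that] Fn by (intro lor_upper[of "{k. idx k = i}"]) (auto simp: x_def v)
        finally show ?thesis using K Fn by simp
      qed
      then have Nx: "(\<Sum>i<b. norm (c i) * N (x i)) \<le> (\<Sum>i<b. norm (c i) * K)"
        by (intro sum_mono mult_left_mono) auto
      have "N (f c) \<le> (\<Sum>i<b. norm (c i) * N (x i))"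
        unfolding f_def by (rule normed_fspace_sum_le[OF S NS xS])
      also note Nx
      also have "(\<Sum>i<b. norm (c i) * K) = K * (\<Sum>i<b. norm (c i))"
        by (subst mult.commute) (simp only: sum_distrib_right)
      finally show ?thesis .
    qed
    have lower: "(\<Sum>i<b. norm (c i)) \<le> D * K ^ 3 * N (f c)" for c
    proof (cases "b = 0")
      case True
      then show ?thesis using assms(1) K normed_fspaceD(1)[OF NS fS, of c] by simp
    next
      case False
      \<comment> \<open>Rotated moduli of the coefficients give functions with the same
        rearrangement as \<open>f c\<close>, and the sum \<open>h\<close> over all rotations has
        constant modulus on the blocks.\<close>
      define c' :: "nat \<Rightarrow> nat \<Rightarrow> 'k" where "c' = (\<lambda>l i. of_real (norm (c ((l + i) mod b))))"
      define h where "h = (\<lambda>k. \<Sum>l<b. 1 * f (c' l) k)"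
      have superlevel: "finite {k. t < norm (f a k)} \<and> card {k. t < norm (f a k)} = n * (\<Sum>i<b. of_bool (t < norm (a i) / F n))"
        if "0 \<le> t" for t a
      proof -
        have eq: "{k. t < norm (f a k)} = (\<Union>i\<in>{i\<in>{..<b}. t < norm (a i) / F n}. {k. idx k = i})"
          using that by (auto simp: f norm_mult v)
        have "card (\<Union>i\<in>{i\<in>{..<b}. t < norm (a i) / F n}. {k. idx k = i}) = (\<Sum>i\<in>{i\<in>{..<b}. t < norm (a i) / F n}. card {k. idx k = i})"
          using card_idx by (intro card_UN_disjoint) auto
        also have "\<dots> = (\<Sum>i\<in>{i\<in>{..<b}. t < norm (a i) / F n}. n)"
          using card_idx by (intro sum.cong) auto
        also have "\<dots> = n * (\<Sum>i<b. of_bool (t < norm (a i) / F n))"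
          by (simp add: sum_of_bool_eq Int_def)
        finally show ?thesis unfolding eq using card_idx by auto
      qed
      have rearr: "rearrangement (f (c' l)) j = rearrangement (f c) j" for l j
      proof (rule rearrangement_eq_if_card_eq)
        fix t :: real assume t: "0 \<le> t"
        have "(\<Sum>i<b. of_bool (t < norm (c' l i) / F n) :: nat) = (\<Sum>i<b. of_bool (t < norm (c i) / F n))"
          using sum_rotate[where h = "\<lambda>i. of_bool (t < norm (c i) / F n) :: nat" and a = l and b = b] by (simp add: c'_def)
        then show "finite {k. t < norm (f (c' l) k)} \<and> finite {k. t < norm (f c k)} \<and>
            card {k. t < norm (f (c' l) k)} = card {k. t < norm (f c k)}"
          using superlevel[OF t, of "c' l"] superlevel[OF t, of c] by simp
      qed
      have lor_eq: "lor (f (c' l)) = lor (f c)" for l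
        unfolding lorentz_norm_def lorentz_term_def rearr ..
      define T where "T = (\<Sum>i<b. norm (c i))"
      have T0: "0 \<le> T" by (simp add: T_def sum_nonneg)
      have hS: "h \<in> S" unfolding h_def by (rule function_subspace_sum[OF S fS])
      have hval: "norm (h k) = T / F n" if "k < b * n" for k
      proof -
        have "h k = (\<Sum>l<b. of_real (norm (c ((idx k + l) mod b)))) * v"
          using that by (simp add: h_def f idx c'_def sum_distrib_right add.commute)
        also have "\<dots> = (\<Sum>i<b. of_real (norm (c i))) * v"
          using sum_rotate[where h = "\<lambda>i. of_real (norm (c i)) :: 'k" and a = "idx k" and b = b] by simp
        also have "\<dots> = of_real T * v" by (simp add: T_def)
        finally show ?thesis using T0 by (simp add: norm_mult v)
      qed
      \<comment> \<open>The hypothesis enters here: \<open>h\<close> has modulus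
        \<open>T / F n\<close> on \<open>b * n\<close> coordinates, so its quasi-norm is at least
        \<open>T * b / D\<close>, while the triangle inequality for \<open>N\<close> bounds it by
        \<open>b\<close> times the norm of \<open>f c\<close>, up to powers of
        \<open>K\<close>.\<close>
      have "T * real b / D \<le> T / F n * F (b * n)"
      proof -
        have "T / F n * (real b * F n) \<le> T / F n * (D * F (b * n))" using n T0 Fn by (intro mult_left_mono) auto
        then show ?thesis using Fn assms(1) by (simp add: field_simps)
      qed
      also have "\<dots> \<le> lor h"
        using hval T0 Fn by (intro lor_lower[OF hS, of "{..<b * n}"]) auto
      also have "\<dots> \<le> K * N h" by (rule lor_le[OF hS])
      also have "N h \<le> (\<Sum>l<b. norm (1 :: 'k) * N (f (c' l)))"
        unfolding h_def by (rule normed_fspace_sum_le[OF S NS fS])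
      also have "\<dots> \<le> (\<Sum>l<b. K * (K * N (f c)))"
      proof (rule sum_mono)
        fix l
        have "N (f (c' l)) \<le> K * lor (f (c' l))" by (rule N_le[OF fS])
        also have "\<dots> \<le> K * (K * N (f c))" unfolding lor_eq using K by (intro mult_left_mono lor_le[OF fS]) auto
        finally show "norm (1 :: 'k) * N (f (c' l)) \<le> K * (K * N (f c))" by simp
      qed
      finally have "T * real b / D \<le> K * (real b * (K * (K * N (f c))))" using K by simp
      then have "T * real b \<le> (D * K ^ 3 * N (f c)) * real b"
        using assms(1) by (simp add: pos_divide_le_eq power3_eq_cube mult_ac)
      then show ?thesis using False by (simp add: T_def)
    qed
    have "(\<Sum>i<b. norm (c i)) \<le> (K + D * K ^ 3) * N (f c)" for c
      using lower[of c] K normed_fspaceD(1)[OF NS fS, of c] by (simp add: distrib_right add_increasing)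
    moreover have "N (f c) \<le> (K + D * K ^ 3) * (\<Sum>i<b. norm (c i))" for c
      using upper[of c] K assms(1) by (simp add: distrib_right add_increasing2 sum_nonneg)
    ultimately show "\<exists>x. (\<forall>i<b. x i \<in> S) \<and> (\<forall>c. (\<Sum>i<b. norm (c i)) \<le> (K + D * K ^ 3) * N (\<lambda>k. \<Sum>i<b. c i * x i k) \<and>
      N (\<lambda>k. \<Sum>i<b. c i * x i k) \<le> (K + D * K ^ 3) * (\<Sum>i<b. norm (c i)))"
      using xS unfolding f_def by (intro exI[of _ x]) blast
  qed
qed

text \<open>Take disjoint blocks of length \<open>2 ^ i\<close> and height
  \<open>1 / s (2 ^ i)\<close>. With coefficients bounded by \<open>t\<close> their sum has
  quasi-norm at most \<open>D * t\<close>, because by doubling a coordinate larger than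
  \<open>D * t / s n\<close> must be among the first \<open>n - 1\<close>. So the blocks span copies
  of \<open>l_inf\<close>.\<close>

lemma not_infinite:
  assumes "doubling s" shows "q \<noteq> \<infinity>"
proof
  assume q: "q = \<infinity>"
  obtain D where D: "\<And>m. 1 \<le> m \<Longrightarrow> s m / s (nat \<lceil>real m / 2\<rceil>) \<le> D"
    using assms by (auto simp: doubling_def bdd_above_def)
  have "nat \<lceil>real 1 / 2\<rceil> = 1" by linarith
  then have D1: "1 \<le> D" using D[of 1] s_pos[of 1] by simp
  have half: "s m \<le> D * s j" if "1 \<le> m" "m \<le> 2 * j" for m j
  proof -
    have h: "1 \<le> nat \<lceil>real m / 2\<rceil>" "nat \<lceil>real m / 2\<rceil> \<le> j" using that by linarith+
    have "s m \<le> D * s (nat \<lceil>real m / 2\<rceil>)" using D[OF that(1)] s_pos[OF h(1)] by (simp add: pos_divide_le_eq)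
    also have "\<dots> \<le> D * s j" using D1 h by (intro mult_left_mono s_mono) auto
    finally show ?thesis .
  qed
  have F: "F m = s m" for m by (rule trans[OF F_def if_P[OF q]])
  \<comment> \<open>The blocks before the \<open>i\<close>-th have total length
    \<open>2 ^ i - 1\<close>.\<close>
  define M :: "nat \<Rightarrow> nat" where "M = (\<lambda>i. 2 ^ i - 1)"
  have M: "strict_mono M" "M 0 = 0" by (auto simp: M_def strict_mono_Suc_iff less_diff_conv intro!: diff_less_mono)
  define idx where "idx = interval_block M"
  have idx: "idx k = i \<longleftrightarrow> M i \<le> k \<and> k < M (Suc i)" for k i
    unfolding idx_def by (rule interval_block_iff[OF M])
  have card_idx: "card {k. idx k = i} = 2 ^ i" "finite {k. idx k = i}" for i
  proof -
    have eq: "{k. idx k = i} = {M i..<M (Suc i)}" by (auto simp: idx)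
    show "card {k. idx k = i} = 2 ^ i" "finite {k. idx k = i}" unfolding eq by (simp_all add: M_def)
  qed
  define v :: "nat \<Rightarrow> 'k" where "v = (\<lambda>i. of_real (1 / s (2 ^ i)))"
  have sp: "0 < s (2 ^ i)" for i by (rule s_pos) simp
  have v: "norm (v i) = 1 / s (2 ^ i)" for i using sp[of i] by (simp add: v_def norm_divide)
  define x where "x = (\<lambda>i k. if idx k = i then v i else 0)"
  have xS: "x i \<in> S" for i
  proof (rule finite_support_in_S)
    have "{k. x i k \<noteq> 0} \<subseteq> {k. idx k = i}" by (auto simp: x_def split: if_splits)
    then show "finite {k. x i k \<noteq> 0}" by (rule finite_subset) (rule card_idx)
  qed
  show False
  proof (rule not_superreflexive_if_linf_blocks[OF sr e, of "K * D"])
    show "0 < K * D" using K D1 by simp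
    show "\<forall>b::nat. \<exists>x. (\<forall>i<b. x i \<in> S) \<and> (\<forall>c. (\<forall>i<b. norm (c i) \<le> K * D * N (\<lambda>k. \<Sum>i<b. c i * x i k)) \<and>
      (\<forall>t\<ge>0. (\<forall>i<b. norm (c i) \<le> t) \<longrightarrow> N (\<lambda>k. \<Sum>i<b. c i * x i k) \<le> K * D * t))"
    proof (intro allI exI[of _ x] conjI impI)
      fix b :: nat and c :: "nat \<Rightarrow> 'k"
      show "x i \<in> S" for i by (rule xS)
      define f where "f = (\<lambda>k. \<Sum>i<b. c i * x i k)"
      have f: "f k = (if idx k < b then c (idx k) * v (idx k) else 0)" for k
        unfolding f_def x_def by (rule block_sum)
      have fS: "f \<in> S" unfolding f_def by (rule function_subspace_sum[OF S xS])
      show "norm (c i) \<le> K * D * N (\<lambda>k. \<Sum>i<b. c i * x i k)" if "i < b" for i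
      proof -
        have "norm (c i) / s (2 ^ i) * F (2 ^ i) \<le> lor f"
          using that sp[of i] card_idx[of i] by (intro lor_lower[OF fS, of "{k. idx k = i}"]) (auto simp: f norm_mult v)
        also have "\<dots> \<le> K * N f" by (rule lor_le[OF fS])
        also have "\<dots> \<le> K * D * N f"
          using K D1 normed_fspaceD(1)[OF NS fS] by (intro mult_right_mono) auto
        finally show ?thesis using sp[of i] by (simp add: F f_def)
      qed
      fix t :: real assume t: "0 \<le> t" "\<forall>i<b. norm (c i) \<le> t"
      have "rearrangement f n * s n \<le> D * t" if n: "1 \<le> n" for n
      proof -
        have "{k. D * t / s n < norm (f k)} \<subseteq> {..<n - 1}"
        proof
          fix k assume "k \<in> {k. D * t / s n < norm (f k)}"
          then have k: "D * t / s n < norm (f k)" by simp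
          moreover have "0 \<le> D * t / s n" using D1 t s_pos[OF n] by simp
          ultimately have ib: "idx k < b" by (auto simp: f split: if_splits)
          define i where "i = idx k"
          have "norm (f k) \<le> t / s (2 ^ i)"
            using t ib sp[of i] by (simp add: f norm_mult v i_def divide_right_mono)
          with k have "D * t / s n < t / s (2 ^ i)" by linarith
          then have lt: "D * s (2 ^ i) * t < s n * t" using sp[of i] s_pos[OF n] by (simp add: field_simps)
          show "k \<in> {..<n - 1}"
          proof (rule ccontr)
            assume "k \<notin> {..<n - 1}"
            moreover have "k < M (Suc i)" using idx[of k i] by (simp add: i_def)
            ultimately have "n \<le> 2 * 2 ^ i" by (simp add: M_def)
            then have "s n * t \<le> D * s (2 ^ i) * t" using half[OF n] t by (intro mult_right_mono) auto
            then show False using lt by simp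
          qed
        qed
        then have "finite {k. D * t / s n < norm (f k)}" "card {k. D * t / s n < norm (f k)} \<le> n - 1"
          using finite_subset card_mono[of "{..<n - 1}"] by fastforce+
        then have "rearrangement f n \<le> D * t / s n"
          using n D1 t s_pos[OF n] by (intro rearrangement_le) auto
        then show ?thesis using s_pos[OF n] by (simp add: pos_le_divide_eq)
      qed
      then have "lor f \<le> D * t" unfolding lor_infinite[OF q] by (intro cSup_least) auto
      then have "K * lor f \<le> K * (D * t)" using K by (intro mult_left_mono) auto
      then show "N (\<lambda>k. \<Sum>i<b. c i * x i k) \<le> K * D * t" using N_le[OF fS] by (simp add: f_def mult.assoc)
    qed
  qed
qed

text \<open>For an exponent at most 1, blocks of rapidly growing length span \<open>l_1\<close>. Up
  to position \<open>M (Suc j)\<close> the rearrangement is at least the height of block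
  \<open>j\<close>, and since \<open>W\<close> doubles, at least half of the mass of that block is
  collected beyond position \<open>M j\<close>. These ranges are disjoint for different
  \<open>j\<close>, so the sum of \<open>norm (c j) powr r\<close> is controlled, and with it the
  \<open>l_1\<close>-norm. The other estimate is the triangle inequality for
  \<open>N\<close>.\<close>

lemma one_less_exponent:
  assumes q: "q \<noteq> \<infinity>" and unbdd: "\<forall>B. \<exists>m. B < W m" shows "1 < r"
proof (rule ccontr)
  assume "\<not> 1 < r"
  then have r: "0 < r" "r \<le> 1" using r_pos[OF q] by auto
  have "\<forall>m. \<exists>m'. 2 * W m + 1 < W m'" using unbdd by blast
  from choice[OF this] obtain g where g: "\<And>m. 2 * W m + 1 < W (g m)" by blast
  define M where "M = (\<lambda>i. (g ^^ i) 0)"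
  have M_Suc: "M (Suc i) = g (M i)" for i by (simp add: M_def)
  have "m < g m" for m using g[of m] W_mono[of "g m" m] W_nonneg[of m] by (force simp: not_less[symmetric])
  then have M: "strict_mono M" unfolding strict_mono_Suc_iff M_Suc by blast
  have M0: "M 0 = 0" by (simp add: M_def)
  have M1: "1 \<le> M (Suc i)" for i using strict_mono_imp_increasing[OF M, of "Suc i"] by simp
  have WM: "2 * W (M i) \<le> W (M (Suc i))" for i using g[of "M i"] by (simp add: M_Suc)
  \<comment> \<open>The blocks of lengths \<open>M (Suc i)\<close> are laid end to end, and
    \<open>P i\<close> is the total length before the \<open>i\<close>-th. The positions
    \<open>M j\<close> refer to the rearrangement instead.\<close>
  define P where "P = (\<lambda>i. \<Sum>j<i. M (Suc j))"
  have P: "strict_mono P" "P 0 = 0" using M1 by (auto simp: P_def strict_mono_Suc_iff Suc_le_eq)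
  define idx where "idx = interval_block P"
  have idx: "idx k = i \<longleftrightarrow> P i \<le> k \<and> k < P (Suc i)" for k i
    unfolding idx_def by (rule interval_block_iff[OF P])
  have card_idx: "card {k. idx k = i} = M (Suc i)" "finite {k. idx k = i}" for i
  proof -
    have eq: "{k. idx k = i} = {P i..<P (Suc i)}" by (auto simp: idx)
    show "card {k. idx k = i} = M (Suc i)" "finite {k. idx k = i}" unfolding eq by (simp_all add: P_def)
  qed
  define v :: "nat \<Rightarrow> 'k" where "v = (\<lambda>i. of_real (1 / F (M (Suc i))))"
  have Fp: "0 < F (M (Suc i))" for i by (rule F_pos[OF M1])
  have v: "norm (v i) = 1 / F (M (Suc i))" for i using Fp[of i] by (simp add: v_def norm_divide)
  have Fr: "F (M (Suc i)) powr r = W (M (Suc i))" for i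
    using q r W_nonneg[of "M (Suc i)"] by (simp add: F_def powr_powr)
  define x where "x = (\<lambda>i k. if idx k = i then v i else 0)"
  have xS: "x i \<in> S" for i
  proof (rule finite_support_in_S)
    have "{k. x i k \<noteq> 0} \<subseteq> {k. idx k = i}" by (auto simp: x_def split: if_splits)
    then show "finite {k. x i k \<noteq> 0}" by (rule finite_subset) (rule card_idx)
  qed
  have Nx: "N (x i) \<le> K" for i
  proof -
    have "N (x i) \<le> K * lor (x i)" by (rule N_le[OF xS])
    also have "lor (x i) \<le> 1 / F (M (Suc i)) * F (M (Suc i))"
      using card_idx[of i] Fp[of i] by (intro lor_upper[of "{k. idx k = i}"]) (auto simp: x_def v)
    finally show ?thesis using K Fp[of i] by simp
  qed
  define R where "R = 2 powr (1 / r)"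
  have R: "0 < R" by (simp add: R_def)
  show False
  proof (rule not_superreflexive_if_l1_blocks[OF sr e, of "K * (1 + R)"])
    show "0 < K * (1 + R)" using K R by simp
    show "\<forall>b::nat. \<exists>x. (\<forall>i<b. x i \<in> S) \<and> (\<forall>c. (\<Sum>i<b. norm (c i)) \<le> K * (1 + R) * N (\<lambda>k. \<Sum>i<b. c i * x i k) \<and>
      N (\<lambda>k. \<Sum>i<b. c i * x i k) \<le> K * (1 + R) * (\<Sum>i<b. norm (c i)))"
    proof (intro allI exI[of _ x] conjI impI)
      fix b :: nat and c :: "nat \<Rightarrow> 'k"
      show "x i \<in> S" for i by (rule xS)
      define f where "f = (\<lambda>k. \<Sum>i<b. c i * x i k)"
      have f: "f k = (if idx k < b then c (idx k) * v (idx k) else 0)" for k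
        unfolding f_def x_def by (rule block_sum)
      have fS: "f \<in> S" unfolding f_def by (rule function_subspace_sum[OF S xS])
      have "N f \<le> (\<Sum>i<b. norm (c i) * N (x i))"
        unfolding f_def by (rule normed_fspace_sum_le[OF S NS xS])
      also have "\<dots> \<le> (\<Sum>i<b. norm (c i) * (K * (1 + R)))"
      proof (intro sum_mono mult_left_mono)
        have "K * 1 \<le> K * (1 + R)" using K R by (intro mult_left_mono) auto
        then show "N (x i) \<le> K * (1 + R)" for i using Nx[of i] by simp
      qed auto
      also have "\<dots> = K * (1 + R) * (\<Sum>i<b. norm (c i))"
        by (subst mult.commute) (simp only: sum_distrib_right)
      finally show "N (\<lambda>k. \<Sum>i<b. c i * x i k) \<le> K * (1 + R) * (\<Sum>i<b. norm (c i))" by (simp add: f_def)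
      define T where "T = (\<lambda>n. rearrangement f n powr r * (s n powr (r - 1) * w n))"
      have "(\<Sum>i<j. norm (c i) powr r) \<le> 2 * sum T {1..M j}" if "j \<le> b" for j
        using that
      proof (induction j)
        case 0
        then show ?case by (simp add: M0)
      next
        case (Suc j)
        have MM: "M j \<le> M (Suc j)" using strict_monoD[OF M, of j "Suc j"] by simp
        define t where "t = norm (c j) / F (M (Suc j))"
        have t: "0 \<le> t" using Fp[of j] by (simp add: t_def)
        \<comment> \<open>All \<open>M (Suc j)\<close> coordinates of block \<open>j\<close> have
          modulus \<open>t\<close>, so \<open>t\<close> bounds the rearrangement from below up to
          that position, whatever the other coefficients are.\<close>
        have "t powr r * (s n powr (r - 1) * w n) \<le> T n" if n: "n \<in> {M j<..M (Suc j)}" for n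
        proof -
          have "t \<le> rearrangement f n"
            using n card_idx[of j] Suc.prems
            by (intro rearrangement_ge[OF S_tendsto[OF fS], of _ "{k. idx k = j}"]) (auto simp: f norm_mult v t_def)
          then show ?thesis
            unfolding T_def using t r w_nonneg[of n] n by (intro mult_right_mono powr_mono2) auto
        qed
        then have "(\<Sum>n\<in>{M j<..M (Suc j)}. t powr r * (s n powr (r - 1) * w n)) \<le> sum T {M j<..M (Suc j)}"
          by (intro sum_mono)
        moreover have "(\<Sum>n\<in>{M j<..M (Suc j)}. s n powr (r - 1) * w n) = W (M (Suc j)) - W (M j)"
          using sum_from_1_split[OF MM, of "\<lambda>n. s n powr (r - 1) * w n"] by (simp add: W_def)
        ultimately have 1: "t powr r * (W (M (Suc j)) - W (M j)) \<le> sum T {M j<..M (Suc j)}"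
          by (simp add: sum_distrib_left[symmetric])
        have "norm (c j) powr r = t powr r * W (M (Suc j))"
          using Fp[of j] by (simp add: t_def powr_divide Fr[symmetric])
        also have "\<dots> \<le> t powr r * (2 * (W (M (Suc j)) - W (M j)))"
          using WM[of j] by (intro mult_left_mono) auto
        also have "\<dots> = 2 * (t powr r * (W (M (Suc j)) - W (M j)))" by (rule mult.left_commute)
        also have "\<dots> \<le> 2 * sum T {M j<..M (Suc j)}" using 1 by (intro mult_left_mono) auto
        finally show ?case
          using Suc sum_from_1_split[OF MM, of T] by simp
      qed
      then have "(\<Sum>i<b. norm (c i) powr r) \<le> 2 * sum T {1..M b}" by simp
      also have "\<dots> \<le> 2 * lor f powr r" unfolding T_def using sum_le_lor[OF fS q] by simp
      finally have "(\<Sum>i<b. norm (c i) powr r) powr (1 / r) \<le> (2 * lor f powr r) powr (1 / r)"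
        using r by (intro powr_mono2) (auto simp: sum_nonneg)
      also have "\<dots> = R * lor f" using r lor_nonneg[OF fS] by (simp add: R_def powr_mult powr_powr)
      finally have "(\<Sum>i<b. norm (c i)) \<le> R * lor f"
        using sum_le_powr_sum[OF r, of b "\<lambda>i. norm (c i)"] by simp
      also have "\<dots> \<le> (1 + R) * (K * N f)"
        using lor_le[OF fS] lor_nonneg[OF fS] R by (intro mult_mono) auto
      finally show "(\<Sum>i<b. norm (c i)) \<le> K * (1 + R) * N (\<lambda>k. \<Sum>i<b. c i * x i k)"
        by (simp add: f_def mult_ac)
    qed
  qed
qed

text \<open>Otherwise \<open>F\<close> is bounded, and blocks of a single coordinate already span
  copies of \<open>l_inf\<close>.\<close>

lemma W_unbounded:
  assumes q: "q \<noteq> \<infinity>" shows "\<forall>B. \<exists>m. B < W m"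
proof (rule ccontr)
  assume "\<not> ?thesis"
  then obtain B where B: "\<And>m. W m \<le> B" by (auto simp: not_less)
  have "0 < B" using B[of 1] W_pos[of 1] by simp
  define D where "D = B powr (1 / r) / F 1"
  have F1: "0 < F 1" by (rule F_pos) simp
  have "F (b * 1) \<le> D * F 1" for b
  proof -
    have "F b \<le> B powr (1 / r)"
      using q B[of b] W_nonneg[of b] r_pos[OF q] by (auto simp: F_def intro!: powr_mono2)
    then show ?thesis using F1 by (simp add: D_def)
  qed
  moreover have "0 < D" using F1 \<open>0 < B\<close> by (simp add: D_def)
  ultimately show False using not_linf[of D] by blast
qed

text \<open>\<open>W m\<close> is a Riemann sum for the integral of \<open>x powr (r - 1)\<close>
  from 0 to \<open>s m\<close>. So \<open>F\<close> is equivalent to \<open>s\<close> when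
  \<open>1 < r\<close>, and failure of a regularity property of \<open>s\<close> becomes a statement
  on the norms of blocks.\<close>

lemma W_bounds:
  assumes "1 < r" shows "W m \<le> s m powr r" "s m powr r \<le> r * W m"
proof -
  have s0: "0 \<le> s n" for n using s_mono[of 0 n] by (simp add: primitive_seq_def)
  have "W m \<le> (\<Sum>n=1..m. s m powr (r - 1) * w n)"
    unfolding W_def using assms w_nonneg s0 s_mono by (intro sum_mono mult_right_mono powr_mono2) auto
  also have "\<dots> = s m powr (r - 1) * s m" by (simp add: primitive_seq_def sum_distrib_left)
  also have "\<dots> = s m powr r" using s0[of m] by (cases "s m = 0") (auto simp: powr_diff)
  finally show "W m \<le> s m powr r" .
  show "s m powr r \<le> r * W m"
  proof (induction m)
    case 0
    then show ?case using assms by (simp add: W_def primitive_seq_def)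
  next
    case (Suc m)
    have Suc_s: "s (Suc m) = s m + w (Suc m)" by (simp add: primitive_seq_def)
    have "s (Suc m) powr r - s m powr r \<le> r * s (Suc m) powr (r - 1) * (s (Suc m) - s m)"
      using assms s0 s_mono[of m "Suc m"] by (intro powr_diff_tangent) auto
    moreover have "W (Suc m) = W m + s (Suc m) powr (r - 1) * w (Suc m)" by (simp add: W_def)
    ultimately show ?case using Suc by (simp add: Suc_s distrib_left mult.assoc)
  qed
qed

theorem exponent_and_regularity:
  assumes "doubling s"
  shows "1 < q" "q < \<infinity>" "LRP s" "URP s"
proof -
  have q: "q \<noteq> \<infinity>" by (rule not_infinite[OF assms])
  then show "q < \<infinity>" by simp
  have r1: "1 < r" by (rule one_less_exponent[OF q W_unbounded[OF q]])
  then show "1 < q" using q q_pos by (cases q) auto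
  define D where "D = r powr (1 / r)"
  have D: "0 < D" using r1 by (simp add: D_def)
  have s0: "0 \<le> s n" for n using s_mono[of 0 n] by (simp add: primitive_seq_def)
  have Fs: "F m \<le> s m" for m
  proof -
    have "F m \<le> (s m powr r) powr (1 / r)"
      using q W_bounds(1)[OF r1, of m] W_nonneg[of m] r1 by (auto simp: F_def intro!: powr_mono2)
    then show ?thesis using r1 s0[of m] by (simp add: powr_powr)
  qed
  have sF: "s m \<le> D * F m" for m
  proof -
    have "s m = (s m powr r) powr (1 / r)" using r1 s0[of m] by (simp add: powr_powr)
    also have "\<dots> \<le> (r * W m) powr (1 / r)" using W_bounds(2)[OF r1, of m] r1 by (intro powr_mono2) auto
    also have "\<dots> = D * F m" using q by (simp add: D_def F_def powr_mult)
    finally show ?thesis .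
  qed
  show "LRP s"
  proof (rule ccontr)
    assume "\<not> LRP s"
    then have n: "\<exists>n\<ge>1. s (b * n) < 2 * s n" if "2 \<le> b" for b
      using that unfolding LRP_def by (meson not_le)
    have "\<exists>n\<ge>1. F (b * n) \<le> (1 + 2 * D) * F n" for b
    proof (cases "2 \<le> b")
      case True
      then obtain n where "1 \<le> n" "s (b * n) < 2 * s n" using n by blast
      moreover have "0 \<le> F n" by (rule F_nonneg)
      ultimately show ?thesis
        using Fs[of "b * n"] sF[of n] by (intro exI[of _ n]) (simp add: algebra_simps)
    next
      case False
      \<comment> \<open>For \<open>b < 2\<close> the estimate is immediate with
        \<open>n = 1\<close>; only \<open>2 \<le> b\<close> draws on the failure of the LRP.\<close>
      then have "b * 1 \<le> 1" by simp
      then have "F (b * 1) \<le> F 1" using W_mono[of "b * 1" 1] W_nonneg r1 q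
        by (auto simp: F_def intro!: powr_mono2)
      moreover have "0 \<le> D * F 1" using D F_nonneg by simp
      ultimately show ?thesis by (intro exI[of _ 1]) (simp add: algebra_simps)
    qed
    then show False using not_linf[of "1 + 2 * D"] D by simp
  qed
  show "URP s"
  proof (rule ccontr)
    assume "\<not> URP s"
    then have n: "\<exists>n\<ge>1. real b / 2 * s n < s (b * n)" if "2 \<le> b" for b
      using that unfolding URP_def by (meson not_le)
    have "\<exists>n\<ge>1. real b * F n \<le> (1 + 2 * D) * F (b * n)" for b
    proof (cases "2 \<le> b")
      case True
      then obtain n where n: "1 \<le> n" "real b / 2 * s n < s (b * n)" using n by blast
      have "real b * F n \<le> real b * s n" using Fs by (intro mult_left_mono) auto
      also have "\<dots> \<le> 2 * (D * F (b * n))" using n(2) sF[of "b * n"] by simp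
      also have "\<dots> \<le> (1 + 2 * D) * F (b * n)" using F_nonneg[of "b * n"] by (simp add: algebra_simps)
      finally show ?thesis using n by blast
    next
      case False
      then have "b = 0 \<or> b = 1" by auto
      moreover have "F 1 \<le> (1 + 2 * D) * F 1" using F_nonneg[of 1] D by (simp add: algebra_simps)
      ultimately show ?thesis
        using F_nonneg[of 0] D by (intro exI[of _ 1]) auto
    qed
    then show False using not_l1[of "1 + 2 * D"] D by simp
  qed
qed

end

lemma regular_if_superreflexive:
  fixes e :: "(nat \<Rightarrow> 'k::{real_normed_field, euclidean_space}) \<Rightarrow> 'v"
  assumes "is_weight w" "doubling (primitive_seq w)" "0 < q" "inj e"
    and sr: "superreflexive TYPE('v) (lorentz_space w q :: ('k, nat \<Rightarrow> 'k) nspace)"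
  shows "1 < q \<and> q < \<infinity> \<and> LRP (primitive_seq w) \<and> URP (primitive_seq w)"
proof -
  obtain N where qb: "quasi_banach (lorentz_space w q :: ('k, nat \<Rightarrow> 'k) nspace)"
    and N: "is_norm ((lorentz_space w q :: ('k, nat \<Rightarrow> 'k) nspace)\<lparr>vnorm := N\<rparr>)"
    and eq: "equivalent_to_vnorm (lorentz_space w q :: ('k, nat \<Rightarrow> 'k) nspace) N"
    and srb: "superreflexive_banach TYPE('v) ((lorentz_space w q :: ('k, nat \<Rightarrow> 'k) nspace)\<lparr>vnorm := N\<rparr>)"
    using sr unfolding superreflexive_def by blast
  note fs = lorentz_space_eq_fspace fspace_vnorm_update fspace_simps
  have nn: "0 \<le> lorentz_norm w q f" "0 \<le> N f" if "f \<in> lorentz_set w q" for f :: "nat \<Rightarrow> 'k"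
    using that qb N by (auto simp: quasi_banach_def is_norm_def is_quasinorm_def lorentz_space_eq_fspace)
  obtain c C where c: "0 < c" "\<And>f :: nat \<Rightarrow> 'k. f \<in> lorentz_set w q \<Longrightarrow> c * N f \<le> lorentz_norm w q f"
    "\<And>f :: nat \<Rightarrow> 'k. f \<in> lorentz_set w q \<Longrightarrow> lorentz_norm w q f \<le> C * N f"
    using eq by (auto simp: equivalent_to_vnorm_def lorentz_space_eq_fspace)
  define K where "K = max (1 / c) C"
  have "lorentz_superreflexive w q N K e"
  proof (unfold_locales)
    show "is_weight w" "0 < q" "inj e" by (rule assms)+
    show "superreflexive_banach TYPE('v) (fspace (lorentz_set w q) N)" using srb by (simp only: fs)
    show "0 < K" using c(1) by (simp add: K_def less_max_iff_disj)
    fix f :: "nat \<Rightarrow> 'k" assume f: "f \<in> lorentz_set w q"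
    have "N f \<le> 1 / c * lorentz_norm w q f" using c(1) c(2)[OF f] by (simp add: field_simps)
    also have "\<dots> \<le> K * lorentz_norm w q f" using nn[OF f] by (intro mult_right_mono) (auto simp: K_def)
    finally show "N f \<le> K * lorentz_norm w q f" .
    have "lorentz_norm w q f \<le> C * N f" by (rule c(3)[OF f])
    also have "\<dots> \<le> K * N f" using nn[OF f] by (intro mult_right_mono) (auto simp: K_def)
    finally show "lorentz_norm w q f \<le> K * N f" .
  qed
  then interpret lorentz_superreflexive w q N K e .
  show ?thesis using exponent_and_regularity[OF assms(2)] by blast
qed

subsection \<open>Regular Lorentz spaces are superreflexive\<close>

text \<open>The LRP passes from \<open>a\<close> to every larger base because \<open>s\<close> is
  monotone. The URP passes from \<open>b\<close> to its powers because
  \<open>(b / 2) ^ k \<le> b ^ k / 2\<close>. So a power of \<open>b\<close> above \<open>a\<close>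
  serves both.\<close>

lemma common_base:
  assumes "is_weight w" "LRP (primitive_seq w)" "URP (primitive_seq w)"
  obtains \<beta> where "2 \<le> \<beta>" "\<And>n. 1 \<le> n \<Longrightarrow> 2 * primitive_seq w n \<le> primitive_seq w (\<beta> * n)"
    "\<And>n. 1 \<le> n \<Longrightarrow> primitive_seq w (\<beta> * n) \<le> real \<beta> / 2 * primitive_seq w n"
proof -
  interpret weight w by unfold_locales (rule assms(1))
  obtain a where a: "2 \<le> a" "\<And>n. 1 \<le> n \<Longrightarrow> 2 * s n \<le> s (a * n)" using assms(2) by (auto simp: LRP_def)
  obtain b where b: "2 \<le> b" "\<And>n. 1 \<le> n \<Longrightarrow> s (b * n) \<le> real b / 2 * s n" using assms(3) by (auto simp: URP_def)
  have pow: "s (b ^ k * n) \<le> (real b / 2) ^ k * s n" if "1 \<le> n" for k n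
  proof (induction k)
    case (Suc k)
    have "1 \<le> b ^ k * n" using b(1) that by simp
    then have "s (b * (b ^ k * n)) \<le> real b / 2 * s (b ^ k * n)" by (rule b(2))
    also have "\<dots> \<le> real b / 2 * ((real b / 2) ^ k * s n)" using Suc by (intro mult_left_mono) auto
    finally show ?case by (simp add: mult.assoc)
  qed simp
  define k where "k = Suc a"
  have ak: "a < b ^ k"
  proof -
    have "a < b ^ a" using b(1) by (intro power_gt_expt) auto
    also have "\<dots> \<le> b ^ k" using b(1) by (simp add: k_def)
    finally show ?thesis .
  qed
  show ?thesis
  proof (rule that[of "b ^ k"])
    show "2 \<le> b ^ k" using a(1) ak by linarith
    fix n :: nat assume n: "1 \<le> n"
    have "2 * s n \<le> s (a * n)" by (rule a(2)[OF n])
    also have "\<dots> \<le> s (b ^ k * n)" using ak by (intro s_mono mult_right_mono) auto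
    finally show "2 * s n \<le> s (b ^ k * n)" .
    have "s (b ^ k * n) \<le> (real b / 2) ^ k * s n" by (rule pow[OF n])
    also have "\<dots> \<le> real (b ^ k) / 2 * s n"
    proof (rule mult_right_mono)
      have "(2::real) ^ 1 \<le> 2 ^ k" by (intro power_increasing) (auto simp: k_def)
      then show "(real b / 2) ^ k \<le> real (b ^ k) / 2"
        unfolding power_divide of_nat_power by (intro divide_left_mono) auto
      show "0 \<le> s n" using s_pos[OF n] by simp
    qed
    finally show "s (b ^ k * n) \<le> real (b ^ k) / 2 * s n" .
  qed
qed

text \<open>The values \<open>\<rho> = 7/8\<close> and \<open>\<eta> = 6/7\<close> are a choice of
  numbers below 1 with \<open>1 / (2 * \<rho>) < \<eta>\<close>, here 4/7 < 6/7. So the first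
  condition holds strictly at \<open>r = 1\<close> and by continuity for some \<open>r > 1\<close>;
  the second holds for large \<open>m\<close> because \<open>2 * \<rho> > 1\<close>.\<close>

lemma exists_exponents:
  fixes \<beta> :: nat
  assumes "2 \<le> \<beta>"
  obtains r m where "1 < r" "(real \<beta> / (2 * (7/8))) powr r \<le> 6/7 * real \<beta>"
    "real \<beta> \<le> 6/7 * (2 * (7/8)) powr (r * real (Suc m))"
proof -
  define a where "a = real \<beta> / (2 * (7/8))"
  have a: "0 < a" "a < 6/7 * real \<beta>" using assms by (auto simp: a_def)
  have "((\<lambda>r. a powr r) \<longlongrightarrow> a powr 1) (at_right 1)"
    using a by (intro tendsto_powr tendsto_const tendsto_ident_at) auto
  then have "\<forall>\<^sub>F r in at_right 1. a powr r < 6/7 * real \<beta>"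
    using a by (intro order_tendstoD(2)) auto
  then obtain d where d: "1 < d" "\<And>r. 1 < r \<Longrightarrow> r < d \<Longrightarrow> a powr r < 6/7 * real \<beta>"
    by (auto simp: eventually_at_right_field)
  define r where "r = (1 + d) / 2"
  have r: "1 < r" "r < d" using d(1) by (auto simp: r_def field_simps)
  obtain m where m: "7/6 * real \<beta> < (7/4) ^ m" using real_arch_pow[of "7/4" "7/6 * real \<beta>"] by auto
  have "(7/4 :: real) ^ m = (7/4) powr real m" by (simp add: powr_realpow)
  also have "\<dots> \<le> (7/4) powr (r * real (Suc m))"
  proof (rule powr_mono)
    have "1 * real m \<le> r * real (Suc m)" using r by (intro mult_mono) auto
    then show "real m \<le> r * real (Suc m)" by simp
  qed simp
  finally have "real \<beta> \<le> 6/7 * (7/4) powr (r * real (Suc m))" using m by simp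
  then show ?thesis using that[of r m] r d(2)[OF r] by (simp add: a_def)
qed

lemma lorentz_norm_scale:
  fixes f :: "nat \<Rightarrow> 'k::real_normed_field"
  assumes "is_weight w" "0 < q" "f \<in> lorentz_set w (ereal q)"
  shows "lorentz_norm w (ereal q) (\<lambda>k. c * f k) = norm c * lorentz_norm w (ereal q) f"
proof -
  interpret weight w by unfold_locales (rule assms(1))
  have f: "f \<longlonglongrightarrow> 0" "summable (\<lambda>i. lorentz_term w q f (Suc i))"
    using assms(3) by (auto simp: lorentz_set_def)
  have cf: "(\<lambda>k. c * f k) \<longlonglongrightarrow> 0" by (rule tendsto_mult_right_zero[OF f(1)])
  have "lorentz_term w q (\<lambda>k. c * f k) (Suc i) = norm c powr q * lorentz_term w q f (Suc i)" for i
  proof -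
    have "rearrangement (\<lambda>k. c * f k) (Suc i) = norm c * rearrangement f (Suc i)"
      by (rule rearrangement_scale[OF f(1) cf]) (auto simp: norm_mult)
    then show ?thesis using term_eq[OF f(1), of "Suc i"] term_eq[OF cf, of "Suc i"]
        rearrangement_nonneg[OF f(1), of "Suc i"] by (simp add: powr_mult)
  qed
  then have "(\<Sum>i. lorentz_term w q (\<lambda>k. c * f k) (Suc i)) = norm c powr q * (\<Sum>i. lorentz_term w q f (Suc i))"
    using suminf_mult[OF f(2)] by simp
  moreover have "0 \<le> (\<Sum>i. lorentz_term w q f (Suc i))"
    using f term_nonneg[OF f(1)] by (intro suminf_nonneg) auto
  ultimately show ?thesis using assms(2) by (simp add: lorentz_norm_def powr_mult powr_powr)
qed

text \<open>The witness is \<open>renorm\<close>, which is complete and uniformly convex, so that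
  Banach spaces finitely representable in it are reflexive. The quasi-Banach properties of the
  Lorentz quasi-norm follow from the equivalence with \<open>renorm\<close>, except homogeneity,
  which is checked on the rearrangement.\<close>

lemma superreflexive_if_regular:
  assumes "is_weight w" "1 < q" "LRP (primitive_seq w)" "URP (primitive_seq w)"
  shows "superreflexive TYPE('v) (lorentz_space w (ereal q) :: ('k::{real_normed_field, euclidean_space}, nat \<Rightarrow> 'k) nspace)"
proof -
  obtain \<beta> where \<beta>: "2 \<le> \<beta>" "\<And>n. 1 \<le> n \<Longrightarrow> 2 * primitive_seq w n \<le> primitive_seq w (\<beta> * n)"
    "\<And>n. 1 \<le> n \<Longrightarrow> primitive_seq w (\<beta> * n) \<le> real \<beta> / 2 * primitive_seq w n"
    using common_base[OF assms(1,3,4)] by blast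
  obtain r m where rm: "1 < r" "(real \<beta> / (2 * (7/8))) powr r \<le> 6/7 * real \<beta>"
    "real \<beta> \<le> 6/7 * (2 * (7/8)) powr (r * real (Suc m))"
    using exists_exponents[OF \<beta>(1)] by blast
  interpret orl: orlicz r m by unfold_locales (rule rm(1))
  interpret regular_lorentz w q \<beta> r m "7/8" "6/7"
    by unfold_locales (use assms \<beta> rm in \<open>auto simp: orl.p_def\<close>)
  let ?S = "lorentz_set w (ereal q) :: (nat \<Rightarrow> 'k) set"
  let ?lor = "lorentz_norm w (ereal q) :: (nat \<Rightarrow> 'k) \<Rightarrow> real"
  let ?N = "renorm :: (nat \<Rightarrow> 'k) \<Rightarrow> real"
  obtain C where C: "0 < C"
    "\<And>f :: nat \<Rightarrow> 'k. f \<longlonglongrightarrow> 0 \<Longrightarrow> f \<in> ?S \<longleftrightarrow> norm_finite f"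
    "\<And>f. f \<in> ?S \<Longrightarrow> ?N f \<le> C * ?lor f \<and> ?lor f \<le> C * ?N f"
    using renorm_equivalent[where ?'k = 'k] by blast
  interpret sf: seminorm_family "norm_upto :: nat \<Rightarrow> (nat \<Rightarrow> 'k) \<Rightarrow> real" "\<sigma> 0"
  proof
    show "norm_upto n (\<lambda>k. a * f k) = norm a * norm_upto n f" for n a and f :: "nat \<Rightarrow> 'k"
      by (rule norm_upto_scale) (auto simp: norm_mult)
    show "\<exists>n. \<sigma> 0 * norm (f k) \<le> norm_upto n f" for f :: "nat \<Rightarrow> 'k" and k
      using norm_le_norm_upto[of k "Suc k" f] by blast
    show "norm_upto n f \<le> b" if "\<And>k. (\<lambda>i. u i k) \<longlonglongrightarrow> f k" "\<forall>\<^sub>F i in sequentially. norm_upto n (u i) \<le> b"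
      for u and f :: "nat \<Rightarrow> 'k" and n b
      using that by (rule norm_upto_le_limit)
  qed (auto intro: norm_upto_nonneg norm_upto_triangle sigma_pos)
  have S0: "f \<longlonglongrightarrow> 0" if "f \<in> ?S" for f using that by (simp add: lorentz_set_def)
  have SV: "sf.V = ?S"
  proof (intro Set.set_eqI)
    show "f \<in> sf.V \<longleftrightarrow> f \<in> ?S" for f
      using C(2)[of f, unfolded norm_finite_def] S0[of f] by (auto simp: sf.V_def)
  qed
  have mu: "sf.\<mu> = ?N" by (auto simp: sf.\<mu>_def renorm_def fun_eq_iff)
  note sub = sf.subspace_V[unfolded SV] and norm = sf.is_norm_mu[unfolded SV mu]
    and compl = sf.complete_mu[unfolded SV mu]
  note normD = normed_fspaceD[OF norm]
  have fin: "norm_finite f" if "f \<in> ?S" for f using C(2)[OF S0[OF that]] that by blast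
  have banach: "banach_nspace (fspace ?S ?N)"
    using sub norm compl by (simp add: banach_nspace_def module_fspace_iff)
  have uc: "unif_convex (fspace ?S ?N)"
    unfolding unif_convex_def fspace_simps
  proof (intro allI impI)
    fix \<epsilon> :: real assume "0 < \<epsilon>"
    from renorm_uniformly_convex[OF this, where ?'a = 'k] obtain \<delta> where \<delta>: "0 < \<delta>"
      "\<And>f g :: nat \<Rightarrow> 'k. norm_finite f \<Longrightarrow> norm_finite g \<Longrightarrow> renorm f \<le> 1 \<Longrightarrow> renorm g \<le> 1 \<Longrightarrow>
        renorm (\<lambda>k. f k - g k) \<ge> \<epsilon> \<Longrightarrow> renorm (\<lambda>k. f k + g k) \<le> 2 * (1 - \<delta>)" by blast
    show "\<exists>\<delta>>0. \<forall>f\<in>?S. \<forall>g\<in>?S. renorm f \<le> 1 \<longrightarrow> renorm g \<le> 1 \<longrightarrow>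
        \<epsilon> \<le> renorm (\<lambda>k. f k + - 1 * g k) \<longrightarrow> renorm (\<lambda>k. f k + g k) \<le> 2 * (1 - \<delta>)"
      using \<delta> fin by (intro exI[of _ \<delta>]) auto
  qed
  have "superreflexive_banach TYPE('v) (fspace ?S ?N)"
    unfolding superreflexive_banach_def
  proof (intro conjI banach allI impI, elim conjE)
    fix Y :: "('k, 'v) nspace"
    assume Y: "banach_nspace Y" and fr: "finitely_representable Y (fspace ?S ?N)"
    interpret Y: normed_nspace Y by (rule normed_nspace.intro) (use Y in \<open>auto simp: banach_nspace_def\<close>)
    show "reflexive_nspace Y"
      using Y by (intro Y.milman_pettis Y.unif_convex_if_finitely_representable[OF fr uc]) (simp add: banach_nspace_def)
  qed
  moreover have "equivalent_to_vnorm (lorentz_space w (ereal q)) ?N"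
    unfolding equivalent_to_vnorm_def lorentz_space_eq_fspace fspace_simps
    using C(1,3) by (intro exI[of _ "1 / C"] exI[of _ C]) (auto simp: divide_le_eq mult.commute)
  moreover have "quasi_banach (fspace ?S ?lor)"
    unfolding quasi_banach_def
  proof (intro conjI)
    show "Module.module scalar_ring (fspace ?S ?lor)" using sub by (simp add: module_fspace_iff)
    have lor0: "0 \<le> ?lor f" for f by (simp add: lorentz_norm_def)
    show "is_quasinorm (fspace ?S ?lor)"
      unfolding is_quasinorm_def fspace_simps
    proof (intro conjI ballI allI)
      fix f assume f: "f \<in> ?S"
      show "0 \<le> ?lor f" by (rule lor0)
      show "?lor f = 0 \<longleftrightarrow> f = (\<lambda>k. 0)"
        using C(1) C(3)[OF f] normD(1,2)[OF f] lor0[of f] by (auto simp: antisym)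
      show "?lor (\<lambda>k. c * f k) = norm c * ?lor f" for c
        using assms f by (intro lorentz_norm_scale) auto
    next
      show "\<exists>K. \<forall>f\<in>?S. \<forall>g\<in>?S. ?lor (\<lambda>k. f k + g k) \<le> K * (?lor f + ?lor g)"
      proof (intro exI[of _ "C * C"] ballI)
        fix f g assume fg: "f \<in> ?S" "g \<in> ?S"
        have "?lor (\<lambda>k. f k + g k) \<le> C * ?N (\<lambda>k. f k + g k)"
          using C(3)[OF function_subspaceD(2)[OF sub fg]] by simp
        also have "\<dots> \<le> C * (?N f + ?N g)" using normD(4)[OF fg] C(1) by (intro mult_left_mono) auto
        also have "\<dots> \<le> C * (C * ?lor f + C * ?lor g)"
          using C(1) C(3)[OF fg(1)] C(3)[OF fg(2)] by (intro mult_left_mono add_mono) auto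
        finally show "?lor (\<lambda>k. f k + g k) \<le> C * C * (?lor f + ?lor g)" by (simp add: algebra_simps)
      qed
    qed
    show "complete_nspace (fspace ?S ?lor)"
      unfolding complete_nspace_def
    proof (intro allI impI, elim conjE)
      fix u :: "nat \<Rightarrow> nat \<Rightarrow> 'k"
      assume "\<forall>i. u i \<in> carrier (fspace ?S ?lor)"
        and cauchy: "\<forall>e>0. \<exists>M. \<forall>i\<ge>M. \<forall>j\<ge>M. vnorm (fspace ?S ?lor) (u i \<ominus>\<^bsub>fspace ?S ?lor\<^esub> u j) < e"
      then have u: "u i \<in> ?S" for i by simp
      note dS = function_subspace_diff[OF sub]
      have "\<forall>e>0. \<exists>M. \<forall>i\<ge>M. \<forall>j\<ge>M. vnorm (fspace ?S ?N) (u i \<ominus>\<^bsub>fspace ?S ?N\<^esub> u j) < e"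
      proof (intro allI impI)
        fix e :: real assume "0 < e"
        then have "0 < e / C" using C(1) by simp
        then obtain M where M: "\<forall>i\<ge>M. \<forall>j\<ge>M. ?lor (\<lambda>k. u i k - u j k) < e / C"
          using cauchy by (auto simp: fspace_minus[OF sub u])
        have "?N (\<lambda>k. u i k - u j k) < e" if ij: "M \<le> i" "M \<le> j" for i j
        proof -
          have "?lor (\<lambda>k. u i k - u j k) < e / C" using M ij by blast
          then have "C * ?lor (\<lambda>k. u i k - u j k) < e" using C(1) by (simp add: pos_less_divide_eq mult.commute)
          then show ?thesis using C(3)[OF dS[OF u[of i] u[of j]]] by linarith
        qed
        then show "\<exists>M. \<forall>i\<ge>M. \<forall>j\<ge>M. vnorm (fspace ?S ?N) (u i \<ominus>\<^bsub>fspace ?S ?N\<^esub> u j) < e"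
          by (auto simp: fspace_minus[OF sub u])
      qed
      then obtain x where x: "x \<in> ?S" "(\<lambda>i. ?N (\<lambda>k. u i k - x k)) \<longlonglongrightarrow> 0"
        using compl[unfolded complete_nspace_def, rule_format, of u] u by (auto simp: fspace_minus[OF sub])
      have "(\<lambda>i. ?lor (\<lambda>k. u i k - x k)) \<longlonglongrightarrow> 0"
      proof (rule tendsto_sandwich[OF _ _ tendsto_const tendsto_mult_right_zero[OF x(2), of C]])
        show "\<forall>\<^sub>F i in sequentially. 0 \<le> ?lor (\<lambda>k. u i k - x k)"
          by (intro always_eventually allI lor0)
        show "\<forall>\<^sub>F i in sequentially. ?lor (\<lambda>k. u i k - x k) \<le> C * ?N (\<lambda>k. u i k - x k)"
          using C(3)[OF dS[OF u x(1)]] by (intro always_eventually allI) blast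
      qed
      then show "\<exists>x\<in>carrier (fspace ?S ?lor). (\<lambda>i. vnorm (fspace ?S ?lor) (u i \<ominus>\<^bsub>fspace ?S ?lor\<^esub> x)) \<longlonglongrightarrow> 0"
        using x(1) by (intro bexI[of _ x]) (simp_all add: fspace_minus[OF sub x(1)])
    qed
  qed
  ultimately show ?thesis
    unfolding superreflexive_def lorentz_space_eq_fspace fspace_vnorm_update
    using norm by blast
qed

text \<open>A real is coded by a set of naturals, and a sequence of such sets by a single one
  through the pairing function.\<close>

lemma sequences_inject_into_reals: "\<exists>f :: (nat \<Rightarrow> real) \<Rightarrow> real. inj f"
proof -
  obtain h :: "nat set \<Rightarrow> real" where h: "bij h"
    using nat_sets_eqpoll_reals by (auto simp: eqpoll_def)
  define g where "g = inv_into UNIV h"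
  have g: "inj g" using h by (auto simp: g_def bij_def intro: inj_on_inv_into)
  define F where "F = (\<lambda>x :: nat \<Rightarrow> real. {prod_encode (i, n) | i n. n \<in> g (x i)})"
  have mem: "prod_encode (i, n) \<in> F x \<longleftrightarrow> n \<in> g (x i)" for i n x
    by (auto simp: F_def)
  have "inj F"
  proof (rule injI)
    fix x y assume "F x = F y"
    then have "g (x i) = g (y i)" for i using mem[of i _ x] mem[of i _ y] by auto
    then show "x = y" using g by (auto simp: inj_def)
  qed
  then have "inj (h \<circ> F)" using h by (intro inj_compose) (auto simp: bij_def)
  then show ?thesis by blast
qed

lemma complex_sequences_inject_into_reals: "\<exists>f :: (nat \<Rightarrow> complex) \<Rightarrow> real. inj f"
proof -
  obtain f :: "(nat \<Rightarrow> real) \<Rightarrow> real" where f: "inj f" using sequences_inject_into_reals by blast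
  define g where "g = (\<lambda>(x :: nat \<Rightarrow> complex) n. if even n then Re (x (n div 2)) else Im (x (n div 2)))"
  have "inj g"
  proof (rule injI)
    fix x y assume eq: "g x = g y"
    have "x i = y i" for i
      using fun_cong[OF eq, of "2 * i"] fun_cong[OF eq, of "2 * i + 1"] by (simp add: g_def complex_eq_iff)
    then show "x = y" by auto
  qed
  then have "inj (f \<circ> g)" using f by (intro inj_compose)
  then show ?thesis by blast
qed

text \<open>The injection of the reals makes \<open>'v\<close> large enough to hold copies of the
  non-reflexive spaces of real or complex sequences that refute superreflexivity.\<close>

theorem theorem3p16:
  fixes w :: "nat \<Rightarrow> real" and q :: ereal
  assumes "is_weight w" and "doubling (primitive_seq w)" and "0 < q"
    and "\<exists>\<iota> :: real \<Rightarrow> 'v. inj \<iota>"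
  shows "(superreflexive TYPE('v) (lorentz_space w q :: (real, nat \<Rightarrow> real) nspace) \<longleftrightarrow>
            1 < q \<and> q < \<infinity> \<and> LRP (primitive_seq w) \<and> URP (primitive_seq w)) \<and>
         (superreflexive TYPE('v) (lorentz_space w q :: (complex, nat \<Rightarrow> complex) nspace) \<longleftrightarrow>
            1 < q \<and> q < \<infinity> \<and> LRP (primitive_seq w) \<and> URP (primitive_seq w))"
proof -
  obtain \<iota> :: "real \<Rightarrow> 'v" where \<iota>: "inj \<iota>" using assms(4) by blast
  obtain f :: "(nat \<Rightarrow> real) \<Rightarrow> real" where f: "inj f" using sequences_inject_into_reals by blast
  obtain g :: "(nat \<Rightarrow> complex) \<Rightarrow> real" where g: "inj g" using complex_sequences_inject_into_reals by blast
  let ?reg = "1 < q \<and> q < \<infinity> \<and> LRP (primitive_seq w) \<and> URP (primitive_seq w)"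
  have q: "q = ereal (real_of_ereal q)" "1 < real_of_ereal q" if ?reg using that by (cases q; simp)+
  have "superreflexive TYPE('v) (lorentz_space w q :: (real, nat \<Rightarrow> real) nspace)" if reg: ?reg
    by (subst q(1)[OF reg], rule superreflexive_if_regular[OF assms(1) q(2)[OF reg]]) (use reg in blast)+
  moreover have "superreflexive TYPE('v) (lorentz_space w q :: (complex, nat \<Rightarrow> complex) nspace)" if reg: ?reg
    by (subst q(1)[OF reg], rule superreflexive_if_regular[OF assms(1) q(2)[OF reg]]) (use reg in blast)+
  ultimately show ?thesis
    using regular_if_superreflexive[OF assms(1-3) inj_compose[OF \<iota> f]]
      regular_if_superreflexive[OF assms(1-3) inj_compose[OF \<iota> g]] by blast
qed

end
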